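(* Let $1<p<\infty$, $1\le q\le\infty$, $\varepsilon>0$ and $\vartheta>1$. Suppose $w_*\in\mathcal{W}_0(\mathbb{R})$. Let $\mu$ be a complex measure on $\mathbb{R}$ such that $\mu(\mathbb{R})=0$ and \[ L_3(\lambda):=\int_{\mathbb{R}}e^{\vartheta\,w_*(\lambda|\xi|^{1+\varepsilon})}\,d|\mu|(\xi)<\infty \] for every $\lambda>0$. Let $f$ be the inverse Fourier transform of $\mu$, $f(t)=\frac1{\sqrt{2\pi}}\int_{\mathbb{R}}e^{\mathrm{i}t\xi}\,d\mu(\xi)$. Then $f\in C^\infty(\mathbb{R})$ and the composition operator $T_f:u\mapsto f\circ u$ maps $\mathcal{M}^{w_*}_{p,q}(\mathbb{R}^n)$ into $\mathcal{M}^{w_*}_{p,q}(\mathbb{R}^n)$, i.e. $f\circ u\in\mathcal{M}^{w_*}_{p,q}(\mathbb{R}^n)$ for every real-valued $u\in\mathcal{M}^{w_*}_{p,q}(\mathbb{R}^n)$.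
   Context: Fourier transform on $\mathbb{R}^n$: $\mathcal{F}f(\xi)=(2\pi)^{-n/2}\int_{\mathbb{R}^n}f(x)e^{-\mathrm{i}x\cdot\xi}\,dx$. Frequency-uniform decomposition: fix $\rho\in C_0^\infty(\mathbb{R}^n)$ with values in $[0,1]$, supported in $[-1,1]^n$, with $\rho(\xi)=1$ if $|\xi_i|\le\frac12$ for all $i$. Put $\rho_k(\xi)=\rho(\xi-k)$, $\sigma_k=\rho_k\big(\sum_{m\in\mathbb{Z}^n}\rho_m\big)^{-1}$ and $\Box_kf=\mathcal{F}^{-1}(\sigma_k\mathcal{F}f)$ for $k\in\mathbb{Z}^n$. Modulation space: for $1\le p,q\le\infty$ and a monotonically increasing weight function $w_*$ on $[0,\infty)$ with $w_*(0)\ge0$, $\mathcal{M}^{w_*}_{p,q}(\mathbb{R}^n)$ is the set of all $f\in L^p(\mathbb{R}^n)$ with $\|f\|_{\mathcal{M}^{w_*}_{p,q}}:=\big(\sum_{k\in\mathbb{Z}^n}e^{q\,w_*(|k|)}\|\Box_kf\|_{L^p}^q\big)^{1/q}<\infty$ (supremum over $k$ if $q=\infty$). Weights: a measurable function $h:(0,\infty)\to(0,\infty)$ is regularly varying of index $\alpha\in\mathbb{R}$ if $\lim_{t\to\infty}h(tx)/h(t)=x^\alpha$ for all $x>0$; it is slowly varying if this holds with $\alpha=0$. The set $\mathcal{W}(\mathbb{R})$ consists of all functions $w_*=w_*(x)$, $x\in[0,\infty)$, such that: (A1) $w_*\in C^\infty(0,\infty)$ is regularly varying with index $\alpha$, $0\le\alpha<1$;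 (A2) $w_*\ge1$; (A3) $w_*$ is strictly increasing; (A4) $\lim_{t\to\infty}(w_*(t)-M\log t)=\infty$ for all $M$; (A5) $w_*'(0)=0$; (A6) $w_*''$ has finitely many changes of sign, with a number $\tau$ such that $w_*''(x)<0$ for all $x>\tau$. $\mathcal{W}_0(\mathbb{R})$ is the set of $w_*\in\mathcal{W}(\mathbb{R})$ that are slowly varying. *)

theory Defs
  imports "HOL-Analysis.Analysis" "HOL-Probability.Essential_Supremum"
begin

section \<open>Smooth functions and Schwartz functions\<close>

text \<open>Directional derivatives along the standard basis are the partial derivatives; a function is
  \<open>C\<^sup>\<infinity>\<close> on an open set if all its iterated partial derivatives exist and are differentiable there.\<close>

definition dir_deriv ::
    "'a::euclidean_space \<Rightarrow> ('a \<Rightarrow> 'b::real_normed_vector) \<Rightarrow> 'a \<Rightarrow> 'b" where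
  "dir_deriv v f x = frechet_derivative f (at x) v"

definition iter_deriv ::
    "'a::euclidean_space list \<Rightarrow> ('a \<Rightarrow> 'b::real_normed_vector) \<Rightarrow> 'a \<Rightarrow> 'b" where
  "iter_deriv vs f = foldr dir_deriv vs f"

definition smooth_on :: "'a::euclidean_space set \<Rightarrow> ('a \<Rightarrow> 'b::real_normed_vector) \<Rightarrow> bool" where
  "smooth_on S f \<longleftrightarrow>
     open S \<and> (\<forall>vs. set vs \<subseteq> Basis \<longrightarrow> (\<forall>x\<in>S. iter_deriv vs f differentiable (at x)))"

definition schwartz :: "('a::euclidean_space \<Rightarrow> complex) \<Rightarrow> bool" where
  "schwartz \<phi> \<longleftrightarrow> smooth_on UNIV \<phi> \<and>
     (\<forall>(N::nat) vs. set vs \<subseteq> Basis \<longrightarrow> bounded (range (\<lambda>x. norm x ^ N *\<^sub>R iter_deriv vs \<phi> x)))"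


section \<open>Lebesgue spaces\<close>

text \<open>The power \<open>x\<^sup>a\<close> of an extended nonnegative number, used for exponents \<open>a > 0\<close> only.\<close>

definition epow :: "ennreal \<Rightarrow> real \<Rightarrow> ennreal" where
  "epow x a = (if x = \<infinity> then \<infinity> else ennreal (enn2real x powr a))"

definition Lp_norm :: "ennreal \<Rightarrow> ('a::euclidean_space \<Rightarrow> complex) \<Rightarrow> ennreal" where
  "Lp_norm p f =
     (if p = \<infinity> then esssup lebesgue (\<lambda>x. ennreal (norm (f x)))
      else epow (\<integral>\<^sup>+x. ennreal (norm (f x) powr enn2real p) \<partial>lebesgue) (1 / enn2real p))"

definition Lp_space :: "ennreal \<Rightarrow> ('a::euclidean_space \<Rightarrow> complex) set" where
  "Lp_space p = {f. f \<in> borel_measurable lebesgue \<and> Lp_norm p f < \<infinity>}"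


section \<open>Fourier transform of functions and of tempered distributions\<close>

definition fourier :: "('a::euclidean_space \<Rightarrow> complex) \<Rightarrow> 'a \<Rightarrow> complex" where
  "fourier f \<xi> =
     complex_of_real ((2 * pi) powr (- real DIM('a) / 2)) * (LINT x|lebesgue. f x * cis (- (x \<bullet> \<xi>)))"

definition inv_fourier :: "('a::euclidean_space \<Rightarrow> complex) \<Rightarrow> 'a \<Rightarrow> complex" where
  "inv_fourier g x =
     complex_of_real ((2 * pi) powr (- real DIM('a) / 2)) * (LINT \<xi>|lebesgue. g \<xi> * cis (x \<bullet> \<xi>))"

text \<open>For \<open>f \<in> L\<^sup>p\<close> with \<open>p > 2\<close> the Fourier transform of \<open>f\<close> is only a tempered distribution, so
  \<open>\<F>\<^sup>-\<^sup>1(\<sigma> \<F>f)\<close> is taken in the sense of distributions. A distribution is a functional of which only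
  the values at Schwartz functions matter; its transforms and its products with smooth functions are
  defined by duality with respect to the bilinear pairing \<open>\<langle>f, \<phi>\<rangle> = \<integral> f \<phi>\<close>. Every functional
  used below arises by these operations from an \<open>L\<^sup>p\<close> function, hence is linear and continuous.\<close>

type_synonym 'a distr = "('a \<Rightarrow> complex) \<Rightarrow> complex"

definition distr_of :: "('a::euclidean_space \<Rightarrow> complex) \<Rightarrow> 'a distr" where
  "distr_of f = (\<lambda>\<phi>. LINT x|lebesgue. f x * \<phi> x)"

definition distr_fourier :: "'a::euclidean_space distr \<Rightarrow> 'a distr" where
  "distr_fourier T = (\<lambda>\<phi>. T (fourier \<phi>))"

definition distr_inv_fourier :: "'a::euclidean_space distr \<Rightarrow> 'a distr" where
  "distr_inv_fourier T = (\<lambda>\<phi>. T (inv_fourier \<phi>))"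

definition distr_mult :: "('a::euclidean_space \<Rightarrow> complex) \<Rightarrow> 'a distr \<Rightarrow> 'a distr" where
  "distr_mult s T = (\<lambda>\<phi>. T (\<lambda>x. s x * \<phi> x))"

text \<open>The \<open>L\<^sup>p\<close> norm of a distribution is that of the \<open>L\<^sup>p\<close> function representing it (unique up to null
  sets), and \<open>\<infinity>\<close>, the infimum of the empty set, if there is none.\<close>

definition distr_Lp_norm :: "ennreal \<Rightarrow> 'a::euclidean_space distr \<Rightarrow> ennreal" where
  "distr_Lp_norm p T =
     (INF g\<in>{g \<in> Lp_space p. \<forall>\<phi>. schwartz \<phi> \<longrightarrow> distr_of g \<phi> = T \<phi>}. Lp_norm p g)"


section \<open>Frequency-uniform decomposition and modulation spaces\<close>

definition decomp_bump :: "(real^'n \<Rightarrow> real) \<Rightarrow> bool" where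
  "decomp_bump \<rho> \<longleftrightarrow> smooth_on UNIV \<rho> \<and> (\<forall>\<xi>. 0 \<le> \<rho> \<xi> \<and> \<rho> \<xi> \<le> 1) \<and>
     (\<forall>\<xi>. \<rho> \<xi> \<noteq> 0 \<longrightarrow> (\<forall>i. \<bar>\<xi> $ i\<bar> \<le> 1)) \<and>
     (\<forall>\<xi>. (\<forall>i. \<bar>\<xi> $ i\<bar> \<le> 1 / 2) \<longrightarrow> \<rho> \<xi> = 1)"

definition lattice_vec :: "int^'n \<Rightarrow> real^'n" where
  "lattice_vec k = (\<chi> i. real_of_int (k $ i))"

definition decomp_sigma :: "(real^'n \<Rightarrow> real) \<Rightarrow> int^'n \<Rightarrow> real^'n \<Rightarrow> real" where
  "decomp_sigma \<rho> k \<xi> =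
     \<rho> (\<xi> - lattice_vec k) / (\<Sum>\<^sub>\<infinity>m\<in>(UNIV :: (int^'n) set). \<rho> (\<xi> - lattice_vec m))"

definition freq_box ::
    "(real^'n \<Rightarrow> real) \<Rightarrow> int^'n \<Rightarrow> (real^'n \<Rightarrow> complex) \<Rightarrow> (real^'n) distr" where
  "freq_box \<rho> k f =
     distr_inv_fourier
       (distr_mult (\<lambda>\<xi>. complex_of_real (decomp_sigma \<rho> k \<xi>)) (distr_fourier (distr_of f)))"

definition modulation_norm ::
    "(real^'n \<Rightarrow> real) \<Rightarrow> (real \<Rightarrow> real) \<Rightarrow> ennreal \<Rightarrow> ennreal \<Rightarrow> (real^'n \<Rightarrow> complex) \<Rightarrow> ennreal" where
  "modulation_norm \<rho> w p q f =
     (if q = \<infinity> then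
        (SUP k. ennreal (exp (w (norm (lattice_vec k)))) * distr_Lp_norm p (freq_box \<rho> k f))
      else
        epow (\<Sum>\<^sub>\<infinity>k\<in>UNIV. ennreal (exp (enn2real q * w (norm (lattice_vec k)))) *
                epow (distr_Lp_norm p (freq_box \<rho> k f)) (enn2real q))
             (1 / enn2real q))"

definition modulation_space ::
    "(real^'n \<Rightarrow> real) \<Rightarrow> (real \<Rightarrow> real) \<Rightarrow> ennreal \<Rightarrow> ennreal \<Rightarrow> (real^'n \<Rightarrow> complex) set" where
  "modulation_space \<rho> w p q = {f \<in> Lp_space p. modulation_norm \<rho> w p q f < \<infinity>}"


section \<open>Weights\<close>

text \<open>Functions on \<open>(0,\<infinity>)\<close> and \<open>[0,\<infinity>)\<close> are total functions whose values elsewhere are irrelevant.\<close>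

definition regularly_varying :: "real \<Rightarrow> (real \<Rightarrow> real) \<Rightarrow> bool" where
  "regularly_varying \<alpha> h \<longleftrightarrow>
     h \<in> borel_measurable (restrict_space borel {0<..}) \<and> (\<forall>x>0. h x > 0) \<and>
     (\<forall>x>0. ((\<lambda>t. h (t * x) / h t) \<longlongrightarrow> x powr \<alpha>) at_top)"

definition slowly_varying :: "(real \<Rightarrow> real) \<Rightarrow> bool" where
  "slowly_varying h \<longleftrightarrow> regularly_varying 0 h"

text \<open>The number of sign changes of \<open>g\<close> on \<open>S\<close> is the largest \<open>N\<close> for which there are
  \<open>x\<^sub>0 < \<dots> < x\<^sub>N\<close> in \<open>S\<close> at which \<open>g\<close> takes nonzero values of alternating signs.\<close>

definition finitely_many_sign_changes :: "real set \<Rightarrow> (real \<Rightarrow> real) \<Rightarrow> bool" where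
  "finitely_many_sign_changes S g \<longleftrightarrow>
     (\<exists>B. \<forall>N (x :: nat \<Rightarrow> real).
        (\<forall>i\<le>N. x i \<in> S) \<and> (\<forall>i<N. x i < x (Suc i) \<and> g (x i) * g (x (Suc i)) < 0) \<longrightarrow> N \<le> B)"

definition weights_W :: "(real \<Rightarrow> real) set" where
  "weights_W = {w.
     smooth_on {0<..} w \<and> (\<exists>\<alpha>. 0 \<le> \<alpha> \<and> \<alpha> < 1 \<and> regularly_varying \<alpha> w) \<and>
     (\<forall>x\<ge>0. w x \<ge> 1) \<and>
     strict_mono_on {0..} w \<and>
     (\<forall>M. filterlim (\<lambda>t. w t - M * ln t) at_top at_top) \<and>
     (w has_real_derivative 0) (at 0 within {0..}) \<and>
     finitely_many_sign_changes {0<..} (deriv (deriv w)) \<and>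
     (\<exists>\<tau>. \<forall>x>0. x > \<tau> \<longrightarrow> deriv (deriv w) x < 0)}"

definition weights_W0 :: "(real \<Rightarrow> real) set" where
  "weights_W0 = {w \<in> weights_W. slowly_varying w}"


section \<open>Complex measures on the real line\<close>

definition complex_measure :: "(real set \<Rightarrow> complex) \<Rightarrow> bool" where
  "complex_measure \<mu> \<longleftrightarrow>
     (\<forall>A :: nat \<Rightarrow> real set. range A \<subseteq> sets borel \<longrightarrow> disjoint_family A \<longrightarrow>
        (\<lambda>i. \<mu> (A i)) sums \<mu> (\<Union>i. A i))"

text \<open>The total variation \<open>|\<mu>|\<close>.\<close>

definition total_variation :: "(real set \<Rightarrow> complex) \<Rightarrow> real measure" where
  "total_variation \<mu> = measure_of UNIV (sets borel)
     (\<lambda>E. SUP A\<in>{A :: nat \<Rightarrow> real set. range A \<subseteq> sets borel \<and> disjoint_family A \<and> (\<Union>i. A i) = E}.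
        \<Sum>i. ennreal (norm (\<mu> (A i))))"

text \<open>The positive part \<open>\<nu>\<^sup>+(E) = sup {\<nu>(A). A \<subseteq> E}\<close> in the Jordan decomposition of a signed measure
  \<open>\<nu>\<close>; the negative part is \<open>(-\<nu>)\<^sup>+\<close>. Truncating negative values by \<open>ennreal\<close> is harmless, as
  \<open>\<nu>({}) = 0\<close>.\<close>

definition pos_variation :: "(real set \<Rightarrow> real) \<Rightarrow> real measure" where
  "pos_variation \<nu> = measure_of UNIV (sets borel)
     (\<lambda>E. SUP A\<in>{A \<in> sets borel. A \<subseteq> E}. ennreal (\<nu> A))"

definition complex_measure_integral ::
    "(real set \<Rightarrow> complex) \<Rightarrow> (real \<Rightarrow> complex) \<Rightarrow> complex" where
  "complex_measure_integral \<mu> g =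
     (LINT x|pos_variation (\<lambda>A. Re (\<mu> A)). g x) - (LINT x|pos_variation (\<lambda>A. - Re (\<mu> A)). g x) +
     \<i> * ((LINT x|pos_variation (\<lambda>A. Im (\<mu> A)). g x) - (LINT x|pos_variation (\<lambda>A. - Im (\<mu> A)). g x))"

definition inv_fourier_measure :: "(real set \<Rightarrow> complex) \<Rightarrow> real \<Rightarrow> complex" where
  "inv_fourier_measure \<mu> t =
     complex_of_real (1 / sqrt (2 * pi)) * complex_measure_integral \<mu> (\<lambda>\<xi>. cis (t * \<xi>))"

end

theory Submission
  imports Defs "HOL-Probability.Characteristic_Functions" "HOL-Probability.Sinc_Integral"
begin

text \<open>Since \<open>\<mu>(\<real>) = 0\<close>, \<open>f \<circ> u\<close> is a combination of integrals of \<open>e\<^sup>i\<^sup>\<xi>\<^sup>u - 1\<close> against four positive measures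
  dominated by the total variation of \<open>\<mu>\<close>, so it suffices to bound the boxes of \<open>e\<^sup>i\<^sup>\<xi>\<^sup>u - 1\<close> by a constant
  times \<open>exp (\<theta> w(L \<Xi>\<^sup>1\<^sup>+\<^sup>e))\<close> with \<open>\<Xi> = max 1 \<bar>\<xi>\<bar>\<close>. The boxes are compared with \<open>e\<^sup>-\<^sup>w\<^sup>(\<^sup>k\<^sup>) \<alpha>\<^sub>k\<close> for one
  moderate majorant \<open>\<alpha>\<close> of the box sequence of \<open>u\<close>. Slow variation gives \<open>w(x + y) \<le> w(x) + \<delta> w(y) + C\<close>
  for \<open>x \<ge> y\<close>, which makes such bounds stable under products.

  Split \<open>u = v + (u - v)\<close> with a low-pass filter at frequency \<open>R = \<Xi>\<^sup>e + 1\<close>. In the weaker weight \<open>e\<^sup>w\<^sup>/\<^sup>2\<close> the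
  high part is \<open>O(1/\<Xi>)\<close>, so its exponential series is bounded uniformly in \<open>\<xi>\<close>. The powers of the bounded low
  part \<open>v\<close> have spectrum in cubes of side \<open>O(R j)\<close>, so a box at distance \<open>M\<close> only sees the tail \<open>j \<ge> M / (3 R)\<close>
  of the exponential series; the tail is negligible for \<open>M \<ge> L R \<Xi>\<close>, and the remaining boxes
  cost the factor \<open>e\<^sup>w\<^sup>(\<^sup>L\<^sup>R\<^sup>\<Xi>\<^sup>)\<close>.\<close>

section \<open>Convolution in Lebesgue spaces\<close>

text \<open>The exponential series of \<open>u\<close> alone only gives bounds of size
  \<open>exp (C * \<bar>\<xi>\<bar>)\<close>. The hypothesis cannot integrate them, because a slowly
  varying \<open>w\<close> grows more slowly than every power; this is what forces the detour
  through frequencies. The height \<open>\<Xi> powr e\<close> of the cut comes from \<open>w\<close>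
  dominating every multiple of the logarithm: above that frequency half of the weight already pays
  for a factor \<Xi>. The cut times \<Xi> is what later stands inside \<open>w\<close> and produces
  the exponent 1 + e. The excess of \<theta> over 1 pays, in the same way, for all polynomial
  factors.

  The exponent q enters only through the majorant \<alpha>: summability is used when \<alpha> is
  built and when the final norm is computed, and in between every box bound is pointwise in k.

  All norms are handled as explicit bounds. Infinite sums are integrals over counting measures, so
  that Minkowski's inequality, proved here with a factor 2, is paid for once per sum and not once
  per term.

  The condition on \<mu> says that f vanishes at 0; nonzero constants do not lie in the Lebesgue
  spaces considered.\<close>

lemma nn_integral_affine_euclidean:
  fixes f :: "'a::euclidean_space \<Rightarrow> ennreal"
  assumes [measurable]: "f \<in> borel_measurable borel" and c: "c \<noteq> 0"
  shows "(\<integral>\<^sup>+x. f x \<partial>lborel) = ennreal (\<bar>c\<bar> ^ DIM('a)) * (\<integral>\<^sup>+x. f (t + c *\<^sub>R x) \<partial>lborel)"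
  by (subst lborel_affine[OF c, of t])
     (simp add: nn_integral_density nn_integral_distr nn_integral_cmult)

lemma integral_affine_euclidean:
  fixes f :: "'a::euclidean_space \<Rightarrow> complex"
  assumes [measurable]: "f \<in> borel_measurable borel" and c: "c \<noteq> 0"
  shows "(\<integral>x. f x \<partial>lborel) = \<bar>c\<bar> ^ DIM('a) *\<^sub>R (\<integral>x. f (t + c *\<^sub>R x) \<partial>lborel)"
  by (subst lborel_affine[OF c, of t])
     (simp add: integral_density integral_distr)

lemma nn_integral_reflect:
  fixes f :: "'a::euclidean_space \<Rightarrow> ennreal"
  assumes [measurable]: "f \<in> borel_measurable borel"
  shows "(\<integral>\<^sup>+y. f (x - y) \<partial>lborel) = (\<integral>\<^sup>+y. f y \<partial>lborel)"
  using nn_integral_affine_euclidean[OF assms, of "-1" x] by simp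

lemma nn_integral_translate:
  fixes f :: "'a::euclidean_space \<Rightarrow> ennreal"
  assumes [measurable]: "f \<in> borel_measurable borel"
  shows "(\<integral>\<^sup>+y. f (y - x) \<partial>lborel) = (\<integral>\<^sup>+y. f y \<partial>lborel)"
  using nn_integral_affine_euclidean[OF assms, of 1 "-x"] by simp

lemma integral_reflect:
  fixes f :: "'a::euclidean_space \<Rightarrow> complex"
  assumes [measurable]: "f \<in> borel_measurable borel"
  shows "(\<integral>y. f (x - y) \<partial>lborel) = (\<integral>y. f y \<partial>lborel)"
  using integral_affine_euclidean[OF assms, of "-1" x] by simp

lemma integral_translate:
  fixes f :: "'a::euclidean_space \<Rightarrow> complex"
  assumes [measurable]: "f \<in> borel_measurable borel"
  shows "(\<integral>y. f (y - x) \<partial>lborel) = (\<integral>y. f y \<partial>lborel)"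
  using integral_affine_euclidean[OF assms, of 1 "-x"] by simp

text \<open>Stated with the iterated integral of the norm, which is the quantity that kernel
  estimates bound directly. With a counting measure as one factor it also exchanges sums and
  integrals.\<close>

lemma Fubini_swap:
  fixes F :: "'a \<Rightarrow> 'b \<Rightarrow> complex"
  assumes "sigma_finite_measure N" "sigma_finite_measure M"
    and [measurable]: "(\<lambda>(a, y). F a y) \<in> borel_measurable (N \<Otimes>\<^sub>M M)"
    and fin: "(\<integral>\<^sup>+a. \<integral>\<^sup>+y. norm (F a y) \<partial>M \<partial>N) < \<infinity>"
  shows "(\<integral>a. \<integral>y. F a y \<partial>M \<partial>N) = (\<integral>y. \<integral>a. F a y \<partial>N \<partial>M)"
    and "AE y in M. integrable N (\<lambda>a. F a y)"
    and "integrable M (\<lambda>y. \<integral>a. F a y \<partial>N)"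
    and "integrable N (\<lambda>a. \<integral>y. F a y \<partial>M)"
proof -
  interpret N: sigma_finite_measure N by fact
  interpret M: sigma_finite_measure M by fact
  interpret pair_sigma_finite N M ..
  have "(\<integral>\<^sup>+z. norm (case z of (a, y) \<Rightarrow> F a y) \<partial>(N \<Otimes>\<^sub>M M)) < \<infinity>"
    using fin by (subst M.nn_integral_fst[symmetric]) auto
  then have int: "integrable (N \<Otimes>\<^sub>M M) (\<lambda>(a, y). F a y)"
    by (intro integrableI_bounded) auto
  from Fubini_integral[OF int]
  show "(\<integral>a. \<integral>y. F a y \<partial>M \<partial>N) = (\<integral>y. \<integral>a. F a y \<partial>N \<partial>M)" by simp
  show "AE y in M. integrable N (\<lambda>a. F a y)"
    using AE_integrable_snd[OF int] by simp
  show "integrable M (\<lambda>y. \<integral>a. F a y \<partial>N)"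
    using integrable_snd[OF int] by simp
  show "integrable N (\<lambda>a. \<integral>y. F a y \<partial>M)"
    using integrable_fst[OF int] by simp
qed

text \<open>A non-integrable function has Bochner integral 0 by default, so the bound survives in
  that case, and norm estimates can precede the proof of integrability.\<close>

lemma norm_integral_le_nn_integral:
  fixes f :: "'a \<Rightarrow> complex"
  shows "ennreal (norm (integral\<^sup>L M f)) \<le> (\<integral>\<^sup>+x. norm (f x) \<partial>M)"
proof (cases "integrable M f")
  case True
  then show ?thesis by (rule integral_norm_bound_ennreal)
qed (simp add: not_integrable_integral_eq)

section \<open>Norm bounds with explicit constants\<close>

text \<open>An upper bound instead of the norm itself, so that constants can be tracked through sums
  and products. Strict positivity of \<open>c\<close> keeps \<open>c powr (1 - r)\<close> meaningful
  in the splittings below.\<close>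

definition Lp_bdd :: "real \<Rightarrow> real \<Rightarrow> ('a::euclidean_space \<Rightarrow> complex) \<Rightarrow> bool" where
  "Lp_bdd r c g \<longleftrightarrow> 0 < c \<and> g \<in> borel_measurable borel \<and>
     (\<integral>\<^sup>+x. ennreal (norm (g x) powr r) \<partial>lborel) \<le> ennreal (c powr r)"

text \<open>One constant for two purposes: the sup norm of the kernel yields bounded convolutions,
  its integral yields convolutions bounded in the same Lebesgue space.\<close>

definition kernel_bdd :: "real \<Rightarrow> ('a::euclidean_space \<Rightarrow> complex) \<Rightarrow> bool" where
  "kernel_bdd A K \<longleftrightarrow> 0 < A \<and> K \<in> borel_measurable borel \<and> (\<forall>x. norm (K x) \<le> A) \<and>
     (\<integral>\<^sup>+x. ennreal (norm (K x)) \<partial>lborel) \<le> ennreal A"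

definition conv :: "('a::euclidean_space \<Rightarrow> complex) \<Rightarrow> ('a \<Rightarrow> complex) \<Rightarrow> 'a \<Rightarrow> complex" where
  "conv K g x = (\<integral>z. K z * g (x - z) \<partial>lborel)"

lemma Lp_bdd_measurable: "Lp_bdd r c g \<Longrightarrow> g \<in> borel_measurable borel"
  by (simp add: Lp_bdd_def)

lemma Lp_bdd_pos: "Lp_bdd r c g \<Longrightarrow> 0 < c"
  by (simp add: Lp_bdd_def)

lemma kernel_bdd_measurable: "kernel_bdd A K \<Longrightarrow> K \<in> borel_measurable borel"
  by (simp add: kernel_bdd_def)

lemma kernel_bdd_pos: "kernel_bdd A K \<Longrightarrow> 0 < A"
  by (simp add: kernel_bdd_def)

lemma kernel_bdd_integrable: "kernel_bdd A K \<Longrightarrow> integrable lborel K"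
  unfolding kernel_bdd_def
  by (intro integrableI_bounded) (auto intro: le_less_trans)

lemma Lp_bdd_mono: "Lp_bdd r c g \<Longrightarrow> c \<le> c' \<Longrightarrow> 0 < r \<Longrightarrow> Lp_bdd r c' g"
  using powr_mono2[of r c c'] unfolding Lp_bdd_def by (auto intro: order_trans ennreal_leI)

lemma Lp_bdd_dom:
  assumes "Lp_bdd r c g" "h \<in> borel_measurable borel" "0 < r"
    and "AE x in lborel. norm (h x) \<le> norm (g x)"
  shows "Lp_bdd r c h"
proof -
  have "(\<integral>\<^sup>+x. ennreal (norm (h x) powr r) \<partial>lborel) \<le> (\<integral>\<^sup>+x. ennreal (norm (g x) powr r) \<partial>lborel)"
    using assms(3,4) by (intro nn_integral_mono_AE) (auto elim!: eventually_mono intro!: ennreal_leI powr_mono2)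
  then show ?thesis using assms by (auto simp: Lp_bdd_def)
qed

lemma Lp_bdd_cong_AE:
  assumes "Lp_bdd r c g" "h \<in> borel_measurable borel" "0 < r" "AE x in lborel. h x = g x"
  shows "Lp_bdd r c h"
  using assms by (intro Lp_bdd_dom[OF assms(1)]) (auto elim: eventually_mono)

lemma Lp_bdd_scale:
  assumes "Lp_bdd r c g" "0 < s" "norm a \<le> s" "0 < r"
  shows "Lp_bdd r (s * c) (\<lambda>x. a * g x)"
proof -
  have [measurable]: "g \<in> borel_measurable borel" using assms by (simp add: Lp_bdd_def)
  have c: "0 < c" using assms by (simp add: Lp_bdd_def)
  have "(\<integral>\<^sup>+x. ennreal (norm (a * g x) powr r) \<partial>lborel)
      = ennreal (norm a powr r) * (\<integral>\<^sup>+x. ennreal (norm (g x) powr r) \<partial>lborel)"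
    by (subst nn_integral_cmult[symmetric]) (auto simp: norm_mult powr_mult ennreal_mult)
  also have "\<dots> \<le> ennreal (s powr r) * ennreal (c powr r)"
    using assms by (intro mult_mono ennreal_leI powr_mono2) (auto simp: Lp_bdd_def)
  also have "\<dots> = ennreal ((s * c) powr r)" using assms c by (simp add: powr_mult ennreal_mult)
  finally show ?thesis using assms c by (simp add: Lp_bdd_def)
qed

lemma Lp_bdd_mult_bounded:
  assumes "Lp_bdd r c g" "0 < s" "h \<in> borel_measurable borel" "AE x in lborel. norm (h x) \<le> s" "0 < r"
  shows "Lp_bdd r (s * c) (\<lambda>x. h x * g x)"
proof -
  have [measurable]: "g \<in> borel_measurable borel" using assms by (simp add: Lp_bdd_def)
  have "Lp_bdd r (s * c) (\<lambda>x. of_real s * g x)" using assms by (intro Lp_bdd_scale) auto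
  then show ?thesis
    using assms(2-5)
    by (rule_tac Lp_bdd_dom) (auto simp: norm_mult elim!: eventually_mono intro!: mult_right_mono)
qed

text \<open>Splitting at \<open>t = d\<close> replaces Hoelder's inequality; it costs a factor 2 below.\<close>

lemma le_powr_split:
  fixes t d r :: real
  assumes "0 \<le> t" "0 < d" "1 < r"
  shows "t \<le> d powr (1 - r) * t powr r + d"
proof (cases "t \<le> d")
  case True
  moreover have "0 \<le> d powr (1 - r) * t powr r" by simp
  ultimately show ?thesis by linarith
next
  case False
  then have "t = t powr (1 - r) * t powr r"
    using assms by (simp add: powr_add[symmetric])
  also have "\<dots> \<le> d powr (1 - r) * t powr r"
    using False assms by (intro mult_right_mono powr_mono2') auto
  finally show ?thesis using assms by linarith
qed

text \<open>A weighted Hoelder inequality up to the factor \<open>2 powr r\<close>. Splitting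
  \<open>h a\<close> at the level \<open>s * c a\<close> bounds the integral of \<open>h\<close> by
  \<open>s powr (1 - r) * J + s * C\<close>, and the number \<open>s\<close> is then free to be
  optimised.\<close>

lemma nn_integral_powr_le:
  fixes h c :: "'a \<Rightarrow> real"
  assumes r: "1 < r" and C: "0 < C"
    and [measurable]: "h \<in> borel_measurable N" "c \<in> borel_measurable N"
    and h: "\<And>a. a \<in> space N \<Longrightarrow> 0 \<le> h a" and c: "\<And>a. a \<in> space N \<Longrightarrow> 0 < c a"
    and cC: "(\<integral>\<^sup>+a. c a \<partial>N) \<le> ennreal C"
  shows "epow (\<integral>\<^sup>+a. h a \<partial>N) r
      \<le> ennreal (2 powr r * C powr (r - 1)) * (\<integral>\<^sup>+a. ennreal (h a powr r * c a powr (1 - r)) \<partial>N)"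
proof -
  define J where "J = (\<integral>\<^sup>+a. ennreal (h a powr r * c a powr (1 - r)) \<partial>N)"
  have split: "(\<integral>\<^sup>+a. h a \<partial>N) \<le> ennreal (s powr (1 - r)) * J + ennreal s * ennreal C" if s: "0 < s" for s
  proof -
    have "(\<integral>\<^sup>+a. h a \<partial>N) \<le> (\<integral>\<^sup>+a. ennreal (s powr (1 - r)) * ennreal (h a powr r * c a powr (1 - r)) + ennreal s * ennreal (c a) \<partial>N)"
    proof (intro nn_integral_mono)
      fix a assume a: "a \<in> space N"
      have "h a \<le> (s * c a) powr (1 - r) * h a powr r + s * c a"
        using h[OF a] c[OF a] s r by (intro le_powr_split) auto
      also have "\<dots> = s powr (1 - r) * (h a powr r * c a powr (1 - r)) + s * c a"
        using c[OF a] s by (simp add: powr_mult)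
      finally show "ennreal (h a) \<le> ennreal (s powr (1 - r)) * ennreal (h a powr r * c a powr (1 - r)) + ennreal s * ennreal (c a)"
        using c[OF a] s by (simp flip: ennreal_plus ennreal_mult' add: ennreal_leI)
    qed
    also have "\<dots> = ennreal (s powr (1 - r)) * J + ennreal s * (\<integral>\<^sup>+a. c a \<partial>N)"
      unfolding J_def by (simp add: nn_integral_add nn_integral_cmult)
    also have "\<dots> \<le> ennreal (s powr (1 - r)) * J + ennreal s * ennreal C"
      using cC by (intro add_mono mult_left_mono) auto
    finally show ?thesis .
  qed
  show ?thesis
  proof (cases J)
    case top
    have "ennreal (2 powr r * C powr (r - 1)) * J = \<infinity>"
      using C top by (simp add: ennreal_mult_eq_top_iff)
    then show ?thesis unfolding J_def by simp
  next
    case (real j)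
    have fin: "(\<integral>\<^sup>+a. h a \<partial>N) < \<infinity>"
      using split[of 1] real by (auto simp: ennreal_mult_less_top intro: le_less_trans)
    define H where "H = enn2real (\<integral>\<^sup>+a. h a \<partial>N)"
    have HH: "(\<integral>\<^sup>+a. h a \<partial>N) = ennreal H" using fin by (simp add: H_def)
    have H0: "0 \<le> H" by (simp add: H_def)
    have splitr: "H \<le> s powr (1 - r) * j + s * C" if "0 < s" for s
    proof -
      have "ennreal H \<le> ennreal (s powr (1 - r) * j + s * C)"
        using split[OF that] real that C by (simp add: HH ennreal_mult ennreal_plus)
      then show ?thesis using real that C by (subst (asm) ennreal_le_iff) auto
    qed
    have "H powr r \<le> 2 powr r * C powr (r - 1) * j"
    \<comment> \<open>The balancing choice of \<open>s\<close> below requires \<open>j > 0\<close>;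
      for \<open>j = 0\<close> the level may instead tend to 0.\<close>
    proof (cases "j = 0")
      case True
      have "H \<le> e" if "0 < e" for e
        using splitr[of "e / C"] that C True by simp
      then have "H = 0" using H0 by (meson dense_le leD le_less not_le)
      then show ?thesis using real by simp
    next
      case False
      then have j: "0 < j" using real by simp
      \<comment> \<open>This \<open>s\<close> makes the two terms of the splitting equal, so their
        sum is \<open>2 * s * C\<close>.\<close>
      define s where "s = (j / C) powr (1 / r)"
      have s: "0 < s" using j C by (simp add: s_def)
      have sr: "s powr r = j / C" using j C r by (simp add: s_def powr_powr)
      have "s powr (1 - r) * j = s * C"
        using sr s C j by (simp add: powr_diff field_simps)
      then have "H \<le> 2 * s * C" using splitr[OF s] by linarith
      then have "H powr r \<le> (2 * s * C) powr r" using H0 r by (intro powr_mono2) auto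
      also have "\<dots> = 2 powr r * (s powr r) * C powr r" using s C by (simp add: powr_mult)
      also have "\<dots> = 2 powr r * C powr (r - 1) * j"
        using C by (simp add: sr powr_diff field_simps)
      finally show ?thesis .
    qed
    then show ?thesis
      using real C unfolding J_def[symmetric]
      by (simp add: HH epow_def ennreal_mult'[symmetric] H0 ennreal_leI)
  qed
qed

text \<open>Minkowski's integral inequality with the loss of a factor 2. The weighted Hoelder bound
  is applied with the norms \<open>c a\<close> themselves as weight: after the integrals are
  exchanged, \<open>c a powr (1 - r)\<close> turns the given bound \<open>c a powr r\<close> back
  into \<open>c a\<close>, whose integral is at most \<open>C\<close>.\<close>

lemma Minkowski_nn:
  fixes h :: "'a \<Rightarrow> 'b \<Rightarrow> real" and c :: "'a \<Rightarrow> real"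
  assumes r: "1 < r" and C: "0 < C" and "sigma_finite_measure N" "sigma_finite_measure M"
    and hm: "(\<lambda>(a, x). h a x) \<in> borel_measurable (N \<Otimes>\<^sub>M M)"
    and cm[measurable]: "c \<in> borel_measurable N"
    and h: "\<And>a x. 0 \<le> h a x" and c: "\<And>a. a \<in> space N \<Longrightarrow> 0 < c a"
    and hc: "\<And>a. a \<in> space N \<Longrightarrow> (\<integral>\<^sup>+x. ennreal (h a x powr r) \<partial>M) \<le> ennreal (c a powr r)"
    and cC: "(\<integral>\<^sup>+a. c a \<partial>N) \<le> ennreal C"
  shows "(\<integral>\<^sup>+x. epow (\<integral>\<^sup>+a. h a x \<partial>N) r \<partial>M) \<le> ennreal ((2 * C) powr r)"
proof -
  interpret N: sigma_finite_measure N by fact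
  interpret M: sigma_finite_measure M by fact
  interpret pair_sigma_finite N M ..
  note hm[measurable]
  have swapm[measurable]: "(\<lambda>(x, a). h a x) \<in> borel_measurable (M \<Otimes>\<^sub>M N)"
    using measurable_compose[OF measurable_pair_swap' hm] by (simp add: split_beta')
  have "(\<integral>\<^sup>+x. epow (\<integral>\<^sup>+a. h a x \<partial>N) r \<partial>M)
      \<le> (\<integral>\<^sup>+x. ennreal (2 powr r * C powr (r - 1)) * (\<integral>\<^sup>+a. ennreal (h a x powr r * c a powr (1 - r)) \<partial>N) \<partial>M)"
    using assms by (intro nn_integral_mono nn_integral_powr_le) auto
  also have "\<dots> = ennreal (2 powr r * C powr (r - 1)) * (\<integral>\<^sup>+x. \<integral>\<^sup>+a. ennreal (h a x powr r * c a powr (1 - r)) \<partial>N \<partial>M)"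
    by (rule nn_integral_cmult) measurable
  also have "(\<integral>\<^sup>+x. \<integral>\<^sup>+a. ennreal (h a x powr r * c a powr (1 - r)) \<partial>N \<partial>M)
      = (\<integral>\<^sup>+a. \<integral>\<^sup>+x. ennreal (h a x powr r * c a powr (1 - r)) \<partial>M \<partial>N)"
    by (rule Fubini') measurable
  also have "\<dots> \<le> (\<integral>\<^sup>+a. ennreal (c a) \<partial>N)"
  proof (intro nn_integral_mono)
    fix a assume a: "a \<in> space N"
    have [measurable]: "h a \<in> borel_measurable M"
      using measurable_Pair2[OF hm a] by simp
    have "(\<integral>\<^sup>+x. ennreal (h a x powr r * c a powr (1 - r)) \<partial>M)
        = (\<integral>\<^sup>+x. ennreal (h a x powr r) \<partial>M) * ennreal (c a powr (1 - r))"
      by (subst nn_integral_multc[symmetric]) (auto simp: ennreal_mult)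
    also have "\<dots> \<le> ennreal (c a powr r) * ennreal (c a powr (1 - r))"
      using hc[OF a] by (intro mult_right_mono) auto
    also have "\<dots> = ennreal (c a)"
      using c[OF a] by (simp flip: ennreal_mult powr_add)
    finally show "(\<integral>\<^sup>+x. ennreal (h a x powr r * c a powr (1 - r)) \<partial>M) \<le> ennreal (c a)" .
  qed
  also have "\<dots> \<le> ennreal C" by (rule cC)
  finally have "(\<integral>\<^sup>+x. epow (\<integral>\<^sup>+a. h a x \<partial>N) r \<partial>M) \<le> ennreal (2 powr r * C powr (r - 1)) * ennreal C"
    by (simp add: mult_left_mono)
  also have "\<dots> = ennreal ((2 * C) powr r)"
    using C by (simp add: ennreal_mult'[symmetric] powr_mult powr_diff)
  finally show ?thesis .
qed

text \<open>For a counting measure \<open>N\<close> this sums infinitely many functions at the price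
  of a single factor 2, whereas adding them one at a time would lose a factor in each step.\<close>

lemma Lp_bdd_integral:
  fixes G :: "'b \<Rightarrow> 'a::euclidean_space \<Rightarrow> complex"
  assumes r: "1 < r" and C: "0 < C" and N: "sigma_finite_measure N"
    and Gm[measurable]: "(\<lambda>(a, x). G a x) \<in> borel_measurable (N \<Otimes>\<^sub>M borel)"
    and cm[measurable]: "c \<in> borel_measurable N"
    and G: "\<And>a. a \<in> space N \<Longrightarrow> Lp_bdd r (c a) (G a)"
    and cC: "(\<integral>\<^sup>+a. ennreal (c a) \<partial>N) \<le> ennreal C"
  shows "Lp_bdd r (2 * C) (\<lambda>x. \<integral>a. G a x \<partial>N)"
proof -
  interpret N: sigma_finite_measure N by fact
  have Gm': "(\<lambda>(a, x). norm (G a x)) \<in> borel_measurable (N \<Otimes>\<^sub>M lborel)" by measurable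
  have swapm[measurable]: "(\<lambda>(x, a). G a x) \<in> borel_measurable (borel \<Otimes>\<^sub>M N)"
    using measurable_compose[OF measurable_pair_swap' Gm] by (simp add: split_beta')
  have "(\<integral>\<^sup>+x. ennreal (norm (\<integral>a. G a x \<partial>N) powr r) \<partial>lborel) \<le> (\<integral>\<^sup>+x. epow (\<integral>\<^sup>+a. norm (G a x) \<partial>N) r \<partial>lborel)"
  proof (intro nn_integral_mono)
    fix x
    have le: "ennreal (norm (\<integral>a. G a x \<partial>N)) \<le> (\<integral>\<^sup>+a. norm (G a x) \<partial>N)"
      by (rule norm_integral_le_nn_integral)
    show "ennreal (norm (\<integral>a. G a x \<partial>N) powr r) \<le> epow (\<integral>\<^sup>+a. norm (G a x) \<partial>N) r"
    proof (cases "\<integral>\<^sup>+a. norm (G a x) \<partial>N")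
      case top
      then show ?thesis by (simp add: epow_def)
    next
      case (real z)
      then show ?thesis using le r by (auto simp: epow_def intro!: ennreal_leI powr_mono2)
    qed
  qed
  also have "\<dots> \<le> ennreal ((2 * C) powr r)"
    using G by (intro Minkowski_nn[OF r C N sigma_finite_lborel Gm' cm _ _ _ cC])
      (auto simp: Lp_bdd_def)
  finally show ?thesis using C by (auto simp: Lp_bdd_def)
qed

section \<open>Convolution with integrable and bounded kernels\<close>

lemma conv_alt:
  fixes K g :: "'a::euclidean_space \<Rightarrow> complex"
  assumes [measurable]: "K \<in> borel_measurable borel" "g \<in> borel_measurable borel"
  shows "conv K g x = (\<integral>y. K (x - y) * g y \<partial>lborel)"
  unfolding conv_def using integral_reflect[of "\<lambda>z. K z * g (x - z)" x] by simp

lemma conv_measurable: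
  assumes [measurable]: "K \<in> borel_measurable borel" "g \<in> borel_measurable borel"
  shows "conv K g \<in> borel_measurable borel"
  unfolding conv_def[abs_def] by measurable

text \<open>Splitting \<open>norm (g y)\<close> at the level \<open>c\<close> leaves two parts: one
  is controlled by the sup norm of the kernel and the r-th power integral of \<open>g\<close>, the
  other by the integral of the kernel. Each contributes \<open>A * c\<close>.\<close>

lemma nn_conv_le:
  fixes K g :: "'a::euclidean_space \<Rightarrow> complex"
  assumes r: "1 < r" and K: "kernel_bdd A K" and g: "Lp_bdd r c g"
  shows "(\<integral>\<^sup>+y. ennreal (norm (K (x - y) * g y)) \<partial>lborel) \<le> ennreal (2 * A * c)"
proof -
  have [measurable]: "K \<in> borel_measurable borel" "g \<in> borel_measurable borel"
    using K g by (auto simp: kernel_bdd_def Lp_bdd_def)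
  have A: "0 < A" and c: "0 < c" and KA: "\<And>x. norm (K x) \<le> A" using K g by (auto simp: kernel_bdd_def Lp_bdd_def)
  have "(\<integral>\<^sup>+y. ennreal (norm (K (x - y) * g y)) \<partial>lborel)
      \<le> (\<integral>\<^sup>+y. ennreal (A * c powr (1 - r)) * ennreal (norm (g y) powr r) + ennreal c * ennreal (norm (K (x - y))) \<partial>lborel)"
  proof (intro nn_integral_mono)
    fix y
    have "norm (K (x - y) * g y) \<le> norm (K (x - y)) * (c powr (1 - r) * norm (g y) powr r + c)"
      unfolding norm_mult using le_powr_split[of "norm (g y)" c r] c r by (intro mult_left_mono) auto
    also have "\<dots> \<le> A * (c powr (1 - r) * norm (g y) powr r) + c * norm (K (x - y))"
      using mult_right_mono[OF KA[of "x - y"], of "c powr (1 - r) * norm (g y) powr r"]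
      by (simp add: algebra_simps)
    finally show "ennreal (norm (K (x - y) * g y)) \<le> ennreal (A * c powr (1 - r)) * ennreal (norm (g y) powr r) + ennreal c * ennreal (norm (K (x - y)))"
      using c A by (simp flip: ennreal_plus ennreal_mult' add: ennreal_leI mult.assoc)
  qed
  also have "\<dots> = ennreal (A * c powr (1 - r)) * (\<integral>\<^sup>+y. ennreal (norm (g y) powr r) \<partial>lborel) + ennreal c * (\<integral>\<^sup>+y. ennreal (norm (K y)) \<partial>lborel)"
    by (simp add: nn_integral_add nn_integral_cmult nn_integral_reflect[of "\<lambda>y. ennreal (norm (K y))"])
  also have "\<dots> \<le> ennreal (A * c powr (1 - r)) * ennreal (c powr r) + ennreal c * ennreal A"
    using K g by (intro add_mono mult_left_mono) (auto simp: kernel_bdd_def Lp_bdd_def)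
  also have "\<dots> = ennreal (A * (c powr (1 - r) * c powr r) + c * A)"
    using A c by (simp flip: ennreal_plus ennreal_mult add: mult.assoc)
  also have "\<dots> = ennreal (2 * A * c)" using c by (simp add: algebra_simps flip: powr_add)
  finally show ?thesis .
qed

lemma conv_integrable:
  fixes K g :: "'a::euclidean_space \<Rightarrow> complex"
  assumes r: "1 < r" and K: "kernel_bdd A K" and g: "Lp_bdd r c g"
  shows "integrable lborel (\<lambda>y. K (x - y) * g y)"
proof (intro integrableI_bounded)
  have [measurable]: "K \<in> borel_measurable borel" "g \<in> borel_measurable borel"
    using K g by (auto simp: kernel_bdd_def Lp_bdd_def)
  show "(\<lambda>y. K (x - y) * g y) \<in> borel_measurable lborel" by measurable
qed (use nn_conv_le[OF assms, of x] in \<open>auto intro: le_less_trans\<close>)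

lemma conv_bound:
  fixes K g :: "'a::euclidean_space \<Rightarrow> complex"
  assumes r: "1 < r" and K: "kernel_bdd A K" and g: "Lp_bdd r c g"
  shows "norm (conv K g x) \<le> 2 * A * c"
proof -
  have "ennreal (norm (conv K g x)) \<le> ennreal (2 * A * c)"
    unfolding conv_alt[OF kernel_bdd_measurable[OF K] Lp_bdd_measurable[OF g]]
    by (rule order_trans[OF norm_integral_le_nn_integral nn_conv_le[OF assms]])
  then show ?thesis using kernel_bdd_pos[OF K] Lp_bdd_pos[OF g] by (subst (asm) ennreal_le_iff) auto
qed

text \<open>A convolution is a superposition of translates, all of which have the same norm. The
  modulus of the kernel becomes the measure \<open>N\<close>, its phase \<open>sgn (K z)\<close>
  stays in the integrand. Only the integral of the kernel enters the constant; this matters for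
  low-pass kernels, for which that integral, but no sup bound, is controlled uniformly in the
  cut-off frequency.\<close>

lemma Lp_bdd_conv_L1:
  fixes K g :: "'a::euclidean_space \<Rightarrow> complex"
  assumes r: "1 < r" and K: "K \<in> borel_measurable borel" "(\<integral>\<^sup>+x. norm (K x) \<partial>lborel) \<le> ennreal A" "0 < A" and g: "Lp_bdd r c g"
  shows "Lp_bdd r (2 * (A * c)) (conv K g)"
proof -
  have [measurable]: "K \<in> borel_measurable borel" "g \<in> borel_measurable borel"
    using K g by (auto simp: Lp_bdd_def)
  have c: "0 < c" using g by (auto simp: Lp_bdd_def)
  define N where "N = density lborel (\<lambda>z. ennreal (norm (K z)))"
  have N: "sigma_finite_measure N"
    unfolding N_def by (subst sigma_finite_measure.sigma_finite_iff_density_finite[OF sigma_finite_lborel]) auto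
  have "Lp_bdd r (2 * (A * c)) (\<lambda>x. \<integral>z. sgn (K z) * g (x - z) \<partial>N)"
  proof (rule Lp_bdd_integral[OF r _ N, where c="\<lambda>_. c"])
    show "0 < A * c" using K(3) c by simp
    show "(\<lambda>(a, x). sgn (K a) * g (x - a)) \<in> borel_measurable (N \<Otimes>\<^sub>M borel)"
      unfolding N_def sgn_div_norm[abs_def] by measurable
    show "(\<integral>\<^sup>+a. ennreal c \<partial>N) \<le> ennreal (A * c)"
      using K c unfolding N_def
      by (subst nn_integral_density) (auto simp: nn_integral_multc ennreal_mult intro!: mult_right_mono)
    fix a
    have "(\<integral>\<^sup>+x. ennreal (norm (sgn (K a) * g (x - a)) powr r) \<partial>lborel) \<le> (\<integral>\<^sup>+x. ennreal (norm (g (x - a)) powr r) \<partial>lborel)"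
      using r by (intro nn_integral_mono ennreal_leI powr_mono2) (auto simp: norm_mult norm_sgn)
    also have "\<dots> = (\<integral>\<^sup>+x. ennreal (norm (g x) powr r) \<partial>lborel)"
      by (rule nn_integral_translate) measurable
    finally show "Lp_bdd r c (\<lambda>x. sgn (K a) * g (x - a))"
      using g by (auto simp: Lp_bdd_def)
  qed (auto simp: N_def)
  moreover have "(\<integral>z. sgn (K z) * g (x - z) \<partial>N) = conv K g x" for x
    unfolding N_def conv_def sgn_div_norm
    by (subst integral_density) (auto intro!: Bochner_Integration.integral_cong simp: scaleR_conv_of_real)
  ultimately show ?thesis by simp
qed

lemma Lp_bdd_conv:
  fixes K g :: "'a::euclidean_space \<Rightarrow> complex"
  assumes "1 < r" "kernel_bdd A K" "Lp_bdd r c g"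
  shows "Lp_bdd r (2 * (A * c)) (conv K g)"
  using assms by (intro Lp_bdd_conv_L1) (auto simp: kernel_bdd_def)

lemma kernel_bdd_sum:
  fixes A :: real
  assumes "finite F" "F \<noteq> {}" "\<And>k. k \<in> F \<Longrightarrow> kernel_bdd A (K k)"
  shows "kernel_bdd (real (card F) * A) (\<lambda>x. \<Sum>k\<in>F. K k x)"
proof -
  have A: "0 < A" using assms by (auto simp: kernel_bdd_def)
  have [measurable]: "\<And>k. k \<in> F \<Longrightarrow> K k \<in> borel_measurable borel" using assms by (auto simp: kernel_bdd_def)
  have "norm (\<Sum>k\<in>F. K k x) \<le> card F * A" for x
    using assms by (intro order_trans[OF sum_norm_bound]) (auto simp: kernel_bdd_def)
  moreover have "(\<integral>\<^sup>+x. ennreal (norm (\<Sum>k\<in>F. K k x)) \<partial>lborel) \<le> (\<integral>\<^sup>+x. (\<Sum>k\<in>F. ennreal (norm (K k x))) \<partial>lborel)"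
    by (intro nn_integral_mono) (auto simp: norm_sum intro!: ennreal_leI)
  moreover have "\<dots> = (\<Sum>k\<in>F. (\<integral>\<^sup>+x. ennreal (norm (K k x)) \<partial>lborel))"
    by (rule nn_integral_sum) auto
  moreover have "\<dots> \<le> (\<Sum>k\<in>F. ennreal A)"
    using assms by (intro sum_mono) (auto simp: kernel_bdd_def)
  moreover have "\<dots> = ennreal (card F * A)" using A by (simp add: ennreal_mult ennreal_of_nat_eq_real_of_nat)
  ultimately show ?thesis using assms A unfolding kernel_bdd_def
    by (auto simp: card_gt_0_iff intro: order_trans)
qed

lemma conv_add:
  assumes "1 < r" "kernel_bdd A K" "Lp_bdd r c g" "Lp_bdd r d h"
  shows "conv K (\<lambda>x. g x + h x) x = conv K g x + conv K h x"
proof -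
  note m[measurable] = Lp_bdd_measurable[OF assms(3)] Lp_bdd_measurable[OF assms(4)] kernel_bdd_measurable[OF assms(2)]
  show ?thesis
    using conv_integrable[OF assms(1,2,3), of x] conv_integrable[OF assms(1,2,4), of x]
    by (subst (1 2 3) conv_alt) (auto simp: algebra_simps)
qed

lemma conv_cmult: "conv K (\<lambda>x. a * g x) x = a * conv K g x"
  unfolding conv_def by (subst integral_mult_right_zero[symmetric]) (simp add: algebra_simps)

lemma conv_diff:
  assumes "1 < r" "kernel_bdd A K" "Lp_bdd r c g" "Lp_bdd r d h"
  shows "conv K (\<lambda>x. g x - h x) x = conv K g x - conv K h x"
proof -
  note m[measurable] = Lp_bdd_measurable[OF assms(3)] Lp_bdd_measurable[OF assms(4)] kernel_bdd_measurable[OF assms(2)]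
  show ?thesis
    using conv_integrable[OF assms(1,2,3), of x] conv_integrable[OF assms(1,2,4), of x]
    by (subst (1 2 3) conv_alt) (auto simp: algebra_simps)
qed

lemma conv_kernel_sum:
  assumes "1 < r" "\<And>k. k \<in> F \<Longrightarrow> kernel_bdd A (K k)" "Lp_bdd r c g"
  shows "conv (\<lambda>x. \<Sum>k\<in>F. K k x) g x = (\<Sum>k\<in>F. conv (K k) g x)"
proof -
  have [measurable]: "\<And>k. k \<in> F \<Longrightarrow> K k \<in> borel_measurable borel" "g \<in> borel_measurable borel"
    using assms by (auto simp: kernel_bdd_def Lp_bdd_def)
  have "conv (\<lambda>x. \<Sum>k\<in>F. K k x) g x = (\<integral>y. (\<Sum>k\<in>F. K k (x - y) * g y) \<partial>lborel)"
    by (subst conv_alt) (auto simp: sum_distrib_right)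
  also have "\<dots> = (\<Sum>k\<in>F. (\<integral>y. K k (x - y) * g y \<partial>lborel))"
    by (rule Bochner_Integration.integral_sum) (use conv_integrable[OF assms(1) assms(2) assms(3)] in auto)
  also have "\<dots> = (\<Sum>k\<in>F. conv (K k) g x)"
    by (intro sum.cong refl conv_alt[symmetric]) auto
  finally show ?thesis .
qed

lemma conv_cong_AE:
  assumes [measurable]: "K \<in> borel_measurable borel" "g \<in> borel_measurable borel" "h \<in> borel_measurable borel"
    and "AE x in lborel. g x = h x"
  shows "conv K g x = conv K h x"
  using assms(4) by (subst (1 2) conv_alt) (auto intro!: integral_cong_AE elim: eventually_mono)

lemma conv_integral:
  fixes G :: "'b \<Rightarrow> 'a::euclidean_space \<Rightarrow> complex"
  assumes r: "1 < r" and N: "sigma_finite_measure N" and K: "kernel_bdd A K"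
    and Gm[measurable]: "(\<lambda>(a, x). G a x) \<in> borel_measurable (N \<Otimes>\<^sub>M borel)"
    and G: "\<And>a. a \<in> space N \<Longrightarrow> Lp_bdd r (c a) (G a)"
    and cm: "c \<in> borel_measurable N" and cC: "(\<integral>\<^sup>+a. ennreal (c a) \<partial>N) < \<infinity>"
  shows "conv K (\<lambda>x. \<integral>a. G a x \<partial>N) x = (\<integral>a. conv K (G a) x \<partial>N)"
proof -
  note [measurable] = kernel_bdd_measurable[OF K]
  interpret N: sigma_finite_measure N by fact
  have A: "0 < A" using K by (simp add: kernel_bdd_def)
  have swapm[measurable]: "(\<lambda>(x, a). G a x) \<in> borel_measurable (borel \<Otimes>\<^sub>M N)"
    using measurable_compose[OF measurable_pair_swap' Gm] by (simp add: split_beta')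
  have "(\<integral>\<^sup>+a. \<integral>\<^sup>+y. norm (K (x - y) * G a y) \<partial>lborel \<partial>N) \<le> (\<integral>\<^sup>+a. ennreal (2 * A) * ennreal (c a) \<partial>N)"
  proof (intro nn_integral_mono)
    fix a assume "a \<in> space N"
    from nn_conv_le[OF r K G[OF this], of x]
    show "(\<integral>\<^sup>+y. norm (K (x - y) * G a y) \<partial>lborel) \<le> ennreal (2 * A) * ennreal (c a)"
      using A by (simp add: ennreal_mult' mult.assoc)
  qed
  also have "\<dots> < \<infinity>" using cC cm by (subst nn_integral_cmult) (auto simp: ennreal_mult_less_top)
  finally have fin: "(\<integral>\<^sup>+a. \<integral>\<^sup>+y. norm (K (x - y) * G a y) \<partial>lborel \<partial>N) < \<infinity>" .
  have "(\<integral>a. conv K (G a) x \<partial>N) = (\<integral>a. \<integral>y. K (x - y) * G a y \<partial>lborel \<partial>N)"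
    using G by (intro Bochner_Integration.integral_cong refl conv_alt) (auto simp: Lp_bdd_def)
  also have "\<dots> = (\<integral>y. \<integral>a. K (x - y) * G a y \<partial>N \<partial>lborel)"
    by (rule Fubini_swap(1)[OF N sigma_finite_lborel _ fin]) measurable
  also have "\<dots> = (\<integral>y. K (x - y) * (\<integral>a. G a y \<partial>N) \<partial>lborel)" by simp
  also have "\<dots> = conv K (\<lambda>x. \<integral>a. G a x \<partial>N) x" by (rule conv_alt[symmetric]) measurable
  finally show ?thesis by simp
qed

text \<open>This takes the place of a convolution algebra: kernels act one after the other on
  \<open>g\<close> and are not convolved with each other.\<close>

lemma conv_commute:
  fixes K K' g :: "'a::euclidean_space \<Rightarrow> complex"
  assumes r: "1 < r" and K: "kernel_bdd A K" and K': "kernel_bdd A' K'" and g: "Lp_bdd r c g"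
  shows "conv K (conv K' g) x = conv K' (conv K g) x"
proof -
  note [measurable] = kernel_bdd_measurable[OF K] kernel_bdd_measurable[OF K'] Lp_bdd_measurable[OF g]
  have A: "0 < A" and A': "0 < A'" using K K' by (auto simp: kernel_bdd_def)
  have c: "0 < c" using g by (auto simp: Lp_bdd_def)
  have le: "(\<integral>\<^sup>+y. norm (K (x - y) * (K' z * g (y - z))) \<partial>lborel) \<le> ennreal (2 * A * c) * ennreal (norm (K' z))" for z
  proof -
    have "(\<integral>\<^sup>+y. norm (K (x - y) * (K' z * g (y - z))) \<partial>lborel) = (\<integral>\<^sup>+y. norm (K (x - y) * g (y - z)) * ennreal (norm (K' z)) \<partial>lborel)"
      by (auto simp: norm_mult ennreal_mult' algebra_simps)
    also have "\<dots> = (\<integral>\<^sup>+y. ennreal (norm (K (x - y) * g (y - z))) \<partial>lborel) * ennreal (norm (K' z))"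
      by (rule nn_integral_multc) measurable
    also have "(\<integral>\<^sup>+y. ennreal (norm (K (x - y) * g (y - z))) \<partial>lborel) = (\<integral>\<^sup>+y. ennreal (norm (K ((x - z) - y) * g y)) \<partial>lborel)"
      using nn_integral_translate[of "\<lambda>y. ennreal (norm (K ((x - z) - y) * g y))" z] by (simp add: algebra_simps)
    also have "\<dots> \<le> ennreal (2 * A * c)" by (rule nn_conv_le[OF r K g])
    finally show ?thesis by (simp add: mult_right_mono)
  qed
  have "(\<integral>\<^sup>+z. \<integral>\<^sup>+y. norm (K (x - y) * (K' z * g (y - z))) \<partial>lborel \<partial>lborel) \<le> (\<integral>\<^sup>+z. ennreal (2 * A * c) * ennreal (norm (K' z)) \<partial>lborel)"
    by (intro nn_integral_mono le)
  also have "\<dots> < \<infinity>"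
    using K' by (subst nn_integral_cmult) (auto simp: kernel_bdd_def ennreal_mult_less_top intro: le_less_trans)
  finally have fin: "(\<integral>\<^sup>+z. \<integral>\<^sup>+y. norm (K (x - y) * (K' z * g (y - z))) \<partial>lborel \<partial>lborel) < \<infinity>" .
  have "conv K (conv K' g) x = (\<integral>y. K (x - y) * conv K' g y \<partial>lborel)"
    by (rule conv_alt) (auto intro: conv_measurable)
  also have "\<dots> = (\<integral>y. \<integral>z. K (x - y) * (K' z * g (y - z)) \<partial>lborel \<partial>lborel)"
    unfolding conv_def by simp
  also have "\<dots> = (\<integral>z. \<integral>y. K (x - y) * (K' z * g (y - z)) \<partial>lborel \<partial>lborel)"
    by (rule Fubini_swap(1)[OF sigma_finite_lborel sigma_finite_lborel _ fin, symmetric]) measurable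
  also have "\<dots> = (\<integral>z. K' z * conv K g (x - z) \<partial>lborel)"
  proof (intro Bochner_Integration.integral_cong refl)
    fix z
    have "(\<integral>y. K (x - y) * (K' z * g (y - z)) \<partial>lborel) = (\<integral>y. K' z * (K ((x - z) - (y - z)) * g (y - z)) \<partial>lborel)"
      by (simp add: algebra_simps)
    also have "\<dots> = K' z * (\<integral>y. K ((x - z) - (y - z)) * g (y - z) \<partial>lborel)"
      by (rule integral_mult_right_zero)
    also have "(\<integral>y. K ((x - z) - (y - z)) * g (y - z) \<partial>lborel) = (\<integral>y. K ((x - z) - y) * g y \<partial>lborel)"
      by (rule integral_translate) measurable
    also have "\<dots> = conv K g (x - z)" by (rule conv_alt[symmetric]) measurable
    finally show "(\<integral>y. K (x - y) * (K' z * g (y - z)) \<partial>lborel) = K' z * conv K g (x - z)" .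
  qed
  also have "\<dots> = conv K' (conv K g) x" by (simp add: conv_def)
  finally show ?thesis .
qed

section \<open>Spectra of bounded functions\<close>

text \<open>The spectrum of a bounded function, described by annihilators: products are then immediate,
  because multiplication by a character shifts the annihilator.\<close>

definition spec_in :: "'a::euclidean_space set \<Rightarrow> ('a \<Rightarrow> complex) \<Rightarrow> bool" where
  "spec_in B g \<longleftrightarrow> g \<in> borel_measurable borel \<and> (\<exists>c. AE x in lborel. norm (g x) \<le> c) \<and>
     (\<forall>\<psi>. integrable lborel \<psi> \<longrightarrow> (\<forall>\<eta>\<in>B. (\<integral>x. \<psi> x * cis (x \<bullet> \<eta>) \<partial>lborel) = 0) \<longrightarrow>
        (\<integral>x. g x * \<psi> x \<partial>lborel) = 0)"

text \<open>Both directions are recorded. The formula for \<open>K\<close> as a superposition of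
  characters locates the spectrum of a convolution; the formula for \<sigma> says how
  \<open>K\<close> acts on characters. The power of \<open>2 * pi\<close> is the product of the two
  symmetric normalisations.\<close>

definition fourier_pair :: "real \<Rightarrow> ('a::euclidean_space \<Rightarrow> complex) \<Rightarrow> ('a \<Rightarrow> complex) \<Rightarrow> bool" where
  "fourier_pair A \<sigma> K \<longleftrightarrow> kernel_bdd A K \<and> integrable lborel \<sigma> \<and>
     (\<forall>x. K x = of_real ((2 * pi) powr (- real DIM('a))) * (\<integral>\<eta>. \<sigma> \<eta> * cis (x \<bullet> \<eta>) \<partial>lborel)) \<and>
     (\<forall>\<eta>. (\<integral>z. K z * cis (- (z \<bullet> \<eta>)) \<partial>lborel) = \<sigma> \<eta>)"

lemma fourier_pair_kernel: "fourier_pair A \<sigma> K \<Longrightarrow> kernel_bdd A K"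
  by (simp add: fourier_pair_def)

lemma cis_measurable[measurable]: "cis \<in> borel_measurable borel"
  by (intro borel_measurable_continuous_onI continuous_intros)

lemma cnj_measurable[measurable]: "cnj \<in> borel_measurable borel"
  by (intro borel_measurable_continuous_onI continuous_intros)

lemma integrable_mult_bounded:
  fixes f g :: "'a \<Rightarrow> complex"
  assumes "integrable M f" "g \<in> borel_measurable M" "AE x in M. norm (g x) \<le> c"
  shows "integrable M (\<lambda>x. g x * f x)"
proof (rule Bochner_Integration.integrable_bound)
  show "integrable M (\<lambda>x. c *\<^sub>R norm (f x))" using assms by auto
  show "AE x in M. norm (g x * f x) \<le> norm (c *\<^sub>R norm (f x))"
    using assms(3) by eventually_elim (auto simp: norm_mult abs_mult intro!: mult_right_mono)
qed (use assms in auto)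

lemma integrable_mult_cis:
  fixes f :: "'a::euclidean_space \<Rightarrow> complex"
  assumes "integrable lborel f"
  shows "integrable lborel (\<lambda>x. f x * cis (x \<bullet> \<eta>))" "integrable lborel (\<lambda>x. f x * cis (- (x \<bullet> \<eta>)))"
    "integrable lborel (\<lambda>x. f x * cis (\<eta> \<bullet> x))"
  using integrable_mult_bounded[OF assms, of "\<lambda>x. cis (x \<bullet> \<eta>)" 1]
    integrable_mult_bounded[OF assms, of "\<lambda>x. cis (- (x \<bullet> \<eta>))" 1]
    integrable_mult_bounded[OF assms, of "\<lambda>x. cis (\<eta> \<bullet> x)" 1]
  by (simp_all add: mult.commute)

lemma fourier_pair_sum:
  fixes A :: real
  assumes "finite F" "F \<noteq> {}" "\<And>k. k \<in> F \<Longrightarrow> fourier_pair A (\<sigma> k) (K k)"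
  shows "fourier_pair (real (card F) * A) (\<lambda>\<xi>. \<Sum>k\<in>F. \<sigma> k \<xi>) (\<lambda>x. \<Sum>k\<in>F. K k x)"
proof -
  have k: "integrable lborel (\<sigma> k)" "integrable lborel (K k)" if "k \<in> F" for k
    using assms(3)[OF that] by (auto simp: fourier_pair_def intro: kernel_bdd_integrable)
  have inv: "K k x = of_real ((2 * pi) powr (- real DIM('b))) * (\<integral>\<eta>. \<sigma> k \<eta> * cis (x \<bullet> \<eta>) \<partial>lborel)"
    and hat: "(\<integral>z. K k z * cis (- (z \<bullet> \<eta>)) \<partial>lborel) = \<sigma> k \<eta>" if "k \<in> F" for k x \<eta>
    using assms(3)[OF that] unfolding fourier_pair_def by blast+
  have "(\<Sum>k\<in>F. K k x) = of_real ((2 * pi) powr (- real DIM('b))) * (\<integral>\<eta>. (\<Sum>k\<in>F. \<sigma> k \<eta>) * cis (x \<bullet> \<eta>) \<partial>lborel)" for x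
  proof -
    have "(\<integral>\<eta>. (\<Sum>k\<in>F. \<sigma> k \<eta>) * cis (x \<bullet> \<eta>) \<partial>lborel) = (\<Sum>k\<in>F. (\<integral>\<eta>. \<sigma> k \<eta> * cis (x \<bullet> \<eta>) \<partial>lborel))"
      unfolding sum_distrib_right by (rule Bochner_Integration.integral_sum) (use k integrable_mult_cis(3) in blast)
    then show ?thesis unfolding sum_distrib_left by (simp add: sum_distrib_left inv cong: sum.cong)
  qed
  moreover have "(\<integral>z. (\<Sum>k\<in>F. K k z) * cis (- (z \<bullet> \<eta>)) \<partial>lborel) = (\<Sum>k\<in>F. \<sigma> k \<eta>)" for \<eta>
  proof -
    have "(\<integral>z. (\<Sum>k\<in>F. K k z) * cis (- (z \<bullet> \<eta>)) \<partial>lborel) = (\<Sum>k\<in>F. (\<integral>z. K k z * cis (- (z \<bullet> \<eta>)) \<partial>lborel))"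
      unfolding sum_distrib_right by (rule Bochner_Integration.integral_sum) (use k integrable_mult_cis(2) in blast)
    then show ?thesis by (simp add: hat cong: sum.cong)
  qed
  moreover have "kernel_bdd (real (card F) * A) (\<lambda>x. \<Sum>k\<in>F. K k x)"
    using assms by (intro kernel_bdd_sum fourier_pair_kernel) auto
  moreover have "integrable lborel (\<lambda>\<xi>. \<Sum>k\<in>F. \<sigma> k \<xi>)" using k by auto
  ultimately show ?thesis unfolding fourier_pair_def by blast
qed

lemma fourier_pair_translate:
  assumes "fourier_pair A \<sigma> K"
  shows "fourier_pair A (\<lambda>\<eta>. \<sigma> (\<eta> - k)) (\<lambda>x. cis (x \<bullet> k) * K x)"
proof -
  have s: "integrable lborel \<sigma>" and K: "kernel_bdd A K"
    and inv: "\<And>x. K x = of_real ((2 * pi) powr (- real DIM('a))) * (\<integral>\<eta>. \<sigma> \<eta> * cis (x \<bullet> \<eta>) \<partial>lborel)"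
    and hat: "\<And>\<eta>. (\<integral>z. K z * cis (- (z \<bullet> \<eta>)) \<partial>lborel) = \<sigma> \<eta>"
    using assms by (auto simp: fourier_pair_def)
  have [measurable]: "\<sigma> \<in> borel_measurable borel" "K \<in> borel_measurable borel"
    using s K by (auto simp: kernel_bdd_def)
  have "integrable lborel (\<lambda>\<eta>. \<sigma> (\<eta> - k))"
    using s nn_integral_translate[of "\<lambda>\<eta>. ennreal (norm (\<sigma> \<eta>))" k]
    by (auto simp: integrable_iff_bounded)
  moreover have "cis (x \<bullet> k) * K x = of_real ((2 * pi) powr (- real DIM('a))) * (\<integral>\<eta>. \<sigma> (\<eta> - k) * cis (x \<bullet> \<eta>) \<partial>lborel)" for x
  proof -
    have "(\<integral>\<eta>. \<sigma> (\<eta> - k) * cis (x \<bullet> \<eta>) \<partial>lborel) = (\<integral>\<eta>. \<sigma> (\<eta> - k) * cis (x \<bullet> (\<eta> - k) + x \<bullet> k) \<partial>lborel)"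
      by (simp add: inner_diff_right)
    also have "\<dots> = (\<integral>\<eta>. \<sigma> \<eta> * cis (x \<bullet> \<eta> + x \<bullet> k) \<partial>lborel)"
      by (rule integral_translate[of "\<lambda>\<eta>. \<sigma> \<eta> * cis (x \<bullet> \<eta> + x \<bullet> k)"]) measurable
    also have "\<dots> = (\<integral>\<eta>. cis (x \<bullet> k) * (\<sigma> \<eta> * cis (x \<bullet> \<eta>)) \<partial>lborel)"
      by (simp add: cis_mult[symmetric] algebra_simps)
    finally show ?thesis by (simp add: inv)
  qed
  moreover have "(\<integral>z. cis (z \<bullet> k) * K z * cis (- (z \<bullet> \<eta>)) \<partial>lborel) = \<sigma> (\<eta> - k)" for \<eta>
  proof -
    have "cis (z \<bullet> k) * K z * cis (- (z \<bullet> \<eta>)) = K z * cis (- (z \<bullet> (\<eta> - k)))" for z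
      by (simp add: inner_diff_right cis_mult algebra_simps)
    then show ?thesis by (simp only: hat)
  qed
  moreover have "kernel_bdd A (\<lambda>x. cis (x \<bullet> k) * K x)"
    using K unfolding kernel_bdd_def by (auto simp: norm_mult)
  ultimately show ?thesis unfolding fourier_pair_def by blast
qed

lemma spec_in_one: "0 \<in> B \<Longrightarrow> spec_in B (\<lambda>_. 1)"
  unfolding spec_in_def by (auto intro!: exI[of _ 1])

text \<open>The characters are moved step by step onto the test function: for \<eta> in
  \<open>B'\<close> the product of \<psi> with the character \<eta> is annihilated on
  \<open>B\<close>, so testing \<open>g\<close> with it gives 0. This says that
  \<open>g * \<psi>\<close> is annihilated on \<open>B'\<close>, and \<open>h\<close> can be tested
  with it.\<close>

lemma spec_in_mult:
  fixes g h :: "'a::euclidean_space \<Rightarrow> complex"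
  assumes g: "spec_in B g" and h: "spec_in B' h" and B: "\<And>b b'. b \<in> B \<Longrightarrow> b' \<in> B' \<Longrightarrow> b + b' \<in> B''"
  shows "spec_in B'' (\<lambda>x. g x * h x)"
  unfolding spec_in_def
proof (intro conjI allI impI)
  obtain c c' where c: "AE x in lborel. norm (g x) \<le> c" and c': "AE x in lborel. norm (h x) \<le> c'"
    using g h unfolding spec_in_def by auto
  have [measurable]: "g \<in> borel_measurable borel" "h \<in> borel_measurable borel"
    using g h by (auto simp: spec_in_def)
  show "(\<lambda>x. g x * h x) \<in> borel_measurable borel" by measurable
  have "AE x in lborel. norm (g x * h x) \<le> c * c'"
    using c c' by eventually_elim (auto simp: norm_mult intro!: mult_mono order_trans[OF norm_ge_zero])
  then show "\<exists>c. AE x in lborel. norm (g x * h x) \<le> c" by blast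
  fix \<psi> :: "'a \<Rightarrow> complex"
  assume psi: "integrable lborel \<psi>" and z: "\<forall>\<eta>\<in>B''. (\<integral>x. \<psi> x * cis (x \<bullet> \<eta>) \<partial>lborel) = 0"
  have "(\<integral>x. h x * (g x * \<psi> x) \<partial>lborel) = 0"
  proof -
    have "integrable lborel (\<lambda>x. g x * \<psi> x)"
      using c by (rule integrable_mult_bounded[OF psi, rotated]) measurable
    moreover have "(\<integral>x. g x * \<psi> x * cis (x \<bullet> \<eta>) \<partial>lborel) = 0" if "\<eta> \<in> B'" for \<eta>
    proof -
      have "(\<integral>x. (\<psi> x * cis (x \<bullet> \<eta>)) * cis (x \<bullet> \<zeta>) \<partial>lborel) = 0" if "\<zeta> \<in> B" for \<zeta>
      proof -
        have "(\<psi> x * cis (x \<bullet> \<eta>)) * cis (x \<bullet> \<zeta>) = \<psi> x * cis (x \<bullet> (\<zeta> + \<eta>))" for x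
          by (simp add: inner_add_right cis_mult algebra_simps)
        then show ?thesis using z B[OF \<open>\<zeta> \<in> B\<close> \<open>\<eta> \<in> B'\<close>] by (simp only:)
      qed
      then have "(\<integral>x. g x * (\<psi> x * cis (x \<bullet> \<eta>)) \<partial>lborel) = 0"
        using g integrable_mult_cis(1)[OF psi, of \<eta>] unfolding spec_in_def by blast
      then show ?thesis by (simp add: mult.assoc)
    qed
    ultimately show ?thesis using h unfolding spec_in_def by blast
  qed
  then show "(\<integral>x. g x * h x * \<psi> x \<partial>lborel) = 0" by (simp add: algebra_simps)
qed

text \<open>The kernel is a superposition of characters with frequencies in \<open>B\<close>. A
  function annihilated by these characters is therefore annihilated by every translate of
  \<open>K\<close>, and by Fubini by every superposition of such translates.\<close>

lemma spec_in_conv: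
  fixes g K :: "'a::euclidean_space \<Rightarrow> complex"
  assumes r: "1 < r" and p: "fourier_pair A \<sigma> K" and g: "Lp_bdd r c g" and B: "\<And>\<eta>. \<eta> \<notin> B \<Longrightarrow> \<sigma> \<eta> = 0"
  shows "spec_in B (conv K g)"
  unfolding spec_in_def
proof (intro conjI allI impI)
  note K = fourier_pair_kernel[OF p]
  have [measurable]: "g \<in> borel_measurable borel" "K \<in> borel_measurable borel"
    using g K by (auto simp: Lp_bdd_def kernel_bdd_def)
  have c: "0 < c" and A: "0 < A" using g K by (auto simp: Lp_bdd_def kernel_bdd_def)
  show "conv K g \<in> borel_measurable borel" by (rule conv_measurable) auto
  show "\<exists>c. AE x in lborel. norm (conv K g x) \<le> c" using conv_bound[OF r K g] by blast
  have sig: "integrable lborel \<sigma>" and inv: "\<And>x. K x = of_real ((2 * pi) powr (- real DIM('a))) * (\<integral>\<eta>. \<sigma> \<eta> * cis (x \<bullet> \<eta>) \<partial>lborel)"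
    using p by (auto simp: fourier_pair_def)
  have [measurable]: "\<sigma> \<in> borel_measurable borel" using sig by auto
  fix \<psi> :: "'a \<Rightarrow> complex"
  assume psi: "integrable lborel \<psi>" and z: "\<forall>\<eta>\<in>B. (\<integral>x. \<psi> x * cis (x \<bullet> \<eta>) \<partial>lborel) = 0"
  have [measurable]: "\<psi> \<in> borel_measurable borel" using psi by auto
  have inner: "(\<integral>x. \<psi> x * K (x - y) \<partial>lborel) = 0" for y
  proof -
    have "(\<integral>\<^sup>+x. \<integral>\<^sup>+\<eta>. norm (\<psi> x * (\<sigma> \<eta> * cis ((x - y) \<bullet> \<eta>))) \<partial>lborel \<partial>lborel) = (\<integral>\<^sup>+x. norm (\<psi> x) \<partial>lborel) * (\<integral>\<^sup>+\<eta>. norm (\<sigma> \<eta>) \<partial>lborel)"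
      by (simp add: norm_mult ennreal_mult nn_integral_cmult nn_integral_multc)
    also have "\<dots> < \<infinity>" using psi sig by (auto simp: integrable_iff_bounded ennreal_mult_less_top)
    finally have fin: "(\<integral>\<^sup>+x. \<integral>\<^sup>+\<eta>. norm (\<psi> x * (\<sigma> \<eta> * cis ((x - y) \<bullet> \<eta>))) \<partial>lborel \<partial>lborel) < \<infinity>" .
    have "(\<integral>x. \<psi> x * K (x - y) \<partial>lborel) = of_real ((2 * pi) powr (- real DIM('a))) * (\<integral>x. \<integral>\<eta>. \<psi> x * (\<sigma> \<eta> * cis ((x - y) \<bullet> \<eta>)) \<partial>lborel \<partial>lborel)"
      unfolding inv
      by (subst integral_mult_right_zero[symmetric]) (simp add: mult.left_commute)
    also have "(\<integral>x. \<integral>\<eta>. \<psi> x * (\<sigma> \<eta> * cis ((x - y) \<bullet> \<eta>)) \<partial>lborel \<partial>lborel) = (\<integral>\<eta>. \<integral>x. \<psi> x * (\<sigma> \<eta> * cis ((x - y) \<bullet> \<eta>)) \<partial>lborel \<partial>lborel)"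
      by (rule Fubini_swap(1)[OF sigma_finite_lborel sigma_finite_lborel _ fin]) measurable
    also have "(\<lambda>\<eta>. \<integral>x. \<psi> x * (\<sigma> \<eta> * cis ((x - y) \<bullet> \<eta>)) \<partial>lborel) = (\<lambda>\<eta>. 0)"
    proof
      fix \<eta>
      have "(\<integral>x. \<psi> x * (\<sigma> \<eta> * cis ((x - y) \<bullet> \<eta>)) \<partial>lborel) = (\<integral>x. (\<sigma> \<eta> * cis (- (y \<bullet> \<eta>))) * (\<psi> x * cis (x \<bullet> \<eta>)) \<partial>lborel)"
        by (simp add: inner_diff_left algebra_simps cis_mult)
      also have "\<dots> = \<sigma> \<eta> * cis (- (y \<bullet> \<eta>)) * (\<integral>x. \<psi> x * cis (x \<bullet> \<eta>) \<partial>lborel)"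
        by (rule integral_mult_right_zero)
      also have "\<dots> = 0" using z B[of \<eta>] by (cases "\<eta> \<in> B") auto
      finally show "(\<integral>x. \<psi> x * (\<sigma> \<eta> * cis ((x - y) \<bullet> \<eta>)) \<partial>lborel) = 0" .
    qed
    finally show ?thesis by simp
  qed
  have "(\<integral>\<^sup>+x. \<integral>\<^sup>+y. norm (\<psi> x * (K (x - y) * g y)) \<partial>lborel \<partial>lborel) \<le> (\<integral>\<^sup>+x. norm (\<psi> x) * ennreal (2 * A * c) \<partial>lborel)"
  proof (rule nn_integral_mono)
    fix x
    have "(\<integral>\<^sup>+y. norm (\<psi> x * (K (x - y) * g y)) \<partial>lborel) = norm (\<psi> x) * (\<integral>\<^sup>+y. norm (K (x - y) * g y) \<partial>lborel)"
      by (simp add: norm_mult[of "\<psi> x"] ennreal_mult nn_integral_cmult)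
    also have "\<dots> \<le> norm (\<psi> x) * ennreal (2 * A * c)"
      using nn_conv_le[OF r K g] by (intro mult_left_mono) auto
    finally show "(\<integral>\<^sup>+y. norm (\<psi> x * (K (x - y) * g y)) \<partial>lborel) \<le> norm (\<psi> x) * ennreal (2 * A * c)" .
  qed
  also have "\<dots> < \<infinity>" using psi by (auto simp: nn_integral_multc integrable_iff_bounded ennreal_mult_less_top)
  finally have fin: "(\<integral>\<^sup>+x. \<integral>\<^sup>+y. norm (\<psi> x * (K (x - y) * g y)) \<partial>lborel \<partial>lborel) < \<infinity>" .
  have "(\<integral>x. conv K g x * \<psi> x \<partial>lborel) = (\<integral>x. \<integral>y. \<psi> x * (K (x - y) * g y) \<partial>lborel \<partial>lborel)"
    by (subst conv_alt) (auto simp: mult.commute)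
  also have "\<dots> = (\<integral>y. \<integral>x. \<psi> x * (K (x - y) * g y) \<partial>lborel \<partial>lborel)"
    by (rule Fubini_swap(1)[OF sigma_finite_lborel sigma_finite_lborel _ fin]) measurable
  also have "\<dots> = (\<integral>y. (\<integral>x. \<psi> x * K (x - y) \<partial>lborel) * g y \<partial>lborel)"
    by (simp flip: integral_mult_left_zero add: mult.assoc)
  finally show "(\<integral>x. conv K g x * \<psi> x \<partial>lborel) = 0" by (simp add: inner)
qed

lemma kernel_cis_integral:
  fixes K :: "'a::euclidean_space \<Rightarrow> complex"
  assumes p: "fourier_pair A \<sigma> K"
  shows "(\<integral>y. K (x - y) * cis (y \<bullet> \<eta>) \<partial>lborel) = cis (x \<bullet> \<eta>) * \<sigma> \<eta>"
proof -
  have [measurable]: "K \<in> borel_measurable borel"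
    using fourier_pair_kernel[OF p] by (auto simp: kernel_bdd_def)
  have "(\<integral>y. K (x - y) * cis (y \<bullet> \<eta>) \<partial>lborel) = (\<integral>y. K (x - y) * cis (x \<bullet> \<eta> - (x - y) \<bullet> \<eta>) \<partial>lborel)"
    by (simp add: inner_diff_left)
  also have "\<dots> = (\<integral>z. K z * cis (x \<bullet> \<eta> - z \<bullet> \<eta>) \<partial>lborel)"
    by (rule integral_reflect[of "\<lambda>z. K z * cis (x \<bullet> \<eta> - z \<bullet> \<eta>)"]) measurable
  also have "\<dots> = (\<integral>z. cis (x \<bullet> \<eta>) * (K z * cis (- (z \<bullet> \<eta>))) \<partial>lborel)"
    by (simp add: cis_mult algebra_simps)
  also have "\<dots> = cis (x \<bullet> \<eta>) * \<sigma> \<eta>"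
    using p unfolding fourier_pair_def integral_mult_right_zero by metis
  finally show ?thesis .
qed

lemma integrable_kernel_reflect:
  fixes K :: "'a::euclidean_space \<Rightarrow> complex"
  assumes K: "kernel_bdd A K"
  shows "integrable lborel (\<lambda>y. K (x - y))"
proof -
  have [measurable]: "K \<in> borel_measurable borel" using K by (simp add: kernel_bdd_def)
  show ?thesis
    using K nn_integral_reflect[of "\<lambda>z. ennreal (norm (K z))" x]
    by (intro integrableI_bounded) (auto simp: kernel_bdd_def intro: le_less_trans)
qed

text \<open>The value at \<open>x\<close> is \<open>g\<close> tested against the reflected kernel
  \<open>K (x - y)\<close>, whose transform is a character times \<sigma> and so vanishes on
  \<open>B\<close>.\<close>

lemma conv_eq_0_of_spec:
  fixes g K :: "'a::euclidean_space \<Rightarrow> complex"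
  assumes p: "fourier_pair A \<sigma> K" and g: "spec_in B g" and B: "\<And>\<eta>. \<eta> \<in> B \<Longrightarrow> \<sigma> \<eta> = 0"
  shows "conv K g x = 0"
proof -
  note K = fourier_pair_kernel[OF p]
  have "integrable lborel (\<lambda>y. K (x - y))" by (rule integrable_kernel_reflect[OF K])
  then have "(\<integral>y. g y * K (x - y) \<partial>lborel) = 0"
    using g B unfolding spec_in_def by (auto simp: kernel_cis_integral[OF p])
  then show ?thesis
    by (subst conv_alt) (use g K in \<open>auto simp: spec_in_def kernel_bdd_def mult.commute\<close>)
qed

text \<open>Dually, the reflected kernel maps a test function \<phi> to some \<psi> with the same
  transform on \<open>B\<close>, because \<sigma> is 1 there. Hence \<open>conv K g\<close> and
  \<open>g\<close> agree on all integrable test functions, and one well-chosen test function turns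
  this into equality almost everywhere.\<close>

lemma conv_eq_self_of_spec:
  fixes g K :: "'a::euclidean_space \<Rightarrow> complex"
  assumes p: "fourier_pair A \<sigma> K" and g: "spec_in B g" and B: "\<And>\<eta>. \<eta> \<in> B \<Longrightarrow> \<sigma> \<eta> = 1"
  shows "AE x in lborel. conv K g x = g x"
proof -
  note K = fourier_pair_kernel[OF p]
  have [measurable]: "g \<in> borel_measurable borel" "K \<in> borel_measurable borel"
    using g K by (auto simp: spec_in_def kernel_bdd_def)
  have A: "0 < A" using K by (simp add: kernel_bdd_def)
  obtain c0 where c0: "AE x in lborel. norm (g x) \<le> c0" using g by (auto simp: spec_in_def)
  define c where "c = max 0 c0"
  have c: "AE x in lborel. norm (g x) \<le> c" using c0 by eventually_elim (simp add: c_def)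
  have c0: "0 \<le> c" by (simp add: c_def)
  have nK: "(\<integral>\<^sup>+y. norm (K (x - y)) \<partial>lborel) \<le> ennreal A" for x
    using K nn_integral_reflect[of "\<lambda>z. ennreal (norm (K z))" x] by (simp add: kernel_bdd_def)
  have nK': "(\<integral>\<^sup>+x. norm (K (x - y)) \<partial>lborel) \<le> ennreal A" for y
    using K nn_integral_translate[of "\<lambda>z. ennreal (norm (K z))" y] by (simp add: kernel_bdd_def)
  have nKg: "(\<integral>\<^sup>+y. norm (K (x - y) * g y) \<partial>lborel) \<le> ennreal (A * c)" for x
  proof -
    have "(\<integral>\<^sup>+y. norm (K (x - y) * g y) \<partial>lborel) \<le> (\<integral>\<^sup>+y. norm (K (x - y)) * ennreal c \<partial>lborel)"
      using c by (intro nn_integral_mono_AE)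
        (auto simp: norm_mult ennreal_mult elim!: eventually_mono intro!: mult_left_mono ennreal_leI)
    also have "\<dots> \<le> ennreal A * ennreal c"
      using nK by (subst nn_integral_multc) (auto intro: mult_right_mono)
    finally show ?thesis using A c0 by (simp add: ennreal_mult)
  qed
  have key: "(\<integral>x. conv K g x * \<phi> x \<partial>lborel) = (\<integral>x. g x * \<phi> x \<partial>lborel)" if phi: "integrable lborel \<phi>" for \<phi>
  proof -
    have [measurable]: "\<phi> \<in> borel_measurable borel" using phi by auto
    have "(\<integral>\<^sup>+x. \<integral>\<^sup>+y. norm (\<phi> x * (K (x - y) * g y)) \<partial>lborel \<partial>lborel) \<le> (\<integral>\<^sup>+x. norm (\<phi> x) * ennreal (A * c) \<partial>lborel)"
    proof (rule nn_integral_mono)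
      fix x
      have "(\<integral>\<^sup>+y. norm (\<phi> x * (K (x - y) * g y)) \<partial>lborel) = norm (\<phi> x) * (\<integral>\<^sup>+y. norm (K (x - y) * g y) \<partial>lborel)"
        by (simp add: norm_mult[of "\<phi> x"] ennreal_mult nn_integral_cmult)
      also have "\<dots> \<le> norm (\<phi> x) * ennreal (A * c)"
        using nKg by (intro mult_left_mono) auto
      finally show "(\<integral>\<^sup>+y. norm (\<phi> x * (K (x - y) * g y)) \<partial>lborel) \<le> norm (\<phi> x) * ennreal (A * c)" .
    qed
    also have "\<dots> < \<infinity>" using phi by (auto simp: nn_integral_multc integrable_iff_bounded ennreal_mult_less_top)
    finally have fin: "(\<integral>\<^sup>+x. \<integral>\<^sup>+y. norm (\<phi> x * (K (x - y) * g y)) \<partial>lborel \<partial>lborel) < \<infinity>" .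
    define \<psi> where "\<psi> y = (\<integral>x. \<phi> x * K (x - y) \<partial>lborel)" for y
    have fin2: "(\<integral>\<^sup>+x. \<integral>\<^sup>+y. norm (\<phi> x * K (x - y)) \<partial>lborel \<partial>lborel) < \<infinity>"
    proof -
      have "(\<integral>\<^sup>+x. \<integral>\<^sup>+y. norm (\<phi> x * K (x - y)) \<partial>lborel \<partial>lborel) \<le> (\<integral>\<^sup>+x. norm (\<phi> x) * ennreal A \<partial>lborel)"
        using nK by (intro nn_integral_mono) (auto simp: norm_mult ennreal_mult nn_integral_cmult intro!: mult_left_mono)
      also have "\<dots> < \<infinity>" using phi by (auto simp: nn_integral_multc integrable_iff_bounded ennreal_mult_less_top)
      finally show ?thesis .
    qed
    have psi: "integrable lborel \<psi>" unfolding \<psi>_def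
      by (rule Fubini_swap(3)[OF sigma_finite_lborel sigma_finite_lborel _ fin2]) measurable
    have "(\<integral>y. (\<psi> y - \<phi> y) * cis (y \<bullet> \<eta>) \<partial>lborel) = 0" if "\<eta> \<in> B" for \<eta>
    proof -
      have fin3: "(\<integral>\<^sup>+x. \<integral>\<^sup>+y. norm (\<phi> x * K (x - y) * cis (y \<bullet> \<eta>)) \<partial>lborel \<partial>lborel) < \<infinity>"
        using fin2 by (simp add: norm_mult)
      have "(\<integral>y. \<psi> y * cis (y \<bullet> \<eta>) \<partial>lborel) = (\<integral>y. \<integral>x. \<phi> x * K (x - y) * cis (y \<bullet> \<eta>) \<partial>lborel \<partial>lborel)"
        unfolding \<psi>_def by simp
      also have "\<dots> = (\<integral>x. \<integral>y. \<phi> x * K (x - y) * cis (y \<bullet> \<eta>) \<partial>lborel \<partial>lborel)"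
        by (rule Fubini_swap(1)[OF sigma_finite_lborel sigma_finite_lborel _ fin3, symmetric]) measurable
      also have "\<dots> = (\<integral>x. \<phi> x * cis (x \<bullet> \<eta>) \<partial>lborel)"
        by (simp add: mult.assoc kernel_cis_integral[OF p] B[OF that])
      finally show ?thesis
        using integrable_mult_cis(1)[OF psi] integrable_mult_cis(1)[OF phi] by (simp add: left_diff_distrib)
    qed
    then have "(\<integral>y. g y * (\<psi> y - \<phi> y) \<partial>lborel) = 0"
      using g psi phi unfolding spec_in_def by blast
    moreover have "integrable lborel (\<lambda>y. g y * \<psi> y)" "integrable lborel (\<lambda>y. g y * \<phi> y)"
      using integrable_mult_bounded[OF psi _ c] integrable_mult_bounded[OF phi _ c] by auto
    ultimately have eq: "(\<integral>y. g y * \<psi> y \<partial>lborel) = (\<integral>y. g y * \<phi> y \<partial>lborel)"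
      by (simp add: right_diff_distrib)
    have "(\<integral>x. conv K g x * \<phi> x \<partial>lborel) = (\<integral>x. \<integral>y. \<phi> x * (K (x - y) * g y) \<partial>lborel \<partial>lborel)"
      by (subst conv_alt) (auto simp: mult.commute)
    also have "\<dots> = (\<integral>y. \<integral>x. \<phi> x * (K (x - y) * g y) \<partial>lborel \<partial>lborel)"
      by (rule Fubini_swap(1)[OF sigma_finite_lborel sigma_finite_lborel _ fin]) measurable
    also have "\<dots> = (\<integral>y. \<psi> y * g y \<partial>lborel)"
      unfolding \<psi>_def by (simp flip: integral_mult_left_zero add: mult.assoc)
    finally show ?thesis using eq by (simp add: mult.commute)
  qed
  \<comment> \<open>The natural test function is the conjugate of the difference \<open>h\<close>,
    but \<open>h\<close> is only bounded. Multiplying it by a strictly positive integrable function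
    makes it admissible without losing any point.\<close>
  obtain f :: "'a \<Rightarrow> ennreal" where f: "f \<in> borel_measurable lborel" "integral\<^sup>N lborel f \<noteq> \<infinity>" "\<And>x. 0 < f x" "\<And>x. f x < \<infinity>"
    using sigma_finite_measure.Ex_finite_integrable_function[OF sigma_finite_lborel] by auto
  define f' where "f' x = enn2real (f x)" for x
  have [measurable]: "f' \<in> borel_measurable borel" using f(1) unfolding f'_def by simp
  have f'0: "0 < f' x" for x using f(3,4)[of x] by (simp add: f'_def enn2real_positive_iff)
  have f'i: "integrable lborel f'"
  proof (rule integrableI_bounded)
    have "(\<integral>\<^sup>+x. ennreal (norm (f' x)) \<partial>lborel) = integral\<^sup>N lborel f"
      using f(4) by (intro nn_integral_cong) (auto simp: f'_def)
    then show "(\<integral>\<^sup>+x. ennreal (norm (f' x)) \<partial>lborel) < \<infinity>" using f(2) by (simp add: top.not_eq_extremum)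
  qed simp
  define h where "h x = conv K g x - g x" for x
  have [measurable]: "conv K g \<in> borel_measurable borel" by (rule conv_measurable) auto
  have hm[measurable]: "h \<in> borel_measurable borel" unfolding h_def by measurable
  have cb: "norm (conv K g x) \<le> A * c" for x
  proof -
    have "ennreal (norm (conv K g x)) \<le> ennreal (A * c)"
      by (subst conv_alt) (auto intro: order_trans[OF norm_integral_le_nn_integral nKg])
    then show ?thesis using A c0 by (subst (asm) ennreal_le_iff) auto
  qed
  have hb: "AE x in lborel. norm (cnj (h x)) \<le> A * c + c"
    using c
  proof eventually_elim
    case (elim x)
    then show ?case using cb[of x] norm_triangle_ineq4[of "conv K g x" "g x"] unfolding h_def complex_mod_cnj by linarith
  qed
  define \<phi> where "\<phi> x = cnj (h x) * of_real (f' x)" for x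
  have [measurable]: "\<phi> \<in> borel_measurable borel" unfolding \<phi>_def
    using measurable_compose[OF hm cnj_measurable] by (auto intro!: borel_measurable_times borel_measurable_of_real)
  have phi: "integrable lborel \<phi>" unfolding \<phi>_def
  proof (rule integrable_mult_bounded[OF _ _ hb])
    show "integrable lborel (\<lambda>x. complex_of_real (f' x))" using f'i by simp
    show "(\<lambda>x. cnj (h x)) \<in> borel_measurable lborel" by measurable
  qed
  have i1: "integrable lborel (\<lambda>x. conv K g x * \<phi> x)"
    by (rule integrable_mult_bounded[OF phi, of _ "A * c"]) (use cb in auto)
  have i2: "integrable lborel (\<lambda>x. g x * \<phi> x)" by (rule integrable_mult_bounded[OF phi _ c]) auto
  have "(\<integral>x. h x * \<phi> x \<partial>lborel) = 0"
    using key[OF phi] i1 i2 by (simp add: h_def left_diff_distrib)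
  moreover have eqh: "h x * \<phi> x = of_real ((norm (h x))\<^sup>2 * f' x)" for x
    unfolding \<phi>_def by (simp only: of_real_mult complex_norm_square mult.assoc)
  moreover have "integrable lborel (\<lambda>x. h x * \<phi> x)" using i1 i2 by (simp add: h_def left_diff_distrib)
  ultimately have "(\<integral>x. (norm (h x))\<^sup>2 * f' x \<partial>lborel) = 0" "integrable lborel (\<lambda>x. (norm (h x))\<^sup>2 * f' x)"
    by (simp_all only: eqh integral_complex_of_real complex_of_real_integrable_eq of_real_eq_0_iff)
  then have "AE x in lborel. (norm (h x))\<^sup>2 * f' x = 0"
    using f'0 by (subst (asm) integral_nonneg_eq_0_iff_AE) (auto simp: less_imp_le)
  then show ?thesis
    by eventually_elim (use f'0 in \<open>auto simp: h_def less_le\<close>)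
qed

section \<open>Fourier inversion and smooth symbols\<close>

lemma
  fixes f :: "'a::euclidean_space \<Rightarrow> real \<Rightarrow> complex"
  assumes f: "\<And>b. b \<in> Basis \<Longrightarrow> integrable lborel (f b)"
  shows integrable_lborel_prod: "integrable lborel (\<lambda>x. \<Prod>b\<in>Basis. f b (x \<bullet> b))"
    and integral_lborel_prod: "(\<integral>x. (\<Prod>b\<in>Basis. f b (x \<bullet> b)) \<partial>lborel) = (\<Prod>b\<in>Basis. (\<integral>t. f b t \<partial>lborel))"
proof -
  interpret product_sigma_finite "\<lambda>_::'a. lborel :: real measure" ..
  have [measurable]: "\<And>b. b \<in> Basis \<Longrightarrow> f b \<in> borel_measurable borel" using f by auto
  have m: "(\<lambda>f. \<Sum>b\<in>Basis. f b *\<^sub>R b) \<in> (\<Pi>\<^sub>M b\<in>(Basis::'a set). lborel) \<rightarrow>\<^sub>M borel" by measurable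
  have eq: "(\<Prod>b\<in>Basis. f b ((\<Sum>b'\<in>Basis. g b' *\<^sub>R b') \<bullet> b)) = (\<Prod>b\<in>Basis. f b (g b))" for g :: "'a \<Rightarrow> real"
    by (intro prod.cong refl) simp
  show "integrable lborel (\<lambda>x. \<Prod>b\<in>Basis. f b (x \<bullet> b))"
    unfolding lborel_eq[where 'a='a]
    by (subst integrable_distr_eq[OF m]) (auto simp: eq intro!: product_integrable_prod f)
  have "(\<integral>x. (\<Prod>b\<in>Basis. f b (x \<bullet> b)) \<partial>lborel) = (\<integral>g. (\<Prod>b\<in>Basis. f b (g b)) \<partial>(\<Pi>\<^sub>M b\<in>(Basis::'a set). lborel))"
    unfolding lborel_eq[where 'a='a] by (subst integral_distr[OF m]) (auto simp: eq)
  also have "\<dots> = (\<Prod>b\<in>Basis. (\<integral>t. f b t \<partial>lborel))"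
    by (rule product_integral_prod) (auto intro: f)
  finally show "(\<integral>x. (\<Prod>b\<in>Basis. f b (x \<bullet> b)) \<partial>lborel) = (\<Prod>b\<in>Basis. (\<integral>t. f b t \<partial>lborel))" .
qed

definition gauss :: "'a::euclidean_space \<Rightarrow> real" where
  "gauss x = exp (- (norm x)\<^sup>2 / 2)"

lemma gauss_measurable[measurable]: "gauss \<in> borel_measurable borel"
  unfolding gauss_def[abs_def] by measurable

lemma gauss_bounds: "0 < gauss x" "gauss x \<le> 1"
  by (auto simp: gauss_def)

lemma gauss_prod: "gauss x = (\<Prod>b\<in>Basis. exp (- (x \<bullet> b)\<^sup>2 / 2))"
  unfolding gauss_def
  by (simp add: exp_sum[symmetric] sum_negf sum_divide_distrib[symmetric] norm_eq_sqrt_inner euclidean_inner[of x x] power2_eq_square sum_nonneg)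

lemma cis_inner_prod: "cis (x \<bullet> y) = (\<Prod>b\<in>Basis. cis ((x \<bullet> b) * (y \<bullet> b)))"
proof -
  have "cis (\<Sum>b\<in>B. g b) = (\<Prod>b\<in>B. cis (g b))" if "finite B" for B :: "'a set" and g
    using that by (induction B rule: finite_induct) (auto simp: cis_mult[symmetric])
  then show ?thesis by (subst euclidean_inner) simp
qed

text \<open>This is the characteristic function of the standard normal distribution, whose density
  is the Gaussian divided by \<open>sqrt (2 * pi)\<close>.\<close>

lemma fourier_gauss_real:
  "integrable lborel (\<lambda>t::real. complex_of_real (exp (- t\<^sup>2 / 2)) * cis (t * s))"
  "(\<integral>t. complex_of_real (exp (- t\<^sup>2 / 2)) * cis (t * s) \<partial>lborel) = of_real (sqrt (2 * pi) * exp (- s\<^sup>2 / 2))"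
proof -
  have eq: "complex_of_real (exp (- t\<^sup>2 / 2)) = of_real (sqrt (2 * pi)) * of_real (std_normal_density t)" for t
    unfolding std_normal_density_def of_real_mult[symmetric] by simp
  have "integrable lborel (\<lambda>t::real. complex_of_real (exp (- t\<^sup>2 / 2)))"
    unfolding eq by (intro integrable_mult_right integrable_of_real integrable_normal_density) simp_all
  from integrable_mult_cis(1)[OF this, of s]
  show "integrable lborel (\<lambda>t::real. complex_of_real (exp (- t\<^sup>2 / 2)) * cis (t * s))" by simp
  have "complex_of_real (exp (- (s^2) / 2)) = char std_normal_distribution s"
    by (simp only: char_std_normal_distribution)
  also have "\<dots> = (\<integral>t. std_normal_density t *\<^sub>R cis (s * t) \<partial>lborel)"
    unfolding char_def by (subst integral_density) (auto simp: cis_conv_exp normal_density_nonneg)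
  finally have *: "(\<integral>t. std_normal_density t *\<^sub>R cis (s * t) \<partial>lborel) = complex_of_real (exp (- (s^2) / 2))" ..
  have "(\<integral>t. complex_of_real (exp (- t\<^sup>2 / 2)) * cis (t * s) \<partial>lborel) = (\<integral>t. of_real (sqrt (2 * pi)) * (std_normal_density t *\<^sub>R cis (s * t)) \<partial>lborel)"
    unfolding eq by (simp add: scaleR_conv_of_real mult.commute mult.left_commute)
  also have "\<dots> = of_real (sqrt (2 * pi)) * (\<integral>t. (std_normal_density t *\<^sub>R cis (s * t)) \<partial>lborel)"
    by (rule integral_mult_right_zero)
  finally show "(\<integral>t. complex_of_real (exp (- t\<^sup>2 / 2)) * cis (t * s) \<partial>lborel) = of_real (sqrt (2 * pi) * exp (- s\<^sup>2 / 2))"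
    by (simp add: *)
qed

lemma fourier_gauss:
  fixes y :: "'a::euclidean_space"
  shows "integrable lborel (\<lambda>x. complex_of_real (gauss x) * cis (x \<bullet> y))"
    "(\<integral>x. complex_of_real (gauss x) * cis (x \<bullet> y) \<partial>lborel) = of_real ((2 * pi) powr (real DIM('a) / 2) * gauss y)"
proof -
  let ?f = "\<lambda>b t. complex_of_real (exp (- t\<^sup>2 / 2)) * cis (t * (y \<bullet> b))"
  have eq: "complex_of_real (gauss x) * cis (x \<bullet> y) = (\<Prod>b\<in>Basis. ?f b (x \<bullet> b))" for x
    by (simp add: gauss_prod cis_inner_prod prod.distrib)
  show "integrable lborel (\<lambda>x. complex_of_real (gauss x) * cis (x \<bullet> y))"
    unfolding eq by (rule integrable_lborel_prod) (rule fourier_gauss_real)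
  have "sqrt (2 * pi) ^ DIM('a) = (2 * pi) powr (real DIM('a) / 2)"
    by (simp add: powr_half_sqrt[symmetric] powr_powr powr_realpow[symmetric])
  moreover have "(\<integral>x. (\<Prod>b\<in>Basis. ?f b (x \<bullet> b)) \<partial>lborel) = (\<Prod>b\<in>Basis. (\<integral>t. ?f b t \<partial>lborel))"
    by (rule integral_lborel_prod) (rule fourier_gauss_real(1))
  moreover have "\<dots> = (\<Prod>b\<in>(Basis::'a set). of_real (sqrt (2 * pi) * exp (- (y \<bullet> b)\<^sup>2 / 2)))"
    by (simp only: fourier_gauss_real(2))
  moreover have "\<dots> = of_real (sqrt (2 * pi) ^ DIM('a) * gauss y)"
    by (simp only: of_real_prod[symmetric] prod.distrib prod_constant gauss_prod)
  ultimately show "(\<integral>x. complex_of_real (gauss x) * cis (x \<bullet> y) \<partial>lborel) = of_real ((2 * pi) powr (real DIM('a) / 2) * gauss y)"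
    unfolding eq by (simp only:)
qed

lemma integrable_gauss: "integrable lborel (gauss :: 'a::euclidean_space \<Rightarrow> real)"
  using fourier_gauss(1)[of "0::'a"] by (simp add: complex_of_real_integrable_eq)

lemma integral_gauss: "integral\<^sup>L lborel (gauss :: 'a::euclidean_space \<Rightarrow> real) = (2 * pi) powr (real DIM('a) / 2)"
proof -
  have "complex_of_real (integral\<^sup>L lborel (gauss :: 'a \<Rightarrow> real)) = of_real ((2 * pi) powr (real DIM('a) / 2))"
    using fourier_gauss(2)[of "0::'a"] by (simp add: gauss_def[of 0])
  then show ?thesis by (simp only: of_real_eq_iff)
qed

lemma fourier_gauss_scaled:
  fixes y :: "'a::euclidean_space"
  assumes d: "0 < d"
  shows "(\<integral>x. complex_of_real (gauss (d *\<^sub>R x)) * cis (x \<bullet> y) \<partial>lborel)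
    = of_real ((1 / d) ^ DIM('a) * (2 * pi) powr (real DIM('a) / 2) * gauss ((1/d) *\<^sub>R y))"
proof -
  have "(\<integral>x. complex_of_real (gauss x) * cis (x \<bullet> ((1/d) *\<^sub>R y)) \<partial>lborel)
    = d ^ DIM('a) *\<^sub>R (\<integral>x. complex_of_real (gauss (d *\<^sub>R x)) * cis ((d *\<^sub>R x) \<bullet> ((1/d) *\<^sub>R y)) \<partial>lborel)"
    using d integral_affine_euclidean[of "\<lambda>x. complex_of_real (gauss x) * cis (x \<bullet> ((1/d) *\<^sub>R y))" d 0] by simp
  then show ?thesis using d unfolding fourier_gauss(2)
    by (simp add: scaleR_conv_of_real field_simps power_divide)
qed

text \<open>The integral of \<open>K\<close> is regularised by Gaussians.\<close>

theorem fourier_inversion: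
  fixes \<sigma> :: "'a::euclidean_space \<Rightarrow> complex"
  assumes s: "integrable lborel \<sigma>" and cont: "continuous_on UNIV \<sigma>" and c: "\<And>x. norm (\<sigma> x) \<le> c"
    and K: "\<And>x. K x = of_real ((2 * pi) powr (- real DIM('a))) * (\<integral>\<eta>. \<sigma> \<eta> * cis (x \<bullet> \<eta>) \<partial>lborel)"
    and Ki: "integrable lborel K"
  shows "(\<integral>z. K z * cis (- (z \<bullet> \<eta>)) \<partial>lborel) = \<sigma> \<eta>"
proof (rule LIMSEQ_unique)
  have [measurable]: "\<sigma> \<in> borel_measurable borel" "K \<in> borel_measurable borel" using s Ki by auto
  define d where "d m = 1 / real (Suc m)" for m
  have d: "0 < d m" for m by (simp add: d_def)
  have dlim: "d \<longlonglongrightarrow> 0" unfolding d_def by (rule LIMSEQ_Suc[OF lim_1_over_n])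
  define I where "I m = (\<integral>z. K z * cis (- (z \<bullet> \<eta>)) * of_real (gauss (d m *\<^sub>R z)) \<partial>lborel)" for m
  show "I \<longlonglongrightarrow> (\<integral>z. K z * cis (- (z \<bullet> \<eta>)) \<partial>lborel)"
    unfolding I_def
  proof (rule integral_dominated_convergence[where w="\<lambda>z. norm (K z)"])
    show "AE z in lborel. (\<lambda>m. K z * cis (- (z \<bullet> \<eta>)) * complex_of_real (gauss (d m *\<^sub>R z))) \<longlonglongrightarrow> K z * cis (- (z \<bullet> \<eta>))"
    proof (rule AE_I2)
      fix z :: 'a
      have "(\<lambda>m. complex_of_real (gauss (d m *\<^sub>R z))) \<longlonglongrightarrow> complex_of_real (exp (- (norm (0 *\<^sub>R z))\<^sup>2 / 2))"
        unfolding gauss_def by (intro tendsto_intros dlim) auto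
      then show "(\<lambda>m. K z * cis (- (z \<bullet> \<eta>)) * complex_of_real (gauss (d m *\<^sub>R z))) \<longlonglongrightarrow> K z * cis (- (z \<bullet> \<eta>))"
        using tendsto_mult[OF tendsto_const[of "K z * cis (- (z \<bullet> \<eta>))"]] by fastforce
    qed
    show "AE z in lborel. norm (K z * cis (- (z \<bullet> \<eta>)) * complex_of_real (gauss (d m *\<^sub>R z))) \<le> norm (K z)" for m
      by (auto simp: norm_mult less_imp_le[OF gauss_bounds(1)] gauss_bounds(2) mult_left_le)
  qed (use Ki in auto)
  \<comment> \<open>Inserting the formula for \<open>K\<close> and exchanging the integrals leaves
    the transform of a wide Gaussian, that is, a narrow Gaussian centred at \<eta>; the substitution
    of step \<open>d m\<close> turns it into an average of \<sigma> near \<eta> with a fixed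
    Gaussian weight.\<close>
  have eq: "I m = of_real ((2 * pi) powr (- real DIM('a) / 2)) * (\<integral>y. \<sigma> (\<eta> + d m *\<^sub>R y) * of_real (gauss y) \<partial>lborel)" for m
  proof -
    let ?C = "complex_of_real ((2 * pi) powr (- real DIM('a)))"
    let ?F = "\<lambda>z \<zeta>. \<sigma> \<zeta> * (of_real (gauss (d m *\<^sub>R z)) * cis (z \<bullet> (\<zeta> - \<eta>)))"
    have "(\<integral>\<^sup>+z. ennreal (gauss (d m *\<^sub>R z)) \<partial>(lborel :: 'a measure)) < \<infinity>"
    proof -
      have "(\<integral>\<^sup>+z. ennreal (gauss z) \<partial>(lborel :: 'a measure)) = ennreal (d m ^ DIM('a)) * (\<integral>\<^sup>+z. ennreal (gauss (d m *\<^sub>R z)) \<partial>(lborel :: 'a measure))" (is "?A = _")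
        using nn_integral_affine_euclidean[of "\<lambda>z::'a. ennreal (gauss z)" "d m" 0] d[of m] by simp
      moreover have "?A < \<infinity>"
        using integrable_gauss by (auto simp: integrable_iff_bounded less_imp_le[OF gauss_bounds(1)])
      ultimately show ?thesis using d[of m] by (auto simp: ennreal_mult_less_top)
    qed
    moreover have "(\<integral>\<^sup>+z. \<integral>\<^sup>+\<zeta>. norm (?F z \<zeta>) \<partial>lborel \<partial>lborel) = (\<integral>\<^sup>+\<zeta>. norm (\<sigma> \<zeta>) \<partial>lborel) * (\<integral>\<^sup>+z. ennreal (gauss (d m *\<^sub>R z)) \<partial>(lborel :: 'a measure))"
      by (simp add: norm_mult ennreal_mult less_imp_le[OF gauss_bounds(1)] nn_integral_multc nn_integral_cmult)
    ultimately have fin: "(\<integral>\<^sup>+z. \<integral>\<^sup>+\<zeta>. norm (?F z \<zeta>) \<partial>lborel \<partial>lborel) < \<infinity>"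
      using s by (auto simp: integrable_iff_bounded ennreal_mult_less_top)
    have "I m = (\<integral>z. \<integral>\<zeta>. ?C * ?F z \<zeta> \<partial>lborel \<partial>lborel)"
      unfolding I_def
    proof (intro Bochner_Integration.integral_cong refl)
      fix z
      have "K z * cis (- (z \<bullet> \<eta>)) * complex_of_real (gauss (d m *\<^sub>R z))
        = ?C * ((\<integral>\<zeta>. \<sigma> \<zeta> * cis (z \<bullet> \<zeta>) \<partial>lborel) * (cis (- (z \<bullet> \<eta>)) * complex_of_real (gauss (d m *\<^sub>R z))))"
        by (simp add: K algebra_simps)
      also have "(\<integral>\<zeta>. \<sigma> \<zeta> * cis (z \<bullet> \<zeta>) \<partial>lborel) * (cis (- (z \<bullet> \<eta>)) * complex_of_real (gauss (d m *\<^sub>R z)))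
         = (\<integral>\<zeta>. ?F z \<zeta> \<partial>lborel)"
      proof -
        have "?F z \<zeta> = \<sigma> \<zeta> * cis (z \<bullet> \<zeta>) * (cis (- (z \<bullet> \<eta>)) * complex_of_real (gauss (d m *\<^sub>R z)))" for \<zeta>
        proof -
          have "cis (z \<bullet> (\<zeta> - \<eta>)) = cis (z \<bullet> \<zeta>) * cis (- (z \<bullet> \<eta>))" by (simp add: cis_mult inner_diff_right)
          then show ?thesis by (simp only: mult_ac)
        qed
        then show ?thesis by (simp only: integral_mult_left_zero)
      qed
      also have "?C * \<dots> = (\<integral>\<zeta>. ?C * ?F z \<zeta> \<partial>lborel)" by (rule integral_mult_right_zero[symmetric])
      finally show "K z * cis (- (z \<bullet> \<eta>)) * complex_of_real (gauss (d m *\<^sub>R z)) = (\<integral>\<zeta>. ?C * ?F z \<zeta> \<partial>lborel)" .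
    qed
    also have "\<dots> = ?C * (\<integral>z. \<integral>\<zeta>. ?F z \<zeta> \<partial>lborel \<partial>lborel)" by simp
    also have "(\<integral>z. \<integral>\<zeta>. ?F z \<zeta> \<partial>lborel \<partial>lborel) = (\<integral>\<zeta>. \<integral>z. ?F z \<zeta> \<partial>lborel \<partial>lborel)"
      by (rule Fubini_swap(1)[OF sigma_finite_lborel sigma_finite_lborel _ fin]) measurable
    also have "\<dots> = (\<integral>\<zeta>. \<sigma> \<zeta> * of_real ((1 / d m) ^ DIM('a) * (2 * pi) powr (real DIM('a) / 2) * gauss ((1 / d m) *\<^sub>R (\<zeta> - \<eta>))) \<partial>lborel)"
      by (simp only: integral_mult_right_zero fourier_gauss_scaled[OF d])
    also have "\<dots> = d m ^ DIM('a) *\<^sub>R (\<integral>y. \<sigma> (\<eta> + d m *\<^sub>R y) * of_real ((1 / d m) ^ DIM('a) * (2 * pi) powr (real DIM('a) / 2) * gauss y) \<partial>lborel)"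
      using d[of m] by (subst integral_affine_euclidean[where t=\<eta> and c="d m"]) simp_all
    also have "\<dots> = of_real ((2 * pi) powr (real DIM('a) / 2)) * (\<integral>y. \<sigma> (\<eta> + d m *\<^sub>R y) * of_real (gauss y) \<partial>lborel)"
    proof -
      have "\<sigma> (\<eta> + d m *\<^sub>R y) * of_real ((1 / d m) ^ DIM('a) * (2 * pi) powr (real DIM('a) / 2) * gauss y) =
         of_real ((1 / d m) ^ DIM('a) * (2 * pi) powr (real DIM('a) / 2)) * (\<sigma> (\<eta> + d m *\<^sub>R y) * of_real (gauss y))" for y
        by (simp add: algebra_simps)
      then show ?thesis using d[of m]
        by (simp only: integral_mult_right_zero) (simp add: scaleR_conv_of_real power_divide)
    qed
    finally show ?thesis
      by (simp add: mult.assoc[symmetric] powr_add[symmetric] flip: of_real_mult)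
  qed
  \<comment> \<open>Continuity of \<sigma> gives the pointwise limit, and its bound \<open>c\<close>
    the dominating function.\<close>
  have "(\<lambda>m. \<integral>y. \<sigma> (\<eta> + d m *\<^sub>R y) * of_real (gauss y) \<partial>lborel) \<longlonglongrightarrow> (\<integral>y. \<sigma> \<eta> * of_real (gauss y) \<partial>(lborel :: 'a measure))"
  proof (rule integral_dominated_convergence[where w="\<lambda>y. c * gauss y"])
    show "integrable lborel (\<lambda>y::'a. c * gauss y)" using integrable_gauss by auto
    show "AE y in lborel. (\<lambda>m. \<sigma> (\<eta> + d m *\<^sub>R y) * complex_of_real (gauss y)) \<longlonglongrightarrow> \<sigma> \<eta> * complex_of_real (gauss y)"
    proof (rule AE_I2)
      fix y
      have "(\<lambda>m. \<eta> + d m *\<^sub>R y) \<longlonglongrightarrow> \<eta> + 0 *\<^sub>R y" by (intro tendsto_intros dlim)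
      moreover have "isCont \<sigma> (\<eta> + 0 *\<^sub>R y)" using cont by (simp add: continuous_on_eq_continuous_at)
      ultimately have "(\<lambda>m. \<sigma> (\<eta> + d m *\<^sub>R y)) \<longlonglongrightarrow> \<sigma> (\<eta> + 0 *\<^sub>R y)"
        by (rule isCont_tendsto_compose[rotated])
      then show "(\<lambda>m. \<sigma> (\<eta> + d m *\<^sub>R y) * complex_of_real (gauss y)) \<longlonglongrightarrow> \<sigma> \<eta> * complex_of_real (gauss y)"
        by (auto intro!: tendsto_intros)
    qed
    show "AE y in lborel. norm (\<sigma> (\<eta> + d m *\<^sub>R y) * complex_of_real (gauss y)) \<le> c * gauss y" for m
      using c by (auto simp: norm_mult less_imp_le[OF gauss_bounds(1)] intro!: mult_right_mono)
  qed auto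
  then have "I \<longlonglongrightarrow> of_real ((2 * pi) powr (- real DIM('a) / 2)) * (\<integral>y. \<sigma> \<eta> * of_real (gauss (y::'a)) \<partial>lborel)"
    unfolding eq by (intro tendsto_intros)
  also have "of_real ((2 * pi) powr (- real DIM('a) / 2)) * (\<integral>y. \<sigma> \<eta> * of_real (gauss (y::'a)) \<partial>lborel) = \<sigma> \<eta>"
    by (simp add: integral_gauss powr_add[symmetric] flip: of_real_mult)
  finally show "I \<longlonglongrightarrow> \<sigma> \<eta>" .
qed

section \<open>Integrability from decay\<close>

lemma nn_integral_inverse_1_plus_square: "(\<integral>\<^sup>+t. ennreal (1 / (1 + t\<^sup>2)) \<partial>(lborel :: real measure)) < \<infinity>"
proof -
  have "integrable lborel (\<lambda>t::real. inverse (1 + t\<^sup>2))"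
    using integrable_inverse_1_plus_square by (simp add: set_integrable_def)
  then show ?thesis by (auto simp: integrable_iff_bounded inverse_eq_divide)
qed

text \<open>Quadratic decay in each coordinate separately makes the majorant a product, so that its
  integral reduces to dimension one.\<close>

lemma kernel_bdd_of_decay:
  fixes K :: "'a::euclidean_space \<Rightarrow> complex"
  assumes [measurable]: "K \<in> borel_measurable borel" and C: "\<And>x. norm (K x) \<le> C * (\<Prod>b\<in>Basis. 1 / (1 + (x \<bullet> b)\<^sup>2))"
  shows "\<exists>A. kernel_bdd A K"
proof -
  have C0: "0 \<le> C" using order_trans[OF norm_ge_zero C[of 0]] by simp
  have "(\<integral>\<^sup>+x. ennreal (norm (K x)) \<partial>lborel) \<le> (\<integral>\<^sup>+x. ennreal C * (\<Prod>b\<in>Basis. ennreal (1 / (1 + (x \<bullet> b)\<^sup>2))) \<partial>(lborel :: 'a measure))"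
  proof (rule nn_integral_mono)
    fix x
    show "ennreal (norm (K x)) \<le> ennreal C * (\<Prod>b\<in>Basis. ennreal (1 / (1 + (x \<bullet> b)\<^sup>2)))"
      using ennreal_leI[OF C[of x]] C0 by (simp add: prod_ennreal ennreal_mult prod_nonneg)
  qed
  also have "\<dots> = ennreal C * (\<Prod>b\<in>(Basis::'a set). (\<integral>\<^sup>+t. ennreal (1 / (1 + t\<^sup>2)) \<partial>lborel))"
    using nn_integral_lborel_prod[of "\<lambda>(_::'a) t. ennreal (1 / (1 + t\<^sup>2))"] by (simp add: nn_integral_cmult)
  also have "\<dots> < \<infinity>"
    using nn_integral_inverse_1_plus_square by (simp add: ennreal_mult_less_top power_less_top_ennreal)
  finally obtain A1 where A1: "(\<integral>\<^sup>+x. ennreal (norm (K x)) \<partial>lborel) = ennreal A1" "0 \<le> A1"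
    by (metis ennreal_cases infinity_ennreal_def less_irrefl)
  have "norm (K x) \<le> C" for x
  proof -
    have "(\<Prod>b\<in>Basis. 1 / (1 + (x \<bullet> b)\<^sup>2)) \<le> 1" by (intro prod_le_1) (auto intro!: divide_le_eq_1_pos[THEN iffD2] add_pos_nonneg)
    then show ?thesis using C[of x] C0 by (meson mult_left_le order_trans)
  qed
  then have "norm (K x) \<le> C + A1 + 1" for x using A1(2) by (smt (verit))
  then show ?thesis using A1 C0
    by (intro exI[of _ "C + A1 + 1"]) (auto simp: kernel_bdd_def intro!: ennreal_leI)
qed

section \<open>Differentiability of finite order\<close>

text \<open>A recursion on the order that strips off the innermost derivative. Rules for sums,
  products and inverses then follow by induction on the order, which lists of directions would not
  allow so directly.\<close>

primrec diff_order :: "nat \<Rightarrow> ('a::euclidean_space \<Rightarrow> 'b::real_normed_vector) \<Rightarrow> bool" where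
  "diff_order 0 f \<longleftrightarrow> (\<forall>x. f differentiable at x)"
| "diff_order (Suc m) f \<longleftrightarrow> (\<forall>x. f differentiable at x) \<and> (\<forall>b\<in>Basis. diff_order m (dir_deriv b f))"

lemma diff_order_differentiable: "diff_order m f \<Longrightarrow> f differentiable at x"
  by (cases m) auto

lemma diff_order_Suc_imp: "diff_order (Suc m) f \<Longrightarrow> diff_order m f"
proof (induction m arbitrary: f)
  case (Suc m)
  then have "\<And>b. b \<in> Basis \<Longrightarrow> diff_order (Suc m) (dir_deriv b f)" "\<And>x. f differentiable at x" by auto
  then show ?case using Suc.IH by auto
qed simp

lemma dir_deriv_eqI: "(f has_derivative f') (at x) \<Longrightarrow> dir_deriv v f x = f' v"
  unfolding dir_deriv_def using frechet_derivative_at by metis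

lemma has_derivative_frechet: "f differentiable at x \<Longrightarrow> (f has_derivative frechet_derivative f (at x)) (at x)"
  using frechet_derivative_works by blast

lemma diff_order_add:
  "diff_order m f \<Longrightarrow> diff_order m g \<Longrightarrow> diff_order m (\<lambda>x. f x + g x)"
proof (induction m arbitrary: f g)
  case (Suc m)
  have "dir_deriv b (\<lambda>x. f x + g x) = (\<lambda>x. dir_deriv b f x + dir_deriv b g x)" for b
  proof
    fix x
    show "dir_deriv b (\<lambda>x. f x + g x) x = dir_deriv b f x + dir_deriv b g x"
      by (rule dir_deriv_eqI[THEN trans])
        (use Suc.prems in \<open>auto intro!: has_derivative_add has_derivative_frechet simp: dir_deriv_def\<close>)
  qed
  then show ?case using Suc by auto
qed auto

lemma diff_order_const: "diff_order m (\<lambda>x::'a::euclidean_space. c)"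
proof (induction m arbitrary: c)
  case (Suc m)
  have "dir_deriv b (\<lambda>x::'a. c) = (\<lambda>x. 0)" for b
    by (rule ext, rule dir_deriv_eqI[THEN trans]) (auto intro: has_derivative_const)
  then show ?case using Suc by auto
qed auto

lemma diff_order_sum:
  "finite F \<Longrightarrow> (\<And>k. k \<in> F \<Longrightarrow> diff_order m (f k)) \<Longrightarrow> diff_order m (\<lambda>x. \<Sum>k\<in>F. f k x)"
  by (induction F rule: finite_induct) (auto intro: diff_order_add diff_order_const)

lemma diff_order_mult:
  fixes f g :: "'a::euclidean_space \<Rightarrow> 'b::real_normed_algebra"
  shows "diff_order m f \<Longrightarrow> diff_order m g \<Longrightarrow> diff_order m (\<lambda>x. f x * g x)"
proof (induction m arbitrary: f g)
  case (Suc m)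
  have "dir_deriv b (\<lambda>x. f x * g x) = (\<lambda>x. f x * dir_deriv b g x + dir_deriv b f x * g x)" for b
  proof
    fix x
    show "dir_deriv b (\<lambda>x. f x * g x) x = f x * dir_deriv b g x + dir_deriv b f x * g x"
      by (rule dir_deriv_eqI[THEN trans])
        (use Suc.prems in \<open>auto intro!: has_derivative_mult has_derivative_frechet simp: dir_deriv_def\<close>)
  qed
  then show ?case using Suc diff_order_Suc_imp[OF Suc.prems(1)] diff_order_Suc_imp[OF Suc.prems(2)]
    by (auto intro!: diff_order_add)
qed auto

lemma diff_order_inverse:
  fixes f :: "'a::euclidean_space \<Rightarrow> real"
  assumes "\<And>x. f x \<noteq> 0"
  shows "diff_order m f \<Longrightarrow> diff_order m (\<lambda>x. inverse (f x))"
proof (induction m)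
  case 0
  then show ?case
    using Deriv.has_derivative_inverse[OF assms has_derivative_frechet[OF diff_order_differentiable[OF 0]]]
    unfolding differentiable_def diff_order.simps by blast
next
  case (Suc m)
  have "dir_deriv b (\<lambda>x. inverse (f x)) = (\<lambda>x. - 1 * (inverse (f x) * dir_deriv b f x * inverse (f x)))" for b
  proof
    fix x
    show "dir_deriv b (\<lambda>x. inverse (f x)) x = - 1 * (inverse (f x) * dir_deriv b f x * inverse (f x))"
      by (rule dir_deriv_eqI[THEN trans], rule Deriv.has_derivative_inverse)
        (use Suc.prems assms in \<open>auto intro!: has_derivative_frechet simp: dir_deriv_def\<close>)
  qed
  moreover have "diff_order m (\<lambda>x. - 1 * (inverse (f x) * dir_deriv b f x * inverse (f x)))" if "b \<in> Basis" for b
    using Suc that diff_order_Suc_imp[OF Suc.prems(1)] by (intro diff_order_mult diff_order_const) auto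
  moreover have "(\<lambda>x. inverse (f x)) differentiable at x" for x
    using Deriv.has_derivative_inverse[OF assms has_derivative_frechet[OF diff_order_differentiable[OF Suc.prems]]]
    unfolding differentiable_def by blast
  ultimately show ?case by simp
qed

lemma differentiable_of_real_comp:
  "f differentiable at x \<Longrightarrow> (\<lambda>x. complex_of_real (f x)) differentiable at x"
  unfolding differentiable_def using has_derivative_of_real by blast

lemma diff_order_of_real:
  fixes f :: "'a::euclidean_space \<Rightarrow> real"
  shows "diff_order m f \<Longrightarrow> diff_order m (\<lambda>x. complex_of_real (f x))"
proof (induction m arbitrary: f)
  case 0
  then show ?case by (auto intro: differentiable_of_real_comp)
next
  case (Suc m)
  have "dir_deriv b (\<lambda>x. complex_of_real (f x)) = (\<lambda>x. complex_of_real (dir_deriv b f x))" for b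
  proof
    fix x
    show "dir_deriv b (\<lambda>x. complex_of_real (f x)) x = complex_of_real (dir_deriv b f x)"
      by (rule dir_deriv_eqI[THEN trans], rule has_derivative_of_real)
        (use Suc.prems in \<open>auto intro!: has_derivative_frechet simp: dir_deriv_def\<close>)
  qed
  then show ?case using Suc by (auto intro: differentiable_of_real_comp)
qed

lemma has_derivative_affine_comp:
  assumes "(f has_derivative f') (at (t + s *\<^sub>R x))"
  shows "((\<lambda>x. f (t + s *\<^sub>R x)) has_derivative (\<lambda>h. f' (s *\<^sub>R h))) (at x)"
proof -
  have "((\<lambda>x. t + s *\<^sub>R x) has_derivative (\<lambda>h. s *\<^sub>R h)) (at x)"
    by (auto intro!: derivative_eq_intros)
  from diff_chain_at[OF this assms] show ?thesis by (simp add: o_def)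
qed

lemma differentiable_affine_comp:
  "f differentiable at (t + s *\<^sub>R x) \<Longrightarrow> (\<lambda>x. f (t + s *\<^sub>R x)) differentiable at x"
  unfolding differentiable_def using has_derivative_affine_comp by blast

lemma diff_order_affine:
  fixes f :: "'a::euclidean_space \<Rightarrow> complex"
  shows "diff_order m f \<Longrightarrow> diff_order m (\<lambda>x. f (t + s *\<^sub>R x))"
proof (induction m arbitrary: f)
  case 0
  then show ?case by (auto intro: differentiable_affine_comp)
next
  case (Suc m)
  have d: "f differentiable at x" for x using Suc.prems by auto
  have "dir_deriv b (\<lambda>x. f (t + s *\<^sub>R x)) = (\<lambda>x. of_real s * dir_deriv b f (t + s *\<^sub>R x))" for b
  proof
    fix x
    have "linear (frechet_derivative f (at (t + s *\<^sub>R x)))" by (rule linear_frechet_derivative[OF d])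
    then have "frechet_derivative f (at (t + s *\<^sub>R x)) (s *\<^sub>R b) = of_real s * frechet_derivative f (at (t + s *\<^sub>R x)) b"
      by (simp add: linear_cmul scaleR_conv_of_real)
    then show "dir_deriv b (\<lambda>x. f (t + s *\<^sub>R x)) x = of_real s * dir_deriv b f (t + s *\<^sub>R x)"
      by (subst dir_deriv_eqI[OF has_derivative_affine_comp[OF has_derivative_frechet[OF d]]]) (simp add: dir_deriv_def)
  qed
  moreover have "(\<lambda>x. f (t + s *\<^sub>R x)) differentiable at x" for x
    by (intro differentiable_affine_comp d)
  ultimately show ?case using Suc by (auto intro!: diff_order_mult diff_order_const)
qed

lemma diff_order_translate:
  fixes f :: "'a::euclidean_space \<Rightarrow> real"
  shows "diff_order m f \<Longrightarrow> diff_order m (\<lambda>x. f (x - t))"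
proof (induction m arbitrary: f)
  case 0
  then show ?case using differentiable_affine_comp[of f "-t" 1] by auto
next
  case (Suc m)
  have d: "f differentiable at x" for x using Suc.prems by auto
  have h: "((\<lambda>x. f (x - t)) has_derivative frechet_derivative f (at (x - t))) (at x)" for x
    using has_derivative_affine_comp[of f "frechet_derivative f (at (x - t))" "-t" 1 x] has_derivative_frechet[OF d, of "x - t"] by simp
  have "dir_deriv b (\<lambda>x. f (x - t)) = (\<lambda>x. dir_deriv b f (x - t))" for b
    by (rule ext) (subst dir_deriv_eqI[OF h], simp add: dir_deriv_def)
  moreover have "(\<lambda>x. f (x - t)) differentiable at x" for x
    using h unfolding differentiable_def by blast
  ultimately show ?case using Suc by auto
qed

lemma dir_deriv_cong_open:
  assumes "open S" "x \<in> S" "\<And>y. y \<in> S \<Longrightarrow> f y = g y" "g differentiable at x"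
  shows "dir_deriv b f x = dir_deriv b g x" "f differentiable at x"
proof -
  have "(f has_derivative frechet_derivative g (at x)) (at x)"
    using has_derivative_transform_within_open[OF has_derivative_frechet[OF assms(4)] assms(1,2)] assms(3) by auto
  then show "dir_deriv b f x = dir_deriv b g x" "f differentiable at x"
    using dir_deriv_eqI by (auto simp: dir_deriv_def differentiable_def)
qed

text \<open>Intended for the denominator of the partition of unity: near each point it is a finite
  sum, but over a finite set that depends on the point.\<close>

lemma diff_order_local:
  assumes "\<And>x. \<exists>S g. open S \<and> x \<in> S \<and> diff_order m g \<and> (\<forall>y\<in>S. f y = g y)"
  shows "diff_order m f"
  using assms
proof (induction m arbitrary: f)
  case 0
  then show ?case by (metis dir_deriv_cong_open(2) diff_order.simps(1))
next
  case (Suc m)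
  have "f differentiable at x" for x
    using Suc.prems[of x] by (metis dir_deriv_cong_open(2) diff_order.simps(2))
  moreover have "diff_order m (dir_deriv b f)" if "b \<in> Basis" for b
  proof (rule Suc.IH)
    fix x
    obtain S g where "open S" "x \<in> S" and g: "diff_order (Suc m) g" and eq: "\<forall>y\<in>S. f y = g y"
      using Suc.prems[of x] by blast
    then show "\<exists>S g. open S \<and> x \<in> S \<and> diff_order m g \<and> (\<forall>y\<in>S. dir_deriv b f y = g y)"
      using that by (intro exI[of _ S] exI[of _ "dir_deriv b g"]) (auto intro: dir_deriv_cong_open(1))
  qed
  ultimately show ?case by auto
qed

lemma iter_deriv_snoc: "iter_deriv (vs @ [b]) f = iter_deriv vs (dir_deriv b f)"
  by (simp add: iter_deriv_def)

lemma diff_order_iff: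
  "diff_order m f \<longleftrightarrow> (\<forall>vs x. set vs \<subseteq> Basis \<and> length vs \<le> m \<longrightarrow> iter_deriv vs f differentiable at x)"
proof (induction m arbitrary: f)
  case 0
  then show ?case by (auto simp: iter_deriv_def)
next
  case (Suc m)
  show ?case
  proof
    assume L: "diff_order (Suc m) f"
    show "\<forall>vs x. set vs \<subseteq> Basis \<and> length vs \<le> Suc m \<longrightarrow> iter_deriv vs f differentiable at x"
    proof (intro allI impI)
      fix vs :: "'a list" and x
      assume vs: "set vs \<subseteq> Basis \<and> length vs \<le> Suc m"
      show "iter_deriv vs f differentiable at x"
      \<comment> \<open>\<open>iter_deriv\<close> is a right fold, so the last entry of the list is
        the derivative taken first.\<close>
      proof (cases vs rule: rev_cases)
        case Nil
        then show ?thesis using L by (auto simp: iter_deriv_def)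
      next
        case (snoc ws b)
        then have "diff_order m (dir_deriv b f)" using L vs by auto
        then show ?thesis using Suc.IH snoc vs by (auto simp: iter_deriv_snoc)
      qed
    qed
  next
    assume R: "\<forall>vs x. set vs \<subseteq> Basis \<and> length vs \<le> Suc m \<longrightarrow> iter_deriv vs f differentiable at x"
    have "f differentiable at x" for x using R[rule_format, of "[]" x] by (simp add: iter_deriv_def)
    moreover have "diff_order m (dir_deriv b f)" if "b \<in> Basis" for b
    proof -
      have "iter_deriv ws (dir_deriv b f) differentiable at x" if "set ws \<subseteq> Basis \<and> length ws \<le> m" for ws x
        using R[rule_format, of "ws @ [b]" x] that \<open>b \<in> Basis\<close> by (simp add: iter_deriv_snoc)
      then show ?thesis using Suc.IH by blast
    qed
    ultimately show "diff_order (Suc m) f" by simp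
  qed
qed

lemma smooth_on_UNIV_iff: "smooth_on UNIV f \<longleftrightarrow> (\<forall>m. diff_order m f)"
  unfolding smooth_on_def diff_order_iff by auto

lemma smooth_iter_deriv: "smooth_on UNIV f \<Longrightarrow> b \<in> Basis \<Longrightarrow> smooth_on UNIV (dir_deriv b f)"
  unfolding smooth_on_UNIV_iff by (metis diff_order.simps(2))

lemma smooth_differentiable: "smooth_on UNIV f \<Longrightarrow> f differentiable at x"
  unfolding smooth_on_UNIV_iff using diff_order_differentiable by blast

lemma smooth_continuous: "smooth_on UNIV f \<Longrightarrow> continuous_on UNIV f"
  using smooth_differentiable differentiable_imp_continuous_within
  by (simp add: continuous_on_eq_continuous_at) blast

lemma dir_deriv_eq_0_outside:
  assumes "closed C" "\<And>x. x \<notin> C \<Longrightarrow> f x = 0" "x \<notin> C"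
  shows "dir_deriv b f x = 0"
proof -
  have "dir_deriv b f x = dir_deriv b (\<lambda>_. 0) x"
    by (rule dir_deriv_cong_open[of "- C"]) (use assms in auto)
  also have "\<dots> = 0" by (rule dir_deriv_eqI[THEN trans]) (auto intro: has_derivative_const)
  finally show ?thesis .
qed

lemma iter_deriv_compact_support:
  assumes "smooth_on UNIV f" "closed C" "\<And>x. x \<notin> C \<Longrightarrow> f x = 0" "set vs \<subseteq> Basis"
  shows "(\<forall>x. x \<notin> C \<longrightarrow> iter_deriv vs f x = 0) \<and> continuous_on UNIV (iter_deriv vs f)"
  using assms
proof (induction vs arbitrary: f rule: rev_induct)
  case Nil
  then show ?case by (auto simp: iter_deriv_def smooth_continuous)
next
  case (snoc b vs)
  then show ?case
    unfolding iter_deriv_snoc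
    by (intro snoc.IH) (auto intro: smooth_iter_deriv dir_deriv_eq_0_outside[of C])
qed

lemma schwartz_compact_support:
  fixes f :: "'a::euclidean_space \<Rightarrow> complex"
  assumes "smooth_on UNIV f" "compact C" "\<And>x. x \<notin> C \<Longrightarrow> f x = 0"
  shows "schwartz f"
  unfolding schwartz_def
proof (intro conjI allI impI assms(1))
  fix N :: nat and vs :: "'a list"
  assume "set vs \<subseteq> Basis"
  with assms have 0: "\<And>x. x \<notin> C \<Longrightarrow> iter_deriv vs f x = 0" and cont: "continuous_on UNIV (iter_deriv vs f)"
    using iter_deriv_compact_support[of f C vs] by (auto simp: compact_imp_closed)
  have "continuous_on C (\<lambda>x. norm x ^ N *\<^sub>R iter_deriv vs f x)"
    by (intro continuous_intros continuous_on_subset[OF cont]) auto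
  then have "bounded ((\<lambda>x. norm x ^ N *\<^sub>R iter_deriv vs f x) ` C)"
    using assms(2) compact_continuous_image compact_imp_bounded by blast
  moreover have "range (\<lambda>x. norm x ^ N *\<^sub>R iter_deriv vs f x) \<subseteq> insert 0 ((\<lambda>x. norm x ^ N *\<^sub>R iter_deriv vs f x) ` C)"
  proof (rule image_subsetI)
    fix x
    show "norm x ^ N *\<^sub>R iter_deriv vs f x \<in> insert 0 ((\<lambda>x. norm x ^ N *\<^sub>R iter_deriv vs f x) ` C)"
      using 0[of x] by (cases "x \<in> C") auto
  qed
  ultimately show "bounded (range (\<lambda>x. norm x ^ N *\<^sub>R iter_deriv vs f x))"
    by (meson bounded_insert bounded_subset)
qed

section \<open>Finite differences and kernels of smooth symbols\<close>

text \<open>Differences replace integration by parts: their effect on the transform is an exact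
  factor \<open>1 - cis (h * (x \<bullet> v))\<close>, obtained from translation invariance alone,
  and their step may depend on \<open>x\<close>.\<close>

fun fin_diff :: "(real \<times> 'a::euclidean_space) list \<Rightarrow> ('a \<Rightarrow> complex) \<Rightarrow> 'a \<Rightarrow> complex" where
  "fin_diff [] g = g"
| "fin_diff ((h, v) # ops) g = (\<lambda>x. fin_diff ops g x - fin_diff ops g (x - h *\<^sub>R v))"

lemma fin_diff_deriv:
  assumes "\<And>x. g differentiable at x"
  shows "fin_diff ops g differentiable at x \<and> dir_deriv v (fin_diff ops g) x = fin_diff ops (dir_deriv v g) x"
proof (induction ops arbitrary: x)
  case Nil
  then show ?case using assms by simp
next
  case (Cons op ops)
  obtain h u where op: "op = (h, u)" by (cases op)
  let ?G = "fin_diff ops g"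
  have d: "?G differentiable at y" for y using Cons by blast
  have "((\<lambda>x. ?G (x - h *\<^sub>R u)) has_derivative frechet_derivative ?G (at (x - h *\<^sub>R u))) (at x)"
    using has_derivative_affine_comp[of ?G "frechet_derivative ?G (at (x - h *\<^sub>R u))" "- h *\<^sub>R u" 1 x] has_derivative_frechet[OF d, of "x - h *\<^sub>R u"]
    by simp
  then have *: "((\<lambda>x. ?G x - ?G (x - h *\<^sub>R u)) has_derivative (\<lambda>y. frechet_derivative ?G (at x) y - frechet_derivative ?G (at (x - h *\<^sub>R u)) y)) (at x)"
    by (intro has_derivative_diff has_derivative_frechet d)
  then show ?case
    using Cons[of x] Cons[of "x - h *\<^sub>R u"] dir_deriv_eqI[OF *, of v] by (auto simp: op dir_deriv_def differentiable_def)
qed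

lemma norm_diff_le_dir_deriv:
  fixes G :: "'a::euclidean_space \<Rightarrow> complex"
  assumes d: "\<And>x. G differentiable at x" and B: "\<And>x. norm (dir_deriv v G x) \<le> B"
  shows "norm (G x - G (x - h *\<^sub>R v)) \<le> B * \<bar>h\<bar>"
proof -
  define \<phi> where "\<phi> t = G (x + t *\<^sub>R v)" for t
  have der: "(\<phi> has_derivative (\<lambda>s. s *\<^sub>R dir_deriv v G (x + t *\<^sub>R v))) (at t)" for t
  proof -
    let ?D = "frechet_derivative G (at (x + t *\<^sub>R v))"
    have "((\<lambda>t. x + t *\<^sub>R v) has_derivative (\<lambda>s. s *\<^sub>R v)) (at t)" by (auto intro!: derivative_eq_intros)
    from diff_chain_at[OF this has_derivative_frechet[OF d]]
    have "(\<phi> has_derivative (\<lambda>s. ?D (s *\<^sub>R v))) (at t)" by (simp add: o_def \<phi>_def[abs_def])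
    moreover have "?D (s *\<^sub>R v) = s *\<^sub>R ?D v" for s
      using linear_frechet_derivative[OF d] by (rule linear_cmul)
    ultimately show ?thesis by (simp add: dir_deriv_def)
  qed
  have "norm (\<phi> 0 - \<phi> (- h)) \<le> B * norm (0 - (- h))"
  proof (rule differentiable_bound[where S=UNIV])
    show "(\<phi> has_derivative (\<lambda>s. s *\<^sub>R dir_deriv v G (x + t *\<^sub>R v))) (at t within UNIV)" for t using der by simp
    show "onorm (\<lambda>s. s *\<^sub>R dir_deriv v G (x + t *\<^sub>R v)) \<le> B" for t
    proof (rule onorm_le)
      fix s
      show "norm (s *\<^sub>R dir_deriv v G (x + t *\<^sub>R v)) \<le> B * norm s"
        using mult_left_mono[OF B[of "x + t *\<^sub>R v"], of "\<bar>s\<bar>"] by (simp add: mult.commute)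
    qed
  qed auto
  then show ?thesis by (simp add: \<phi>_def)
qed

text \<open>Differences commute with derivatives, so each one costs a single mean value estimate.
  The head of the list is differentiated first, whence the reversal.\<close>

lemma fin_diff_bound:
  assumes "smooth_on UNIV g" "set (map snd ops) \<subseteq> Basis"
    and "\<And>x. norm (iter_deriv (rev (map snd ops)) g x) \<le> C"
  shows "norm (fin_diff ops g x) \<le> C * (\<Prod>op\<leftarrow>ops. \<bar>fst op\<bar>)"
  using assms
proof (induction ops arbitrary: g x)
  case Nil
  then show ?case by (simp add: iter_deriv_def)
next
  case (Cons op ops)
  obtain h v where op: "op = (h, v)" by (cases op)
  have v: "v \<in> Basis" using Cons.prems op by auto
  have d: "g differentiable at x" for x using Cons.prems(1) by (rule smooth_differentiable)
  have "norm (fin_diff ops (dir_deriv v g) y) \<le> C * (\<Prod>op\<leftarrow>ops. \<bar>fst op\<bar>)" for y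
    using Cons.prems v op by (intro Cons.IH smooth_iter_deriv) (auto simp: iter_deriv_snoc)
  then have "norm (dir_deriv v (fin_diff ops g) y) \<le> C * (\<Prod>op\<leftarrow>ops. \<bar>fst op\<bar>)" for y
    using fin_diff_deriv[OF d, of ops y v] by simp
  then show ?case
    using norm_diff_le_dir_deriv[of "fin_diff ops g" v "C * (\<Prod>op\<leftarrow>ops. \<bar>fst op\<bar>)" x h] fin_diff_deriv[OF d, of ops]
    by (auto simp: op mult_ac)
qed

lemma fin_diff_support:
  assumes "\<And>x. R < norm x \<Longrightarrow> g x = 0" "R + (\<Sum>op\<leftarrow>ops. \<bar>fst op\<bar> * norm (snd op)) < norm x"
  shows "fin_diff ops g x = 0"
  using assms
proof (induction ops arbitrary: x)
  case (Cons op ops)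
  obtain h v where op: "op = (h, v)" by (cases op)
  have 0: "0 \<le> \<bar>h\<bar> * norm v" by simp
  have "norm x \<le> norm (x - h *\<^sub>R v) + \<bar>h\<bar> * norm v"
    using norm_triangle_sub[of x "h *\<^sub>R v"] by simp
  then have "R + (\<Sum>op\<leftarrow>ops. \<bar>fst op\<bar> * norm (snd op)) < norm (x - h *\<^sub>R v)"
    "R + (\<Sum>op\<leftarrow>ops. \<bar>fst op\<bar> * norm (snd op)) < norm x"
    using Cons.prems(2) 0 unfolding op list.map sum_list.Cons fst_conv snd_conv by linarith+
  then show ?case using Cons.IH[OF Cons.prems(1)] by (simp add: op)
qed simp

lemma fin_diff_fourier:
  fixes g :: "'a::euclidean_space \<Rightarrow> complex"
  assumes "integrable lborel g"
  shows "integrable lborel (fin_diff ops g) \<and>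
    (\<integral>\<eta>. fin_diff ops g \<eta> * cis (x \<bullet> \<eta>) \<partial>lborel) = (\<Prod>op\<leftarrow>ops. 1 - cis (fst op * (x \<bullet> snd op))) * (\<integral>\<eta>. g \<eta> * cis (x \<bullet> \<eta>) \<partial>lborel)"
proof (induction ops)
  case Nil
  then show ?case using assms by simp
next
  case (Cons op ops)
  obtain h v where op: "op = (h, v)" by (cases op)
  let ?G = "fin_diff ops g"
  have i: "integrable lborel ?G" using Cons by simp
  have [measurable]: "?G \<in> borel_measurable borel" using i by auto
  have i2: "integrable lborel (\<lambda>\<eta>. ?G (\<eta> - h *\<^sub>R v))"
    using i nn_integral_translate[of "\<lambda>\<eta>. ennreal (norm (?G \<eta>))" "h *\<^sub>R v"]
    by (auto simp: integrable_iff_bounded)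
  have "(\<integral>\<eta>. ?G (\<eta> - h *\<^sub>R v) * cis (x \<bullet> \<eta>) \<partial>lborel) = (\<integral>\<eta>. ?G (\<eta> - h *\<^sub>R v) * cis (x \<bullet> (\<eta> - h *\<^sub>R v) + x \<bullet> (h *\<^sub>R v)) \<partial>lborel)"
    by (simp add: inner_diff_right)
  also have "\<dots> = (\<integral>\<eta>. ?G \<eta> * cis (x \<bullet> \<eta> + x \<bullet> (h *\<^sub>R v)) \<partial>lborel)"
    by (rule integral_translate[of "\<lambda>\<eta>. ?G \<eta> * cis (x \<bullet> \<eta> + x \<bullet> (h *\<^sub>R v))"]) measurable
  also have "\<dots> = (\<integral>\<eta>. cis (h * (x \<bullet> v)) * (?G \<eta> * cis (x \<bullet> \<eta>)) \<partial>lborel)"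
    by (simp add: cis_mult[symmetric] algebra_simps)
  finally have "(\<integral>\<eta>. ?G (\<eta> - h *\<^sub>R v) * cis (x \<bullet> \<eta>) \<partial>lborel) = cis (h * (x \<bullet> v)) * (\<integral>\<eta>. ?G \<eta> * cis (x \<bullet> \<eta>) \<partial>lborel)" by simp
  then have "(\<integral>\<eta>. (?G \<eta> - ?G (\<eta> - h *\<^sub>R v)) * cis (x \<bullet> \<eta>) \<partial>lborel) = (1 - cis (h * (x \<bullet> v))) * (\<integral>\<eta>. ?G \<eta> * cis (x \<bullet> \<eta>) \<partial>lborel)"
    using integrable_mult_cis(3)[OF i, of x] integrable_mult_cis(3)[OF i2, of x] by (simp add: left_diff_distrib)
  then show ?case using Cons i i2 by (simp add: op mult.assoc)
qed

lemma compact_support_integrable: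
  fixes g :: "'a::euclidean_space \<Rightarrow> complex"
  assumes [measurable]: "g \<in> borel_measurable borel" and "\<And>x. R < norm x \<Longrightarrow> g x = 0" "\<And>x. norm (g x) \<le> C"
  shows "integrable lborel g" "(\<integral>\<^sup>+x. norm (g x) \<partial>lborel) \<le> ennreal (C * measure lborel (cball (0::'a) R))"
proof -
  have C: "0 \<le> C" using order_trans[OF norm_ge_zero assms(3)] .
  have f: "emeasure lborel (cball (0::'a) R) = ennreal (measure lborel (cball (0::'a) R))"
    using emeasure_bounded_finite[OF bounded_cball, of "0::'a" R] by (intro emeasure_eq_ennreal_measure) simp
  have "(\<integral>\<^sup>+x. norm (g x) \<partial>lborel) \<le> (\<integral>\<^sup>+x. ennreal C * indicator (cball (0::'a) R) x \<partial>lborel)"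
    using assms by (intro nn_integral_mono) (auto simp: indicator_def ennreal_leI not_le)
  also have "\<dots> = ennreal (C * measure lborel (cball (0::'a) R))"
    using C by (simp add: nn_integral_cmult_indicator f ennreal_mult)
  finally show *: "(\<integral>\<^sup>+x. norm (g x) \<partial>lborel) \<le> ennreal (C * measure lborel (cball (0::'a) R))" .
  then show "integrable lborel g" by (intro integrableI_bounded) (auto intro: le_less_trans)
qed

text \<open>For fixed \<open>x\<close>, the step \<open>1 / (x \<bullet> b)\<close> in direction
  \<open>b\<close> makes the factor of each difference equal to the constant
  \<open>1 - cis 1\<close>, while the difference itself is of size
  \<open>1 / \<bar>x \<bullet> b\<bar>\<close>. Two such differences in every coordinate of size at
  least 1 give quadratic decay, so the kernel is integrable and the inversion theorem supplies the
  other half of the pair.\<close>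

theorem fourier_pair_smooth:
  fixes \<sigma> :: "'a::euclidean_space \<Rightarrow> complex"
  assumes s: "smooth_on UNIV \<sigma>" and R: "\<And>x. R < norm x \<Longrightarrow> \<sigma> x = 0"
  defines "K \<equiv> (\<lambda>x. of_real ((2 * pi) powr (- real DIM('a))) * (\<integral>\<eta>. \<sigma> \<eta> * cis (x \<bullet> \<eta>) \<partial>lborel))"
  shows "\<exists>A. fourier_pair A \<sigma> K"
proof -
  have cont: "continuous_on UNIV \<sigma>" by (rule smooth_continuous[OF s])
  then have [measurable]: "\<sigma> \<in> borel_measurable borel" by (rule borel_measurable_continuous_onI)
  have Sch: "schwartz \<sigma>"
    by (rule schwartz_compact_support[OF s, of "cball 0 R"]) (auto intro: R)
  have bd: "\<exists>C. \<forall>x. norm (iter_deriv vs \<sigma> x) \<le> C" if "set vs \<subseteq> Basis" for vs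
    using Sch that unfolding schwartz_def bounded_iff by (auto dest!: spec[of _ 0])
  have "\<exists>C. \<forall>vs\<in>{vs. set vs \<subseteq> Basis \<and> length vs \<le> 2 * DIM('a)}. \<forall>x. norm (iter_deriv vs \<sigma> x) \<le> C"
  proof -
    have fin: "finite {vs. set vs \<subseteq> (Basis::'a set) \<and> length vs \<le> 2 * DIM('a)}"
      by (rule finite_lists_length_le) simp
    obtain f where f: "\<And>vs x. set vs \<subseteq> Basis \<Longrightarrow> norm (iter_deriv vs \<sigma> x) \<le> f vs"
      using bd by metis
    have "norm (iter_deriv vs \<sigma> x) \<le> Max (f ` {vs. set vs \<subseteq> (Basis::'a set) \<and> length vs \<le> 2 * DIM('a)})"
      if "set vs \<subseteq> Basis" "length vs \<le> 2 * DIM('a)" for vs x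
      using that by (intro order_trans[OF f Max_ge] finite_imageI fin) auto
    then show ?thesis by blast
  qed
  then obtain C where C: "\<And>vs x. set vs \<subseteq> Basis \<Longrightarrow> length vs \<le> 2 * DIM('a) \<Longrightarrow> norm (iter_deriv vs \<sigma> x) \<le> C"
    by blast
  have C0: "0 \<le> C" using order_trans[OF norm_ge_zero C[of "[]"]] by simp
  have sC: "norm (\<sigma> x) \<le> C" for x using C[of "[]" x] by (simp add: iter_deriv_def)
  have si: "integrable lborel \<sigma>" using compact_support_integrable(1)[of \<sigma> R C] R sC by auto
  \<comment> \<open>The minimum with 1 allows the exponent \<open>2 * card S\<close>, which depends
    on \<open>x\<close>, to be replaced by \<open>2 * DIM('a)\<close>.\<close>
  define a where "a = min 1 (norm (1 - cis 1))"
  have "cis 1 \<noteq> 1"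
  proof
    assume "cis 1 = 1"
    then have "sin (1::real) = 0" by (simp add: complex_eq_iff)
    moreover have "sin (1::real) > 0" by (rule sin_gt_zero) (use pi_gt3 in auto)
    ultimately show False by simp
  qed
  then have a: "0 < a" "a \<le> 1" "a \<le> norm (1 - cis 1)" by (auto simp: a_def)
  \<comment> \<open>There are at most \<open>2 * DIM('a)\<close> differences, each of step at most
    1, so the support grows by at most that much.\<close>
  define V where "V = measure lborel (cball (0::'a) (R + 2 * DIM('a)))"
  define D where "D = (2 * pi) powr (- real DIM('a)) * (C * V) / a ^ (2 * DIM('a)) * 2 ^ DIM('a)"
  have "norm (K x) \<le> D * (\<Prod>b\<in>Basis. 1 / (1 + (x \<bullet> b)\<^sup>2))" for x
  proof -
    define S where "S = {b \<in> Basis. 1 \<le> \<bar>x \<bullet> b\<bar>}"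
    have S: "finite S" "S \<subseteq> Basis" by (auto simp: S_def)
    obtain bs where bs: "set bs = S" "distinct bs" using finite_distinct_list[OF S(1)] by blast
    have len: "length bs = card S" using bs distinct_card by metis
    have cS: "card S \<le> DIM('a)" using S by (simp add: card_mono)
    \<comment> \<open>Each direction occurs twice, for the square; coordinates below 1 are left out,
      so that no step exceeds 1.\<close>
    define ops where "ops = map (\<lambda>b. (1 / (x \<bullet> b), b)) (bs @ bs)"
    have prod_ops: "(\<Prod>op\<leftarrow>ops. f (fst op) (snd op)) = (\<Prod>b\<in>S. f (1 / (x \<bullet> b)) b)\<^sup>2" for f :: "real \<Rightarrow> 'a \<Rightarrow> 'c::comm_monoid_mult"
      using bs prod.distinct_set_conv_list[OF bs(2), of "\<lambda>b. f (1 / (x \<bullet> b)) b"]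
      by (simp add: ops_def o_def power2_eq_square)
    have bnd: "norm (fin_diff ops \<sigma> y) \<le> C * (\<Prod>b\<in>S. \<bar>1 / (x \<bullet> b)\<bar>)\<^sup>2" for y
    proof -
      have "norm (fin_diff ops \<sigma> y) \<le> C * (\<Prod>op\<leftarrow>ops. \<bar>fst op\<bar>)"
        using S bs len cS by (intro fin_diff_bound[OF s] C) (auto simp: ops_def o_def)
      also have "(\<Prod>op\<leftarrow>ops. \<bar>fst op\<bar>) = (\<Prod>b\<in>S. \<bar>1 / (x \<bullet> b)\<bar>)\<^sup>2" by (rule prod_ops)
      finally show ?thesis .
    qed
    have supp: "fin_diff ops \<sigma> y = 0" if "R + 2 * DIM('a) < norm y" for y
    proof (rule fin_diff_support[OF R])
      have "(\<Sum>op\<leftarrow>ops. \<bar>fst op\<bar> * norm (snd op)) \<le> (\<Sum>op\<leftarrow>ops. 1)"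
      proof (rule sum_list_mono)
        fix op assume "op \<in> set ops"
        then obtain b where b: "b \<in> S" "op = (1 / (x \<bullet> b), b)" using bs by (auto simp: ops_def)
        then have "1 \<le> \<bar>x \<bullet> b\<bar>" "norm b = 1" by (auto simp: S_def)
        then show "\<bar>fst op\<bar> * norm (snd op) \<le> 1" by (simp add: b divide_le_eq)
      qed
      also have "\<dots> = real (length ops)" by (simp add: sum_list_triv)
      also have "\<dots> \<le> 2 * DIM('a)" using len cS by (simp add: ops_def)
      finally show "R + (\<Sum>op\<leftarrow>ops. \<bar>fst op\<bar> * norm (snd op)) < norm y" using that by simp
    qed auto
    have fi: "integrable lborel (fin_diff ops \<sigma>)" using fin_diff_fourier[OF si] by blast
    then have [measurable]: "fin_diff ops \<sigma> \<in> borel_measurable borel" by auto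
    have "ennreal (norm (\<integral>\<eta>. fin_diff ops \<sigma> \<eta> * cis (x \<bullet> \<eta>) \<partial>lborel)) \<le> (\<integral>\<^sup>+\<eta>. norm (fin_diff ops \<sigma> \<eta>) \<partial>lborel)"
      by (rule order_trans[OF norm_integral_le_nn_integral]) (simp add: norm_mult)
    also have "\<dots> \<le> ennreal (C * (\<Prod>b\<in>S. \<bar>1 / (x \<bullet> b)\<bar>)\<^sup>2 * V)"
      unfolding V_def by (rule compact_support_integrable(2)) (use bnd supp in auto)
    finally have up: "norm (\<integral>\<eta>. fin_diff ops \<sigma> \<eta> * cis (x \<bullet> \<eta>) \<partial>lborel) \<le> C * (\<Prod>b\<in>S. \<bar>1 / (x \<bullet> b)\<bar>)\<^sup>2 * V"
      using C0 by (subst (asm) ennreal_le_iff) (auto simp: V_def)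
    have "(\<Prod>op\<leftarrow>ops. 1 - cis (fst op * (x \<bullet> snd op))) = (\<Prod>b\<in>S. 1 - cis (1 / (x \<bullet> b) * (x \<bullet> b)))\<^sup>2" by (rule prod_ops)
    also have "\<dots> = (\<Prod>b\<in>S. 1 - cis 1)\<^sup>2" by (intro arg_cong[where f="\<lambda>z. z\<^sup>2"] prod.cong) (auto simp: S_def)
    also have "\<dots> = (1 - cis 1) ^ (2 * card S)" by (simp add: power_mult[symmetric] mult.commute)
    finally have "norm (\<integral>\<eta>. fin_diff ops \<sigma> \<eta> * cis (x \<bullet> \<eta>) \<partial>lborel) = norm (1 - cis 1) ^ (2 * card S) * norm (\<integral>\<eta>. \<sigma> \<eta> * cis (x \<bullet> \<eta>) \<partial>lborel)"
      using fin_diff_fourier[OF si, of ops x] by (simp add: norm_mult norm_power)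
    moreover have "a ^ (2 * DIM('a)) \<le> norm (1 - cis 1) ^ (2 * card S)"
    proof -
      have "a ^ (2 * DIM('a)) \<le> a ^ (2 * card S)" using a cS by (intro power_decreasing) auto
      also have "\<dots> \<le> norm (1 - cis 1) ^ (2 * card S)" using a by (intro power_mono) auto
      finally show ?thesis .
    qed
    then have "a ^ (2 * DIM('a)) * norm (\<integral>\<eta>. \<sigma> \<eta> * cis (x \<bullet> \<eta>) \<partial>lborel) \<le> norm (1 - cis 1) ^ (2 * card S) * norm (\<integral>\<eta>. \<sigma> \<eta> * cis (x \<bullet> \<eta>) \<partial>lborel)"
      by (rule mult_right_mono) simp
    ultimately have "a ^ (2 * DIM('a)) * norm (\<integral>\<eta>. \<sigma> \<eta> * cis (x \<bullet> \<eta>) \<partial>lborel) \<le> C * (\<Prod>b\<in>S. \<bar>1 / (x \<bullet> b)\<bar>)\<^sup>2 * V"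
      using up by linarith
    then have 1: "norm (\<integral>\<eta>. \<sigma> \<eta> * cis (x \<bullet> \<eta>) \<partial>lborel) \<le> C * V / a ^ (2 * DIM('a)) * (\<Prod>b\<in>S. \<bar>1 / (x \<bullet> b)\<bar>)\<^sup>2"
      using a by (simp add: field_simps)
    have "(\<Prod>b\<in>S. \<bar>1 / (x \<bullet> b)\<bar>)\<^sup>2 = (\<Prod>b\<in>S. \<bar>1 / (x \<bullet> b)\<bar>\<^sup>2)" by (rule prod_power_distrib)
    also have "\<dots> = (\<Prod>b\<in>Basis. if b \<in> S then \<bar>1 / (x \<bullet> b)\<bar>\<^sup>2 else 1)"
      using S by (simp add: prod.If_cases Int_absorb1)
    \<comment> \<open>The factor 2 covers both cases: a coordinate in \<open>S\<close> has square at
      least 1, any other has square at most 1.\<close>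
    also have "\<dots> \<le> (\<Prod>b\<in>Basis. 2 * (1 / (1 + (x \<bullet> b)\<^sup>2)))"
    proof (rule prod_mono)
      fix b :: 'a assume b: "b \<in> Basis"
      have pos: "0 < 1 + (x \<bullet> b)\<^sup>2" by (rule add_pos_nonneg) auto
      show "0 \<le> (if b \<in> S then \<bar>1 / (x \<bullet> b)\<bar>\<^sup>2 else 1) \<and> (if b \<in> S then \<bar>1 / (x \<bullet> b)\<bar>\<^sup>2 else 1) \<le> 2 * (1 / (1 + (x \<bullet> b)\<^sup>2))"
      proof (cases "b \<in> S")
        case True
        then have "1 \<le> (x \<bullet> b)\<^sup>2" using abs_le_square_iff[of 1 "x \<bullet> b"] by (simp add: S_def)
        then have "1 + (x \<bullet> b)\<^sup>2 \<le> 2 * (x \<bullet> b)\<^sup>2" "0 < (x \<bullet> b)\<^sup>2" by linarith+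
        then show ?thesis using True pos by (simp add: power_divide field_simps)
      next
        case False
        then have "(x \<bullet> b)\<^sup>2 \<le> 1" using b abs_le_square_iff[of "x \<bullet> b" 1] by (simp add: S_def)
        then show ?thesis using False pos by (simp add: field_simps)
      qed
    qed
    also have "\<dots> = 2 ^ DIM('a) * (\<Prod>b\<in>Basis. 1 / (1 + (x \<bullet> b)\<^sup>2))" by (simp only: prod.distrib prod_constant)
    finally have 2: "(\<Prod>b\<in>S. \<bar>1 / (x \<bullet> b)\<bar>)\<^sup>2 \<le> 2 ^ DIM('a) * (\<Prod>b\<in>Basis. 1 / (1 + (x \<bullet> b)\<^sup>2))" .
    have "norm (K x) = (2 * pi) powr (- real DIM('a)) * norm (\<integral>\<eta>. \<sigma> \<eta> * cis (x \<bullet> \<eta>) \<partial>lborel)"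
      by (simp add: K_def norm_mult)
    also have "\<dots> \<le> (2 * pi) powr (- real DIM('a)) * (C * V / a ^ (2 * DIM('a)) * (2 ^ DIM('a) * (\<Prod>b\<in>Basis. 1 / (1 + (x \<bullet> b)\<^sup>2))))"
      using C0 a by (intro mult_left_mono order_trans[OF 1] 2) (auto simp: V_def)
    also have "\<dots> = D * (\<Prod>b\<in>Basis. 1 / (1 + (x \<bullet> b)\<^sup>2))" by (simp add: D_def)
    finally show ?thesis .
  qed
  moreover have Km: "K \<in> borel_measurable borel" unfolding K_def by measurable
  ultimately obtain A where A: "kernel_bdd A K" using kernel_bdd_of_decay by blast
  have "(\<integral>z. K z * cis (- (z \<bullet> \<eta>)) \<partial>lborel) = \<sigma> \<eta>" for \<eta>
    by (rule fourier_inversion[OF si cont sC _ kernel_bdd_integrable[OF A]]) (simp add: K_def)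
  then show ?thesis using A si unfolding fourier_pair_def by (auto simp: K_def)
qed

section \<open>Functions determined by averages\<close>

text \<open>Boxes are stable under intersection and generate the Borel sets, so the vanishing of the
  integral spreads from boxes to all Borel sets by Dynkin's argument.\<close>

lemma AE_zero_of_box_integrals:
  fixes f :: "'a::euclidean_space \<Rightarrow> complex"
  assumes f: "integrable lborel f" and box: "\<And>l u. (\<integral>x. indicator (box l u) x *\<^sub>R f x \<partial>lborel) = 0"
  shows "AE x in lborel. f x = 0"
proof (rule sigma_finite_measure.density_zero[OF sigma_finite_lborel f])
  fix A :: "'a set" assume A: "A \<in> sets lborel"
  have [measurable]: "f \<in> borel_measurable borel" using f by auto
  let ?G = "range (\<lambda>(a, b). box a b :: 'a set)"
  have bor: "sets borel = sigma_sets UNIV ?G" by (subst borel_eq_box) simp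
  have si: "set_integrable lborel B f" if "B \<in> sigma_sets UNIV ?G" for B
    using that f unfolding set_integrable_def bor[symmetric] by (intro integrable_mult_indicator) auto
  have un: "\<exists>n. x \<in> box (- real n *\<^sub>R One) (real n *\<^sub>R One)" for x :: 'a
  proof -
    obtain n where n: "norm x < real n" using reals_Archimedean2 by blast
    have "- real n < x \<bullet> b \<and> x \<bullet> b < real n" if "b \<in> Basis" for b
      using Basis_le_norm[OF that, of x] n by auto
    then show ?thesis by (intro exI[of _ n]) (auto simp: mem_box)
  qed
  \<comment> \<open>The whole space is not a box; its integral, required for complements, is the
    limit over an exhaustion.\<close>
  have "(\<lambda>n. \<integral>x. indicator (box (- real n *\<^sub>R One) (real n *\<^sub>R One)) x *\<^sub>R f x \<partial>lborel) \<longlonglongrightarrow> (\<integral>x. f x \<partial>lborel)"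
  proof (rule integral_dominated_convergence[where w="\<lambda>x. norm (f x)"])
    show "AE x in lborel. (\<lambda>n. indicator (box (- real n *\<^sub>R One) (real n *\<^sub>R One)) x *\<^sub>R f x) \<longlonglongrightarrow> f x"
    proof (rule AE_I2)
      fix x :: 'a
      obtain n0 where n0: "x \<in> box (- real n0 *\<^sub>R One) (real n0 *\<^sub>R One)" using un by blast
      have "eventually (\<lambda>n. indicator (box (- real n *\<^sub>R One) (real n *\<^sub>R One)) x *\<^sub>R f x = f x) sequentially"
        using eventually_ge_at_top[of n0]
      proof eventually_elim
        case (elim n)
        then have "x \<in> box (- real n *\<^sub>R One) (real n *\<^sub>R One)" using n0 by (force simp: mem_box)
        then show ?case by simp
      qed
      then show "(\<lambda>n. indicator (box (- real n *\<^sub>R One) (real n *\<^sub>R One)) x *\<^sub>R f x) \<longlonglongrightarrow> f x"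
        by (rule tendsto_eventually)
    qed
  qed (use f in \<open>auto simp: indicator_def\<close>)
  then have tot: "(\<integral>x. f x \<partial>lborel) = 0" unfolding box by (auto dest: LIMSEQ_unique[OF _ tendsto_const])
  have "Int_stable ?G" by (auto simp: Int_stable_def box_Int_box)
  moreover have "?G \<subseteq> Pow UNIV" by simp
  moreover have "A \<in> sigma_sets UNIV ?G" using A bor by simp
  ultimately have "set_lebesgue_integral lborel A f = 0"
  proof (induction A rule: sigma_sets_induct_disjoint)
    case (basic B)
    then show ?case using box unfolding set_lebesgue_integral_def by auto
  next
    case empty
    then show ?case by (simp add: set_lebesgue_integral_def)
  next
    case (compl B)
    have eq: "indicator (UNIV - B) x *\<^sub>R f x = f x - indicator B x *\<^sub>R f x" for x by (auto simp: indicator_def)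
    then have "set_lebesgue_integral lborel (UNIV - B) f = (\<integral>x. f x \<partial>lborel) - set_lebesgue_integral lborel B f"
      using f si[OF compl(1)] unfolding set_lebesgue_integral_def set_integrable_def eq by simp
    then show ?case using tot compl by simp
  next
    case (union B)
    have "(\<Union>i. B i) \<in> sigma_sets UNIV ?G" using union(2) by (intro sigma_sets.Union) auto
    then have "set_lebesgue_integral lborel (\<Union>i. B i) f = (\<Sum>i. set_lebesgue_integral lborel (B i) f)"
      using union si bor by (intro lebesgue_integral_countable_add) (auto simp: disjoint_family_on_def)
    then show ?case using union(3) by simp
  qed
  then show "set_lebesgue_integral lborel A f = 0" .
qed

lemma Lp_bdd_local_integral:
  fixes h :: "'a::euclidean_space \<Rightarrow> complex"
  assumes "1 < r" "Lp_bdd r c h" "B \<in> sets borel"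
  shows "(\<integral>\<^sup>+x. norm (indicator B x *\<^sub>R h x) \<partial>lborel) \<le> ennreal (c powr r) + emeasure lborel B"
proof -
  have [measurable]: "h \<in> borel_measurable borel" "B \<in> sets borel" using assms by (auto simp: Lp_bdd_def)
  have "(\<integral>\<^sup>+x. norm (indicator B x *\<^sub>R h x) \<partial>lborel) \<le> (\<integral>\<^sup>+x. ennreal (norm (h x) powr r) + indicator B x \<partial>lborel)"
  proof (rule nn_integral_mono)
    fix x
    show "ennreal (norm (indicator B x *\<^sub>R h x)) \<le> ennreal (norm (h x) powr r) + indicator B x"
      using le_powr_split[of "norm (h x)" 1 r] assms(1)
      by (auto simp: indicator_def ennreal_1[symmetric] simp flip: ennreal_plus simp del: ennreal_1 intro!: ennreal_leI)
  qed
  also have "\<dots> = (\<integral>\<^sup>+x. ennreal (norm (h x) powr r) \<partial>lborel) + emeasure lborel B"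
    by (subst nn_integral_add) auto
  also have "\<dots> \<le> ennreal (c powr r) + emeasure lborel B"
    using assms by (intro add_right_mono) (auto simp: Lp_bdd_def)
  finally show ?thesis .
qed

text \<open>Up to scaling, the dilates of \<kappa> are an approximate identity of nonzero mass.
  Averages of \<open>h\<close> over boxes are tested against them: the test is 0 for every dilate,
  and in the limit it is the mass of \<kappa> times the integral of \<open>h\<close> over the box.
  Working with box averages replaces convergence at Lebesgue points.\<close>

lemma approx_identity_zero:
  fixes h \<kappa> :: "'a::euclidean_space \<Rightarrow> complex"
  assumes r: "1 < r" and h: "Lp_bdd r c h" and k: "integrable lborel \<kappa>" and k0: "(\<integral>x. \<kappa> x \<partial>lborel) \<noteq> 0"
    and z: "\<And>m. AE a in lborel. (\<integral>x. \<kappa> (real (Suc m) *\<^sub>R (a - x)) * h x \<partial>lborel) = 0"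
  shows "AE x in lborel. h x = 0"
proof -
  have [measurable]: "h \<in> borel_measurable borel" "\<kappa> \<in> borel_measurable borel" using h k by (auto simp: Lp_bdd_def)
  have boxz: "(\<integral>x. indicator (box l u) x *\<^sub>R h x \<partial>lborel) = 0" for l u :: 'a
  proof -
    define B where "B = box l u"
    have [measurable]: "B \<in> sets borel" by (simp add: B_def)
    have Bfin: "emeasure lborel B < \<infinity>" unfolding B_def by (rule emeasure_lborel_box_finite)
    define M where "M = c powr r + measure lborel B"
    have M: "ennreal M = ennreal (c powr r) + emeasure lborel B" and M0: "0 \<le> M"
      using Bfin by (auto simp: M_def emeasure_eq_ennreal_measure less_top)
    define d where "d m = 1 / real (Suc m)" for m
    have dlim: "d \<longlonglongrightarrow> 0" unfolding d_def by (rule LIMSEQ_Suc[OF lim_1_over_n])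
    have d: "0 < d m" "d m \<le> 1" for m by (auto simp: d_def)
    \<comment> \<open>The average of \<open>h\<close> over \<open>B\<close>, shifted by
      \<open>d m *\<^sub>R z\<close>; it is bounded uniformly in \<open>m\<close> and
      \<open>z\<close>, and tends to the average without shift.\<close>
    define H where "H m z = (\<integral>a. indicator B a *\<^sub>R h (a - d m *\<^sub>R z) \<partial>lborel)" for m z
    have nnH: "(\<integral>\<^sup>+a. norm (indicator B a *\<^sub>R h (a - d m *\<^sub>R z)) \<partial>lborel) \<le> ennreal M" for m z
    proof -
      have "Lp_bdd r c (\<lambda>a. h (a - d m *\<^sub>R z))"
        using h nn_integral_translate[of "\<lambda>x. ennreal (norm (h x) powr r)" "d m *\<^sub>R z"] by (auto simp: Lp_bdd_def)
      from Lp_bdd_local_integral[OF r this, of B] show ?thesis by (simp add: M)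
    qed
    have Hb: "norm (H m z) \<le> M" for m z
    proof -
      have "ennreal (norm (H m z)) \<le> ennreal M"
        unfolding H_def by (rule order_trans[OF norm_integral_le_nn_integral nnH])
      then show ?thesis using M0 by simp
    qed
    have Hlim: "(\<lambda>m. H m z) \<longlonglongrightarrow> (\<integral>x. indicator B x *\<^sub>R h x \<partial>lborel)" for z
    proof -
      have Heq: "H m z = (\<integral>x. indicator B (x + d m *\<^sub>R z) *\<^sub>R h x \<partial>lborel)" for m
        unfolding H_def using integral_translate[of "\<lambda>x. indicator B (x + d m *\<^sub>R z) *\<^sub>R h x" "d m *\<^sub>R z"] by simp
      obtain R where R: "\<And>x. x \<in> B \<Longrightarrow> norm x \<le> R" using bounded_box[of l u] by (auto simp: bounded_iff B_def)
      let ?C = "cball (0::'a) (R + norm z)"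
      show ?thesis unfolding Heq
      proof (rule integral_dominated_convergence[where w="\<lambda>x. norm (indicator ?C x *\<^sub>R h x)"])
        have "(\<integral>\<^sup>+x. norm (indicator ?C x *\<^sub>R h x) \<partial>lborel) < \<infinity>"
          using Lp_bdd_local_integral[OF r h, of ?C] emeasure_bounded_finite[OF bounded_cball, of "0::'a" "R + norm z"]
          by (auto simp: less_top[symmetric] top_unique)
        moreover have "?C \<in> sets borel" by simp
        then have "(\<lambda>x. norm (indicator ?C x *\<^sub>R h x)) \<in> borel_measurable lborel" by measurable
        ultimately show "integrable lborel (\<lambda>x. norm (indicator ?C x *\<^sub>R h x))" by (intro integrableI_bounded) auto
        \<comment> \<open>The shifted indicators converge at every point off the boundary of the
          box, which is a null set.\<close>
        have null: "emeasure lborel (cbox l u - box l u) = 0"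
          by (subst emeasure_Diff) (auto simp: box_subset_cbox emeasure_lborel_box_eq emeasure_lborel_cbox_eq)
        have fr: "AE x in lborel. x \<notin> cbox l u - box l u"
          by (rule AE_not_in) (use null in \<open>auto simp: null_sets_def\<close>)
        show "AE x in lborel. (\<lambda>m. indicator B (x + d m *\<^sub>R z) *\<^sub>R h x) \<longlonglongrightarrow> indicator B x *\<^sub>R h x"
          using fr
        proof eventually_elim
          case (elim x)
          have lim: "(\<lambda>m. x + d m *\<^sub>R z) \<longlonglongrightarrow> x + 0 *\<^sub>R z" by (intro tendsto_intros dlim)
          have "eventually (\<lambda>m. (x + d m *\<^sub>R z \<in> B) = (x \<in> B)) sequentially"
          proof (cases "x \<in> B")
            case True
            then show ?thesis using topological_tendstoD[OF lim, of B] by (auto simp: B_def elim: eventually_mono)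
          next
            case False
            then have "x \<in> - cbox l u" using elim by (auto simp: B_def)
            then have "eventually (\<lambda>m. x + d m *\<^sub>R z \<in> - cbox l u) sequentially"
              using topological_tendstoD[OF lim, of "- cbox l u"] by (auto simp: closed_cbox)
            then show ?thesis using False box_subset_cbox[of l u] by (auto simp: B_def elim!: eventually_mono)
          qed
          then have "eventually (\<lambda>m. indicator B (x + d m *\<^sub>R z) *\<^sub>R h x = indicator B x *\<^sub>R h x) sequentially"
            by eventually_elim (auto simp: indicator_def)
          then show ?case by (rule tendsto_eventually)
        qed
        show "AE x in lborel. norm (indicator B (x + d m *\<^sub>R z) *\<^sub>R h x) \<le> norm (indicator ?C x *\<^sub>R h x)" for m
        proof (rule AE_I2)
          fix x
          show "norm (indicator B (x + d m *\<^sub>R z) *\<^sub>R h x) \<le> norm (indicator ?C x *\<^sub>R h x)"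
          proof (cases "x + d m *\<^sub>R z \<in> B")
            case True
            have "norm x \<le> norm (x + d m *\<^sub>R z) + norm (d m *\<^sub>R z)" by (metis add_diff_cancel norm_triangle_sub norm_triangle_ineq4)
            also have "norm (d m *\<^sub>R z) \<le> norm z" using d[of m] by (simp add: mult_left_le_one_le)
            finally have "x \<in> ?C" using R[OF True] by simp
            then show ?thesis by (auto simp: indicator_def)
          qed auto
        qed
      qed auto
    qed
    \<comment> \<open>After Fubini, the substitution of the dilated difference for \<open>z\<close>
      turns the inner integral into the hypothesis \<open>z\<close>.\<close>
    have zero: "(\<integral>z. \<kappa> z * H m z \<partial>lborel) = 0" for m
    proof -
      let ?L = "real (Suc m)"
      have L: "?L * d m = 1" "?L > 0" by (auto simp: d_def)
      have inner: "(\<integral>z. \<kappa> z * h (a - d m *\<^sub>R z) \<partial>lborel) = ?L ^ DIM('a) *\<^sub>R (\<integral>x. \<kappa> (?L *\<^sub>R (a - x)) * h x \<partial>lborel)" for a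
      proof -
        have "(\<integral>z. \<kappa> z * h (a - d m *\<^sub>R z) \<partial>lborel) = \<bar>- ?L\<bar> ^ DIM('a) *\<^sub>R (\<integral>x. \<kappa> (?L *\<^sub>R a + (- ?L) *\<^sub>R x) * h (a - d m *\<^sub>R (?L *\<^sub>R a + (- ?L) *\<^sub>R x)) \<partial>lborel)"
          by (rule integral_affine_euclidean) auto
        also have "(\<lambda>x. \<kappa> (?L *\<^sub>R a + (- ?L) *\<^sub>R x) * h (a - d m *\<^sub>R (?L *\<^sub>R a + (- ?L) *\<^sub>R x))) = (\<lambda>x. \<kappa> (?L *\<^sub>R (a - x)) * h x)"
          using L by (auto simp: fun_eq_iff scaleR_diff_right mult.commute simp del: of_nat_Suc)
        finally show ?thesis by (simp del: of_nat_Suc)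
      qed
      have "(\<integral>\<^sup>+z. \<integral>\<^sup>+a. norm (\<kappa> z * (indicator B a *\<^sub>R h (a - d m *\<^sub>R z))) \<partial>lborel \<partial>lborel) \<le> (\<integral>\<^sup>+z. norm (\<kappa> z) * ennreal M \<partial>lborel)"
      proof (rule nn_integral_mono)
        fix z
        have "(\<integral>\<^sup>+a. norm (\<kappa> z * (indicator B a *\<^sub>R h (a - d m *\<^sub>R z))) \<partial>lborel) = norm (\<kappa> z) * (\<integral>\<^sup>+a. norm (indicator B a *\<^sub>R h (a - d m *\<^sub>R z)) \<partial>lborel)"
          by (simp only: norm_mult[of "\<kappa> z"] ennreal_mult norm_ge_zero) (rule nn_integral_cmult, measurable)
        also have "\<dots> \<le> norm (\<kappa> z) * ennreal M" by (intro mult_left_mono nnH) auto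
        finally show "(\<integral>\<^sup>+a. norm (\<kappa> z * (indicator B a *\<^sub>R h (a - d m *\<^sub>R z))) \<partial>lborel) \<le> norm (\<kappa> z) * ennreal M" .
      qed
      also have "\<dots> < \<infinity>" using k by (auto simp: nn_integral_multc integrable_iff_bounded ennreal_mult_less_top)
      finally have fin: "(\<integral>\<^sup>+z. \<integral>\<^sup>+a. norm (\<kappa> z * (indicator B a *\<^sub>R h (a - d m *\<^sub>R z))) \<partial>lborel \<partial>lborel) < \<infinity>" .
      have "(\<integral>z. \<kappa> z * H m z \<partial>lborel) = (\<integral>z. \<integral>a. \<kappa> z * (indicator B a *\<^sub>R h (a - d m *\<^sub>R z)) \<partial>lborel \<partial>lborel)"
        unfolding H_def by (simp only: integral_mult_right_zero)
      also have "\<dots> = (\<integral>a. \<integral>z. \<kappa> z * (indicator B a *\<^sub>R h (a - d m *\<^sub>R z)) \<partial>lborel \<partial>lborel)"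
        by (rule Fubini_swap(1)[OF sigma_finite_lborel sigma_finite_lborel _ fin]) measurable
      also have "\<dots> = (\<integral>a. indicator B a *\<^sub>R (\<integral>z. \<kappa> z * h (a - d m *\<^sub>R z) \<partial>lborel) \<partial>lborel)"
        by (simp flip: integral_scaleR_right)
      also have "\<dots> = (\<integral>a. 0 \<partial>(lborel :: 'a measure))"
        using z[of m] unfolding inner by (intro integral_cong_AE) (auto elim: eventually_mono simp del: of_nat_Suc)
      finally show ?thesis by simp
    qed
    have "(\<lambda>m. \<integral>z. \<kappa> z * H m z \<partial>lborel) \<longlonglongrightarrow> (\<integral>z. \<kappa> z * (\<integral>x. indicator B x *\<^sub>R h x \<partial>lborel) \<partial>lborel)"
    proof (rule integral_dominated_convergence[where w="\<lambda>z. norm (\<kappa> z) * M"])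
      show "(\<lambda>z. \<kappa> z * H m z) \<in> borel_measurable lborel" for m unfolding H_def by measurable
      show "AE z in lborel. norm (\<kappa> z * H m z) \<le> norm (\<kappa> z) * M" for m
        using Hb by (auto simp: norm_mult intro!: mult_left_mono)
      show "AE z in lborel. (\<lambda>m. \<kappa> z * H m z) \<longlonglongrightarrow> \<kappa> z * (\<integral>x. indicator B x *\<^sub>R h x \<partial>lborel)"
        by (intro AE_I2 tendsto_mult tendsto_const Hlim)
    qed (use k in auto)
    then have "(\<integral>z. \<kappa> z * (\<integral>x. indicator B x *\<^sub>R h x \<partial>lborel) \<partial>lborel) = 0"
      unfolding zero by (auto dest: LIMSEQ_unique[OF _ tendsto_const])
    then show ?thesis using k0 by (simp add: B_def)
  qed
  \<comment> \<open>The function \<open>h\<close> is only locally integrable, so the criterion for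
    integrable functions is applied to its truncations to large boxes.\<close>
  have "AE x in lborel. indicator (box (- real n *\<^sub>R One) (real n *\<^sub>R One)) x *\<^sub>R h x = 0" for n
  proof (rule AE_zero_of_box_integrals)
    let ?B = "box (- real n *\<^sub>R One) (real n *\<^sub>R One :: 'a)"
    have "(\<integral>\<^sup>+x. norm (indicator ?B x *\<^sub>R h x) \<partial>lborel) < \<infinity>"
      using Lp_bdd_local_integral[OF r h, of ?B] emeasure_lborel_box_finite[of "- real n *\<^sub>R One" "real n *\<^sub>R One :: 'a"]
      by (auto simp: less_top[symmetric] top_unique)
    then show "integrable lborel (\<lambda>x. indicator ?B x *\<^sub>R h x)" by (intro integrableI_bounded) auto
    fix l u :: 'a
    obtain l' u' where "box l u \<inter> ?B = box l' u'" using box_Int_box by blast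
    moreover have "indicator (box l u) x *\<^sub>R indicator ?B x *\<^sub>R h x = indicator (box l u \<inter> ?B) x *\<^sub>R h x" for x
      by (auto simp: indicator_def)
    ultimately show "(\<integral>x. indicator (box l u) x *\<^sub>R indicator ?B x *\<^sub>R h x \<partial>lborel) = 0"
      by (simp only: boxz)
  qed
  then have "AE x in lborel. \<forall>n. indicator (box (- real n *\<^sub>R One) (real n *\<^sub>R One)) x *\<^sub>R h x = 0"
    by (simp only: AE_all_countable) blast
  then show ?thesis
  proof eventually_elim
    case (elim x)
    obtain n where n: "norm x < real n" using reals_Archimedean2 by blast
    have "- real n < x \<bullet> b \<and> x \<bullet> b < real n" if "b \<in> Basis" for b
      using Basis_le_norm[OF that, of x] n by auto
    then have "x \<in> box (- real n *\<^sub>R One) (real n *\<^sub>R One)" by (auto simp: mem_box)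
    then show ?case using elim[rule_format, of n] by simp
  qed
qed

section \<open>Schwartz functions and Lebesgue norms\<close>

text \<open>The product of the \<open>1 + (x \<bullet> b)\<^sup>2\<close> is at most a constant
  times \<open>1 + norm x ^ (2 * n)\<close>, so the seminorms of order 0 and 2n without derivatives
  suffice.\<close>

lemma schwartz_kernel_bdd:
  fixes \<phi> :: "'a::euclidean_space \<Rightarrow> complex"
  assumes "schwartz \<phi>"
  shows "\<exists>A. kernel_bdd A \<phi>"
proof -
  have s: "smooth_on UNIV \<phi>" using assms by (simp add: schwartz_def)
  have b: "\<exists>C. \<forall>x. norm x ^ N * norm (\<phi> x) \<le> C" for N
  proof -
    have "set [] \<subseteq> (Basis :: 'a set)" by simp
    then have "bounded (range (\<lambda>x. norm x ^ N *\<^sub>R iter_deriv [] \<phi> x))"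
      using assms unfolding schwartz_def by blast
    then show ?thesis by (auto simp: bounded_iff iter_deriv_def)
  qed
  let ?n = "DIM('a)"
  obtain C0 where C0: "\<And>x. norm (\<phi> x) \<le> C0" using b[of 0] by auto
  obtain C1 where C1: "\<And>x. norm x ^ (2 * ?n) * norm (\<phi> x) \<le> C1" using b[of "2 * ?n"] by auto
  show ?thesis
  proof (rule kernel_bdd_of_decay)
    show "\<phi> \<in> borel_measurable borel" by (rule borel_measurable_continuous_onI[OF smooth_continuous[OF s]])
    fix x :: 'a
    let ?P = "\<Prod>b\<in>Basis. 1 + (x \<bullet> b)\<^sup>2"
    have P0: "0 < ?P" by (intro prod_pos) (auto intro: add_pos_nonneg)
    have "?P \<le> (\<Prod>b\<in>(Basis::'a set). 1 + (norm x)\<^sup>2)"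
      by (intro prod_mono) (auto simp: Basis_le_norm abs_le_square_iff[symmetric])
    also have "\<dots> = (1 + (norm x)\<^sup>2) ^ ?n" by simp
    also have "\<dots> \<le> (2 * max 1 ((norm x)\<^sup>2)) ^ ?n" by (intro power_mono) auto
    also have "\<dots> = 2 ^ ?n * (max 1 ((norm x)\<^sup>2)) ^ ?n" by (rule power_mult_distrib)
    also have "\<dots> \<le> 2 ^ ?n * (1 + norm x ^ (2 * ?n))"
      by (intro mult_left_mono) (auto simp: max_def power_mult)
    finally have "norm (\<phi> x) * ?P \<le> norm (\<phi> x) * (2 ^ ?n * (1 + norm x ^ (2 * ?n)))"
      by (intro mult_left_mono) auto
    also have "\<dots> = 2 ^ ?n * (norm (\<phi> x) + norm x ^ (2 * ?n) * norm (\<phi> x))" by (simp add: algebra_simps)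
    also have "\<dots> \<le> 2 ^ ?n * (C0 + C1)" using C0 C1 by (intro mult_left_mono add_mono) auto
    finally have "norm (\<phi> x) \<le> 2 ^ ?n * (C0 + C1) / ?P" using P0 by (simp add: le_divide_eq)
    also have "\<dots> = 2 ^ ?n * (C0 + C1) * (\<Prod>b\<in>Basis. 1 / (1 + (x \<bullet> b)\<^sup>2))" by (simp add: prod_dividef)
    finally show "norm (\<phi> x) \<le> 2 ^ ?n * (C0 + C1) * (\<Prod>b\<in>Basis. 1 / (1 + (x \<bullet> b)\<^sup>2))" .
  qed
qed

lemma completion_ex_borel_measurable_complex:
  fixes g :: "'a \<Rightarrow> complex"
  assumes g: "g \<in> borel_measurable (completion M)"
  shows "\<exists>g'\<in>borel_measurable M. (AE x in M. g x = g' x)"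
proof -
  have "(\<lambda>x. Re (g x)) \<in> borel_measurable (completion M)" "(\<lambda>x. Im (g x)) \<in> borel_measurable (completion M)"
    using g by measurable
  from this[THEN completion_ex_borel_measurable_real]
  obtain a b where ab: "a \<in> borel_measurable M" "b \<in> borel_measurable M" "AE x in M. Re (g x) = a x" "AE x in M. Im (g x) = b x"
    by blast
  then show ?thesis
    by (intro bexI[of _ "\<lambda>x. Complex (a x) (b x)"])
      (auto simp: complex_eq_iff Complex_eq elim: eventually_elim2)
qed

lemma Lp_norm_finite_exponent:
  assumes "p < \<infinity>" "g \<in> borel_measurable borel"
  shows "Lp_norm p g = epow (\<integral>\<^sup>+x. ennreal (norm (g x) powr enn2real p) \<partial>lborel) (1 / enn2real p)"
  using assms unfolding Lp_norm_def by (subst nn_integral_completion) auto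

lemma Lp_norm_cong_AE:
  assumes "p < \<infinity>" "AE x in lborel. f x = g x"
  shows "Lp_norm p f = Lp_norm p g"
proof -
  have "AE x in lebesgue. f x = g x" using assms(2) by (rule AE_completion)
  then have "(\<integral>\<^sup>+x. ennreal (norm (f x) powr enn2real p) \<partial>lebesgue) = (\<integral>\<^sup>+x. ennreal (norm (g x) powr enn2real p) \<partial>lebesgue)"
    by (intro nn_integral_cong_AE) (auto elim: eventually_mono)
  then show ?thesis using assms(1) by (simp add: Lp_norm_def)
qed

lemma Lp_norm_le_iff:
  assumes p: "1 < p" "p < \<infinity>" and "g \<in> borel_measurable borel" and c: "0 < c"
  shows "Lp_norm p g \<le> ennreal c \<longleftrightarrow> Lp_bdd (enn2real p) c g"
proof -
  define r where "r = enn2real p"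
  have r: "1 < r" using p unfolding r_def
    by (metis enn2real_1 enn2real_less_iff ennreal_1 ennreal_enn2real_if ennreal_less_iff infinity_ennreal_def linorder_not_less order_less_imp_not_less zero_le_one top.not_eq_extremum)
  define I where "I = (\<integral>\<^sup>+x. ennreal (norm (g x) powr r) \<partial>lborel)"
  have "epow I (1 / r) \<le> ennreal c \<longleftrightarrow> I \<le> ennreal (c powr r)"
  proof (cases I)
    case (real i)
    have "i powr (1 / r) \<le> c \<longleftrightarrow> i \<le> c powr r"
    proof
      assume "i powr (1 / r) \<le> c"
      then have "(i powr (1 / r)) powr r \<le> c powr r" using r by (intro powr_mono2) auto
      then show "i \<le> c powr r" using r real by (simp add: powr_powr)
    next
      assume "i \<le> c powr r"
      then have "i powr (1 / r) \<le> (c powr r) powr (1 / r)" using r real by (intro powr_mono2) auto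
      then show "i powr (1 / r) \<le> c" using r c by (simp add: powr_powr)
    qed
    then show ?thesis using real c by (simp add: epow_def)
  qed (use c in \<open>auto simp: epow_def top_unique\<close>)
  then show ?thesis
    using assms Lp_norm_finite_exponent[OF p(2) assms(3)] by (auto simp: Lp_bdd_def I_def r_def)
qed

lemma Lp_norm_finite_imp_bdd:
  assumes "1 < p" "p < \<infinity>" "g \<in> borel_measurable borel" "Lp_norm p g < \<infinity>"
  shows "\<exists>c. Lp_bdd (enn2real p) c g"
proof -
  have "Lp_norm p g \<le> ennreal (enn2real (Lp_norm p g) + 1)"
    using assms(4) by (cases "Lp_norm p g") (auto intro: ennreal_leI)
  moreover have "0 < enn2real (Lp_norm p g) + 1" by (simp add: add_nonneg_pos)
  ultimately show ?thesis using Lp_norm_le_iff[OF assms(1-3)] by blast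
qed

text \<open>The integral over a two-point counting measure, which explains the factor 2.\<close>

lemma Lp_bdd_add:
  fixes g h :: "'a::euclidean_space \<Rightarrow> complex"
  assumes r: "1 < r" and g: "Lp_bdd r c g" and h: "Lp_bdd r d h"
  shows "Lp_bdd r (2 * (c + d)) (\<lambda>x. g x + h x)"
proof -
  have [measurable]: "g \<in> borel_measurable borel" "h \<in> borel_measurable borel" using g h by (auto simp: Lp_bdd_def)
  have c: "0 < c" "0 < d" using g h by (auto simp: Lp_bdd_def)
  have "Lp_bdd r (2 * (c + d)) (\<lambda>x. \<integral>a. (if a then g x else h x) \<partial>count_space (UNIV :: bool set))"
  proof (rule Lp_bdd_integral[OF r, where c="\<lambda>a. if a then c else d"])
    show "sigma_finite_measure (count_space (UNIV :: bool set))" by (rule sigma_finite_measure_count_space_finite) simp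
    show "(\<lambda>(a, x). if a then g x else h x) \<in> borel_measurable (count_space UNIV \<Otimes>\<^sub>M borel)"
      by (rule measurable_pair_measure_countable1) auto
    show "(\<integral>\<^sup>+a. ennreal (if a then c else d) \<partial>count_space UNIV) \<le> ennreal (c + d)"
      using c by (simp add: nn_integral_count_space_finite UNIV_bool add.commute flip: ennreal_plus)
  qed (use c g h in auto)
  then show ?thesis by (simp add: lebesgue_integral_count_space_finite UNIV_bool add.commute)
qed

lemma Lp_bdd_minus: "Lp_bdd r c g \<Longrightarrow> Lp_bdd r c (\<lambda>x. - g x)"
  by (auto simp: Lp_bdd_def)

lemma Lp_bdd_diff:
  assumes "1 < r" "Lp_bdd r c g" "Lp_bdd r d h"
  shows "Lp_bdd r (2 * (c + d)) (\<lambda>x. g x - h x)"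
  using Lp_bdd_add[OF assms(1,2) Lp_bdd_minus[OF assms(3)]] by simp

section \<open>The frequency-uniform decomposition\<close>

definition near :: "int \<Rightarrow> int^'n \<Rightarrow> int^'n \<Rightarrow> bool" where
  "near s k m \<longleftrightarrow> (\<forall>i. \<bar>k $ i - m $ i\<bar> \<le> s)"

definition cube :: "real^'n \<Rightarrow> real \<Rightarrow> (real^'n) set" where
  "cube c s = {\<xi>. \<forall>i. \<bar>\<xi> $ i - c $ i\<bar> \<le> s}"

definition near_count :: "'n::finite itself \<Rightarrow> int \<Rightarrow> nat" where
  "near_count _ s = card {m :: int^'n. near s 0 m}"

lemma finite_near_0: "finite {m :: int^'n. near s 0 m}"
proof -
  have "finite (PiE (UNIV :: 'n set) (\<lambda>_. {-s..s}))" by (intro finite_PiE) auto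
  moreover have "{m :: int^'n. near s 0 m} \<subseteq> vec_lambda ` PiE UNIV (\<lambda>_. {-s..s})"
  proof
    fix m :: "int^'n" assume "m \<in> {m. near s 0 m}"
    then have "vec_nth m \<in> PiE UNIV (\<lambda>_. {-s..s})" by (auto simp: near_def abs_le_iff minus_le_iff)
    then show "m \<in> vec_lambda ` PiE UNIV (\<lambda>_. {-s..s})" by (metis imageI vec_nth_inverse)
  qed
  ultimately show ?thesis by (meson finite_surj)
qed

lemma near_eq_image: "{m :: int^'n. near s k m} = (\<lambda>j. k + j) ` {m. near s 0 m}"
proof (intro set_eqI iffI)
  fix m assume "m \<in> {m. near s k m}"
  then have "m = k + (m - k)" "m - k \<in> {m. near s 0 m}" by (auto simp: near_def abs_minus_commute)
  then show "m \<in> (\<lambda>j. k + j) ` {m. near s 0 m}" by blast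
qed (auto simp: near_def)

lemma finite_near: "finite {m :: int^'n. near s k m}"
  by (subst near_eq_image) (intro finite_imageI finite_near_0)

lemma card_near: "card {m :: int^'n. near s k m} = near_count TYPE('n) s"
  unfolding near_count_def by (subst near_eq_image) (intro card_image inj_onI, simp)

lemma near_commute: "near s k m \<longleftrightarrow> near s m k"
  by (auto simp: near_def abs_minus_commute)

lemma lattice_vec_nth[simp]: "lattice_vec k $ i = real_of_int (k $ i)"
  by (simp add: lattice_vec_def)

lemma lattice_vec_add: "lattice_vec (k + m) = lattice_vec k + lattice_vec m"
  by (simp add: vec_eq_iff)

lemma lattice_vec_0[simp]: "lattice_vec 0 = 0"
  by (simp add: vec_eq_iff)

lemma finite_lattice_cube: "finite {m :: int^'n. \<xi> \<in> cube (lattice_vec m) s}"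
proof -
  define c :: "int^'n" where "c = (\<chi> i. round (\<xi> $ i))"
  have "{m :: int^'n. \<xi> \<in> cube (lattice_vec m) s} \<subseteq> {m. near (\<lceil>s\<rceil> + 1) c m}"
  proof safe
    fix m :: "int^'n" assume m: "\<xi> \<in> cube (lattice_vec m) s"
    have "\<bar>c $ i - m $ i\<bar> \<le> \<lceil>s\<rceil> + 1" for i
    proof -
      have "\<bar>\<xi> $ i - real_of_int (m $ i)\<bar> \<le> s" using m by (simp add: cube_def)
      moreover have "\<bar>real_of_int (c $ i) - \<xi> $ i\<bar> \<le> 1/2" using of_int_round_abs_le[of "\<xi> $ i"] by (simp add: c_def)
      ultimately have "\<bar>real_of_int (c $ i) - real_of_int (m $ i)\<bar> \<le> s + 1" by linarith
      then show ?thesis by linarith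
    qed
    then show "near (\<lceil>s\<rceil> + 1) c m" by (simp add: near_def)
  qed
  then show ?thesis using finite_near finite_subset by blast
qed

lemma norm_le_of_cube: "\<xi> \<in> cube 0 s \<Longrightarrow> norm (\<xi> :: real^'n) \<le> real CARD('n) * s"
proof -
  assume "\<xi> \<in> cube 0 s"
  then have "(\<Sum>i\<in>UNIV. \<bar>\<xi> $ i\<bar>) \<le> (\<Sum>i\<in>(UNIV :: 'n set). s)" by (intro sum_mono) (auto simp: cube_def)
  then show ?thesis using norm_le_l1_cart[of \<xi>] by simp
qed

locale decomposition =
  fixes \<rho> :: "real^'n \<Rightarrow> real"
  assumes bump: "decomp_bump \<rho>"
begin

section \<open>Symbols and kernels of the decomposition\<close>

definition denom :: "real^'n \<Rightarrow> real" where
  "denom \<xi> = (\<Sum>\<^sub>\<infinity>m\<in>(UNIV :: (int^'n) set). \<rho> (\<xi> - lattice_vec m))"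

definition sg :: "int^'n \<Rightarrow> real^'n \<Rightarrow> complex" where
  "sg k \<xi> = complex_of_real (decomp_sigma \<rho> k \<xi>)"

definition Kb :: "int^'n \<Rightarrow> real^'n \<Rightarrow> complex" where
  "Kb k x = of_real ((2 * pi) powr (- real DIM(real^'n))) * (\<integral>\<eta>. sg k \<eta> * cis (x \<bullet> \<eta>) \<partial>lborel)"

lemma rho_support: "\<rho> (\<xi> - lattice_vec m) \<noteq> 0 \<Longrightarrow> \<xi> \<in> cube (lattice_vec m) 1"
  using bump by (auto simp: decomp_bump_def cube_def)

lemma rho_nonneg: "0 \<le> \<rho> \<xi>"
  using bump by (auto simp: decomp_bump_def)

lemma denom_eq_sum:
  assumes "finite F" "\<And>m. \<xi> \<in> cube (lattice_vec m) 1 \<Longrightarrow> m \<in> F"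
  shows "denom \<xi> = (\<Sum>m\<in>F. \<rho> (\<xi> - lattice_vec m))"
proof -
  have "denom \<xi> = (\<Sum>\<^sub>\<infinity>m\<in>F. \<rho> (\<xi> - lattice_vec m))"
    unfolding denom_def using assms rho_support by (intro infsum_cong_neutral) auto
  then show ?thesis using assms by simp
qed

text \<open>Rounding every coordinate finds a lattice point whose translated bump equals 1 at the
  given frequency.\<close>

lemma denom_ge_1: "1 \<le> denom \<xi>"
proof -
  define c :: "int^'n" where "c = (\<chi> i. round (\<xi> $ i))"
  have c: "\<bar>\<xi> $ i - real_of_int (c $ i)\<bar> \<le> 1/2" for i
    using of_int_round_abs_le[of "\<xi> $ i"] by (simp add: c_def abs_minus_commute)
  then have "\<rho> (\<xi> - lattice_vec c) = 1" using bump by (auto simp: decomp_bump_def)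
  moreover have "\<bar>\<xi> $ i - real_of_int (c $ i)\<bar> \<le> 1" for i using c[of i] by linarith
  then have "c \<in> {m. \<xi> \<in> cube (lattice_vec m) 1}" by (simp add: cube_def)
  moreover have "\<rho> (\<xi> - lattice_vec c) \<le> (\<Sum>m\<in>{m. \<xi> \<in> cube (lattice_vec m) 1}. \<rho> (\<xi> - lattice_vec m))"
    if "c \<in> {m. \<xi> \<in> cube (lattice_vec m) 1}"
    using that by (intro member_le_sum) (auto simp: rho_nonneg finite_lattice_cube)
  ultimately show ?thesis using denom_eq_sum[OF finite_lattice_cube, of \<xi>] by simp
qed

text \<open>This makes every symbol a translate of \<open>sg 0\<close>, so that a single constant
  serves all kernels.\<close>

lemma denom_periodic: "denom (\<xi> - lattice_vec k) = denom \<xi>"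
proof -
  have "bij (\<lambda>m :: int^'n. k + m)" by (rule o_bij[of "\<lambda>m. m - k"]) (auto simp: fun_eq_iff)
  then have "infsum (\<lambda>m. \<rho> (\<xi> - lattice_vec (k + m))) UNIV = infsum (\<lambda>m. \<rho> (\<xi> - lattice_vec m)) UNIV"
    by (rule infsum_reindex_bij_betw)
  then show ?thesis by (simp add: denom_def lattice_vec_add diff_diff_eq)
qed

lemma decomp_sigma_eq: "decomp_sigma \<rho> k \<xi> = \<rho> (\<xi> - lattice_vec k) / denom \<xi>"
  by (simp add: decomp_sigma_def denom_def)

lemma sg_translate: "sg k \<xi> = sg 0 (\<xi> - lattice_vec k)"
  by (simp add: sg_def decomp_sigma_eq denom_periodic)

lemma sg_support: "\<xi> \<notin> cube (lattice_vec k) 1 \<Longrightarrow> sg k \<xi> = 0"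
  using rho_support by (auto simp: sg_def decomp_sigma_eq)

lemma sg_0_pos: "sg 0 0 \<noteq> 0"
proof -
  have "\<rho> 0 = 1" using bump by (auto simp: decomp_bump_def)
  then show ?thesis using denom_ge_1[of 0] by (simp add: sg_def decomp_sigma_eq)
qed

lemma sum_sg:
  assumes "finite F" "\<And>m. \<xi> \<in> cube (lattice_vec m) 1 \<Longrightarrow> m \<in> F"
  shows "(\<Sum>m\<in>F. sg m \<xi>) = 1"
proof -
  have "(\<Sum>m\<in>F. sg m \<xi>) = complex_of_real ((\<Sum>m\<in>F. \<rho> (\<xi> - lattice_vec m)) / denom \<xi>)"
    by (simp add: sg_def decomp_sigma_eq sum_divide_distrib)
  also have "\<dots> = 1" using denom_eq_sum[OF assms] denom_ge_1[of \<xi>] by simp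
  finally show ?thesis .
qed

lemma rho_diff_order: "diff_order m \<rho>"
  using bump unfolding decomp_bump_def smooth_on_UNIV_iff by blast

lemma denom_diff_order: "diff_order m denom"
proof (rule diff_order_local)
  fix x :: "real^'n"
  \<comment> \<open>The half-width 2 is that of the support of a bump plus the radius of the ball,
    so that one finite set serves the whole ball.\<close>
  let ?F = "{m :: int^'n. x \<in> cube (lattice_vec m) 2}"
  let ?g = "\<lambda>y. \<Sum>k\<in>?F. \<rho> (y - lattice_vec k)"
  have "denom y = ?g y" if y: "y \<in> ball x 1" for y
  proof (rule denom_eq_sum)
    fix k :: "int^'n" assume k: "y \<in> cube (lattice_vec k) 1"
    have "\<bar>x $ i - real_of_int (k $ i)\<bar> \<le> 2" for i
    proof -
      have "\<bar>(x - y) $ i\<bar> \<le> norm (x - y)" by (rule component_le_norm_cart)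
      then have "\<bar>x $ i - y $ i\<bar> \<le> 1" using y by (simp add: dist_norm)
      moreover have "\<bar>y $ i - real_of_int (k $ i)\<bar> \<le> 1" using k by (simp add: cube_def)
      ultimately show ?thesis by linarith
    qed
    then show "k \<in> ?F" by (simp add: cube_def)
  qed (rule finite_lattice_cube)
  moreover have "diff_order m ?g"
    by (intro diff_order_sum diff_order_translate rho_diff_order finite_lattice_cube)
  ultimately show "\<exists>S g. open S \<and> x \<in> S \<and> diff_order m g \<and> (\<forall>y\<in>S. denom y = g y)"
    by (intro exI[of _ "ball x 1"] exI[of _ ?g]) auto
qed

lemma sg_smooth: "smooth_on UNIV (sg 0)"
  unfolding smooth_on_UNIV_iff
proof
  fix m
  have "sg 0 = (\<lambda>\<xi>. complex_of_real (\<rho> \<xi> * inverse (denom \<xi>)))"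
    by (rule ext) (simp add: sg_def decomp_sigma_eq field_simps)
  moreover have "denom \<xi> \<noteq> 0" for \<xi> using denom_ge_1[of \<xi>] by auto
  then have "diff_order m (\<lambda>\<xi>. complex_of_real (\<rho> \<xi> * inverse (denom \<xi>)))"
    by (intro diff_order_of_real diff_order_mult rho_diff_order diff_order_inverse denom_diff_order)
  ultimately show "diff_order m (sg 0)" by (simp only:)
qed

lemma sg_bounded_support: "real CARD('n) < norm \<xi> \<Longrightarrow> sg 0 \<xi> = 0"
  using norm_le_of_cube[of \<xi> 1] sg_support[of \<xi> 0] by fastforce

definition A0 :: real where "A0 = (SOME A. fourier_pair A (sg 0) (Kb 0))"

lemma fourier_pair_0: "fourier_pair A0 (sg 0) (Kb 0)"
proof -
  have "\<exists>A. fourier_pair A (sg 0) (Kb 0)"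
    using fourier_pair_smooth[OF sg_smooth sg_bounded_support] unfolding Kb_def[abs_def] by simp
  then show ?thesis unfolding A0_def by (rule someI_ex)
qed

lemma fourier_pair_k: "fourier_pair A0 (sg k) (Kb k)"
proof -
  have eq: "(\<lambda>\<eta>. sg 0 (\<eta> - lattice_vec k)) = sg k" by (rule ext) (rule sg_translate[symmetric])
  have p: "fourier_pair A0 (sg k) (\<lambda>x. cis (x \<bullet> lattice_vec k) * Kb 0 x)"
    using fourier_pair_translate[OF fourier_pair_0, of "lattice_vec k"] unfolding eq .
  then have "(\<lambda>x. cis (x \<bullet> lattice_vec k) * Kb 0 x) = Kb k" unfolding fourier_pair_def Kb_def[abs_def] by blast
  then show ?thesis using p by simp
qed

lemma Kb_kernel: "kernel_bdd A0 (Kb k)"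
  by (rule fourier_pair_kernel[OF fourier_pair_k])

lemma A0_pos: "0 < A0"
  by (rule kernel_bdd_pos[OF Kb_kernel[of 0]])

lemma Kb_measurable[measurable]: "Kb k \<in> borel_measurable borel"
  by (rule kernel_bdd_measurable[OF Kb_kernel])

lemma fourier_pair_F:
  assumes "finite F" "F \<noteq> {}"
  shows "fourier_pair (real (card F) * A0) (\<lambda>\<xi>. \<Sum>k\<in>F. sg k \<xi>) (\<lambda>x. \<Sum>k\<in>F. Kb k x)"
  using assms fourier_pair_k by (rule fourier_pair_sum)

lemma spec_Kb: "1 < r \<Longrightarrow> Lp_bdd r c g \<Longrightarrow> spec_in (cube (lattice_vec k) 1) (conv (Kb k) g)"
  using spec_in_conv[OF _ fourier_pair_k] sg_support by blast

lemma conv_Kb_far: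
  assumes g: "spec_in (cube c s) g" and i: "s + 1 < \<bar>real_of_int (k $ i) - c $ i\<bar>"
  shows "conv (Kb k) g x = 0"
proof (rule conv_eq_0_of_spec[OF fourier_pair_k g])
  fix \<eta> assume "\<eta> \<in> cube c s"
  then have "\<bar>\<eta> $ i - c $ i\<bar> \<le> s" by (simp add: cube_def)
  then have "1 < \<bar>\<eta> $ i - real_of_int (k $ i)\<bar>" using i by linarith
  then have "\<eta> \<notin> cube (lattice_vec k) 1" unfolding cube_def by (auto simp: not_le)
  then show "sg k \<eta> = 0" by (rule sg_support)
qed

lemma conv_Kb_Kb_far:
  assumes "1 < r" "Lp_bdd r c g" "\<not> near 2 k l"
  shows "conv (Kb k) (conv (Kb l) g) x = 0"
proof -
  obtain i where "\<not> \<bar>k $ i - l $ i\<bar> \<le> 2" using assms(3) by (auto simp: near_def)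
  then have "1 + 1 < \<bar>real_of_int (k $ i) - lattice_vec l $ i\<bar>" by simp
  then show ?thesis by (rule conv_Kb_far[OF spec_Kb[OF assms(1,2)]])
qed

lemma conv_F_of_spec:
  assumes g: "spec_in B g" and F: "finite F" "\<And>\<xi> m. \<xi> \<in> B \<Longrightarrow> \<xi> \<in> cube (lattice_vec m) 1 \<Longrightarrow> m \<in> F" "F \<noteq> {}"
  shows "AE x in lborel. conv (\<lambda>x. \<Sum>k\<in>F. Kb k x) g x = g x"
  by (rule conv_eq_self_of_spec[OF fourier_pair_F g]) (use F sum_sg in auto)

lemma near_of_cube:
  assumes "\<xi> \<in> cube (lattice_vec l) 1" "\<xi> \<in> cube (lattice_vec m) 1"
  shows "near 2 l m"
proof -
  have "\<bar>l $ i - m $ i\<bar> \<le> 2" for i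
  proof -
    have "\<bar>\<xi> $ i - real_of_int (l $ i)\<bar> \<le> 1" "\<bar>\<xi> $ i - real_of_int (m $ i)\<bar> \<le> 1"
      using assms by (auto simp: cube_def)
    then show ?thesis by linarith
  qed
  then show ?thesis by (simp add: near_def)
qed

text \<open>On the support of \<open>sg l\<close> only the symbols with index near \<open>l\<close>
  are nonzero, and they sum to 1.\<close>

lemma conv_near_self:
  assumes "1 < r" "Lp_bdd r c g"
  shows "AE x in lborel. conv (\<lambda>x. \<Sum>k\<in>{k. near 2 l k}. Kb k x) (conv (Kb l) g) x = conv (Kb l) g x"
proof (rule conv_F_of_spec[OF spec_Kb[OF assms] finite_near])
  show "{k. near 2 l k} \<noteq> {}" by (auto simp: near_def intro!: exI[of _ l])
qed (auto intro: near_of_cube)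

section \<open>Reconstruction from the boxes\<close>

text \<open>The sup bound for one convolution with the sum of the \<open>near_count\<close> kernels
  that reproduce a box.\<close>

definition C1 :: real where "C1 = 2 * (real (near_count TYPE('n) 2) * A0)"

lemma C1_pos: "0 < C1"
proof -
  have "(0 :: int^'n) \<in> {m. near 2 0 m}" by (simp add: near_def)
  then have "0 < near_count TYPE('n) 2" unfolding near_count_def using finite_near card_gt_0_iff by blast
  then show ?thesis using A0_pos by (simp add: C1_def)
qed

text \<open>A box is reproduced by the sum of the neighbouring kernels, and convolution with a
  bounded integrable kernel maps the Lebesgue space to bounded functions. The name is that of the
  classical inequality for functions of bounded spectrum.\<close>

lemma Nikolskij:
  assumes "1 < r" "Lp_bdd r c g" "Lp_bdd r b (conv (Kb l) g)"
  shows "AE x in lborel. norm (conv (Kb l) g x) \<le> C1 * b"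
proof -
  have ne: "{k. near 2 l k} \<noteq> {}" by (auto simp: near_def intro!: exI[of _ l])
  note p = fourier_pair_kernel[OF fourier_pair_F[OF finite_near ne]]
  show ?thesis
    using conv_near_self[OF assms(1,2), of l]
  proof eventually_elim
    case (elim x)
    then show ?case using conv_bound[OF assms(1) p assms(3), of x] by (simp add: card_near C1_def)
  qed
qed

lemma conv_zero: "conv K (\<lambda>_. 0) x = 0"
  by (simp add: conv_def)

text \<open>The dilates of \<open>Kb 0\<close> are an approximate identity of mass
  \<open>sg 0 0\<close>, and their symbols have compact support. The convolution of \<open>v\<close>
  with such a dilate is reproduced by finitely many boxes; commuting these past the dilate makes
  them act on \<open>v\<close>, where they vanish.\<close>

lemma Lp_zero_of_boxes:
  assumes r: "1 < r" and v: "Lp_bdd r c v" and z: "\<And>l. AE x in lborel. conv (Kb l) v x = 0"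
  shows "AE x in lborel. v x = 0"
proof (rule approx_identity_zero[OF r v, of "Kb 0"])
  show "integrable lborel (Kb 0)" by (rule kernel_bdd_integrable[OF Kb_kernel])
  have "(\<integral>x. Kb 0 x \<partial>lborel) = (\<integral>x. Kb 0 x * cis (- (x \<bullet> 0)) \<partial>lborel)" by simp
  also have "\<dots> = sg 0 0" using fourier_pair_0 unfolding fourier_pair_def by blast
  finally show "(\<integral>x. Kb 0 x \<partial>lborel) \<noteq> 0" using sg_0_pos by simp
  fix m
  define L where "L = real (Suc m)"
  have L: "0 < L" by (simp add: L_def)
  have [measurable]: "v \<in> borel_measurable borel" using v by (simp add: Lp_bdd_def)
  define \<sigma> where "\<sigma> \<xi> = of_real ((1 / L) ^ DIM(real^'n)) * sg 0 (0 + (1 / L) *\<^sub>R \<xi>)" for \<xi>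
  have sm: "smooth_on UNIV \<sigma>" unfolding \<sigma>_def[abs_def] smooth_on_UNIV_iff
    using sg_smooth by (intro allI diff_order_mult diff_order_const diff_order_affine) (auto simp: smooth_on_UNIV_iff)
  have sup: "\<sigma> \<xi> = 0" if "L * real CARD('n) < norm \<xi>" for \<xi>
    using that L sg_bounded_support[of "(1 / L) *\<^sub>R \<xi>"] by (simp add: \<sigma>_def field_simps)
  have csup: "\<sigma> \<xi> = 0" if "\<xi> \<notin> cube 0 L" for \<xi>
  proof -
    have "\<exists>i. L < \<bar>\<xi> $ i\<bar>" using that by (simp add: cube_def not_le)
    then obtain i where "L < \<bar>\<xi> $ i\<bar>" ..
    then have "1 < \<bar>((1 / L) *\<^sub>R \<xi>) $ i\<bar>" using L by (simp add: abs_mult field_simps)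
    then have "(1 / L) *\<^sub>R \<xi> \<notin> cube (lattice_vec 0) 1" unfolding cube_def by (auto simp: not_le intro!: exI[of _ i])
    from sg_support[OF this] show ?thesis by (simp add: \<sigma>_def)
  qed
  define \<kappa> where "\<kappa> x = Kb 0 (L *\<^sub>R x)" for x
  have keq: "\<kappa> x = of_real ((2 * pi) powr (- real DIM(real^'n))) * (\<integral>\<eta>. \<sigma> \<eta> * cis (x \<bullet> \<eta>) \<partial>lborel)" for x
  proof -
    have sgm[measurable]: "sg 0 \<in> borel_measurable borel"
      by (rule borel_measurable_continuous_onI[OF smooth_continuous[OF sg_smooth]])
    have sm'[measurable]: "\<sigma> \<in> borel_measurable borel"
      by (rule borel_measurable_continuous_onI[OF smooth_continuous[OF sm]])
    have "(\<integral>\<eta>. \<sigma> \<eta> * cis (x \<bullet> \<eta>) \<partial>lborel) = \<bar>L\<bar> ^ DIM(real^'n) *\<^sub>R (\<integral>\<eta>. \<sigma> (0 + L *\<^sub>R \<eta>) * cis (x \<bullet> (0 + L *\<^sub>R \<eta>)) \<partial>lborel)"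
      using L by (intro integral_affine_euclidean) auto
    also have "(\<lambda>\<eta>. \<sigma> (0 + L *\<^sub>R \<eta>) * cis (x \<bullet> (0 + L *\<^sub>R \<eta>))) = (\<lambda>\<eta>. of_real ((1 / L) ^ DIM(real^'n)) * (sg 0 \<eta> * cis ((L *\<^sub>R x) \<bullet> \<eta>)))"
      using L by (simp add: \<sigma>_def fun_eq_iff)
    also have "\<bar>L\<bar> ^ DIM(real^'n) *\<^sub>R (\<integral>\<eta>. of_real ((1 / L) ^ DIM(real^'n)) * (sg 0 \<eta> * cis ((L *\<^sub>R x) \<bullet> \<eta>)) \<partial>lborel) = (\<integral>\<eta>. sg 0 \<eta> * cis ((L *\<^sub>R x) \<bullet> \<eta>) \<partial>lborel)"
      using L by (simp only: integral_mult_right_zero) (simp add: scaleR_conv_of_real power_divide)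
    finally show ?thesis by (simp add: \<kappa>_def Kb_def)
  qed
  have "\<kappa> = (\<lambda>x. of_real ((2 * pi) powr (- real DIM(real^'n))) * (\<integral>\<eta>. \<sigma> \<eta> * cis (x \<bullet> \<eta>) \<partial>lborel))"
    by (rule ext) (rule keq)
  then obtain A where p: "fourier_pair A \<sigma> \<kappa>"
    using fourier_pair_smooth[OF sm sup] by auto
  \<comment> \<open>A cube of half-width 1 that meets \<open>cube 0 L\<close> has a centre whose
    coordinates are at most \<open>L + 1\<close> in size.\<close>
  define F where "F = {m :: int^'n. near (\<lceil>L\<rceil> + 1) 0 m}"
  have "0 \<in> F" using L by (simp add: F_def near_def)
  then have F: "finite F" "F \<noteq> {}" by (auto simp: F_def finite_near)
  have "AE x in lborel. conv (\<lambda>x. \<Sum>k\<in>F. Kb k x) (conv \<kappa> v) x = conv \<kappa> v x"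
  proof (rule conv_F_of_spec[OF spec_in_conv[OF r p v csup] F(1) _ F(2)])
    fix \<xi> :: "real^'n" and m assume a: "\<xi> \<in> cube 0 L" "\<xi> \<in> cube (lattice_vec m) 1"
    have "\<bar>(0 :: int^'n) $ i - m $ i\<bar> \<le> \<lceil>L\<rceil> + 1" for i
    proof -
      have "\<bar>\<xi> $ i\<bar> \<le> L" "\<bar>\<xi> $ i - real_of_int (m $ i)\<bar> \<le> 1" using a by (auto simp: cube_def)
      then have "\<bar>real_of_int (m $ i)\<bar> \<le> L + 1" by linarith
      then show ?thesis by simp linarith
    qed
    then show "m \<in> F" by (simp add: F_def near_def)
  qed
  moreover have "conv (\<lambda>x. \<Sum>k\<in>F. Kb k x) (conv \<kappa> v) x = 0" for x
  proof -
    note kF = fourier_pair_kernel[OF fourier_pair_F[OF F]]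
    have km[measurable]: "\<kappa> \<in> borel_measurable borel" by (rule kernel_bdd_measurable[OF fourier_pair_kernel[OF p]])
    have cm: "conv (\<lambda>x. \<Sum>k\<in>F. Kb k x) v \<in> borel_measurable borel" by (rule conv_measurable) measurable
    have "AE x in lborel. \<forall>k\<in>F. conv (Kb k) v x = 0" using z F(1) by (auto simp: AE_finite_all)
    then have "AE x in lborel. conv (\<lambda>x. \<Sum>k\<in>F. Kb k x) v x = 0"
      by eventually_elim (simp add: conv_kernel_sum[OF r Kb_kernel v])
    then have "conv \<kappa> (conv (\<lambda>x. \<Sum>k\<in>F. Kb k x) v) x = conv \<kappa> (\<lambda>_. 0) x"
      by (intro conv_cong_AE km cm) auto
    then show ?thesis
      using conv_commute[OF r kF fourier_pair_kernel[OF p] v, of x] by (simp add: conv_zero)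
  qed
  ultimately have "AE a in lborel. conv \<kappa> v a = 0" by simp
  moreover have "conv \<kappa> v a = (\<integral>x. Kb 0 (L *\<^sub>R (a - x)) * v x \<partial>lborel)" for a
    by (subst conv_alt) (auto simp: \<kappa>_def kernel_bdd_measurable[OF fourier_pair_kernel[OF p]])
  ultimately show "AE a in lborel. (\<integral>x. Kb 0 (real (Suc m) *\<^sub>R (a - x)) * v x \<partial>lborel) = 0" by (simp add: L_def)
qed

text \<open>If the box norms are summable, the series of boxes converges to some \<open>s\<close>.
  Each box of \<open>s\<close> involves only neighbouring terms and equals the same box of
  \<open>u\<close>, so the boxes of \<open>u - s\<close> vanish and \<open>u = s\<close>. The bounds
  of the terms then carry over to \<open>u\<close>.\<close>

lemma synthesis:
  assumes r: "1 < r" and u: "Lp_bdd r c u" and b: "\<And>k. Lp_bdd r (b k) (conv (Kb k) u)"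
    and S: "(\<integral>\<^sup>+k. ennreal (b k) \<partial>count_space UNIV) \<le> ennreal S" "0 < S"
  shows "AE x in lborel. u x = (\<integral>k. conv (Kb k) u x \<partial>count_space UNIV)"
    and "AE x in lborel. norm (u x) \<le> C1 * S"
    and "Lp_bdd r (2 * S) u"
proof -
  have sf: "sigma_finite_measure (count_space (UNIV :: (int^'n) set))"
    by (rule sigma_finite_measure_count_space_countable) auto
  have um[measurable]: "u \<in> borel_measurable borel" using u by (simp add: Lp_bdd_def)
  have cm[measurable]: "conv (Kb k) u \<in> borel_measurable borel" for k by (rule conv_measurable) measurable
  have jm: "(\<lambda>(k, x). conv (Kb k) u x) \<in> borel_measurable (count_space UNIV \<Otimes>\<^sub>M borel)"
    by (rule measurable_pair_measure_countable1) auto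
  have Sfin: "(\<integral>\<^sup>+k. ennreal (b k) \<partial>count_space UNIV) < \<infinity>" using S by (auto intro: le_less_trans)
  define s where "s x = (\<integral>k. conv (Kb k) u x \<partial>count_space UNIV)" for x
  have s: "Lp_bdd r (2 * S) s" unfolding s_def
    by (rule Lp_bdd_integral[OF r S(2) sf jm _ b S(1)]) auto
  have sm[measurable]: "s \<in> borel_measurable borel" using s by (simp add: Lp_bdd_def)
  have box0: "AE x in lborel. conv (Kb l) (\<lambda>x. u x - s x) x = 0" for l
  proof -
    \<comment> \<open>The two kernels are commuted, so that the terms are the neighbours of one box
      of \<open>u\<close>, which reproduce it.\<close>
    have "conv (Kb l) s x = conv (\<lambda>x. \<Sum>k\<in>{k. near 2 l k}. Kb k x) (conv (Kb l) u) x" for x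
    proof -
      have "conv (Kb l) s x = (\<integral>k. conv (Kb l) (conv (Kb k) u) x \<partial>count_space UNIV)"
        unfolding s_def by (rule conv_integral[OF r sf Kb_kernel jm b _ Sfin]) auto
      also have "\<dots> = (\<integral>k. conv (Kb k) (conv (Kb l) u) x \<partial>count_space UNIV)"
        by (intro Bochner_Integration.integral_cong refl conv_commute[OF r Kb_kernel Kb_kernel u])
      also have "\<dots> = (\<Sum>k | k \<in> UNIV \<and> conv (Kb k) (conv (Kb l) u) x \<noteq> 0. conv (Kb k) (conv (Kb l) u) x)"
        by (rule lebesgue_integral_count_space_finite_support)
          (rule finite_subset[OF _ finite_near[of 2 l]], use conv_Kb_Kb_far[OF r u] near_commute in blast)
      also have "\<dots> = (\<Sum>k\<in>{k. near 2 l k}. conv (Kb k) (conv (Kb l) u) x)"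
        by (rule sum.mono_neutral_left[OF finite_near]) (use conv_Kb_Kb_far[OF r u] near_commute in blast)+
      also have "\<dots> = conv (\<lambda>x. \<Sum>k\<in>{k. near 2 l k}. Kb k x) (conv (Kb l) u) x"
        by (rule conv_kernel_sum[OF r Kb_kernel b, symmetric])
      finally show ?thesis .
    qed
    then show ?thesis
      using conv_near_self[OF r u, of l] conv_diff[OF r Kb_kernel u s, of l]
      by (auto elim: eventually_mono)
  qed
  have "AE x in lborel. u x - s x = 0"
    by (rule Lp_zero_of_boxes[OF r Lp_bdd_diff[OF r u s] box0])
  then have us: "AE x in lborel. u x = s x" by (auto elim: eventually_mono)
  then show "AE x in lborel. u x = (\<integral>k. conv (Kb k) u x \<partial>count_space UNIV)" by (simp add: s_def)
  show "Lp_bdd r (2 * S) u" by (rule Lp_bdd_cong_AE[OF s um _ us]) (use r in simp)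
  have "AE x in lborel. \<forall>k. norm (conv (Kb k) u x) \<le> C1 * b k"
    using Nikolskij[OF r u b] by (simp add: AE_all_countable)
  with us show "AE x in lborel. norm (u x) \<le> C1 * S"
  proof eventually_elim
    case (elim x)
    have "ennreal (norm (s x)) \<le> (\<integral>\<^sup>+k. ennreal (norm (conv (Kb k) u x)) \<partial>count_space UNIV)"
      unfolding s_def by (rule norm_integral_le_nn_integral)
    also have "\<dots> \<le> (\<integral>\<^sup>+k. ennreal C1 * ennreal (b k) \<partial>count_space UNIV)"
      using elim C1_pos Lp_bdd_pos[OF b] by (intro nn_integral_mono) (auto simp: ennreal_mult'[symmetric] intro!: ennreal_leI)
    also have "\<dots> \<le> ennreal C1 * ennreal S"
      using S by (subst nn_integral_cmult) (auto intro: mult_left_mono)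
    finally have "ennreal (norm (s x)) \<le> ennreal (C1 * S)" using C1_pos by (simp add: ennreal_mult')
    then show ?case using C1_pos S elim by (subst (asm) ennreal_le_iff) auto
  qed
qed

end

section \<open>Boxes as distributions\<close>

context decomposition
begin

lemma sg_integrable: "integrable lborel (sg k)"
  using fourier_pair_k[of k] by (simp add: fourier_pair_def)

lemma sg_measurable[measurable]: "sg k \<in> borel_measurable borel"
  using sg_integrable[of k] by auto

text \<open>Unfolding the dualities leaves a transform, a symbol and an inverse transform acting on
  the test function; exchanging the integrals collects the symbol and both normalisations into
  \<open>Kb k\<close>.\<close>

lemma freq_box_test:
  assumes phi: "schwartz \<phi>"
  shows "freq_box \<rho> k f \<phi> = (\<integral>y. f y * (\<integral>x. \<phi> x * Kb k (x - y) \<partial>lborel) \<partial>lebesgue)"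
proof -
  obtain A where A: "kernel_bdd A \<phi>" using schwartz_kernel_bdd[OF phi] by blast
  have phi_i: "integrable lborel \<phi>" by (rule kernel_bdd_integrable[OF A])
  have [measurable]: "\<phi> \<in> borel_measurable borel" by (rule kernel_bdd_measurable[OF A])
  define C where "C = complex_of_real ((2 * pi) powr (- real DIM(real^'n) / 2))"
  have CC: "C * C = of_real ((2 * pi) powr (- real DIM(real^'n)))"
    by (simp add: C_def powr_add[symmetric] flip: of_real_mult)
  have inv: "inv_fourier \<phi> \<eta> = C * (\<integral>x. \<phi> x * cis (\<eta> \<bullet> x) \<partial>lborel)" for \<eta>
    unfolding inv_fourier_def C_def by (subst integral_completion) auto
  have four: "fourier (\<lambda>\<xi>. complex_of_real (decomp_sigma \<rho> k \<xi>) * inv_fourier \<phi> \<xi>) y = (\<integral>x. \<phi> x * Kb k (x - y) \<partial>lborel)" for y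
  proof -
    let ?F = "\<lambda>x \<eta>. \<phi> x * (sg k \<eta> * cis ((x - y) \<bullet> \<eta>))"
    have "(\<integral>\<^sup>+x. \<integral>\<^sup>+\<eta>. norm (?F x \<eta>) \<partial>lborel \<partial>lborel) = (\<integral>\<^sup>+x. norm (\<phi> x) \<partial>lborel) * (\<integral>\<^sup>+\<eta>. norm (sg k \<eta>) \<partial>lborel)"
      by (simp add: norm_mult ennreal_mult nn_integral_cmult nn_integral_multc)
    also have "\<dots> < \<infinity>" using phi_i sg_integrable[of k] by (auto simp: integrable_iff_bounded ennreal_mult_less_top)
    finally have fin: "(\<integral>\<^sup>+x. \<integral>\<^sup>+\<eta>. norm (?F x \<eta>) \<partial>lborel \<partial>lborel) < \<infinity>" .
    have "fourier (\<lambda>\<xi>. complex_of_real (decomp_sigma \<rho> k \<xi>) * inv_fourier \<phi> \<xi>) y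
      = C * (\<integral>\<eta>. sg k \<eta> * (C * (\<integral>x. \<phi> x * cis (\<eta> \<bullet> x) \<partial>lborel)) * cis (- (\<eta> \<bullet> y)) \<partial>lborel)"
      unfolding fourier_def C_def[symmetric] inv sg_def[symmetric] by (subst integral_completion) auto
    also have "\<dots> = C * (\<integral>\<eta>. C * (\<integral>x. ?F x \<eta> \<partial>lborel) \<partial>lborel)"
    proof -
      have "sg k \<eta> * (C * (\<integral>x. \<phi> x * cis (\<eta> \<bullet> x) \<partial>lborel)) * cis (- (\<eta> \<bullet> y)) = C * (\<integral>x. ?F x \<eta> \<partial>lborel)" for \<eta>
      proof -
        have "?F x \<eta> = (sg k \<eta> * cis (- (\<eta> \<bullet> y))) * (\<phi> x * cis (\<eta> \<bullet> x))" for x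
        proof -
          have "cis ((x - y) \<bullet> \<eta>) = cis (- (\<eta> \<bullet> y)) * cis (\<eta> \<bullet> x)"
            by (simp add: cis_mult inner_diff_right inner_commute[of _ \<eta>])
          then show ?thesis by (simp only: mult_ac)
        qed
        then have "(\<integral>x. ?F x \<eta> \<partial>lborel) = (sg k \<eta> * cis (- (\<eta> \<bullet> y))) * (\<integral>x. \<phi> x * cis (\<eta> \<bullet> x) \<partial>lborel)"
          by (simp only: integral_mult_right_zero)
        then show ?thesis by (simp only: mult_ac)
      qed
      then show ?thesis by (simp only:)
    qed
    also have "\<dots> = (C * C) * (\<integral>\<eta>. \<integral>x. ?F x \<eta> \<partial>lborel \<partial>lborel)"
      by (simp only: integral_mult_right_zero mult.assoc)
    also have "(\<integral>\<eta>. \<integral>x. ?F x \<eta> \<partial>lborel \<partial>lborel) = (\<integral>x. \<integral>\<eta>. ?F x \<eta> \<partial>lborel \<partial>lborel)"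
      by (rule Fubini_swap(1)[OF sigma_finite_lborel sigma_finite_lborel _ fin, symmetric]) measurable
    also have "(C * C) * \<dots> = (\<integral>x. (C * C) * (\<phi> x * (\<integral>\<eta>. sg k \<eta> * cis ((x - y) \<bullet> \<eta>) \<partial>lborel)) \<partial>lborel)"
      by (simp only: integral_mult_right_zero)
    also have "\<dots> = (\<integral>x. \<phi> x * Kb k (x - y) \<partial>lborel)"
      unfolding CC Kb_def by (simp only: mult_ac)
    finally show ?thesis .
  qed
  show ?thesis
    unfolding freq_box_def distr_inv_fourier_def distr_mult_def distr_fourier_def distr_of_def four ..
qed

lemma test_measurable:
  assumes "\<phi> \<in> borel_measurable borel"
  shows "(\<lambda>y. \<integral>x. \<phi> x * Kb k (x - y) \<partial>lborel) \<in> borel_measurable borel"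
  using assms by measurable

lemma freq_box_cong_AE:
  assumes "schwartz \<phi>" "f \<in> borel_measurable lebesgue" "g \<in> borel_measurable borel" "AE x in lborel. f x = g x"
  shows "freq_box \<rho> k f \<phi> = freq_box \<rho> k g \<phi>"
proof -
  obtain A where A: "kernel_bdd A \<phi>" using schwartz_kernel_bdd[OF assms(1)] by blast
  have m: "(\<lambda>y. \<integral>x. \<phi> x * Kb k (x - y) \<partial>lborel) \<in> borel_measurable lebesgue"
    by (rule measurable_completion) (use test_measurable[OF kernel_bdd_measurable[OF A]] in simp)
  have g: "g \<in> borel_measurable lebesgue" using assms(3) by (simp add: measurable_completion)
  have "AE x in lebesgue. f x = g x" using assms(4) by (rule AE_completion)
  then show ?thesis
    unfolding freq_box_test[OF assms(1)] using m g assms(2)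
    by (intro integral_cong_AE) (auto elim: eventually_mono)
qed

lemma freq_box_eq_conv:
  assumes r: "1 < r" and f: "Lp_bdd r c f" and phi: "schwartz \<phi>"
  shows "freq_box \<rho> k f \<phi> = distr_of (conv (Kb k) f) \<phi>"
proof -
  obtain A where A: "kernel_bdd A \<phi>" using schwartz_kernel_bdd[OF phi] by blast
  have phi_i: "integrable lborel \<phi>" by (rule kernel_bdd_integrable[OF A])
  have [measurable]: "\<phi> \<in> borel_measurable borel" "f \<in> borel_measurable borel"
    using kernel_bdd_measurable[OF A] f by (auto simp: Lp_bdd_def)
  have tm[measurable]: "(\<lambda>y. \<integral>x. \<phi> x * Kb k (x - y) \<partial>lborel) \<in> borel_measurable borel" by (rule test_measurable) measurable
  have cm[measurable]: "conv (Kb k) f \<in> borel_measurable borel" by (rule conv_measurable) measurable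
  have "(\<integral>\<^sup>+x. \<integral>\<^sup>+y. norm (\<phi> x * (Kb k (x - y) * f y)) \<partial>lborel \<partial>lborel) \<le> (\<integral>\<^sup>+x. norm (\<phi> x) * ennreal (2 * A0 * c) \<partial>lborel)"
  proof (rule nn_integral_mono)
    fix x
    have "(\<integral>\<^sup>+y. norm (\<phi> x * (Kb k (x - y) * f y)) \<partial>lborel) = norm (\<phi> x) * (\<integral>\<^sup>+y. norm (Kb k (x - y) * f y) \<partial>lborel)"
      by (simp add: norm_mult[of "\<phi> x"] ennreal_mult nn_integral_cmult)
    also have "\<dots> \<le> norm (\<phi> x) * ennreal (2 * A0 * c)"
      using nn_conv_le[OF r Kb_kernel f] by (intro mult_left_mono) auto
    finally show "(\<integral>\<^sup>+y. norm (\<phi> x * (Kb k (x - y) * f y)) \<partial>lborel) \<le> norm (\<phi> x) * ennreal (2 * A0 * c)" .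
  qed
  also have "\<dots> < \<infinity>" using phi_i by (auto simp: nn_integral_multc integrable_iff_bounded ennreal_mult_less_top)
  finally have fin: "(\<integral>\<^sup>+x. \<integral>\<^sup>+y. norm (\<phi> x * (Kb k (x - y) * f y)) \<partial>lborel \<partial>lborel) < \<infinity>" .
  have "freq_box \<rho> k f \<phi> = (\<integral>y. f y * (\<integral>x. \<phi> x * Kb k (x - y) \<partial>lborel) \<partial>lborel)"
    unfolding freq_box_test[OF phi] by (subst integral_completion) auto
  also have "\<dots> = (\<integral>y. \<integral>x. \<phi> x * (Kb k (x - y) * f y) \<partial>lborel \<partial>lborel)"
    by (simp only: mult.commute[of "f _"] integral_mult_left_zero[symmetric] mult.assoc)
  also have "\<dots> = (\<integral>x. \<integral>y. \<phi> x * (Kb k (x - y) * f y) \<partial>lborel \<partial>lborel)"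
    by (rule Fubini_swap(1)[OF sigma_finite_lborel sigma_finite_lborel _ fin, symmetric]) measurable
  also have "\<dots> = (\<integral>x. conv (Kb k) f x * \<phi> x \<partial>lborel)"
    by (subst conv_alt) (auto simp: mult.commute)
  also have "\<dots> = distr_of (conv (Kb k) f) \<phi>"
    unfolding distr_of_def by (subst integral_completion) auto
  finally show ?thesis .
qed

lemma bump_schwartz: "schwartz (\<lambda>x. complex_of_real (\<rho> (L *\<^sub>R (a - x))))" if "0 < L"
proof (rule schwartz_compact_support[of _ "cball a (real CARD('n) / L)"])
  have "diff_order m (\<lambda>x. complex_of_real (\<rho> (L *\<^sub>R a + (- L) *\<^sub>R x)))" for m
    using diff_order_affine[OF diff_order_of_real[OF rho_diff_order], of m "L *\<^sub>R a" "- L"] by simp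
  then show "smooth_on UNIV (\<lambda>x. complex_of_real (\<rho> (L *\<^sub>R (a - x))))"
    unfolding smooth_on_UNIV_iff by (simp add: scaleR_diff_right)
  fix x assume "x \<notin> cball a (real CARD('n) / L)"
  then have "real CARD('n) < L * norm (a - x)"
    using that by (simp add: dist_norm not_le divide_less_eq mult.commute)
  then have "real CARD('n) < norm (L *\<^sub>R (a - x))" using that by (simp only: norm_scaleR abs_of_pos)
  then have "L *\<^sub>R (a - x) \<notin> cube 0 1" using norm_le_of_cube[of "L *\<^sub>R (a - x)" 1] by auto
  then show "complex_of_real (\<rho> (L *\<^sub>R (a - x))) = 0"
    using rho_support[of "L *\<^sub>R (a - x)" 0] by (auto simp: lattice_vec_0)
qed auto

text \<open>Dilated, translated and reflected bumps are Schwartz functions, so the pairings include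
  those with an approximate identity.\<close>

lemma distr_determines:
  fixes g h :: "real^'n \<Rightarrow> complex"
  assumes r: "1 < r" and g: "Lp_bdd r c g" and h: "Lp_bdd r d h"
    and eq: "\<And>\<phi>. schwartz \<phi> \<Longrightarrow> distr_of g \<phi> = distr_of h \<phi>"
  shows "AE x in lborel. g x = h x"
proof -
  have [measurable]: "g \<in> borel_measurable borel" "h \<in> borel_measurable borel" using g h by (auto simp: Lp_bdd_def)
  define \<kappa> where "\<kappa> x = complex_of_real (\<rho> x)" for x
  have sch: "schwartz \<kappa>" using bump_schwartz[of 1 0] schwartz_compact_support[of \<kappa> "cube 0 1"]
  proof -
    have s: "smooth_on UNIV \<kappa>" unfolding smooth_on_UNIV_iff \<kappa>_def[abs_def]
      by (intro allI diff_order_of_real rho_diff_order)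
    show ?thesis
    proof (rule schwartz_compact_support[OF s])
      show "compact (cball (0::real^'n) (real CARD('n)))" by simp
      fix x :: "real^'n" assume "x \<notin> cball 0 (real CARD('n))"
      then have "x \<notin> cube 0 1" using norm_le_of_cube[of x 1] by auto
      then show "\<kappa> x = 0" using rho_support[of x 0] by (auto simp: \<kappa>_def)
    qed
  qed
  obtain A where A: "kernel_bdd A \<kappa>" using schwartz_kernel_bdd[OF sch] by blast
  have km[measurable]: "\<kappa> \<in> borel_measurable borel" by (rule kernel_bdd_measurable[OF A])
  have ki: "integrable lborel \<kappa>" by (rule kernel_bdd_integrable[OF A])
  have k0: "(\<integral>x. \<kappa> x \<partial>lborel) \<noteq> 0"
  proof
    assume "(\<integral>x. \<kappa> x \<partial>lborel) = 0"
    then have z: "(\<integral>x. \<rho> x \<partial>lborel) = 0" by (simp add: \<kappa>_def)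
    have ri: "integrable lborel \<rho>" using ki by (simp add: \<kappa>_def[abs_def] complex_of_real_integrable_eq)
    then have "AE x in lborel. \<rho> x = 0" using z rho_nonneg integral_nonneg_eq_0_iff_AE[OF ri] by auto
    \<comment> \<open>The bump equals 1 on a cube of side 1, so it cannot vanish almost
      everywhere.\<close>
    then have "AE x in lborel. x \<notin> box (- (1/2) *\<^sub>R One) ((1/2) *\<^sub>R One :: real^'n)"
    proof eventually_elim
      case (elim x)
      show ?case
      proof
        assume "x \<in> box (- (1/2) *\<^sub>R One) ((1/2) *\<^sub>R One)"
        then have "\<forall>b\<in>Basis. - (1/2) < x \<bullet> b \<and> x \<bullet> b < 1/2" by (simp add: mem_box)
        then have "- (1/2) < x \<bullet> axis i 1 \<and> x \<bullet> axis i 1 < 1/2" for i by simp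
        then have "- (1/2) < x $ i \<and> x $ i < 1/2" for i by (simp add: inner_axis)
        then have "\<bar>x $ i\<bar> \<le> 1/2" for i by (smt (verit))
        then show False using elim bump by (auto simp: decomp_bump_def)
      qed
    qed
    then have "emeasure lborel (box (- (1/2) *\<^sub>R One) ((1/2) *\<^sub>R One :: real^'n)) = 0"
      by (subst (asm) AE_iff_null_sets[symmetric]) auto
    then show False by (subst (asm) emeasure_lborel_box) (auto simp: inner_diff_left algebra_simps)
  qed
  have "AE x in lborel. g x - h x = 0"
  proof (rule approx_identity_zero[OF r Lp_bdd_diff[OF r g h] ki k0], rule AE_I2)
    fix m a
    let ?\<phi> = "\<lambda>x. \<kappa> (real (Suc m) *\<^sub>R (a - x))"
    have s: "schwartz ?\<phi>" unfolding \<kappa>_def by (rule bump_schwartz) simp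
    obtain B where B: "kernel_bdd B ?\<phi>" using schwartz_kernel_bdd[OF s] by blast
    \<comment> \<open>The pairing is a convolution at the point 0 with the reflected test function,
      which makes it integrable.\<close>
    have "kernel_bdd B (\<lambda>x. K (0 - x))" if "kernel_bdd B K" for K :: "real^'n \<Rightarrow> complex"
      using that nn_integral_reflect[of "\<lambda>x. ennreal (norm (K x))" 0] by (auto simp: kernel_bdd_def)
    from this[OF B] have B': "kernel_bdd B (\<lambda>x. ?\<phi> (0 - x))" .
    have i: "integrable lborel (\<lambda>y. ?\<phi> y * g y)" "integrable lborel (\<lambda>y. ?\<phi> y * h y)"
      using conv_integrable[OF r B' g, of 0] conv_integrable[OF r B' h, of 0] by simp_all
    have "(\<integral>x. g x * ?\<phi> x \<partial>lborel) = (\<integral>x. h x * ?\<phi> x \<partial>lborel)"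
      using eq[OF s] unfolding distr_of_def by (subst (asm) (1 2) integral_completion) auto
    then show "(\<integral>x. ?\<phi> x * (g x - h x) \<partial>lborel) = 0"
      using i by (simp add: left_diff_distrib mult.commute del: of_nat_Suc)
  qed
  then show ?thesis by (auto elim: eventually_mono)
qed

text \<open>Any function representing the distribution agrees almost everywhere with the
  convolution, so the infimum in \<open>distr_Lp_norm\<close> is taken over a single value. The
  Borel function \<open>f\<close> stands in for the Lebesgue measurable \<open>u\<close>.\<close>

lemma distr_Lp_norm_freq_box:
  assumes p: "1 < p" "p < \<infinity>" and r: "1 < enn2real p" and u: "u \<in> borel_measurable lebesgue"
    and f: "Lp_bdd (enn2real p) c f" and uf: "AE x in lborel. u x = f x"
  shows "distr_Lp_norm p (freq_box \<rho> k u) = Lp_norm p (conv (Kb k) f)"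
proof -
  let ?r = "enn2real p"
  have fm[measurable]: "f \<in> borel_measurable borel" using f by (simp add: Lp_bdd_def)
  have cm[measurable]: "conv (Kb k) f \<in> borel_measurable borel" by (rule conv_measurable) measurable
  have cL: "Lp_bdd ?r (2 * (A0 * c)) (conv (Kb k) f)" by (rule Lp_bdd_conv[OF r Kb_kernel f])
  have cn: "Lp_norm p (conv (Kb k) f) < \<infinity>"
    using cL Lp_norm_le_iff[OF p cm Lp_bdd_pos[OF cL]] by (auto intro: le_less_trans)
  have fb: "freq_box \<rho> k u \<phi> = distr_of (conv (Kb k) f) \<phi>" if "schwartz \<phi>" for \<phi>
    using freq_box_cong_AE[OF that u fm uf] freq_box_eq_conv[OF r f that] by simp
  have all: "Lp_norm p g = Lp_norm p (conv (Kb k) f)"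
    if g: "g \<in> Lp_space p" "\<forall>\<phi>. schwartz \<phi> \<longrightarrow> distr_of g \<phi> = freq_box \<rho> k u \<phi>" for g
  proof -
    have gm: "g \<in> borel_measurable lebesgue" using g by (simp add: Lp_space_def)
    then obtain g' where g'm: "g' \<in> borel_measurable lborel" and gg: "AE x in lborel. g x = g' x"
      using completion_ex_borel_measurable_complex by blast
    have g'm'[measurable]: "g' \<in> borel_measurable borel" using g'm by simp
    have n: "Lp_norm p g = Lp_norm p g'" by (rule Lp_norm_cong_AE[OF p(2) gg])
    then obtain d where d: "Lp_bdd ?r d g'"
      using Lp_norm_finite_imp_bdd[OF p g'm'] g by (auto simp: Lp_space_def)
    have "AE x in lborel. g' x = conv (Kb k) f x"
    proof (rule distr_determines[OF r d cL])
      fix \<phi> :: "real^'n \<Rightarrow> complex" assume s: "schwartz \<phi>"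
      have "\<phi> \<in> borel_measurable borel"
        using s smooth_continuous by (auto simp: schwartz_def intro: borel_measurable_continuous_onI)
      then have pm: "\<phi> \<in> borel_measurable lebesgue" "g' \<in> borel_measurable lebesgue" by (auto simp: measurable_completion)
      have "AE x in lebesgue. g x = g' x" using gg by (rule AE_completion)
      then have "distr_of g' \<phi> = distr_of g \<phi>"
        unfolding distr_of_def using gm pm by (intro integral_cong_AE) (auto elim: eventually_mono)
      then show "distr_of g' \<phi> = distr_of (conv (Kb k) f) \<phi>" using g(2) s fb by simp
    qed
    then show ?thesis using n Lp_norm_cong_AE[OF p(2)] by metis
  qed
  let ?G = "{g \<in> Lp_space p. \<forall>\<phi>. schwartz \<phi> \<longrightarrow> distr_of g \<phi> = freq_box \<rho> k u \<phi>}"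
  have "conv (Kb k) f \<in> ?G" using cn fb by (auto simp: Lp_space_def measurable_completion)
  then have "Lp_norm p ` ?G = {Lp_norm p (conv (Kb k) f)}" using all by blast
  then show ?thesis unfolding distr_Lp_norm_def by simp
qed

end

section \<open>Slowly varying weights and moderate sequences\<close>

text \<open>A Potter bound: each division of \<open>x\<close> by \<open>a\<close> costs the factor
  \<open>b\<close>, which is exactly the change of \<open>(x / y) powr g\<close>. The additional
  factor \<open>b\<close> pays for the last, incomplete step.\<close>

lemma doubling_growth:
  fixes w :: "real \<Rightarrow> real"
  assumes mono: "\<And>x y. 0 \<le> x \<Longrightarrow> x \<le> y \<Longrightarrow> w x \<le> w y" and pos: "\<And>x. 0 \<le> x \<Longrightarrow> 0 < w x"
    and a: "1 < a" and ab: "a powr g = b" and g: "0 \<le> g"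
    and T: "0 < T" "\<And>t. T \<le> t \<Longrightarrow> w (a * t) \<le> b * w t"
    and y: "T \<le> y" "y \<le> x"
  shows "w x \<le> b * (x / y) powr g * w y"
proof -
  have y0: "0 < y" using T y by linarith
  have b0: "0 < b" using a ab by auto
  have "y \<le> x \<Longrightarrow> x \<le> a ^ j * y \<Longrightarrow> w x \<le> b * (x / y) powr g * w y" for j x
  proof (induction j arbitrary: x)
    case (Suc j)
    show ?case
    proof (cases "x \<le> a * y")
      case True
      have "w x \<le> w (a * y)" using True Suc.prems y0 by (intro mono) auto
      also have "\<dots> \<le> b * w y" using T(2)[OF y(1)] .
      also have "\<dots> = b * 1 * w y" by simp
      also have "\<dots> \<le> b * (x / y) powr g * w y"
        using Suc.prems y0 b0 pos[of y] g by (intro mult_right_mono mult_left_mono ge_one_powr_ge_zero) auto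
      finally show ?thesis .
    next
      case False
      then have x: "y \<le> x / a" "x / a \<le> a ^ j * y" using Suc.prems a by (auto simp: field_simps)
      have "w x = w (a * (x / a))" using a by simp
      also have "\<dots> \<le> b * w (x / a)" using x y by (intro T(2)) linarith
      also have "\<dots> \<le> b * (b * ((x / a) / y) powr g * w y)" using Suc.IH[OF x] b0 by (intro mult_left_mono) auto
      also have "((x / a) / y) powr g = (x / y) powr g / b"
      proof -
        have "(x / a) / y = (x / y) / a" by simp
        then show ?thesis using a y0 Suc.prems by (simp only: powr_divide[of "x / y" a] ab)
      qed
      finally show ?thesis using b0 by simp
    qed
  next
    case 0
    then have "x = y" by simp
    have "1 \<le> b" using a ab g by (metis ge_one_powr_ge_zero less_imp_le)
    then show ?case using \<open>x = y\<close> y0 pos[of y] by simp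
  qed
  moreover obtain j where "x / y < a ^ j" using real_arch_pow[OF a] by blast
  then have "x \<le> a ^ j * y" using y0 by (simp add: field_simps)
  ultimately show ?thesis using y by blast
qed

locale slow_weight =
  fixes w :: "real \<Rightarrow> real"
  assumes W0: "w \<in> weights_W0"
begin

lemma w_ge_1: "0 \<le> x \<Longrightarrow> 1 \<le> w x"
  using W0 by (simp add: weights_W0_def weights_W_def)

lemma w_mono: "0 \<le> x \<Longrightarrow> x \<le> y \<Longrightarrow> w x \<le> w y"
proof -
  assume xy: "0 \<le> x" "x \<le> y"
  have "strict_mono_on {0..} w" using W0 by (simp add: weights_W0_def weights_W_def)
  then have "mono_on {0..} w" by (rule strict_mono_on_imp_mono_on)
  then show ?thesis using xy by (auto simp: mono_on_def)
qed

lemma w_slow: "0 < x \<Longrightarrow> ((\<lambda>t. w (t * x) / w t) \<longlongrightarrow> 1) at_top"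
  using W0 by (auto simp: weights_W0_def slowly_varying_def regularly_varying_def)

lemma w_scaled_le:
  assumes "0 < x" "1 < b"
  shows "\<exists>T\<ge>1. \<forall>t\<ge>T. w (x * t) \<le> b * w t"
proof -
  have "eventually (\<lambda>t. w (t * x) / w t < b) at_top" using w_slow[OF assms(1)] assms(2) by (rule order_tendstoD)
  then obtain T where T: "\<And>t. T \<le> t \<Longrightarrow> w (t * x) / w t < b" by (auto simp: eventually_at_top_linorder)
  have "w (x * t) \<le> b * w t" if "max 1 T \<le> t" for t
    using T[of t] w_ge_1[of t] that by (simp add: divide_less_eq mult.commute)
  then show ?thesis by (intro exI[of _ "max 1 T"]) auto
qed

lemma w_derivs:
  assumes "0 < x"
  shows "(w has_real_derivative deriv w x) (at x)" "deriv w differentiable at x"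
proof -
  have s: "smooth_on {0<..} w" using W0 by (simp add: weights_W0_def weights_W_def)
  have d: "w differentiable at y" if "0 < y" for y
    using s that unfolding smooth_on_def by (auto dest!: conjunct2 spec[of _ "[]"] simp: iter_deriv_def)
  then have D: "(w has_real_derivative deriv w y) (at y)" if "0 < y" for y
    using that by (meson DERIV_deriv_iff_real_differentiable)
  then show "(w has_real_derivative deriv w x) (at x)" using assms by blast
  have "dir_deriv 1 w y = deriv w y" if "0 < y" for y
    using dir_deriv_eqI[OF D[OF that, unfolded has_field_derivative_def], of 1] by simp
  moreover have "iter_deriv [1] w differentiable at x"
    using s assms unfolding smooth_on_def by (auto dest!: conjunct2 spec[of _ "[1]"])
  then have "dir_deriv 1 w differentiable at x" by (simp add: iter_deriv_def)
  ultimately show "deriv w differentiable at x"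
    using assms by (intro dir_deriv_cong_open(2)[of "{0<..}" x "deriv w" "dir_deriv 1 w"]) auto
qed

lemma deriv_w_antimono: "\<exists>\<tau>>0. \<forall>x y. \<tau> < x \<longrightarrow> x \<le> y \<longrightarrow> deriv w y \<le> deriv w x"
proof -
  obtain \<tau> where t: "\<And>x. 0 < x \<Longrightarrow> \<tau> < x \<Longrightarrow> deriv (deriv w) x < 0"
    using W0 by (auto simp: weights_W0_def weights_W_def)
  have "deriv w y \<le> deriv w x" if "max 1 \<tau> < x" "x \<le> y" for x y
  proof (rule DERIV_nonpos_imp_nonincreasing[OF that(2)])
    fix z assume z: "x \<le> z" "z \<le> y"
    have "(deriv w has_real_derivative deriv (deriv w) z) (at z)"
      using w_derivs(2)[of z] z that by (simp add: DERIV_deriv_iff_real_differentiable)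
    moreover have "deriv (deriv w) z \<le> 0" using t[of z] z that by simp
    ultimately show "\<exists>d. (deriv w has_real_derivative d) (at z) \<and> d \<le> 0" by blast
  qed
  then show ?thesis by (intro exI[of _ "max 1 \<tau>"]) auto
qed

text \<open>For large arguments \<open>w\<close> is concave, so its slope beyond \<open>x\<close> is
  at most its mean slope on \<open>[x / 2, x]\<close>, and slow variation makes that slope a small
  multiple of \<open>w x / x\<close>. Since \<open>w\<close> grows at most linearly between
  \<open>y\<close> and \<open>x\<close>, \<open>y * w x / x\<close> is at most
  \<open>2 * w y\<close>.\<close>

lemma w_add_le:
  assumes d: "0 < \<delta>"
  shows "\<exists>C\<ge>0. \<forall>x y. 0 \<le> y \<longrightarrow> y \<le> x \<longrightarrow> w (x + y) \<le> w x + \<delta> * w y + C"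
proof -
  \<comment> \<open>The final coefficient is \<open>4 * e\<close>: a factor 2 from the half interval
    and a factor 2 from the growth comparison.\<close>
  define e where "e = min 1 (\<delta> / 4)"
  have e: "0 < e" "e \<le> 1" "4 * e \<le> \<delta>" using d by (auto simp: e_def)
  obtain T0 where T0: "T0 \<ge> 1" "\<And>t. T0 \<le> t \<Longrightarrow> w (2 * t) \<le> (1 + e) * w t"
    using w_scaled_le[of 2 "1 + e"] e by auto
  obtain \<tau> where tau: "\<tau> > 0" "\<And>x y. \<tau> < x \<Longrightarrow> x \<le> y \<Longrightarrow> deriv w y \<le> deriv w x" using deriv_w_antimono by blast
  define T where "T = max T0 (\<tau> + 1)"
  have T: "1 \<le> T" "\<tau> < T" "\<And>t. T \<le> t \<Longrightarrow> w (2 * t) \<le> (1 + e) * w t" using T0 tau by (auto simp: T_def)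
  have T2: "w (2 * t) \<le> 2 * w t" if "T \<le> t" for t
  proof -
    have "w (2 * t) \<le> (1 + e) * w t" using T(3)[OF that] .
    also have "\<dots> \<le> 2 * w t" using e w_ge_1[of t] T that by (intro mult_right_mono) auto
    finally show ?thesis .
  qed
  have ratio: "w x * y \<le> 2 * w y * x" if "T \<le> y" "y \<le> x" for x y
  proof -
    have "w x \<le> 2 * (x / y) powr 1 * w y"
      using T that w_ge_1 T2 by (intro doubling_growth[where a=2 and T=T] w_mono) (auto intro: less_le_trans[of 0 1])
    then show ?thesis using T that by (simp add: field_simps)
  qed
  \<comment> \<open>The mean value theorem on both sides of \<open>x\<close>; monotonicity of the
    derivative compares the two slopes.\<close>
  have main: "w (x + y) \<le> w x + 2 * e * (y * w x / x)" if x: "2 * T \<le> x" and y: "0 < y" for x y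
  proof -
    have "\<exists>z. x < z \<and> z < x + y \<and> w (x + y) - w x = (x + y - x) * deriv w z"
      using x y T by (intro MVT2 w_derivs(1)) auto
    then obtain z where z: "x < z" "w (x + y) - w x = y * deriv w z" by auto
    have "\<exists>z. x / 2 < z \<and> z < x \<and> w x - w (x / 2) = (x - x / 2) * deriv w z"
      using x T by (intro MVT2 w_derivs(1)) auto
    then obtain z' where z': "x / 2 < z'" "z' < x" "w x - w (x / 2) = x / 2 * deriv w z'" by auto
    have x0: "0 < x" using x T by linarith
    have "deriv w z \<le> deriv w z'" using z z' T x by (intro tau(2)) auto
    then have "w (x + y) - w x \<le> y * deriv w z'" using z y by (simp add: mult_left_mono)
    also have "deriv w z' = 2 / x * (w x - w (x / 2))" using z'(3) x0 by (simp add: field_simps)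
    also have "y * (2 / x * (w x - w (x / 2))) \<le> y * (2 / x * (e * w x))"
    proof -
      have "w x \<le> (1 + e) * w (x / 2)" using T(3)[of "x / 2"] x by simp
      moreover have "e * w (x / 2) \<le> e * w x" using e x0 by (intro mult_left_mono w_mono) auto
      ultimately have "w x - w (x / 2) \<le> e * w x" by (simp add: algebra_simps)
      then show ?thesis using y x0 by (intro mult_left_mono) auto
    qed
    finally show ?thesis by (simp add: field_simps)
  qed
  \<comment> \<open>The first term covers \<open>x < 2 * T\<close>, where the sum stays below
    \<open>4 * T\<close>; the second covers a large \<open>x\<close> with
    \<open>y < T\<close>.\<close>
  define C where "C = w (4 * T) + 4 * w T"
  have wT: "1 \<le> w T" "1 \<le> w (4 * T)" using T by (auto intro!: w_ge_1)
  show ?thesis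
  proof (intro exI[of _ C] conjI allI impI)
    show "0 \<le> C" using wT by (simp add: C_def)
    fix x y :: real assume y: "0 \<le> y" "y \<le> x"
    have wy: "1 \<le> w y" "1 \<le> w x" using y by (auto intro!: w_ge_1)
    have dw: "0 \<le> \<delta> * w y" using d wy by simp
    consider "x < 2 * T" | "2 * T \<le> x" "y = 0" | "2 * T \<le> x" "0 < y" "y < T" | "2 * T \<le> x" "T \<le> y" using y by force
    then show "w (x + y) \<le> w x + \<delta> * w y + C"
    proof cases
      case 1
      then have "w (x + y) \<le> w (4 * T)" using y by (intro w_mono) auto
      then show ?thesis using dw wT wy by (simp add: C_def)
    next
      case 2
      then show ?thesis using dw wT by (simp add: C_def)
    next
      case 3
      have x0: "0 < x" using 3 T by linarith
      have "y * w x \<le> T * w x" using 3 wy by (intro mult_right_mono) auto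
      also have "\<dots> \<le> 2 * w T * x" using ratio[of T x] 3 T by (simp add: mult.commute)
      finally have "y * w x / x \<le> 2 * w T" using x0 by (simp add: divide_le_eq)
      then have "2 * e * (y * w x / x) \<le> 2 * 1 * (2 * w T)" using e wT x0 wy 3 by (intro mult_mono) auto
      then show ?thesis using main[of x y] 3 dw wT by (simp add: C_def)
    next
      case 4
      have x0: "0 < x" "0 < y" using 4 T by linarith+
      have "y * w x / x \<le> 2 * w y" using ratio[of y x] 4 y x0 by (simp add: divide_le_eq mult.commute)
      then have "2 * e * (y * w x / x) \<le> 2 * e * (2 * w y)" using e by (intro mult_left_mono) auto
      also have "\<dots> \<le> \<delta> * w y" using e(3) wy by simp
      finally show ?thesis using main[of x y] 4 x0 wT by (simp add: C_def)
    qed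
  qed
qed

lemma w_shift_le:
  assumes c: "0 \<le> c"
  shows "\<exists>C\<ge>0. \<forall>x\<ge>0. w (x + c) \<le> w x + C"
proof -
  obtain C where C: "C \<ge> 0" "\<And>x y. 0 \<le> y \<Longrightarrow> y \<le> x \<Longrightarrow> w (x + y) \<le> w x + 1 * w y + C" using w_add_le[of 1] by auto
  have wc: "1 \<le> w c" "1 \<le> w (2 * c)" using c by (auto intro!: w_ge_1)
  show ?thesis
  proof (intro exI[of _ "w (2 * c) + w c + C"] conjI allI impI)
    show "0 \<le> w (2 * c) + w c + C" using wc C by simp
    fix x :: real assume x: "0 \<le> x"
    show "w (x + c) \<le> w x + (w (2 * c) + w c + C)"
    proof (cases "c \<le> x")
      case True
      then show ?thesis using C(2)[of c x] c wc by simp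
    next
      case False
      then have "w (x + c) \<le> w (2 * c)" using x c by (intro w_mono) auto
      then show ?thesis using w_ge_1[OF x] wc C by simp
    qed
  qed
qed

text \<open>The Potter bound even gives growth of order 1/4. The square root is then larger by a
  full power of \<open>s\<close>, and any coefficient in front of it can be made small at the cost
  of a constant.\<close>

lemma w_le_sqrt:
  assumes d: "0 < \<delta>"
  shows "\<exists>C\<ge>0. \<forall>t\<ge>0. w t \<le> \<delta> * sqrt t + C"
proof -
  obtain T where T: "T \<ge> 1" "\<And>t. T \<le> t \<Longrightarrow> w (16 * t) \<le> 2 * w t"
    using w_scaled_le[of 16 2] by auto
  \<comment> \<open>Scale 16 and factor 2 are chosen to produce the exponent 1/4.\<close>
  have "(16::real) powr (1/4) = (2 powr 4) powr (1/4)" by simp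
  also have "\<dots> = 2" by (simp only: powr_powr) simp
  finally have p16: "(16::real) powr (1/4) = 2" .
  have wT: "1 \<le> w T" using T by (intro w_ge_1) auto
  define K where "K = 2 * w T"
  have K: "0 < K" using wT by (simp add: K_def)
  have "w t \<le> \<delta> * sqrt t + (K * K / \<delta> + w T)" if t: "0 \<le> t" for t
  proof (cases "T \<le> t")
    case True
    define s where "s = t powr (1/4)"
    have s2: "s\<^sup>2 = sqrt t" using t True T by (simp add: s_def powr_half_sqrt[symmetric] powr_powr powr_realpow[symmetric])
    have "w t \<le> 2 * (t / T) powr (1/4) * w T"
      using T True w_ge_1 by (intro doubling_growth[where a=16 and T=T] w_mono p16) (auto intro: less_le_trans[of 0 1])
    also have "\<dots> \<le> 2 * s * w T"
      using T t wT unfolding s_def by (intro mult_right_mono mult_left_mono powr_mono2) (auto simp: divide_le_eq mult_le_cancel_left1)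
    also have "\<dots> = K * s" by (simp add: K_def)
    also have "K * s \<le> \<delta> * s\<^sup>2 + K * K / \<delta>"
    proof -
      \<comment> \<open>Expanding leaves \<open>- K * \<delta> * s\<close> as the mixed term, which
        gives the inequality after division by \<delta>.\<close>
      have "0 \<le> (\<delta> * s - K)\<^sup>2 + K * \<delta> * s" using K d by (simp add: s_def)
      then have "K * s * \<delta> \<le> (\<delta> * s\<^sup>2 + K * K / \<delta>) * \<delta>" using d by (simp add: power2_eq_square algebra_simps)
      then show ?thesis using d mult_le_cancel_right_pos by blast
    qed
    finally show ?thesis using s2 wT by simp
  next
    case False
    then have "w t \<le> w T" using t by (intro w_mono) auto
    moreover have "0 \<le> \<delta> * sqrt t" "0 \<le> K * K / \<delta>" using d K t by auto
    ultimately show ?thesis by linarith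
  qed
  moreover have "0 \<le> K * K / \<delta> + w T" using K d wT by simp
  ultimately show ?thesis by blast
qed

text \<open>By (A4) the weight exceeds every multiple of the logarithm, so an arbitrarily small
  multiple of it pays for any polynomial factor.\<close>

lemma power_le_exp_w:
  assumes d: "0 < \<delta>"
  shows "\<exists>C\<ge>1. \<forall>t\<ge>0. (1 + t) powr M \<le> C * exp (\<delta> * w t)"
proof -
  define M' where "M' = max M 0"
  have "filterlim (\<lambda>t. w t - M' / \<delta> * ln t) at_top at_top"
  proof -
    have "\<forall>M. filterlim (\<lambda>t. w t - M * ln t) at_top at_top"
      using W0 by (simp add: weights_W0_def weights_W_def)
    then show ?thesis by (rule spec)
  qed
  then have "eventually (\<lambda>t. w t - M' / \<delta> * ln t \<ge> 0) at_top"
    unfolding filterlim_at_top by blast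
  then obtain T0 where T0: "\<And>t. T0 \<le> t \<Longrightarrow> w t - M' / \<delta> * ln t \<ge> 0" by (auto simp: eventually_at_top_linorder)
  define T where "T = max 1 T0"
  define C where "C = max 1 (max (2 powr M') ((1 + T) powr M'))"
  have "(1 + t) powr M \<le> C * exp (\<delta> * w t)" if t: "0 \<le> t" for t
  proof -
    have "(1 + t) powr M \<le> (1 + t) powr M'" using t by (intro powr_mono) (auto simp: M'_def)
    also have "\<dots> \<le> C * exp (\<delta> * w t)"
    proof (cases "T \<le> t")
      case True
      then have t1: "1 \<le> t" by (simp add: T_def)
      have "(1 + t) powr M' \<le> (2 * t) powr M'" using t1 by (intro powr_mono2) (auto simp: M'_def)
      also have "\<dots> = 2 powr M' * exp (M' * ln t)" using t1 by (simp add: powr_mult powr_def[of t])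
      also have "M' * ln t \<le> \<delta> * w t" using T0[of t] True d by (simp add: T_def field_simps)
      finally have "(1 + t) powr M' \<le> 2 powr M' * exp (\<delta> * w t)" by simp
      also have "\<dots> \<le> C * exp (\<delta> * w t)" by (intro mult_right_mono) (auto simp: C_def)
      finally show ?thesis .
    next
      case False
      have "(1 + t) powr M' \<le> (1 + T) powr M'" using False t by (intro powr_mono2) (auto simp: M'_def)
      also have "\<dots> \<le> C * 1" by (simp add: C_def)
      also have "\<dots> \<le> C * exp (\<delta> * w t)" using w_ge_1[OF t] d by (intro mult_left_mono) (auto simp: C_def)
      finally show ?thesis .
    qed
    finally show ?thesis .
  qed
  moreover have "1 \<le> C" by (simp add: C_def)
  ultimately show ?thesis by blast
qed

end

section \<open>Moderate sequences on the lattice\<close>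

text \<open>A form of the Japanese bracket that is submultiplicative without a constant.\<close>

definition jb :: "int^'n \<Rightarrow> real" where
  "jb k = 1 + norm (lattice_vec k)"

lemma jb_ge_1: "1 \<le> jb k"
  by (simp add: jb_def)

lemma jb_pos: "0 < jb k"
  using jb_ge_1[of k] by linarith

lemma jb_0[simp]: "jb 0 = 1"
  by (simp add: jb_def)

lemma lattice_vec_minus: "lattice_vec (- k) = - lattice_vec k"
  by (simp add: vec_eq_iff)

lemma jb_minus[simp]: "jb (- k) = jb k"
  by (simp add: jb_def lattice_vec_minus)

lemma jb_add: "jb (k + m) \<le> jb k * jb m"
proof -
  have "jb (k + m) \<le> 1 + (norm (lattice_vec k) + norm (lattice_vec m))"
    unfolding jb_def lattice_vec_add using norm_triangle_ineq by simp
  also have "\<dots> \<le> jb k * jb m" by (simp add: jb_def algebra_simps)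
  finally show ?thesis .
qed

text \<open>The exponent provides one square for each coordinate, so that the sum over the lattice
  is bounded by a product of one-dimensional sums.\<close>

definition lw :: "int^'n \<Rightarrow> real" where
  "lw k = 1 / jb k ^ (2 * CARD('n))"

lemma lw_pos: "0 < lw k"
  by (simp add: lw_def jb_pos)

lemma lw_le_1: "lw k \<le> 1"
  using jb_ge_1[of k] by (simp add: lw_def divide_le_eq)

lemma lw_0[simp]: "lw 0 = 1"
  by (simp add: lw_def)

lemma lw_add_le: "lw (k + j) \<le> jb j ^ (2 * CARD('n)) * lw (k :: int^'n)"
proof -
  have "jb k = jb ((k + j) + (- j))" by simp
  also have "\<dots> \<le> jb (k + j) * jb (- j)" by (rule jb_add)
  finally have "jb k ^ (2 * CARD('n)) \<le> (jb (k + j) * jb j) ^ (2 * CARD('n))"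
    using jb_pos[of k] by (intro power_mono) auto
  then show ?thesis using jb_pos[of k] jb_pos[of "k + j"] by (simp add: lw_def field_simps power_mult_distrib)
qed

text \<open>Two new terms enter at each step, and each is at most
  \<open>1 / (1 + R) - 1 / (2 + R)\<close>, so the bound telescopes.\<close>

lemma sum_inverse_squares: "(\<Sum>j\<in>{- int R..int R}. 1 / (1 + \<bar>real_of_int j\<bar>)\<^sup>2) \<le> 3 - 2 / (1 + real R)"
proof (induction R)
  case (Suc R)
  have eq: "{- int (Suc R)..int (Suc R)} = insert (- int (Suc R)) (insert (int (Suc R)) {- int R..int R})" by auto
  have "(\<Sum>j\<in>{- int (Suc R)..int (Suc R)}. 1 / (1 + \<bar>real_of_int j\<bar>)\<^sup>2)
    = 2 * (1 / (2 + real R)\<^sup>2) + (\<Sum>j\<in>{- int R..int R}. 1 / (1 + \<bar>real_of_int j\<bar>)\<^sup>2)"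
    unfolding eq by (subst sum.insert, simp, simp, subst sum.insert) (auto simp: algebra_simps)
  also have "\<dots> \<le> 2 * (1 / (2 + real R)\<^sup>2) + (3 - 2 / (1 + real R))" using Suc by simp
  also have "1 / (2 + real R)\<^sup>2 \<le> 1 / ((1 + real R) * (2 + real R))"
    by (intro divide_left_mono) (auto simp: power2_eq_square)
  also have "1 / ((1 + real R) * (2 + real R)) = 1 / (1 + real R) - 1 / (2 + real R)"
    by (simp add: diff_frac_eq)
  also have "2 * (1 / (1 + real R) - 1 / (2 + real R)) + (3 - 2 / (1 + real R)) = 3 - 2 / (2 + real R)"
    by (simp add: algebra_simps)
  finally show ?case by simp
qed auto

lemma near_0_iff: "near s 0 k \<longleftrightarrow> (\<forall>i. - s \<le> k $ i \<and> k $ i \<le> s)"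
proof -
  have "\<bar>0 - j\<bar> \<le> s \<longleftrightarrow> - s \<le> j \<and> j \<le> s" for j :: int by linarith
  then show ?thesis by (simp add: near_def)
qed

lemma sum_lw_box: "(\<Sum>k\<in>{k :: int^'n. near (int R) 0 k}. lw k) \<le> 3 ^ CARD('n)"
proof -
  let ?g = "\<lambda>j. 1 / (1 + \<bar>real_of_int j\<bar>)\<^sup>2"
  have le: "lw k \<le> (\<Prod>i\<in>UNIV. ?g (k $ i))" for k :: "int^'n"
  proof -
    have "(\<Prod>i\<in>UNIV. (1 + \<bar>real_of_int (k $ i)\<bar>)\<^sup>2) \<le> (\<Prod>i\<in>(UNIV::'n set). (jb k)\<^sup>2)"
      using component_le_norm_cart[of "lattice_vec k"] by (intro prod_mono power_mono conjI) (auto simp: jb_def intro!: power_mono)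
    also have "\<dots> = jb k ^ (2 * CARD('n))" by (simp add: power_mult)
    finally have "1 / jb k ^ (2 * CARD('n)) \<le> 1 / (\<Prod>i\<in>UNIV. (1 + \<bar>real_of_int (k $ i)\<bar>)\<^sup>2)"
      using jb_pos[of k] by (intro divide_left_mono mult_pos_pos prod_pos) auto
    then show ?thesis by (simp add: lw_def prod_dividef)
  qed
  have "(\<Sum>k\<in>{k :: int^'n. near (int R) 0 k}. lw k) \<le> (\<Sum>k\<in>{k :: int^'n. near (int R) 0 k}. \<Prod>i\<in>UNIV. ?g (k $ i))"
    by (intro sum_mono le)
  also have "\<dots> = (\<Sum>h\<in>PiE UNIV (\<lambda>_::'n. {- int R..int R}). \<Prod>i\<in>UNIV. ?g (h i))"
    by (rule sum.reindex_bij_witness[of _ vec_lambda vec_nth]) (auto simp: near_0_iff PiE_iff)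
  also have "\<dots> = (\<Prod>i\<in>(UNIV::'n set). \<Sum>j\<in>{- int R..int R}. ?g j)"
    by (rule prod_sum_PiE[symmetric]) auto
  also have "\<dots> \<le> (\<Prod>i\<in>(UNIV::'n set). 3)"
  proof (intro prod_mono conjI)
    show "0 \<le> (\<Sum>j\<in>{- int R..int R}. ?g j)" by (intro sum_nonneg) auto
    have "0 \<le> 2 / (1 + real R)" by simp
    then show "(\<Sum>j\<in>{- int R..int R}. ?g j) \<le> 3" using sum_inverse_squares[of R] by linarith
  qed
  finally show ?thesis by simp
qed

lemma nn_sum_lw: "(\<integral>\<^sup>+k. ennreal (lw k) \<partial>count_space (UNIV :: (int^'n) set)) \<le> ennreal (3 ^ CARD('n))"
proof -
  let ?B = "\<lambda>R. {k :: int^'n. near (int R) 0 k}"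
  have un: "\<exists>R. k \<in> ?B R" for k :: "int^'n"
  proof -
    have "\<bar>k $ i\<bar> \<le> Max (range (\<lambda>i. \<bar>k $ i\<bar>))" for i by (intro Max_ge) auto
    then have "\<bar>k $ i\<bar> \<le> int (nat (Max (range (\<lambda>i. \<bar>k $ i\<bar>))))" for i by (smt (verit) int_nat_eq)
    then show ?thesis by (intro exI[of _ "nat (Max (range (\<lambda>i. \<bar>k $ i\<bar>)))"]) (simp add: near_def)
  qed
  have "(\<integral>\<^sup>+k. ennreal (lw k) \<partial>count_space (UNIV :: (int^'n) set)) = (\<integral>\<^sup>+k. (SUP R. ennreal (lw k) * indicator (?B R) k) \<partial>count_space UNIV)"
  proof (intro nn_integral_cong)
    fix k :: "int^'n"
    obtain R where R: "k \<in> ?B R" using un by blast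
    show "ennreal (lw k) = (SUP R. ennreal (lw k) * indicator (?B R) k)"
    proof (rule antisym)
      show "ennreal (lw k) \<le> (SUP R. ennreal (lw k) * indicator (?B R) k)"
        using R by (intro SUP_upper2[of R]) auto
      show "(SUP R. ennreal (lw k) * indicator (?B R) k) \<le> ennreal (lw k)"
        by (intro SUP_least) (auto simp: indicator_def)
    qed
  qed
  also have "\<dots> = (SUP R. \<integral>\<^sup>+k. ennreal (lw k) * indicator (?B R) k \<partial>count_space UNIV)"
  proof (rule nn_integral_monotone_convergence_SUP)
    show "incseq (\<lambda>R k. ennreal (lw k) * indicator (?B R) k)"
    proof (rule incseq_SucI, rule le_funI)
      fix R and k :: "int^'n"
      show "ennreal (lw k) * indicator (?B R) k \<le> ennreal (lw k) * indicator (?B (Suc R)) k"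
        by (intro mult_left_mono) (auto simp: indicator_def near_def intro: order_trans)
    qed
  qed auto
  also have "\<dots> \<le> ennreal (3 ^ CARD('n))"
  proof (rule SUP_least)
    fix R
    have "(\<integral>\<^sup>+k. ennreal (lw k) * indicator (?B R) k \<partial>count_space UNIV) = (\<Sum>k\<in>?B R. ennreal (lw k))"
      by (subst nn_integral_count_space_indicator[symmetric]) (auto simp: nn_integral_count_space_finite finite_near)
    also have "\<dots> = ennreal (\<Sum>k\<in>?B R. lw k)" by (intro sum_ennreal) (auto intro: less_imp_le lw_pos)
    also have "\<dots> \<le> ennreal (3 ^ CARD('n))" by (intro ennreal_leI sum_lw_box)
    finally show "(\<integral>\<^sup>+k. ennreal (lw k) * indicator (?B R) k \<partial>count_space UNIV) \<le> ennreal (3 ^ CARD('n))" .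
  qed
  finally show ?thesis .
qed

text \<open>Since \<open>j\<close> may have any sign, a moderate sequence changes at most
  polynomially in both directions. The exponent is the one of \<open>lw\<close>.\<close>

definition moderate :: "(int^'n \<Rightarrow> real) \<Rightarrow> bool" where
  "moderate \<alpha> \<longleftrightarrow> (\<forall>k. 0 < \<alpha> k) \<and> (\<forall>k j. \<alpha> (k + j) \<le> jb j ^ (2 * CARD('n)) * \<alpha> k)"

text \<open>Smearing \<open>a\<^sup>q\<close> by the polynomial tail \<open>lw\<close> gives a majorant that is invariant under the
  convolution with rapidly decaying sequences, up to constants, and still lies in \<open>l\<^sup>q\<close>.\<close>

lemma moderate_majorant:
  fixes a :: "int^'n \<Rightarrow> real"
  assumes q: "1 \<le> q" and a: "\<And>k. 0 \<le> a k" and fin: "(\<integral>\<^sup>+k. ennreal (a k powr q) \<partial>count_space UNIV) < \<infinity>"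
  shows "\<exists>\<alpha> B. moderate \<alpha> \<and> (\<forall>k. a k \<le> \<alpha> k) \<and> (\<forall>k. \<alpha> k \<le> B) \<and> (\<integral>\<^sup>+k. ennreal (\<alpha> k powr q) \<partial>count_space UNIV) < \<infinity>"
proof -
  \<comment> \<open>The unit mass at 0 keeps the majorant positive even if \<open>a\<close> vanishes
    identically.\<close>
  define b where "b m = a m powr q + (if m = 0 then 1 else 0)" for m
  have b0: "0 \<le> b m" for m by (simp add: b_def)
  have "(\<integral>\<^sup>+m. ennreal (if m = 0 then 1 else 0) \<partial>count_space (UNIV :: (int^'n) set)) = 1"
    by (subst nn_integral_count_space'[where A="{0}"]) auto
  then have bfin: "(\<integral>\<^sup>+m. ennreal (b m) \<partial>count_space UNIV) < \<infinity>"
    using fin by (simp add: b_def nn_integral_add)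
  define T where "T l = (\<integral>\<^sup>+m. ennreal (b m * lw (l - m)) \<partial>count_space UNIV)" for l
  have Tle: "T l \<le> (\<integral>\<^sup>+m. ennreal (b m) \<partial>count_space UNIV)" for l
    unfolding T_def using b0 lw_le_1 by (intro nn_integral_mono ennreal_leI) (auto intro: mult_left_le)
  have Tfin: "T l < \<infinity>" for l using Tle bfin by (rule le_less_trans)
  have Tterm: "ennreal (b m * lw (l - m)) \<le> T l" for l m
    unfolding T_def by (rule nn_integral_ge_point) simp
  define \<alpha> where "\<alpha> l = enn2real (T l) powr (1 / q)" for l
  have eT: "b m * lw (l - m) \<le> enn2real (T l)" for l m
    using Tterm[of m l] Tfin[of l] b0 lw_pos[of "l - m"] by (subst (asm) ennreal_enn2real[symmetric]) (auto simp: less_imp_le)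
  have Tpos: "0 < enn2real (T l)" for l
  proof -
    have "0 < b 0 * lw (l - 0)" by (simp add: b_def lw_pos add_nonneg_pos)
    then show ?thesis using eT[of 0 l] by linarith
  qed
  have apow: "\<alpha> l powr q = enn2real (T l)" for l using q Tpos[of l] by (simp add: \<alpha>_def powr_powr)
  have "moderate \<alpha>"
    unfolding moderate_def
  proof (intro conjI allI)
    fix k j :: "int^'n"
    show "0 < \<alpha> k" using Tpos[of k] by (simp add: \<alpha>_def)
    let ?J = "jb j ^ (2 * CARD('n))"
    have J: "1 \<le> ?J" using jb_ge_1 by (rule one_le_power)
    have "T (k + j) \<le> (\<integral>\<^sup>+m. ennreal ?J * ennreal (b m * lw (k - m)) \<partial>count_space UNIV)"
      unfolding T_def
    proof (intro nn_integral_mono)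
      fix m
      have "lw (k + j - m) \<le> ?J * lw (k - m)" using lw_add_le[of "k - m" j] by (simp add: algebra_simps)
      then have "b m * lw (k + j - m) \<le> ?J * (b m * lw (k - m))" using mult_left_mono[OF _ b0[of m]] by (simp add: mult.left_commute)
      then show "ennreal (b m * lw (k + j - m)) \<le> ennreal ?J * ennreal (b m * lw (k - m))"
        using J by (subst ennreal_mult'[symmetric]) (auto intro: ennreal_leI)
    qed
    also have "\<dots> = ennreal ?J * T k" unfolding T_def by (rule nn_integral_cmult) simp
    finally have "enn2real (T (k + j)) \<le> enn2real (ennreal ?J * T k)"
      using Tfin by (intro enn2real_mono) (auto simp: ennreal_mult_less_top)
    then have "enn2real (T (k + j)) \<le> ?J * enn2real (T k)" using J by (simp add: enn2real_mult)
    then have "\<alpha> (k + j) \<le> (?J * enn2real (T k)) powr (1 / q)" unfolding \<alpha>_def using q by (intro powr_mono2) auto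
    also have "\<dots> = ?J powr (1 / q) * \<alpha> k" using J by (simp add: \<alpha>_def powr_mult)
    \<comment> \<open>Both \<open>?J \<ge> 1\<close> and \<open>q \<ge> 1\<close> enter here: taking
      the root only improves the factor.\<close>
    also have "?J powr (1 / q) \<le> ?J powr 1" using J q by (intro powr_mono) auto
    finally show "\<alpha> (k + j) \<le> ?J * \<alpha> k" using J by (simp add: \<alpha>_def mult_right_mono)
  qed
  moreover have "a k \<le> \<alpha> k" for k
  proof -
    have "a k powr q \<le> enn2real (T k)" using eT[of k k] by (simp add: b_def split: if_splits)
    then have "(a k powr q) powr (1 / q) \<le> \<alpha> k" unfolding \<alpha>_def using q by (intro powr_mono2) auto
    then show ?thesis using q a[of k] by (simp add: powr_powr)
  qed
  moreover have "\<alpha> k \<le> enn2real (\<integral>\<^sup>+m. ennreal (b m) \<partial>count_space UNIV) powr (1 / q)" for k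
    unfolding \<alpha>_def using q Tle bfin by (intro powr_mono2 enn2real_mono) auto
  moreover have "(\<integral>\<^sup>+k. ennreal (\<alpha> k powr q) \<partial>count_space UNIV) < \<infinity>"
  proof -
    have sf: "sigma_finite_measure (count_space (UNIV :: (int^'n) set))"
      by (rule sigma_finite_measure_count_space_countable) auto
    interpret P: pair_sigma_finite "count_space (UNIV :: (int^'n) set)" "count_space (UNIV :: (int^'n) set)"
      using sf by (simp add: pair_sigma_finite_def)
    have shift: "(\<integral>\<^sup>+l. ennreal (lw (l - m)) \<partial>count_space UNIV) = (\<integral>\<^sup>+l. ennreal (lw (l :: int^'n)) \<partial>count_space UNIV)" for m :: "int^'n"
      by (rule nn_integral_bij_count_space[where f="\<lambda>l. ennreal (lw l)" and g="\<lambda>l. l - m"])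
        (rule o_bij[of "\<lambda>l. l + m"], auto simp: fun_eq_iff)
    \<comment> \<open>The q-th powers were smeared before the root was taken, so this is a
      convolution of two summable sequences.\<close>
    have "(\<integral>\<^sup>+k. ennreal (\<alpha> k powr q) \<partial>count_space UNIV) = (\<integral>\<^sup>+l. T l \<partial>count_space UNIV)"
      using Tfin by (simp add: apow)
    also have "\<dots> = (\<integral>\<^sup>+m. \<integral>\<^sup>+l. ennreal (b m * lw (l - m)) \<partial>count_space UNIV \<partial>count_space UNIV)"
      unfolding T_def by (rule P.Fubini') (auto simp: sets_pair_countable measurable_def)
    also have "\<dots> = (\<integral>\<^sup>+m. ennreal (b m) * (\<integral>\<^sup>+l. ennreal (lw (l :: int^'n)) \<partial>count_space UNIV) \<partial>count_space UNIV)"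
      using b0 by (simp add: ennreal_mult' nn_integral_cmult shift)
    also have "\<dots> = (\<integral>\<^sup>+m. ennreal (b m) \<partial>count_space UNIV) * (\<integral>\<^sup>+l. ennreal (lw (l :: int^'n)) \<partial>count_space UNIV)"
      by (rule nn_integral_multc) simp
    also have "\<dots> < \<infinity>"
      using bfin nn_sum_lw[where 'n='n] by (auto simp: ennreal_mult_less_top intro: le_less_trans)
    finally show ?thesis .
  qed
  ultimately show ?thesis by blast
qed

lemma moderate_const: "0 < c \<Longrightarrow> moderate (\<lambda>_. c)"
  unfolding moderate_def using one_le_power[OF jb_ge_1] by (auto simp: mult_le_cancel_right1)

text \<open>The polynomial lower bound is what later allows box bounds that do not mention \<alpha>
  to be charged to it.\<close>

lemma moderate_ge_lw:
  fixes \<alpha> :: "int^'n \<Rightarrow> real"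
  shows "moderate \<alpha> \<Longrightarrow> \<alpha> 0 * lw k \<le> \<alpha> k"
proof -
  assume "moderate \<alpha>"
  then have "\<alpha> (k + (- k)) \<le> jb (- k) ^ (2 * CARD('n)) * \<alpha> k" unfolding moderate_def by blast
  then show ?thesis using jb_pos[of k] by (simp add: lw_def field_simps)
qed

section \<open>Functions with weighted box bounds\<close>

lemma Lp_bdd_zero: "0 < c \<Longrightarrow> Lp_bdd r c (\<lambda>_. 0)"
  by (simp add: Lp_bdd_def)

lemma nn_sum_exp:
  assumes "0 \<le> z"
  shows "(\<integral>\<^sup>+j. ennreal (z ^ j / fact j) \<partial>count_space UNIV) = ennreal (exp z)"
proof -
  have s: "(\<lambda>j. z ^ j / fact j) sums exp z" using exp_converges[of z] by (simp add: field_simps)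
  have "(\<integral>\<^sup>+j. ennreal (z ^ j / fact j) \<partial>count_space UNIV) = (\<Sum>j. ennreal (z ^ j / fact j))"
    by (rule nn_integral_count_space_nat)
  also have "\<dots> = ennreal (\<Sum>j. z ^ j / fact j)"
    using assms sums_summable[OF s] by (intro suminf_ennreal2) auto
  finally show ?thesis using s by (simp add: sums_iff)
qed

text \<open>The sequence \<alpha> belongs to one function \<open>u\<close> and stays fixed: all
  products and exponentials formed from \<open>u\<close> are measured against it.\<close>

locale modulation_setting = decomposition \<rho> + slow_weight w
  for \<rho> :: "real^'n \<Rightarrow> real" and w :: "real \<Rightarrow> real" +
  fixes r :: real and \<alpha> :: "int^'n \<Rightarrow> real"
  assumes r: "1 < r" and mod: "moderate \<alpha>"
begin

definition wl :: "int^'n \<Rightarrow> real" where "wl k = w (norm (lattice_vec k))"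

lemma wl_ge_1: "1 \<le> wl k"
  unfolding wl_def by (rule w_ge_1) simp

lemma alpha_pos: "0 < \<alpha> k"
  using mod by (simp add: moderate_def)

lemma lattice_power_le:
  assumes "0 < \<delta>"
  shows "\<exists>C\<ge>1. \<forall>k::int^'n. jb k ^ M \<le> C * exp (\<delta> * wl k)"
proof -
  obtain C where C: "C \<ge> 1" "\<And>t. 0 \<le> t \<Longrightarrow> (1 + t) powr real M \<le> C * exp (\<delta> * w t)"
    using power_le_exp_w[OF assms, of "real M"] by blast
  have "jb k ^ M \<le> C * exp (\<delta> * wl k)" for k :: "int^'n"
    using C(2)[of "norm (lattice_vec k)"] jb_pos[of k] by (simp add: wl_def powr_realpow jb_def)
  then show ?thesis using C(1) by blast
qed

lemma norm_lattice_near: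
  assumes "near s l (k :: int^'n)" "0 \<le> s"
  shows "norm (lattice_vec l) \<le> norm (lattice_vec k) + real CARD('n) * real_of_int s"
proof -
  have "lattice_vec l - lattice_vec k \<in> cube 0 (real_of_int s)"
    using assms(1) unfolding cube_def near_def
    by (auto simp: abs_le_iff simp flip: of_int_diff of_int_minus)
  then have "norm (lattice_vec l - lattice_vec k) \<le> real CARD('n) * real_of_int s" by (rule norm_le_of_cube)
  then show ?thesis using norm_triangle_sub[of "lattice_vec l" "lattice_vec k"] by linarith
qed

lemma wl_add_le:
  assumes "0 < \<delta>"
  shows "\<exists>C\<ge>0. \<forall>k m l. near 3 l (k + m) \<longrightarrow> norm (lattice_vec m) \<le> norm (lattice_vec k) \<longrightarrow> wl l \<le> wl k + \<delta> * wl m + C"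
proof -
  obtain C where C: "C \<ge> 0" "\<And>x y. 0 \<le> y \<Longrightarrow> y \<le> x \<Longrightarrow> w (x + y) \<le> w x + \<delta> * w y + C"
    using w_add_le[OF assms] by blast
  let ?c = "real CARD('n) * 3"
  obtain D where D: "D \<ge> 0" "\<And>x. 0 \<le> x \<Longrightarrow> w (x + ?c) \<le> w x + D"
    using w_shift_le[of ?c] by auto
  have "wl l \<le> wl k + \<delta> * wl m + (C + D)"
    if l: "near 3 l (k + m)" and km: "norm (lattice_vec m) \<le> norm (lattice_vec k)" for k m l
  proof -
    have "norm (lattice_vec l) \<le> norm (lattice_vec (k + m)) + ?c" using norm_lattice_near[OF l] by simp
    also have "norm (lattice_vec (k + m)) \<le> norm (lattice_vec k) + norm (lattice_vec m)"
      unfolding lattice_vec_add by (rule norm_triangle_ineq)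
    finally have "wl l \<le> w (norm (lattice_vec k) + norm (lattice_vec m) + ?c)"
      unfolding wl_def by (intro w_mono) auto
    also have "\<dots> \<le> w (norm (lattice_vec k) + norm (lattice_vec m)) + D" by (intro D(2)) auto
    also have "w (norm (lattice_vec k) + norm (lattice_vec m)) \<le> wl k + \<delta> * wl m + C"
      unfolding wl_def using km by (intro C(2)) auto
    finally show ?thesis by simp
  qed
  then show ?thesis using C(1) D(1) by (intro exI[of _ "C + D"]) auto
qed

text \<open>Taking a quarter as the small coefficient, the sum of the two frequencies costs the full
  weight of the larger one and a quarter of that of the smaller one. A quarter of the half weight
  paid by \<open>m\<close> is then left over as \<open>exp (- wl m / 4)\<close>; it moves \<alpha>
  from \<open>k\<close> to \<open>l\<close> and still leaves the summable
  \<open>lw m\<close>.\<close>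

lemma weighted_pair:
  "\<exists>C>0. \<forall>k m l. near 3 l (k + m) \<longrightarrow> norm (lattice_vec m) \<le> norm (lattice_vec k) \<longrightarrow>
     exp (- wl k) * \<alpha> k * exp (- wl m / 2) \<le> C * (exp (- wl l) * \<alpha> l) * lw m \<and>
     exp (- wl k / 2) * exp (- wl m / 2) \<le> C * exp (- wl l / 2) * lw m"
proof -
  let ?N = "2 * CARD('n)"
  obtain C where C: "C \<ge> 0" "\<And>k m l. near 3 l (k + m) \<Longrightarrow> norm (lattice_vec m) \<le> norm (lattice_vec k) \<Longrightarrow> wl l \<le> wl k + (1/4) * wl m + C"
    using wl_add_le[of "1/4"] by auto
  \<comment> \<open>Two factors \<open>jb m ^ ?N\<close> must be absorbed: one from moving \<alpha>,
    one from \<open>lw m\<close>.\<close>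
  obtain D where D: "D \<ge> 1" "\<And>k::int^'n. jb k ^ (2 * ?N) \<le> D * exp (1/4 * wl k)"
    using lattice_power_le[of "1/4" "2 * ?N"] by auto
  let ?c = "1 + real CARD('n) * 3"
  define E where "E = exp C * ?c ^ ?N * D"
  have E: "0 < E" using D by (simp add: E_def add_pos_nonneg)
  have cN: "1 \<le> ?c ^ ?N" by (rule one_le_power) simp
  have lwD: "exp (- (1/4) * wl m) \<le> D * lw m" "exp (- (1/4) * wl m) * jb m ^ ?N \<le> D * lw m" for m :: "int^'n"
  proof -
    have j: "1 \<le> jb m ^ ?N" by (rule one_le_power[OF jb_ge_1])
    have "jb m ^ ?N * jb m ^ ?N \<le> D * exp (1/4 * wl m)" using D(2)[of m] by (simp add: power_add[symmetric])
    then show 2: "exp (- (1/4) * wl m) * jb m ^ ?N \<le> D * lw m"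
      using jb_pos[of m] by (simp add: lw_def exp_minus field_simps)
    have "exp (- (1/4) * wl m) * 1 \<le> exp (- (1/4) * wl m) * jb m ^ ?N" using j by (intro mult_left_mono) auto
    then show "exp (- (1/4) * wl m) \<le> D * lw m" using 2 unfolding mult_1_right by linarith
  qed
  show ?thesis
  proof (intro exI[of _ E] conjI allI impI E)
    fix k m l :: "int^'n"
    assume l: "near 3 l (k + m)" and km: "norm (lattice_vec m) \<le> norm (lattice_vec k)"
    have W: "wl l \<le> wl k + (1/4) * wl m + C" by (rule C(2)[OF l km])
    have "\<alpha> k = \<alpha> (l + (k - l))" by simp
    also have "\<dots> \<le> jb (k - l) ^ ?N * \<alpha> l" using mod unfolding moderate_def by blast
    also have "jb (k - l) ^ ?N \<le> (?c * jb m) ^ ?N"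
    proof (rule power_mono)
      have "near 3 (l - k) m" using l by (auto simp: near_def algebra_simps)
      then have "norm (lattice_vec (l - k)) \<le> norm (lattice_vec m) + real CARD('n) * 3" using norm_lattice_near[of 3 "l - k" m] by simp
      moreover have "jb (k - l) = jb (l - k)" using jb_minus[of "l - k"] by simp
      ultimately show "jb (k - l) \<le> ?c * jb m" by (simp add: jb_def algebra_simps) (smt (verit) mult_nonneg_nonneg norm_ge_zero of_nat_0_le_iff)
    qed (use jb_pos[of "k - l"] in simp)
    finally have a: "\<alpha> k \<le> ?c ^ ?N * jb m ^ ?N * \<alpha> l" using alpha_pos[of l] by (simp add: power_mult_distrib mult_right_mono)
    have "exp (- wl k) * exp (- wl m / 2) \<le> exp (C - wl l) * exp (- (1/4) * wl m)"
      using W by (simp flip: exp_add)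
    then have "(exp (- wl k) * exp (- wl m / 2)) * \<alpha> k \<le> (exp (C - wl l) * exp (- (1/4) * wl m)) * (?c ^ ?N * jb m ^ ?N * \<alpha> l)"
      using alpha_pos[of k] by (intro mult_mono[OF _ a]) (auto simp: less_imp_le)
    also have "\<dots> = exp C * ?c ^ ?N * (exp (- wl l) * \<alpha> l) * (exp (- (1/4) * wl m) * jb m ^ ?N)"
      by (simp add: exp_diff exp_minus field_simps)
    also have "\<dots> \<le> exp C * ?c ^ ?N * (exp (- wl l) * \<alpha> l) * (D * lw m)"
      using alpha_pos[of l] by (intro mult_left_mono lwD) auto
    finally show "exp (- wl k) * \<alpha> k * exp (- wl m / 2) \<le> E * (exp (- wl l) * \<alpha> l) * lw m"
      by (simp add: E_def mult_ac)
    have "exp (- wl k / 2) * exp (- wl m / 2) \<le> exp (C / 2 - wl l / 2) * exp (- (3/8) * wl m)"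
      using W by (simp flip: exp_add)
    also have "\<dots> \<le> exp (C - wl l / 2) * exp (- (1/4) * wl m)"
      using C(1) wl_ge_1[of m] by (intro mult_mono) auto
    also have "\<dots> \<le> exp (C - wl l / 2) * (D * lw m)" by (intro mult_left_mono lwD) auto
    also have "exp (C - wl l / 2) = exp C * 1 * exp (- wl l / 2)" by (simp flip: exp_add)
    also have "exp C * 1 * exp (- wl l / 2) * (D * lw m) \<le> exp C * ?c ^ ?N * exp (- wl l / 2) * (D * lw m)"
      using cN D(1) lw_pos[of m] by (intro mult_right_mono mult_left_mono) (auto simp: less_imp_le)
    finally show "exp (- wl k / 2) * exp (- wl m / 2) \<le> E * exp (- wl l / 2) * lw m"
      by (simp add: E_def mult_ac)
  qed
qed

lemma exp_half_sum: "\<exists>S>0. (\<integral>\<^sup>+k. ennreal (exp (- wl k / 2)) \<partial>count_space UNIV) \<le> ennreal S"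
proof -
  obtain D where D: "D \<ge> 1" "\<And>k::int^'n. jb k ^ (2 * CARD('n)) \<le> D * exp (1/2 * wl k)"
    using lattice_power_le[of "1/2" "2 * CARD('n)"] by auto
  have "exp (- wl k / 2) \<le> D * lw k" for k :: "int^'n"
    using D(2)[of k] jb_pos[of k] by (simp add: lw_def exp_minus field_simps)
  then have "(\<integral>\<^sup>+k. ennreal (exp (- wl k / 2)) \<partial>count_space UNIV) \<le> (\<integral>\<^sup>+k. ennreal D * ennreal (lw (k :: int^'n)) \<partial>count_space UNIV)"
    using D(1) by (intro nn_integral_mono) (auto simp: ennreal_mult'[symmetric] intro: ennreal_leI)
  also have "\<dots> \<le> ennreal D * ennreal (3 ^ CARD('n))"
    using nn_sum_lw[where 'n='n] by (subst nn_integral_cmult) (auto intro: mult_left_mono)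
  also have "\<dots> = ennreal (D * 3 ^ CARD('n))" using D(1) by (simp add: ennreal_mult')
  finally show ?thesis using D(1) by (intro exI[of _ "D * 3 ^ CARD('n)"]) auto
qed

text \<open>\<open>X\<close> bounds the boxes in the full weight. The bound \<open>Y\<close> in the square root of the weight
  controls the sup norm; by slow variation products obey \<open>(X, Y) (X', Y') = C (X Y' + X' Y, Y Y')\<close>.
  Hence a power series in \<open>g\<close> grows only with \<open>Y\<close>.\<close>

definition mod_bdd :: "real \<Rightarrow> real \<Rightarrow> (real^'n \<Rightarrow> complex) \<Rightarrow> bool" where
  "mod_bdd X Y g \<longleftrightarrow> 0 < X \<and> 0 < Y \<and> (\<exists>c. Lp_bdd r c g) \<and>
     (\<forall>l. Lp_bdd r (X * (exp (- wl l) * \<alpha> l)) (conv (Kb l) g)) \<and>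
     (\<forall>l. Lp_bdd r (Y * exp (- wl l / 2)) (conv (Kb l) g))"

lemma mod_bdd_mono: "mod_bdd X Y g \<Longrightarrow> X \<le> X' \<Longrightarrow> Y \<le> Y' \<Longrightarrow> mod_bdd X' Y' g"
  unfolding mod_bdd_def using r alpha_pos
  by (auto intro: Lp_bdd_mono mult_right_mono simp: less_imp_le)

lemma mod_bdd_measurable: "mod_bdd X Y g \<Longrightarrow> g \<in> borel_measurable borel"
  by (auto simp: mod_bdd_def Lp_bdd_def)

lemma mod_bdd_add:
  assumes "mod_bdd X Y g" "mod_bdd X' Y' h"
  shows "mod_bdd (2 * (X + X')) (2 * (Y + Y')) (\<lambda>x. g x + h x)"
proof -
  obtain c d where c: "Lp_bdd r c g" and d: "Lp_bdd r d h" using assms by (auto simp: mod_bdd_def)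
  have eq: "conv (Kb l) (\<lambda>x. g x + h x) = (\<lambda>x. conv (Kb l) g x + conv (Kb l) h x)" for l
    by (rule ext) (rule conv_add[OF r Kb_kernel c d])
  have 1: "Lp_bdd r (2 * (X * (exp (- wl l) * \<alpha> l) + X' * (exp (- wl l) * \<alpha> l))) (conv (Kb l) (\<lambda>x. g x + h x))" for l
    unfolding eq using assms by (intro Lp_bdd_add[OF r]) (auto simp: mod_bdd_def)
  have 2: "Lp_bdd r (2 * (Y * exp (- wl l / 2) + Y' * exp (- wl l / 2))) (conv (Kb l) (\<lambda>x. g x + h x))" for l
    unfolding eq using assms by (intro Lp_bdd_add[OF r]) (auto simp: mod_bdd_def)
  show ?thesis
    using assms 1 2 Lp_bdd_add[OF r c d] unfolding mod_bdd_def by (auto simp: algebra_simps)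
qed

text \<open>Already the half weight makes the box bounds summable, so synthesis applies and its
  constant involves only \<open>Y\<close>.\<close>

lemma mod_bdd_sup: "\<exists>C>0. \<forall>X Y g. mod_bdd X Y g \<longrightarrow> (AE x in lborel. norm (g x) \<le> C * Y) \<and> Lp_bdd r (C * Y) g"
proof -
  obtain S where S: "S > 0" "(\<integral>\<^sup>+k. ennreal (exp (- wl k / 2)) \<partial>count_space UNIV) \<le> ennreal S"
    using exp_half_sum by blast
  have "(AE x in lborel. norm (g x) \<le> (C1 + 2) * S * Y) \<and> Lp_bdd r ((C1 + 2) * S * Y) g" if g: "mod_bdd X Y g" for X Y g
  proof -
    have Y: "0 < Y" using g by (simp add: mod_bdd_def)
    obtain c where c: "Lp_bdd r c g" using g by (auto simp: mod_bdd_def)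
    have b: "Lp_bdd r (Y * exp (- wl k / 2)) (conv (Kb k) g)" for k using g by (simp add: mod_bdd_def)
    have "(\<integral>\<^sup>+k. ennreal (Y * exp (- wl k / 2)) \<partial>count_space UNIV) = ennreal Y * (\<integral>\<^sup>+k. ennreal (exp (- wl k / 2)) \<partial>count_space UNIV)"
      using Y by (simp add: ennreal_mult' nn_integral_cmult)
    also have "\<dots> \<le> ennreal Y * ennreal S" using S by (intro mult_left_mono) auto
    also have "\<dots> = ennreal (S * Y)" using Y S by (simp add: ennreal_mult' mult.commute)
    finally have s: "(\<integral>\<^sup>+k. ennreal (Y * exp (- wl k / 2)) \<partial>count_space UNIV) \<le> ennreal (S * Y)" .
    have SY: "0 < S * Y" using S Y by simp
    have 2: "Lp_bdd r ((C1 + 2) * S * Y) g"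
      by (rule Lp_bdd_mono[OF synthesis(3)[OF r c b s SY]]) (use mult_pos_pos[OF C1_pos SY] r in \<open>auto simp: algebra_simps\<close>)
    have le: "C1 * (S * Y) \<le> (C1 + 2) * S * Y" using SY by (simp add: algebra_simps)
    have "AE x in lborel. norm (g x) \<le> (C1 + 2) * S * Y"
      using synthesis(2)[OF r c b s SY] by eventually_elim (use le in linarith)
    then show ?thesis using 2 by simp
  qed
  moreover have "0 < (C1 + 2) * S" using C1_pos S by simp
  ultimately show ?thesis by blast
qed

section \<open>Products of functions with box bounds\<close>

text \<open>The 4 stems from two summations by \<open>Lp_bdd_integral\<close>. In the bracket, the
  first term sums \<open>lw k + lw m\<close> over the pairs near \<open>l\<close>, the second sums
  \<open>lw k * lw m\<close> over all pairs.\<close>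

definition Cp :: real where
  "Cp = 4 * (2 * (real (near_count TYPE('n) 3) * 3 ^ CARD('n)) + 3 ^ CARD('n) * 3 ^ CARD('n))"

lemma Cp_pos: "0 < Cp"
  by (simp add: Cp_def add_nonneg_pos)

lemma sigma_finite_lattice: "sigma_finite_measure (count_space (UNIV :: (int^'n) set))"
  by (rule sigma_finite_measure_count_space_countable) auto

lemma nn_sum_near:
  "(\<integral>\<^sup>+k. ennreal (if near 3 l (k + m) then c else 0) \<partial>count_space (UNIV :: (int^'n) set)) = ennreal (real (near_count TYPE('n) 3)) * ennreal c"
proof -
  have eq: "near 3 l (k + m) \<longleftrightarrow> k \<in> {k. near 3 (l - m) k}" for k :: "int^'n" by (auto simp: near_def algebra_simps)
  have "(\<integral>\<^sup>+k. ennreal (if near 3 l (k + m) then c else 0) \<partial>count_space UNIV) = (\<integral>\<^sup>+k. ennreal c * indicator {k. near 3 (l - m) k} k \<partial>count_space (UNIV :: (int^'n) set))"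
    unfolding eq by (intro nn_integral_cong) (auto simp: indicator_def)
  also have "\<dots> = ennreal c * emeasure (count_space UNIV) {k. near 3 (l - m) k}"
    by (rule nn_integral_cmult_indicator) simp
  also have "\<dots> = ennreal c * ennreal (real (card {k. near 3 (l - m) k}))"
    by (simp add: emeasure_count_space finite_near ennreal_of_nat_eq_real_of_nat)
  finally show ?thesis by (simp add: card_near mult.commute)
qed

text \<open>Synthesis in both factors writes the box of the product as a double sum. Spectra add up,
  so only pairs with \<open>k + m\<close> within 3 of \<open>l\<close> contribute: 2 from the two
  factors and 1 from the box. For such pairs one index determines the other up to
  \<open>near_count\<close> choices, so even \<open>lw k + lw m\<close> is summable.\<close>

lemma product_box:
  fixes g h :: "real^'n \<Rightarrow> complex"
  assumes g: "Lp_bdd r cg g" and h: "Lp_bdd r ch h"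
    and b: "\<And>k. Lp_bdd r (b k) (conv (Kb k) g)" and b': "\<And>k. Lp_bdd r (b' k) (conv (Kb k) h)"
    and S: "(\<integral>\<^sup>+k. ennreal (b k) \<partial>count_space UNIV) \<le> ennreal S" "0 < S"
    and S': "(\<integral>\<^sup>+k. ennreal (b' k) \<partial>count_space UNIV) \<le> ennreal S'" "0 < S'"
    and G: "0 < G" and near: "\<And>k m. near 3 l (k + m) \<Longrightarrow> Lp_bdd r (G * (lw k + lw m)) (conv (Kb l) (\<lambda>x. conv (Kb k) g x * conv (Kb m) h x))"
  shows "Lp_bdd r (Cp * G) (conv (Kb l) (\<lambda>x. g x * h x))"
proof -
  let ?N = "count_space (UNIV :: (int^'n) set)"
  let ?g = "\<lambda>k. conv (Kb k) g" and ?h = "\<lambda>m. conv (Kb m) h"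
  have gm[measurable]: "g \<in> borel_measurable borel" and hm[measurable]: "h \<in> borel_measurable borel" using g h by (auto simp: Lp_bdd_def)
  have gkm[measurable]: "?g k \<in> borel_measurable borel" and hkm[measurable]: "?h k \<in> borel_measurable borel" for k
    by (auto intro!: conv_measurable)
  have hs: "AE x in lborel. norm (?h m x) \<le> C1 * b' m" for m by (rule Nikolskij[OF r h b'])
  have Cb: "0 < C1 * b' m" for m using C1_pos Lp_bdd_pos[OF b'] by simp
  have Tm: "Lp_bdd r (C1 * b' m * cg) (\<lambda>x. g x * ?h m x)" for m
    using Lp_bdd_mult_bounded[OF g Cb hkm hs] r by (simp add: mult.commute)
  have Tkm: "Lp_bdd r (C1 * b' m * b k) (\<lambda>x. ?g k x * ?h m x)" for k m
  proof -
    have "Lp_bdd r (C1 * b' m * b k) (\<lambda>x. ?h m x * ?g k x)"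
      using r by (intro Lp_bdd_mult_bounded[OF b Cb hkm hs]) simp
    then show ?thesis by (simp only: mult.commute[of "?h m _"])
  qed
  \<comment> \<open>The term \<open>lw k * lw m\<close> keeps the constant positive for pairs whose
    box vanishes, as \<open>Lp_bdd\<close> demands, and is summable.\<close>
  define c where "c k m = G * ((if near 3 l (k + m) then lw k + lw m else 0) + lw k * lw m)" for k m :: "int^'n"
  have c0: "0 < c k m" for k m unfolding c_def using G lw_pos[of k] lw_pos[of m] by (intro mult_pos_pos add_nonneg_pos) auto
  have box: "Lp_bdd r (c k m) (conv (Kb l) (\<lambda>x. ?g k x * ?h m x))" for k m
  proof (cases "near 3 l (k + m)")
    case True
    show ?thesis by (rule Lp_bdd_mono[OF near[OF True]])
      (use True G r lw_pos[of k] lw_pos[of m] in \<open>auto simp: c_def intro!: mult_left_mono\<close>)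
  next
    case False
    have "spec_in (cube (lattice_vec (k + m)) 2) (\<lambda>x. ?g k x * ?h m x)"
    proof (rule spec_in_mult[OF spec_Kb[OF r g] spec_Kb[OF r h]])
      fix \<xi> \<eta> assume a: "\<xi> \<in> cube (lattice_vec k) 1" "\<eta> \<in> cube (lattice_vec m) 1"
      have "\<bar>(\<xi> + \<eta>) $ i - lattice_vec (k + m) $ i\<bar> \<le> 2" for i
      proof -
        have "\<bar>\<xi> $ i - real_of_int (k $ i)\<bar> \<le> 1" "\<bar>\<eta> $ i - real_of_int (m $ i)\<bar> \<le> 1" using a by (auto simp: cube_def)
        then show ?thesis by simp
      qed
      then show "\<xi> + \<eta> \<in> cube (lattice_vec (k + m)) 2" by (simp add: cube_def)
    qed
    moreover obtain i where "\<not> \<bar>l $ i - (k + m) $ i\<bar> \<le> 3" using False by (auto simp: near_def)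
    then have "2 + 1 < \<bar>real_of_int (l $ i) - lattice_vec (k + m) $ i\<bar>" by (simp del: of_int_add)
    ultimately have "conv (Kb l) (\<lambda>x. ?g k x * ?h m x) = (\<lambda>_. 0)" by (intro ext conv_Kb_far)
    then show ?thesis using Lp_bdd_zero[OF c0] by simp
  qed
  define D where "D m = enn2real (\<integral>\<^sup>+k. ennreal (c k m) \<partial>?N)" for m
  define Ctot where "Ctot = G * (2 * (real (near_count TYPE('n) 3) * 3 ^ CARD('n)) + 3 ^ CARD('n) * 3 ^ CARD('n))"
  have Ctot: "0 < Ctot" unfolding Ctot_def using G by (intro mult_pos_pos add_nonneg_pos) auto
  have csum: "(\<integral>\<^sup>+m. \<integral>\<^sup>+k. ennreal (c k m) \<partial>?N \<partial>?N) \<le> ennreal Ctot"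
  proof -
    interpret P: pair_sigma_finite ?N ?N using sigma_finite_lattice by (simp add: pair_sigma_finite_def)
    let ?n3 = "ennreal (real (near_count TYPE('n) 3))" and ?S = "\<integral>\<^sup>+k. ennreal (lw (k :: int^'n)) \<partial>?N"
    let ?if = "\<lambda>k m z. ennreal (if near 3 l (k + m) then z else 0)"
    have split: "ennreal (c k m) = ennreal G * ((?if k m (lw k) + ?if k m (lw m)) + ennreal (lw k) * ennreal (lw m))" for k m
    proof -
      let ?r = "\<lambda>z. if near 3 l (k + m) then z else 0"
      have n: "0 \<le> lw k" "0 \<le> lw m" "0 \<le> ?r (lw k)" "0 \<le> ?r (lw m)" "0 \<le> lw k * lw m"
        using lw_pos[of k] lw_pos[of m] by auto
      have "c k m = G * ((?r (lw k) + ?r (lw m)) + lw k * lw m)" by (simp add: c_def)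
      then have "ennreal (c k m) = ennreal G * ennreal ((?r (lw k) + ?r (lw m)) + lw k * lw m)"
        using G by (simp only: ennreal_mult' less_imp_le)
      also have "ennreal ((?r (lw k) + ?r (lw m)) + lw k * lw m) = ennreal (?r (lw k) + ?r (lw m)) + ennreal (lw k * lw m)"
        using n by (intro ennreal_plus add_nonneg_nonneg)
      also have "ennreal (?r (lw k) + ?r (lw m)) = ennreal (?r (lw k)) + ennreal (?r (lw m))"
        using n by (intro ennreal_plus)
      also have "ennreal (lw k * lw m) = ennreal (lw k) * ennreal (lw m)" using n by (intro ennreal_mult)
      finally show ?thesis .
    qed
    have 1: "(\<integral>\<^sup>+m. \<integral>\<^sup>+k. ?if k m (lw m) \<partial>?N \<partial>?N) = ?n3 * ?S"
      by (simp add: nn_sum_near nn_integral_cmult)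
    have "(\<integral>\<^sup>+m. \<integral>\<^sup>+k. ?if k m (lw k) \<partial>?N \<partial>?N) = (\<integral>\<^sup>+k. \<integral>\<^sup>+m. ?if k m (lw k) \<partial>?N \<partial>?N)"
      by (rule P.Fubini') (auto simp: sets_pair_countable measurable_def)
    also have "\<dots> = (\<integral>\<^sup>+k. \<integral>\<^sup>+m. ?if m k (lw k) \<partial>?N \<partial>?N)" by (simp add: add.commute)
    finally have 2: "(\<integral>\<^sup>+m. \<integral>\<^sup>+k. ?if k m (lw k) \<partial>?N \<partial>?N) = ?n3 * ?S" using 1 by simp
    have 3: "(\<integral>\<^sup>+m. \<integral>\<^sup>+k. ennreal (lw k) * ennreal (lw m) \<partial>?N \<partial>?N) = ?S * ?S"
      by (simp add: nn_integral_cmult nn_integral_multc)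
    have "(\<integral>\<^sup>+m. \<integral>\<^sup>+k. ennreal (c k m) \<partial>?N \<partial>?N) = ennreal G * ((?n3 * ?S + ?n3 * ?S) + ?S * ?S)"
      unfolding split by (simp only: nn_integral_add nn_integral_cmult borel_measurable_count_space 1 2 3)
    also have "\<dots> \<le> ennreal G * ((?n3 * ennreal (3 ^ CARD('n)) + ?n3 * ennreal (3 ^ CARD('n))) + ennreal (3 ^ CARD('n)) * ennreal (3 ^ CARD('n)))"
      by (intro mult_left_mono add_mono mult_mono nn_sum_lw) auto
    also have "\<dots> = ennreal Ctot" unfolding Ctot_def using G
      by (simp add: ennreal_mult'[symmetric] ennreal_plus[symmetric] del: ennreal_plus)
    finally show ?thesis .
  qed
  have Dfin: "(\<integral>\<^sup>+k. ennreal (c k m) \<partial>?N) = ennreal (D m)" for m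
  proof -
    have "(\<integral>\<^sup>+k. ennreal (c k m) \<partial>?N) \<le> (\<integral>\<^sup>+m. \<integral>\<^sup>+k. ennreal (c k m) \<partial>?N \<partial>?N)" by (rule nn_integral_ge_point) simp
    also note csum
    also have "ennreal Ctot < \<infinity>" by simp
    finally have "(\<integral>\<^sup>+k. ennreal (c k m) \<partial>?N) < \<infinity>" .
    then show ?thesis by (simp add: D_def)
  qed
  have Dpos: "0 < D m" for m
  proof -
    have "ennreal (c 0 m) \<le> ennreal (D m)" unfolding Dfin[symmetric] by (rule nn_integral_ge_point) simp
    then show ?thesis using c0[of 0 m] by (simp add: D_def ennreal_le_iff2)
  qed
  have finb: "(\<integral>\<^sup>+k. ennreal (b k) \<partial>?N) < \<infinity>" using S by (auto intro: le_less_trans)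
  have finb': "(\<integral>\<^sup>+k. ennreal (b' k) \<partial>?N) < \<infinity>" using S' by (auto intro: le_less_trans)
  have Bm: "Lp_bdd r (2 * D m) (conv (Kb l) (\<lambda>x. g x * ?h m x))" for m
  proof -
    have jm: "(\<lambda>(k, x). ?g k x * ?h m x) \<in> borel_measurable (?N \<Otimes>\<^sub>M borel)" by (rule measurable_pair_measure_countable1) auto
    have jm2: "(\<lambda>(k, x). conv (Kb l) (\<lambda>x. ?g k x * ?h m x) x) \<in> borel_measurable (?N \<Otimes>\<^sub>M borel)"
      by (rule measurable_pair_measure_countable1) (auto intro!: conv_measurable)
    have fin: "(\<integral>\<^sup>+k. ennreal (C1 * b' m * b k) \<partial>?N) < \<infinity>"
      using finb Cb[of m] by (simp add: ennreal_mult' nn_integral_cmult ennreal_mult_less_top)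
    have "conv (Kb l) (\<lambda>x. g x * ?h m x) = (\<lambda>x. \<integral>k. conv (Kb l) (\<lambda>x. ?g k x * ?h m x) x \<partial>?N)"
    proof
      fix x
      have "conv (Kb l) (\<lambda>x. g x * ?h m x) x = conv (Kb l) (\<lambda>x. \<integral>k. ?g k x * ?h m x \<partial>?N) x"
      proof (rule conv_cong_AE)
        have "Lp_bdd r (2 * enn2real (\<integral>\<^sup>+k. ennreal (C1 * b' m * b k) \<partial>?N) + 2) (\<lambda>x. \<integral>k. ?g k x * ?h m x \<partial>?N)"
          using Lp_bdd_integral[OF r _ sigma_finite_lattice jm _ Tkm, of "enn2real (\<integral>\<^sup>+k. ennreal (C1 * b' m * b k) \<partial>?N) + 1"] fin
          by (simp add: add_nonneg_pos ennreal_plus)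
        then show "(\<lambda>x. \<integral>k. ?g k x * ?h m x \<partial>?N) \<in> borel_measurable borel" by (simp add: Lp_bdd_def)
        show "AE x in lborel. g x * ?h m x = (\<integral>k. ?g k x * ?h m x \<partial>?N)"
          using synthesis(1)[OF r g b S] by eventually_elim simp
      qed auto
      also have "\<dots> = (\<integral>k. conv (Kb l) (\<lambda>x. ?g k x * ?h m x) x \<partial>?N)"
        by (rule conv_integral[OF r sigma_finite_lattice Kb_kernel jm Tkm _ fin]) auto
      finally show "conv (Kb l) (\<lambda>x. g x * ?h m x) x = (\<integral>k. conv (Kb l) (\<lambda>x. ?g k x * ?h m x) x \<partial>?N)" .
    qed
    moreover have "Lp_bdd r (2 * D m) (\<lambda>x. \<integral>k. conv (Kb l) (\<lambda>x. ?g k x * ?h m x) x \<partial>?N)"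
      by (rule Lp_bdd_integral[OF r Dpos sigma_finite_lattice jm2 _ box]) (use Dfin in auto)
    ultimately show ?thesis by simp
  qed
  have jm: "(\<lambda>(m, x). g x * ?h m x) \<in> borel_measurable (?N \<Otimes>\<^sub>M borel)" by (rule measurable_pair_measure_countable1) auto
  have jm2: "(\<lambda>(m, x). conv (Kb l) (\<lambda>x. g x * ?h m x) x) \<in> borel_measurable (?N \<Otimes>\<^sub>M borel)"
    by (rule measurable_pair_measure_countable1) (auto intro!: conv_measurable)
  have fin: "(\<integral>\<^sup>+m. ennreal (C1 * b' m * cg) \<partial>?N) < \<infinity>"
  proof -
    have "(\<integral>\<^sup>+m. ennreal (C1 * b' m * cg) \<partial>?N) = (\<integral>\<^sup>+m. ennreal (C1 * cg) * ennreal (b' m) \<partial>?N)"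
      using C1_pos Lp_bdd_pos[OF g] Lp_bdd_pos[OF b'] by (intro nn_integral_cong) (auto simp: ennreal_mult'[symmetric] less_imp_le mult_ac)
    also have "\<dots> < \<infinity>" using finb' by (simp add: nn_integral_cmult ennreal_mult_less_top)
    finally show ?thesis .
  qed
  have "conv (Kb l) (\<lambda>x. g x * h x) = (\<lambda>x. \<integral>m. conv (Kb l) (\<lambda>x. g x * ?h m x) x \<partial>?N)"
  proof
    fix x
    have "conv (Kb l) (\<lambda>x. g x * h x) x = conv (Kb l) (\<lambda>x. \<integral>m. g x * ?h m x \<partial>?N) x"
    proof (rule conv_cong_AE)
      have "Lp_bdd r (2 * enn2real (\<integral>\<^sup>+m. ennreal (C1 * b' m * cg) \<partial>?N) + 2) (\<lambda>x. \<integral>m. g x * ?h m x \<partial>?N)"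
        using Lp_bdd_integral[OF r _ sigma_finite_lattice jm _ Tm, of "enn2real (\<integral>\<^sup>+m. ennreal (C1 * b' m * cg) \<partial>?N) + 1"] fin
        by (simp add: add_nonneg_pos ennreal_plus)
      then show "(\<lambda>x. \<integral>m. g x * ?h m x \<partial>?N) \<in> borel_measurable borel" by (simp add: Lp_bdd_def)
      show "AE x in lborel. g x * h x = (\<integral>m. g x * ?h m x \<partial>?N)"
        using synthesis(1)[OF r h b' S'] by eventually_elim simp
    qed auto
    also have "\<dots> = (\<integral>m. conv (Kb l) (\<lambda>x. g x * ?h m x) x \<partial>?N)"
      by (rule conv_integral[OF r sigma_finite_lattice Kb_kernel jm Tm _ fin]) auto
    finally show "conv (Kb l) (\<lambda>x. g x * h x) x = (\<integral>m. conv (Kb l) (\<lambda>x. g x * ?h m x) x \<partial>?N)" .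
  qed
  moreover have "Lp_bdd r (2 * (2 * Ctot)) (\<lambda>x. \<integral>m. conv (Kb l) (\<lambda>x. g x * ?h m x) x \<partial>?N)"
  proof (rule Lp_bdd_integral[OF r _ sigma_finite_lattice jm2 _ Bm])
    have "(\<integral>\<^sup>+m. ennreal (2 * D m) \<partial>?N) = 2 * (\<integral>\<^sup>+m. \<integral>\<^sup>+k. ennreal (c k m) \<partial>?N \<partial>?N)"
      using Dpos by (simp add: Dfin ennreal_mult' nn_integral_cmult)
    also have "\<dots> \<le> 2 * ennreal Ctot" by (intro mult_left_mono csum) auto
    finally show "(\<integral>\<^sup>+m. ennreal (2 * D m) \<partial>?N) \<le> ennreal (2 * Ctot)" using Ctot by (simp add: ennreal_mult')
  qed (use Ctot in auto)
  ultimately show ?thesis by (simp add: Ctot_def Cp_def mult_ac)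
qed

text \<open>In each pair the factor with the larger frequency is measured in the full weight and the
  other one in the half weight, which is why \<open>X\<close> is paired with \<open>Y'\<close> and
  \<open>X'\<close> with \<open>Y\<close>. For the second bound both factors are measured in the
  half weight.\<close>

lemma mod_bdd_mult:
  "\<exists>C>0. \<forall>X X' g Y Y' h. mod_bdd X X' g \<longrightarrow> mod_bdd Y Y' h \<longrightarrow>
     mod_bdd (C * (X * Y' + X' * Y)) (C * (X' * Y')) (\<lambda>x. g x * h x)"
proof -
  obtain C3 where C3: "C3 > 0"
    "\<And>k m l. near 3 l (k + m) \<Longrightarrow> norm (lattice_vec m) \<le> norm (lattice_vec k) \<Longrightarrow>
      exp (- wl k) * \<alpha> k * exp (- wl m / 2) \<le> C3 * (exp (- wl l) * \<alpha> l) * lw m"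
    "\<And>k m l. near 3 l (k + m) \<Longrightarrow> norm (lattice_vec m) \<le> norm (lattice_vec k) \<Longrightarrow>
      exp (- wl k / 2) * exp (- wl m / 2) \<le> C3 * exp (- wl l / 2) * lw m"
    using weighted_pair by blast
  obtain S where S: "S > 0" "(\<integral>\<^sup>+k. ennreal (exp (- wl k / 2)) \<partial>count_space UNIV) \<le> ennreal S"
    using exp_half_sum by blast
  obtain C4 where C4: "C4 > 0" "\<And>X Y g. mod_bdd X Y g \<Longrightarrow> AE x in lborel. norm (g x) \<le> C4 * Y"
    using mod_bdd_sup by blast
  define B where "B = 2 * A0 * C1 * C3"
  have B: "0 < B" using A0_pos C1_pos C3(1) by (simp add: B_def)
  have "mod_bdd (Cp * B * (X * Y' + X' * Y)) (Cp * B * (X' * Y')) (\<lambda>x. g x * h x)"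
    if g: "mod_bdd X X' g" and h: "mod_bdd Y Y' h" for X X' g Y Y' h
  proof -
    have pos: "0 < X" "0 < X'" "0 < Y" "0 < Y'" using g h by (auto simp: mod_bdd_def)
    obtain cg ch where cg: "Lp_bdd r cg g" and ch: "Lp_bdd r ch h" using g h by (auto simp: mod_bdd_def)
    have gb: "Lp_bdd r (X' * exp (- wl k / 2)) (conv (Kb k) g)" "Lp_bdd r (X * (exp (- wl k) * \<alpha> k)) (conv (Kb k) g)" for k
      using g by (auto simp: mod_bdd_def)
    have hb: "Lp_bdd r (Y' * exp (- wl k / 2)) (conv (Kb k) h)" "Lp_bdd r (Y * (exp (- wl k) * \<alpha> k)) (conv (Kb k) h)" for k
      using h by (auto simp: mod_bdd_def)
    have sum: "(\<integral>\<^sup>+k. ennreal (Z * exp (- wl k / 2)) \<partial>count_space UNIV) \<le> ennreal (Z * S)" if "0 < Z" for Z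
      using that S by (simp add: ennreal_mult' nn_integral_cmult mult_left_mono)
    have prod: "Lp_bdd r (2 * (A0 * (C1 * y * x))) (conv (Kb l) (\<lambda>z. conv (Kb k) g z * conv (Kb m) h z))"
      if x: "Lp_bdd r x (conv (Kb k) g)" and y: "Lp_bdd r y (conv (Kb m) h)" for x y k m l
    proof (rule Lp_bdd_conv[OF r Kb_kernel])
      have "Lp_bdd r (C1 * y * x) (\<lambda>z. conv (Kb m) h z * conv (Kb k) g z)"
        using C1_pos Lp_bdd_pos[OF y] r by (intro Lp_bdd_mult_bounded[OF x] Nikolskij[OF r ch y] Lp_bdd_measurable[OF y]) auto
      then show "Lp_bdd r (C1 * y * x) (\<lambda>z. conv (Kb k) g z * conv (Kb m) h z)" by (simp add: mult.commute)
    qed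
    have lwp: "0 < lw k" for k :: "int^'n" by (rule lw_pos)
    have 1: "Lp_bdd r (Cp * (B * (X * Y' + X' * Y) * (exp (- wl l) * \<alpha> l))) (conv (Kb l) (\<lambda>x. g x * h x))" for l
    proof (rule product_box[OF cg ch gb(1) hb(1) sum _ sum])
      let ?E = "exp (- wl l) * \<alpha> l"
      have E: "0 < ?E" using alpha_pos by simp
      have "0 < X * Y' + X' * Y" using pos by (intro add_pos_pos mult_pos_pos)
      then show "0 < B * (X * Y' + X' * Y) * ?E" using B E by (intro mult_pos_pos[OF _ E]) simp
      fix k m assume l: "near 3 l (k + m)"
      show "Lp_bdd r (B * (X * Y' + X' * Y) * ?E * (lw k + lw m)) (conv (Kb l) (\<lambda>x. conv (Kb k) g x * conv (Kb m) h x))"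
      proof (cases "norm (lattice_vec m) \<le> norm (lattice_vec k)")
        case True
        have "2 * (A0 * (C1 * (Y' * exp (- wl m / 2)) * (X * (exp (- wl k) * \<alpha> k)))) = 2 * A0 * C1 * (X * Y') * (exp (- wl k) * \<alpha> k * exp (- wl m / 2))"
          by (simp add: mult_ac)
        also have "\<dots> \<le> 2 * A0 * C1 * (X * Y') * (C3 * ?E * lw m)"
          using A0_pos C1_pos pos by (intro mult_left_mono C3(2)[OF l True]) auto
        also have "\<dots> = B * (X * Y') * ?E * lw m" by (simp add: B_def mult_ac)
        also have "\<dots> \<le> B * (X * Y' + X' * Y) * ?E * (lw k + lw m)"
          using B pos E lwp[of k] lwp[of m]
          by (intro mult_mono add_nonneg_nonneg mult_nonneg_nonneg) (auto simp: less_imp_le[OF alpha_pos])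
        finally show ?thesis using r by (intro Lp_bdd_mono[OF prod[OF gb(2) hb(1)]]) auto
      next
        case False
        have l': "near 3 l (m + k)" using l by (simp add: add.commute)
        have "2 * (A0 * (C1 * (Y * (exp (- wl m) * \<alpha> m)) * (X' * exp (- wl k / 2)))) = 2 * A0 * C1 * (X' * Y) * (exp (- wl m) * \<alpha> m * exp (- wl k / 2))"
          by (simp add: mult_ac)
        also have "\<dots> \<le> 2 * A0 * C1 * (X' * Y) * (C3 * ?E * lw k)"
          using A0_pos C1_pos pos False by (intro mult_left_mono C3(2)[OF l']) auto
        also have "\<dots> = B * (X' * Y) * ?E * lw k" by (simp add: B_def mult_ac)
        also have "\<dots> \<le> B * (X * Y' + X' * Y) * ?E * (lw k + lw m)"
          using B pos E lwp[of k] lwp[of m]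
          by (intro mult_mono add_nonneg_nonneg mult_nonneg_nonneg) (auto simp: less_imp_le[OF alpha_pos])
        finally show ?thesis using r by (intro Lp_bdd_mono[OF prod[OF gb(1) hb(2)]]) auto
      qed
    qed (use pos S in auto)
    have 2: "Lp_bdd r (Cp * (B * (X' * Y') * exp (- wl l / 2))) (conv (Kb l) (\<lambda>x. g x * h x))" for l
    proof (rule product_box[OF cg ch gb(1) hb(1) sum _ sum])
      let ?E = "exp (- wl l / 2)"
      show "0 < B * (X' * Y') * ?E" using B pos by simp
      fix k m assume l: "near 3 l (k + m)"
      have "exp (- wl k / 2) * exp (- wl m / 2) \<le> C3 * ?E * (lw k + lw m)"
      proof (cases "norm (lattice_vec m) \<le> norm (lattice_vec k)")
        case True
        have "C3 * ?E * lw m \<le> C3 * ?E * (lw k + lw m)" using C3(1) lwp[of k] by (intro mult_left_mono) auto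
        then show ?thesis using C3(3)[OF l True] by linarith
      next
        case False
        have l': "near 3 l (m + k)" using l by (simp add: add.commute)
        have "C3 * ?E * lw k \<le> C3 * ?E * (lw k + lw m)" using C3(1) lwp[of m] by (intro mult_left_mono) auto
        moreover have "exp (- wl m / 2) * exp (- wl k / 2) \<le> C3 * ?E * lw k" using False by (intro C3(3)[OF l']) auto
        ultimately show ?thesis by (simp only: mult.commute[of "exp (- wl k / 2)"])
      qed
      then have "2 * A0 * C1 * (X' * Y') * (exp (- wl k / 2) * exp (- wl m / 2)) \<le> 2 * A0 * C1 * (X' * Y') * (C3 * ?E * (lw k + lw m))"
        using A0_pos C1_pos pos by (intro mult_left_mono) auto
      then show "Lp_bdd r (B * (X' * Y') * ?E * (lw k + lw m)) (conv (Kb l) (\<lambda>x. conv (Kb k) g x * conv (Kb m) h x))"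
        using r by (intro Lp_bdd_mono[OF prod[OF gb(1) hb(1)]]) (auto simp: B_def mult_ac)
    qed (use pos S in auto)
    have "Lp_bdd r (C4 * X' * ch) (\<lambda>x. g x * h x)"
      using C4(1) pos r by (intro Lp_bdd_mult_bounded[OF ch] C4(2)[OF g] mod_bdd_measurable[OF g]) auto
    then show ?thesis
      using 1 2 B Cp_pos pos unfolding mod_bdd_def by (auto simp: mult.assoc add_pos_pos)
  qed
  then show ?thesis using B Cp_pos by (intro exI[of _ "Cp * B"]) auto
qed

end

section \<open>Exponentials of real functions\<close>

context decomposition
begin

text \<open>The low-pass symbols are even, so that the kernels are real and low-frequency parts of
  real functions are real; the dilations make the bound of the \<open>L\<^sup>1\<close> norms uniform.\<close>

lemma low_pass:
  "\<exists>A>0. \<forall>R\<ge>1. \<exists>B (\<sigma> :: real^'n \<Rightarrow> complex) \<kappa>. fourier_pair B \<sigma> \<kappa> \<and> (\<integral>\<^sup>+x. norm (\<kappa> x) \<partial>lborel) \<le> ennreal A \<and> (\<forall>x. cnj (\<kappa> x) = \<kappa> x) \<and>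
     (\<forall>\<xi>. \<xi> \<notin> cube 0 (3 * R) \<longrightarrow> \<sigma> \<xi> = 0) \<and> (\<forall>\<xi>\<in>cube 0 R. \<sigma> \<xi> = 1)"
proof -
  \<comment> \<open>These are the boxes whose cubes meet \<open>cube 0 1\<close>; their symbols sum
    to 1 there and vanish off \<open>cube 0 3\<close>.\<close>
  define F where "F = {k :: int^'n. near 2 0 k}"
  have F: "finite F" by (simp add: F_def finite_near)
  define \<phi>' where "\<phi>' \<xi> = (\<Sum>k\<in>F. sg k \<xi>)" for \<xi>
  \<comment> \<open>The mean of the dilate and its reflection, which makes the symbol even and keeps
    it real.\<close>
  define \<phi> where "\<phi> R \<xi> = (\<phi>' (0 + (1 / R) *\<^sub>R \<xi>) + \<phi>' (0 + (- 1 / R) *\<^sub>R \<xi>)) * complex_of_real (1 / 2)" for R and \<xi> :: "real^'n"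
  have "diff_order m (sg k)" for m k
  proof -
    have "diff_order m (\<lambda>\<xi>. sg 0 (- lattice_vec k + 1 *\<^sub>R \<xi>))" using sg_smooth unfolding smooth_on_UNIV_iff by (intro diff_order_affine) blast
    moreover have "(\<lambda>\<xi>. sg 0 (- lattice_vec k + 1 *\<^sub>R \<xi>)) = sg k" by (rule ext) (simp add: sg_translate[of k])
    ultimately show ?thesis by simp
  qed
  then have "diff_order m \<phi>'" for m unfolding \<phi>'_def[abs_def] by (intro diff_order_sum F)
  then have sm: "smooth_on UNIV (\<phi> R)" for R unfolding \<phi>_def[abs_def] smooth_on_UNIV_iff
    by (intro allI diff_order_mult diff_order_add diff_order_const diff_order_affine)
  have cm[measurable]: "\<phi> R \<in> borel_measurable borel" for R
    by (rule borel_measurable_continuous_onI[OF smooth_continuous[OF sm]])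
  have real: "cnj (\<phi> R \<xi>) = \<phi> R \<xi>" for R \<xi> by (simp add: \<phi>_def \<phi>'_def sg_def)
  have even: "\<phi> R (- \<xi>) = \<phi> R \<xi>" for R \<xi> by (simp add: \<phi>_def add.commute)
  have supp': "\<phi>' \<eta> = 0" if \<eta>: "\<eta> \<notin> cube 0 3" for \<eta>
  proof -
    have "sg k \<eta> = 0" if "k \<in> F" for k
    proof (rule sg_support, rule notI)
      assume a: "\<eta> \<in> cube (lattice_vec k) 1"
      have "\<bar>\<eta> $ i\<bar> \<le> 3" for i
      proof -
        have "\<bar>\<eta> $ i - real_of_int (k $ i)\<bar> \<le> 1" using a by (auto simp: cube_def)
        moreover have "- 2 \<le> k $ i \<and> k $ i \<le> 2" using that by (auto simp: F_def near_0_iff)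
        then have "\<bar>real_of_int (k $ i)\<bar> \<le> 2" by linarith
        ultimately show ?thesis by linarith
      qed
      then show False using \<eta> by (simp add: cube_def)
    qed
    then show ?thesis by (simp add: \<phi>'_def)
  qed
  have one': "\<phi>' \<eta> = 1" if \<eta>: "\<eta> \<in> cube 0 1" for \<eta>
    unfolding \<phi>'_def
  proof (rule sum_sg[OF F])
    fix m :: "int^'n" assume a: "\<eta> \<in> cube (lattice_vec m) 1"
    have "- 2 \<le> m $ i \<and> m $ i \<le> 2" for i
    proof -
      have "\<bar>\<eta> $ i - real_of_int (m $ i)\<bar> \<le> 1" "\<bar>\<eta> $ i\<bar> \<le> 1" using a \<eta> by (auto simp: cube_def)
      then show ?thesis by linarith
    qed
    then show "m \<in> F" by (simp add: F_def near_0_iff)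
  qed
  have scale: "(1 / R) *\<^sub>R \<xi> \<in> cube 0 s \<longleftrightarrow> \<xi> \<in> cube 0 (s * R)" "(- 1 / R) *\<^sub>R \<xi> \<in> cube 0 s \<longleftrightarrow> \<xi> \<in> cube 0 (s * R)" if "0 < R" for R s \<xi>
    using that by (auto simp: cube_def abs_mult abs_divide divide_le_eq)
  have supp: "\<phi> R \<xi> = 0" if "\<xi> \<notin> cube 0 (3 * R)" "0 < R" for R \<xi>
    using that supp' scale[OF that(2), of \<xi> 3] by (simp add: \<phi>_def)
  have one: "\<phi> R \<xi> = 1" if "\<xi> \<in> cube 0 R" "0 < R" for R \<xi>
    using that one' scale[OF that(2), of \<xi> 1] by (simp add: \<phi>_def)
  define \<kappa> where "\<kappa> R x = of_real ((2 * pi) powr (- real DIM(real^'n))) * (\<integral>\<eta>. \<phi> R \<eta> * cis (x \<bullet> \<eta>) \<partial>lborel)" for R x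
  have pair: "\<exists>A. fourier_pair A (\<phi> R) (\<kappa> R)" if "0 < R" for R
  proof -
    have "\<phi> R \<xi> = 0" if "real CARD('n) * (3 * R) < norm \<xi>" for \<xi>
      using norm_le_of_cube[of \<xi> "3 * R"] that supp[of \<xi> R] \<open>0 < R\<close> by fastforce
    then show ?thesis using fourier_pair_smooth[OF sm] unfolding \<kappa>_def[abs_def] by blast
  qed
  \<comment> \<open>Dilating the symbol dilates the kernel so that its integral norm is unchanged;
    hence one \<open>A\<close> for all \<open>R\<close>.\<close>
  have scaleK: "\<kappa> R x = of_real (R ^ DIM(real^'n)) * \<kappa> 1 (R *\<^sub>R x)" if R: "0 < R" for R x
  proof -
    have "(\<integral>\<eta>. \<phi> R \<eta> * cis (x \<bullet> \<eta>) \<partial>lborel) = \<bar>R\<bar> ^ DIM(real^'n) *\<^sub>R (\<integral>\<eta>. \<phi> R (0 + R *\<^sub>R \<eta>) * cis (x \<bullet> (0 + R *\<^sub>R \<eta>)) \<partial>lborel)"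
      using R by (intro integral_affine_euclidean) auto
    also have "(\<lambda>\<eta>. \<phi> R (0 + R *\<^sub>R \<eta>) * cis (x \<bullet> (0 + R *\<^sub>R \<eta>))) = (\<lambda>\<eta>. \<phi> 1 \<eta> * cis ((R *\<^sub>R x) \<bullet> \<eta>))"
      using R by (simp add: \<phi>_def fun_eq_iff)
    finally show ?thesis using R by (simp add: \<kappa>_def scaleR_conv_of_real mult_ac)
  qed
  obtain A where A: "fourier_pair A (\<phi> 1) (\<kappa> 1)" using pair[of 1] by auto
  note kA = fourier_pair_kernel[OF A]
  show ?thesis
  proof (rule exI[of _ A], intro conjI allI impI)
    show "0 < A" by (rule kernel_bdd_pos[OF kA])
    fix R :: real assume "1 \<le> R"
    then have R: "0 < R" by simp
    obtain B where B: "fourier_pair B (\<phi> R) (\<kappa> R)" using pair[OF R] by blast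
    have k1m[measurable]: "\<kappa> 1 \<in> borel_measurable borel" by (rule kernel_bdd_measurable[OF kA])
    have "(\<integral>\<^sup>+x. norm (\<kappa> R x) \<partial>lborel) = (\<integral>\<^sup>+x. ennreal (R ^ DIM(real^'n)) * ennreal (norm (\<kappa> 1 (R *\<^sub>R x))) \<partial>lborel)"
      using R by (intro nn_integral_cong) (simp add: scaleK[OF R] norm_mult ennreal_mult norm_power)
    also have "\<dots> = ennreal (R ^ DIM(real^'n)) * (\<integral>\<^sup>+x. ennreal (norm (\<kappa> 1 (R *\<^sub>R x))) \<partial>lborel)"
      by (rule nn_integral_cmult) measurable
    also have "\<dots> = (\<integral>\<^sup>+x. ennreal (norm (\<kappa> 1 x)) \<partial>lborel)"
      using nn_integral_affine_euclidean[of "\<lambda>x. ennreal (norm (\<kappa> 1 x))" R 0] R by simp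
    also have "\<dots> \<le> ennreal A" using kA by (simp add: kernel_bdd_def)
    finally have L1: "(\<integral>\<^sup>+x. norm (\<kappa> R x) \<partial>lborel) \<le> ennreal A" .
    have "cnj (\<kappa> R x) = \<kappa> R x" for x
    proof -
      have "cnj (\<integral>\<eta>. \<phi> R \<eta> * cis (x \<bullet> \<eta>) \<partial>lborel) = (\<integral>\<eta>. cnj (\<phi> R \<eta> * cis (x \<bullet> \<eta>)) \<partial>lborel)"
        by (rule Bochner_Integration.integral_cnj[symmetric])
      also have "\<dots> = (\<integral>\<eta>. \<phi> R (0 - \<eta>) * cis (x \<bullet> (0 - \<eta>)) \<partial>lborel)" by (simp add: real even cis_cnj)
      also have "\<dots> = (\<integral>\<eta>. \<phi> R \<eta> * cis (x \<bullet> \<eta>) \<partial>lborel)"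
        by (rule integral_reflect[of "\<lambda>\<eta>. \<phi> R \<eta> * cis (x \<bullet> \<eta>)" 0]) measurable
      finally show ?thesis by (simp add: \<kappa>_def)
    qed
    then have "fourier_pair B (\<phi> R) (\<kappa> R) \<and> (\<integral>\<^sup>+x. norm (\<kappa> R x) \<partial>lborel) \<le> ennreal A \<and> (\<forall>x. cnj (\<kappa> R x) = \<kappa> R x) \<and>
       (\<forall>\<xi>. \<xi> \<notin> cube 0 (3 * R) \<longrightarrow> \<phi> R \<xi> = 0) \<and> (\<forall>\<xi>\<in>cube 0 R. \<phi> R \<xi> = 1)"
      using B L1 supp[OF _ R] one[OF _ R] by simp
    then show "\<exists>B (\<sigma> :: real^'n \<Rightarrow> complex) \<kappa>. fourier_pair B \<sigma> \<kappa> \<and> (\<integral>\<^sup>+x. norm (\<kappa> x) \<partial>lborel) \<le> ennreal A \<and> (\<forall>x. cnj (\<kappa> x) = \<kappa> x) \<and>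
       (\<forall>\<xi>. \<xi> \<notin> cube 0 (3 * R) \<longrightarrow> \<sigma> \<xi> = 0) \<and> (\<forall>\<xi>\<in>cube 0 R. \<sigma> \<xi> = 1)"
      by blast
  qed
qed

end

section \<open>The exponential series with box bounds\<close>

context modulation_setting
begin

lemma mod_bdd_integral:
  fixes G :: "'b \<Rightarrow> real^'n \<Rightarrow> complex"
  assumes N: "sigma_finite_measure N" and Gm: "(\<lambda>(a, x). G a x) \<in> borel_measurable (N \<Otimes>\<^sub>M borel)"
    and xm[measurable]: "x \<in> borel_measurable N" and ym[measurable]: "y \<in> borel_measurable N"
    and G: "\<And>a. a \<in> space N \<Longrightarrow> mod_bdd (x a) (y a) (G a)"
    and X: "(\<integral>\<^sup>+a. ennreal (x a) \<partial>N) \<le> ennreal X" "0 < X" and Y: "(\<integral>\<^sup>+a. ennreal (y a) \<partial>N) \<le> ennreal Y" "0 < Y"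
  shows "mod_bdd (2 * X) (2 * Y) (\<lambda>z. \<integral>a. G a z \<partial>N)"
proof -
  interpret N: sigma_finite_measure N by fact
  note [measurable] = Gm
  obtain C where C: "C > 0" "\<And>X Y g. mod_bdd X Y g \<Longrightarrow> Lp_bdd r (C * Y) g" using mod_bdd_sup by blast
  have GL: "Lp_bdd r (C * y a) (G a)" if "a \<in> space N" for a by (rule C(2)[OF G[OF that]])
  have Cy: "(\<integral>\<^sup>+a. ennreal (C * y a) \<partial>N) \<le> ennreal (C * Y)"
    using C(1) Y by (simp add: ennreal_mult' nn_integral_cmult mult_left_mono)
  have CY: "0 < C * Y" using C Y by simp
  have tot: "Lp_bdd r (2 * (C * Y)) (\<lambda>z. \<integral>a. G a z \<partial>N)"
    by (rule Lp_bdd_integral[OF r CY N Gm _ GL Cy]) auto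
  have eq: "conv (Kb l) (\<lambda>z. \<integral>a. G a z \<partial>N) = (\<lambda>z. \<integral>a. conv (Kb l) (G a) z \<partial>N)" for l
    by (rule ext, rule conv_integral[OF r N Kb_kernel Gm GL]) (use Cy in \<open>auto intro: le_less_trans\<close>)
  have jm: "(\<lambda>(a, z). conv (Kb l) (G a) z) \<in> borel_measurable (N \<Otimes>\<^sub>M borel)" for l
    unfolding conv_def by measurable
  have 1: "Lp_bdd r (2 * (X * (exp (- wl l) * \<alpha> l))) (conv (Kb l) (\<lambda>z. \<integral>a. G a z \<partial>N))" for l
    unfolding eq
  proof (rule Lp_bdd_integral[OF r _ N jm, where c="\<lambda>a. x a * (exp (- wl l) * \<alpha> l)"])
    let ?E = "exp (- wl l) * \<alpha> l"
    have E: "0 < ?E" using alpha_pos by simp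
    show "0 < X * ?E" using X E by simp
    show "Lp_bdd r (x a * ?E) (conv (Kb l) (G a))" if "a \<in> space N" for a
      using G[OF that] by (simp add: mod_bdd_def)
    have "(\<integral>\<^sup>+a. ennreal (x a * ?E) \<partial>N) = (\<integral>\<^sup>+a. ennreal (x a) \<partial>N) * ennreal ?E"
      using E by (simp add: ennreal_mult'' less_imp_le[OF E] nn_integral_multc del: mult_exp_exp)
    also have "\<dots> \<le> ennreal X * ennreal ?E" by (intro mult_right_mono X) simp
    also have "\<dots> = ennreal (X * ?E)" using E by (intro ennreal_mult''[symmetric]) simp
    finally show "(\<integral>\<^sup>+a. ennreal (x a * ?E) \<partial>N) \<le> ennreal (X * ?E)" .
  qed auto
  have 2: "Lp_bdd r (2 * (Y * exp (- wl l / 2))) (conv (Kb l) (\<lambda>z. \<integral>a. G a z \<partial>N))" for l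
    unfolding eq
  proof (rule Lp_bdd_integral[OF r _ N jm, where c="\<lambda>a. y a * exp (- wl l / 2)"])
    let ?E = "exp (- wl l / 2)"
    show "0 < Y * ?E" using Y by simp
    show "Lp_bdd r (y a * ?E) (conv (Kb l) (G a))" if "a \<in> space N" for a
      using G[OF that] by (simp add: mod_bdd_def)
    have "(\<integral>\<^sup>+a. ennreal (y a * ?E) \<partial>N) = (\<integral>\<^sup>+a. ennreal (y a) \<partial>N) * ennreal ?E"
      by (simp add: ennreal_mult'' nn_integral_multc)
    also have "\<dots> \<le> ennreal Y * ennreal ?E" by (intro mult_right_mono Y) simp
    also have "\<dots> = ennreal (Y * ?E)" by (intro ennreal_mult''[symmetric]) simp
    finally show "(\<integral>\<^sup>+a. ennreal (y a * ?E) \<partial>N) \<le> ennreal (Y * ?E)" .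
  qed auto
  show ?thesis using 1 2 tot X Y unfolding mod_bdd_def by (auto simp: mult.assoc)
qed

lemma mod_bdd_scale:
  assumes "mod_bdd X Y g" "0 < s" "norm a \<le> s"
  shows "mod_bdd (s * X) (s * Y) (\<lambda>x. a * g x)"
proof -
  have eq: "conv (Kb l) (\<lambda>x. a * g x) = (\<lambda>x. a * conv (Kb l) g x)" for l by (rule ext) (rule conv_cmult)
  obtain c where c: "Lp_bdd r c g" using assms by (auto simp: mod_bdd_def)
  have sc: "Lp_bdd r (s * b) (\<lambda>x. a * h x)" if "Lp_bdd r b h" for b and h :: "real^'n \<Rightarrow> complex"
    using Lp_bdd_scale[OF that assms(2,3)] r by simp
  show ?thesis using assms sc[OF c] unfolding mod_bdd_def eq by (auto simp: mult.assoc intro!: sc)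
qed

text \<open>The series starts at order 1 because the constant 1 is subtracted, and is written as an
  integral over a counting measure so that convolution and box bounds pass through it in one
  step.\<close>

lemma cis_minus_1_series:
  "cis y - 1 = (\<integral>j. (\<i> * of_real t) ^ Suc j / fact (Suc j) * of_real v ^ Suc j \<partial>count_space UNIV)" if "y = t * v"
proof -
  let ?z = "\<i> * complex_of_real (t * v)"
  have s: "summable (\<lambda>j. norm (?z ^ j / fact j))"
    using summable_norm_exp[of ?z] by (simp add: scaleR_conv_of_real divide_inverse norm_mult mult.commute)
  have e: "(\<lambda>j. ?z ^ j / fact j) sums exp ?z"
    using exp_converges[of ?z] by (simp add: scaleR_conv_of_real divide_inverse mult.commute)
  have term_eq: "(\<i> * of_real t) ^ Suc j / fact (Suc j) * of_real v ^ Suc j = ?z ^ Suc j / fact (Suc j)" for j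
    by (simp add: power_mult_distrib)
  have "integrable (count_space UNIV) (\<lambda>j. ?z ^ Suc j / fact (Suc j))"
    unfolding integrable_count_space_nat_iff using s by (subst summable_Suc_iff)
  then have "(\<integral>j. ?z ^ Suc j / fact (Suc j) \<partial>count_space UNIV) = (\<Sum>j. ?z ^ Suc j / fact (Suc j))"
    by (rule integral_count_space_nat)
  also have "\<dots> = exp ?z - 1"
    using suminf_split_head[OF sums_summable[OF e]] sums_unique[OF e] by simp
  finally show ?thesis unfolding term_eq that cis_conv_exp by simp
qed

text \<open>The product rule is linear in the full-weight bound, so a power of \<open>v\<close>
  contains \<open>X\<close> once and otherwise only \<open>Y\<close>. Therefore \<open>X\<close>
  stays outside the exponential.\<close>

lemma mod_bdd_exp_series:
  "\<exists>C>0. \<forall>\<Xi> X Y t v. 0 < \<Xi> \<longrightarrow> \<bar>t\<bar> \<le> \<Xi> \<longrightarrow> mod_bdd X Y (\<lambda>x. complex_of_real (v x)) \<longrightarrow>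
     mod_bdd (2 * (\<Xi> * X * exp (C * \<Xi> * Y))) (2 * (\<Xi> * Y * exp (C * \<Xi> * Y))) (\<lambda>x. cis (t * v x) - 1)"
proof -
  obtain C2 where C2: "C2 > 0" "\<And>X X' g Y Y' h. mod_bdd X X' g \<Longrightarrow> mod_bdd Y Y' h \<Longrightarrow>
     mod_bdd (C2 * (X * Y' + X' * Y)) (C2 * (X' * Y')) (\<lambda>x. g x * h x)" using mod_bdd_mult by blast
  have "mod_bdd (2 * (\<Xi> * X * exp (2 * C2 * \<Xi> * Y))) (2 * (\<Xi> * Y * exp (2 * C2 * \<Xi> * Y))) (\<lambda>x. cis (t * v x) - 1)"
    if Xi: "0 < \<Xi>" and t: "\<bar>t\<bar> \<le> \<Xi>" and v: "mod_bdd X Y (\<lambda>x. complex_of_real (v x))" for \<Xi> X Y t v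
  proof -
    have X: "0 < X" "0 < Y" using v by (auto simp: mod_bdd_def)
    have vm[measurable]: "v \<in> borel_measurable borel" using measurable_compose[OF mod_bdd_measurable[OF v] borel_measurable_Re] by simp
    have pw: "mod_bdd ((2 * C2 * Y) ^ j * X) ((2 * C2 * Y) ^ j * Y) (\<lambda>x. complex_of_real (v x) ^ Suc j)" for j
    proof -
      \<comment> \<open>The two components are given different rates on purpose: both terms of the
        product rule are at most \<open>C2 * Y\<close> times the old bound for \<open>X\<close>, and
        their sum is covered by the doubled rate.\<close>
      have "mod_bdd ((2 * C2 * Y) ^ j * X) ((C2 * Y) ^ j * Y) (\<lambda>x. complex_of_real (v x) ^ Suc j)"
      proof (induction j)
        case 0
        then show ?case using v by simp
      next
        case (Suc j)
        have le: "(C2 * Y) ^ j \<le> (2 * C2 * Y) ^ j" using C2 X by (intro power_mono) auto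
        have "mod_bdd (C2 * (X * ((C2 * Y) ^ j * Y) + Y * ((2 * C2 * Y) ^ j * X))) (C2 * (Y * ((C2 * Y) ^ j * Y))) (\<lambda>x. complex_of_real (v x) * complex_of_real (v x) ^ Suc j)"
          by (rule C2(2)[OF v Suc])
        then have "mod_bdd (C2 * (X * ((C2 * Y) ^ j * Y) + Y * ((2 * C2 * Y) ^ j * X))) (C2 * (Y * ((C2 * Y) ^ j * Y))) (\<lambda>x. complex_of_real (v x) ^ Suc (Suc j))"
          by (simp only: power_Suc)
        then show ?case
        proof (rule mod_bdd_mono)
          have "C2 * (X * ((C2 * Y) ^ j * Y) + Y * ((2 * C2 * Y) ^ j * X)) \<le> C2 * (X * ((2 * C2 * Y) ^ j * Y) + Y * ((2 * C2 * Y) ^ j * X))"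
            using C2(1) X le by (intro mult_left_mono add_mono mult_right_mono) auto
          also have "\<dots> = (2 * C2 * Y) ^ Suc j * X" by (simp add: algebra_simps)
          finally show "C2 * (X * ((C2 * Y) ^ j * Y) + Y * ((2 * C2 * Y) ^ j * X)) \<le> (2 * C2 * Y) ^ Suc j * X" .
        qed simp_all
      qed
      then show ?thesis
        by (rule mod_bdd_mono) (use C2 X in \<open>auto intro!: mult_right_mono power_mono\<close>)
    qed
    let ?c = "\<lambda>j. (\<i> * complex_of_real t) ^ Suc j / fact (Suc j)"
    define z where "z = 2 * C2 * \<Xi> * Y"
    have z: "0 < z" using C2 X Xi by (simp add: z_def)
    have G: "mod_bdd (\<Xi> * X * (z ^ j / fact j)) (\<Xi> * Y * (z ^ j / fact j)) (\<lambda>x. ?c j * complex_of_real (v x) ^ Suc j)" for j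
    proof -
      have "norm (?c j) = \<bar>t\<bar> ^ Suc j / fact (Suc j)" by (simp add: norm_divide norm_power norm_mult del: fact_Suc)
      also have "\<dots> \<le> \<Xi> ^ Suc j / fact j"
        using t Xi by (intro frac_le power_mono fact_mono) auto
      finally have n: "norm (?c j) \<le> \<Xi> ^ Suc j / fact j" .
      have "mod_bdd (\<Xi> ^ Suc j / fact j * ((2 * C2 * Y) ^ j * X)) (\<Xi> ^ Suc j / fact j * ((2 * C2 * Y) ^ j * Y)) (\<lambda>x. ?c j * complex_of_real (v x) ^ Suc j)"
        by (rule mod_bdd_scale[OF pw _ n]) (use Xi in simp)
      then show ?thesis by (simp add: z_def power_mult_distrib mult_ac)
    qed
    have sf: "sigma_finite_measure (count_space (UNIV :: nat set))" by (rule sigma_finite_measure_count_space_countable) auto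
    have jm: "(\<lambda>(j, x). ?c j * complex_of_real (v x) ^ Suc j) \<in> borel_measurable (count_space UNIV \<Otimes>\<^sub>M borel)"
      by (rule measurable_pair_measure_countable1) auto
    have sums: "(\<integral>\<^sup>+j. ennreal (W * (z ^ j / fact j)) \<partial>count_space UNIV) \<le> ennreal (W * exp z)" if "0 < W" for W
    proof -
      have "(\<integral>\<^sup>+j. ennreal (W * (z ^ j / fact j)) \<partial>count_space UNIV) = (\<integral>\<^sup>+j. ennreal W * ennreal (z ^ j / fact j) \<partial>count_space UNIV)"
        using that by (intro nn_integral_cong ennreal_mult') simp
      also have "\<dots> = ennreal W * ennreal (exp z)" using nn_sum_exp[of z] z by (subst nn_integral_cmult) auto
      also have "\<dots> = ennreal (W * exp z)" using that by (simp add: ennreal_mult')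
      finally show ?thesis by simp
    qed
    have "mod_bdd (2 * (\<Xi> * X * exp z)) (2 * (\<Xi> * Y * exp z)) (\<lambda>x. \<integral>j. ?c j * complex_of_real (v x) ^ Suc j \<partial>count_space UNIV)"
      by (rule mod_bdd_integral[OF sf jm _ _ G sums _ sums]) (use Xi X in auto)
    then show ?thesis using cis_minus_1_series[of _ t] by (simp add: z_def)
  qed
  then show ?thesis using C2(1) by (intro exI[of _ "2 * C2"]) auto
qed

end

lemma norm_cis_minus_1_le: "norm (cis y - 1) \<le> \<bar>y\<bar>"
proof -
  have "norm (iexp y - (\<Sum>k\<le>0. (\<i> * y) ^ k / fact k)) \<le> \<bar>y\<bar> ^ Suc 0 / fact (Suc 0)"
    by (rule iexp_approx1)
  then show ?thesis by (simp add: cis_conv_exp)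
qed

section \<open>Low and high frequencies\<close>

context modulation_setting
begin

text \<open>A bounded \<alpha> lets the full-weight bound imply the half-weight one, so a single
  estimate of the boxes suffices.\<close>

lemma mod_bdd_of_box_bound:
  assumes "0 < X" "\<And>k. \<alpha> k \<le> B" "Lp_bdd r c g"
    and "\<And>l. Lp_bdd r (X * (exp (- wl l) * \<alpha> l)) (conv (Kb l) g)"
  shows "mod_bdd X (X * B) g"
proof -
  have B: "0 < B" using alpha_pos[of 0] assms(2)[of 0] by linarith
  have "Lp_bdd r (X * B * exp (- wl l / 2)) (conv (Kb l) g)" for l
  proof (rule Lp_bdd_mono[OF assms(4)])
    have "exp (- wl l) * \<alpha> l \<le> exp (- wl l / 2) * B"
      using wl_ge_1[of l] alpha_pos[of l] assms(2) by (intro mult_mono) (auto simp: less_imp_le)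
    then show "X * (exp (- wl l) * \<alpha> l) \<le> X * B * exp (- wl l / 2)"
      using assms(1) by (simp add: mult.assoc mult.commute[of B])
  qed (use r in simp)
  then show ?thesis using assms B unfolding mod_bdd_def by auto
qed

lemma exists_large_component:
  "\<exists>i. norm (lattice_vec (l :: int^'n)) \<le> real CARD('n) * real_of_int \<bar>l $ i\<bar>"
proof -
  define M where "M = Max (range (\<lambda>i. \<bar>l $ i\<bar>))"
  have "M \<in> range (\<lambda>i. \<bar>l $ i\<bar>)" unfolding M_def by (intro Max_in) auto
  then obtain i where i: "M = \<bar>l $ i\<bar>" by auto
  have "\<bar>l $ j\<bar> \<le> M" for j unfolding M_def by (intro Max_ge) auto
  then have "\<bar>real_of_int (l $ j)\<bar> \<le> real_of_int M" for j by (metis of_int_abs of_int_le_iff)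
  then have "lattice_vec l \<in> cube 0 (real_of_int M)" by (simp add: cube_def)
  from norm_le_of_cube[OF this] show ?thesis unfolding i by blast
qed

lemma spec_power:
  fixes g :: "real^'n \<Rightarrow> complex"
  assumes "spec_in (cube 0 s) g"
  shows "spec_in (cube 0 (real j * s)) (\<lambda>x. g x ^ j)"
proof (induction j)
  case 0
  then show ?case using spec_in_one[of "cube 0 0 :: (real^'n) set"] by (simp add: cube_def)
next
  case (Suc j)
  have "spec_in (cube 0 (real (Suc j) * s)) (\<lambda>x. g x * g x ^ j)"
  proof (rule spec_in_mult[OF assms Suc])
    fix b b' :: "real^'n" assume a: "b \<in> cube 0 s" "b' \<in> cube 0 (real j * s)"
    have "\<bar>(b + b') $ i\<bar> \<le> real (Suc j) * s" for i
    proof -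
      have "\<bar>b $ i\<bar> \<le> s" "\<bar>b' $ i\<bar> \<le> real j * s" using a by (auto simp: cube_def)
      then show ?thesis using abs_triangle_ineq[of "b $ i" "b' $ i"] by (simp add: algebra_simps)
    qed
    then show "b + b' \<in> cube 0 (real (Suc j) * s)" by (simp add: cube_def)
  qed
  then show ?case by simp
qed

text \<open>The terms of order \<open>j\<close> of the exponential series only contribute to boxes within \<open>3Rj\<close> of
  the origin, so that the box at distance \<open>M\<close> only sees the tail \<open>j \<ge> M / (3R)\<close>.\<close>

lemma low_frequency_tail:
  assumes U0: "Lp_bdd r c (\<lambda>x. complex_of_real (v x))" "AE x in lborel. norm (complex_of_real (v x)) \<le> c"
    and spec: "spec_in (cube 0 (3 * R)) (\<lambda>x. complex_of_real (v x))"
    and c: "1 \<le> c" and Xi: "1 \<le> \<Xi>" "\<bar>t\<bar> \<le> \<Xi>" and R: "0 < R"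
  shows "Lp_bdd r (4 * A0 * exp (2 * (exp 2 * \<Xi> * c) - 2 * ((real_of_int \<bar>l $ i\<bar> - 1) / (3 * R))))
    (conv (Kb l) (\<lambda>x. cis (t * v x) - 1))"
proof -
  let ?U = "\<lambda>x. complex_of_real (v x)"
  \<comment> \<open>Only terms of order at least \<open>J\<close> have a spectrum that reaches the
    box \<open>l\<close>.\<close>
  define J where "J = (real_of_int \<bar>l $ i\<bar> - 1) / (3 * R)"
  \<comment> \<open>The factor \<open>exp 2\<close> lets the tail be summed as a full series: a term
    of order at least \<open>J\<close> may be multiplied by
    \<open>exp (2 * (order - J)) \<ge> 1\<close>.\<close>
  define z where "z = exp 2 * \<Xi> * c"
  have z: "0 < z" using Xi c by (simp add: z_def)
  have Um[measurable]: "?U \<in> borel_measurable borel" using U0(1) by (simp add: Lp_bdd_def)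
  have vm[measurable]: "v \<in> borel_measurable borel" using measurable_compose[OF Um borel_measurable_Re] by simp
  have Upow: "Lp_bdd r (c ^ Suc j) (\<lambda>x. ?U x ^ Suc j)" for j
  proof (induction j)
    case 0
    then show ?case using U0(1) by simp
  next
    case (Suc j)
    have "Lp_bdd r (c * c ^ Suc j) (\<lambda>x. ?U x * ?U x ^ Suc j)"
      using c r by (intro Lp_bdd_mult_bounded[OF Suc _ Um U0(2)]) auto
    then show ?case by (simp only: power_Suc)
  qed
  let ?c = "\<lambda>j. (\<i> * complex_of_real t) ^ Suc j / fact (Suc j)"
  have nc: "norm (?c j) \<le> \<Xi> ^ Suc j / fact j" for j
  proof -
    have "norm (?c j) = \<bar>t\<bar> ^ Suc j / fact (Suc j)" by (simp add: norm_divide norm_power norm_mult del: fact_Suc)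
    also have "\<dots> \<le> \<Xi> ^ Suc j / fact j" using Xi by (intro frac_le power_mono fact_mono) auto
    finally show ?thesis .
  qed
  have G: "Lp_bdd r (\<Xi> ^ Suc j / fact j * c ^ Suc j) (\<lambda>x. ?c j * ?U x ^ Suc j)" for j
    using Xi r by (intro Lp_bdd_scale[OF Upow _ nc]) auto
  have box_term: "Lp_bdd r (2 * A0 * exp (- 2 * J) * z * (z ^ j / fact j)) (conv (Kb l) (\<lambda>x. ?c j * ?U x ^ Suc j))" for j
  proof (cases "real_of_int \<bar>l $ i\<bar> \<le> real (Suc j) * (3 * R) + 1")
    case True
    then have "J \<le> real (Suc j)" using R unfolding J_def by (simp add: divide_le_eq)
    then have "1 \<le> exp (2 * real (Suc j) - 2 * J)" by simp
    also have "\<dots> = exp (- 2 * J) * exp 2 ^ Suc j"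
      by (simp add: exp_of_nat_mult[symmetric] mult.commute flip: exp_add)
    finally have 1: "1 \<le> exp (- 2 * J) * exp 2 ^ Suc j" .
    define q where "q = \<Xi> ^ Suc j / fact j * c ^ Suc j"
    have q: "0 \<le> q" using Xi c by (simp add: q_def)
    have "z * (z ^ j / fact j) = z ^ Suc j / fact j" by simp
    also have "z ^ Suc j = exp 2 ^ Suc j * \<Xi> ^ Suc j * c ^ Suc j" unfolding z_def by (simp only: power_mult_distrib)
    finally have zz: "z * (z ^ j / fact j) = q * exp 2 ^ Suc j"
      by (simp only: q_def mult_ac times_divide_eq_right times_divide_eq_left)
    have "2 * (A0 * q) * 1 \<le> 2 * (A0 * q) * (exp (- 2 * J) * exp 2 ^ Suc j)"
      using A0_pos q by (intro mult_left_mono 1) auto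
    also have "\<dots> = 2 * A0 * exp (- 2 * J) * (q * exp 2 ^ Suc j)" by (simp only: mult_ac)
    also have "\<dots> = 2 * A0 * exp (- 2 * J) * z * (z ^ j / fact j)" by (simp only: zz[symmetric] mult.assoc)
    finally have le: "2 * (A0 * q) \<le> 2 * A0 * exp (- 2 * J) * z * (z ^ j / fact j)" by (simp only: mult_1_right)
    have "Lp_bdd r (2 * (A0 * q)) (conv (Kb l) (\<lambda>x. ?c j * ?U x ^ Suc j))"
      unfolding q_def by (rule Lp_bdd_conv[OF r Kb_kernel G])
    then show ?thesis using le by (rule Lp_bdd_mono) (use r in simp)
  next
    case False
    have "conv (Kb l) (\<lambda>x. ?U x ^ Suc j) x = 0" for x
      by (rule conv_Kb_far[OF spec_power[OF spec], where i=i]) (use False in simp)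
    then have "conv (Kb l) (\<lambda>x. ?c j * ?U x ^ Suc j) = (\<lambda>_. 0)"
      by (intro ext) (simp only: conv_cmult mult_zero_right)
    moreover have "0 < 2 * A0 * exp (- 2 * J) * z * (z ^ j / fact j)" using A0_pos z by simp
    ultimately show ?thesis using Lp_bdd_zero by (simp only:)
  qed
  have sf: "sigma_finite_measure (count_space (UNIV :: nat set))" by (rule sigma_finite_measure_count_space_countable) auto
  have jm: "(\<lambda>(j, x). ?c j * ?U x ^ Suc j) \<in> borel_measurable (count_space UNIV \<Otimes>\<^sub>M borel)"
    by (rule measurable_pair_measure_countable1) auto
  have jm2: "(\<lambda>(j, x). conv (Kb l) (\<lambda>x. ?c j * ?U x ^ Suc j) x) \<in> borel_measurable (count_space UNIV \<Otimes>\<^sub>M borel)"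
    by (rule measurable_pair_measure_countable1) (auto intro!: conv_measurable)
  have sums: "(\<integral>\<^sup>+j. ennreal (W * (y ^ j / fact j)) \<partial>count_space UNIV) = ennreal (W * exp y)" if "0 < W" "0 < y" for W y
  proof -
    have "(\<integral>\<^sup>+j. ennreal (W * (y ^ j / fact j)) \<partial>count_space UNIV) = (\<integral>\<^sup>+j. ennreal W * ennreal (y ^ j / fact j) \<partial>count_space UNIV)"
      using that by (intro nn_integral_cong ennreal_mult') simp
    also have "\<dots> = ennreal W * ennreal (exp y)" using nn_sum_exp[of y] that by (subst nn_integral_cmult) auto
    also have "\<dots> = ennreal (W * exp y)" using that by (simp add: ennreal_mult')
    finally show ?thesis by simp
  qed
  have fin: "(\<integral>\<^sup>+j. ennreal (\<Xi> ^ Suc j / fact j * c ^ Suc j) \<partial>count_space UNIV) < \<infinity>"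
  proof -
    have "\<Xi> ^ Suc j / fact j * c ^ Suc j = \<Xi> * c * ((\<Xi> * c) ^ j / fact j)" for j by (simp add: power_mult_distrib)
    then show ?thesis using sums[of "\<Xi> * c" "\<Xi> * c"] Xi c by (simp only:) simp
  qed
  have "conv (Kb l) (\<lambda>x. cis (t * v x) - 1) = conv (Kb l) (\<lambda>x. \<integral>j. ?c j * ?U x ^ Suc j \<partial>count_space UNIV)"
    by (simp only: cis_minus_1_series[OF refl])
  also have "\<dots> = (\<lambda>x. \<integral>j. conv (Kb l) (\<lambda>x. ?c j * ?U x ^ Suc j) x \<partial>count_space UNIV)"
    by (rule ext, rule conv_integral[OF r sf Kb_kernel jm G _ fin]) auto
  finally have eq: "conv (Kb l) (\<lambda>x. cis (t * v x) - 1) = (\<lambda>x. \<integral>j. conv (Kb l) (\<lambda>x. ?c j * ?U x ^ Suc j) x \<partial>count_space UNIV)" .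
  have W: "0 < 2 * A0 * exp (- 2 * J) * z" using A0_pos z by simp
  have fin': "Lp_bdd r (2 * (2 * A0 * exp (- 2 * J) * z * exp z)) (conv (Kb l) (\<lambda>x. cis (t * v x) - 1))"
    unfolding eq by (rule Lp_bdd_integral[OF r _ sf jm2 _ box_term]) (use W sums[OF W z] in auto)
  have "2 * (2 * A0 * exp (- 2 * J) * z * exp z) \<le> 4 * A0 * exp (2 * z - 2 * J)"
  proof -
    have "z \<le> exp z" using exp_ge_add_one_self[of z] by linarith
    then have "z * exp z \<le> exp z * exp z" by (intro mult_right_mono) auto
    then have "4 * A0 * exp (- 2 * J) * (z * exp z) \<le> 4 * A0 * exp (- 2 * J) * (exp z * exp z)"
      using A0_pos by (intro mult_left_mono) auto
    also have "\<dots> = 4 * A0 * exp (2 * z - 2 * J)" by (simp add: mult.assoc exp_add[symmetric])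
    finally show ?thesis by (simp add: mult_ac)
  qed
  from Lp_bdd_mono[OF fin' this] show ?thesis using r unfolding J_def z_def by simp
qed

text \<open>There are two regimes. If \<open>J < 2 * z\<close>, the box lies within
  \<open>L * R * \<Xi>\<close>, and the crude bound
  \<open>norm (cis y - 1) \<le> \<bar>y\<bar>\<close> is multiplied by the weight at that distance.
  Otherwise the tail leaves \<open>exp (- J)\<close>, while the frequency is of order
  \<open>J\<^sup>2\<close>, so the weight, small compared with a square root, costs less than
  that.\<close>

lemma low_frequency_bound:
  assumes B: "\<And>k. \<alpha> k \<le> B" and c: "1 \<le> c" and e: "0 < e" "e \<le> 1" and h: "0 < \<eta>"
  shows "\<exists>K>0. \<exists>L\<ge>1. \<forall>\<Xi> t R v. 1 \<le> \<Xi> \<longrightarrow> \<bar>t\<bar> \<le> \<Xi> \<longrightarrow> R = \<Xi> powr e + 1 \<longrightarrow>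
    Lp_bdd r c (\<lambda>x. complex_of_real (v x)) \<longrightarrow> (AE x in lborel. norm (complex_of_real (v x)) \<le> c) \<longrightarrow>
    spec_in (cube 0 (3 * R)) (\<lambda>x. complex_of_real (v x)) \<longrightarrow>
    mod_bdd (K * \<Xi> * exp ((1 + \<eta>) * w (L * R * \<Xi>))) (K * \<Xi> * exp ((1 + \<eta>) * w (L * R * \<Xi>)) * B) (\<lambda>x. cis (t * v x) - 1)"
proof -
  let ?n = "real CARD('n)" and ?N = "2 * CARD('n)"
  \<comment> \<open>For \<open>J < 2 * z\<close> a component of \<open>l\<close> is at most
    \<open>3 * R * (2 * z) + 1\<close>, and \<open>?n\<close> passes from the largest component to
    the norm.\<close>
  define L where "L = ?n * (6 * exp 2 * c + 1)"
  have n1: "1 \<le> ?n" by (simp add: Suc_leI)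
  have L: "1 \<le> L"
  proof -
    have "1 * 1 \<le> ?n * (6 * exp 2 * c + 1)" using c n1 by (intro mult_mono) auto
    then show ?thesis by (simp add: L_def)
  qed
  obtain D2 where D2: "D2 \<ge> 1" "\<And>s. 0 \<le> s \<Longrightarrow> (1 + s) powr real ?N \<le> D2 * exp (\<eta> * w s)" using power_le_exp_w[OF h] by blast
  obtain D3 where D3: "D3 \<ge> 1" "\<And>s. 0 \<le> s \<Longrightarrow> (1 + s) powr real ?N \<le> D3 * exp (1 * w s)" using power_le_exp_w[of 1] by auto
  \<comment> \<open>The coefficient makes the weight at \<open>4 * ?n * J\<^sup>2\<close> at most
    \<open>J / 2 + C9\<close>. It is needed twice, once for the weight and once for the polynomial
    factor, which uses up \<open>exp J\<close>.\<close>
  obtain C9 where C9: "C9 \<ge> 0" "\<And>s. 0 \<le> s \<Longrightarrow> w s \<le> 1 / (2 * sqrt (4 * ?n)) * sqrt s + C9"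
    using w_le_sqrt[of "1 / (2 * sqrt (4 * ?n))"] n1 by auto
  \<comment> \<open>One summand for each regime; division by \<open>\<alpha> 0\<close> prepares for
    the lower bound on \<alpha>.\<close>
  define K where "K = (2 * A0 * c * D2 + 4 * A0 * D3 * exp (2 * C9)) / \<alpha> 0"
  have K: "0 < K" using A0_pos c D2 D3 alpha_pos[of 0] by (simp add: K_def add_pos_pos)
  have jbp: "jb l ^ ?N \<le> (1 + s) powr real ?N" if "norm (lattice_vec l) \<le> s" for l :: "int^'n" and s
  proof -
    have "jb l ^ ?N \<le> (1 + s) ^ ?N" using that by (intro power_mono) (auto simp: jb_def)
    moreover have "0 < 1 + s" using that norm_ge_zero[of "lattice_vec l"] by linarith
    ultimately show ?thesis by (simp add: powr_realpow del: of_nat_mult)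
  qed
  have al: "1 \<le> jb l ^ ?N / \<alpha> 0 * \<alpha> l" for l
    using moderate_ge_lw[OF mod, of l] alpha_pos[of 0] jb_pos[of l] by (simp add: lw_def field_simps)
  have "mod_bdd (K * \<Xi> * exp ((1 + \<eta>) * w (L * R * \<Xi>))) (K * \<Xi> * exp ((1 + \<eta>) * w (L * R * \<Xi>)) * B) (\<lambda>x. cis (t * v x) - 1)"
    if Xi: "1 \<le> \<Xi>" "\<bar>t\<bar> \<le> \<Xi>" and R: "R = \<Xi> powr e + 1" and U: "Lp_bdd r c (\<lambda>x. complex_of_real (v x))"
      and Us: "AE x in lborel. norm (complex_of_real (v x)) \<le> c" and sp: "spec_in (cube 0 (3 * R)) (\<lambda>x. complex_of_real (v x))"
    for \<Xi> t R v
  proof (rule mod_bdd_of_box_bound[OF _ B])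
    let ?W = "w (L * R * \<Xi>)"
    let ?Z = "K * \<Xi> * exp ((1 + \<eta>) * ?W)"
    have "0 \<le> \<Xi> powr e" by simp
    then have R1: "1 \<le> R" "0 < R" unfolding R by linarith+
    have RX: "R \<le> 2 * \<Xi>"
    proof -
      have "\<Xi> powr e \<le> \<Xi> powr 1" using Xi e by (intro powr_mono) auto
      then show ?thesis using Xi by (simp add: R)
    qed
    have LRX: "0 \<le> L * R * \<Xi>" using L R1 Xi by simp
    show "0 < ?Z" using K Xi by simp
    have Um[measurable]: "(\<lambda>x. complex_of_real (v x)) \<in> borel_measurable borel" using U by (simp add: Lp_bdd_def)
    have vm[measurable]: "v \<in> borel_measurable borel" using measurable_compose[OF Um borel_measurable_Re] by simp
    have "Lp_bdd r (\<Xi> * c) (\<lambda>x. complex_of_real t * complex_of_real (v x))" using Xi r by (intro Lp_bdd_scale[OF U]) auto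
    then show E: "Lp_bdd r (\<Xi> * c) (\<lambda>x. cis (t * v x) - 1)"
      by (rule Lp_bdd_dom) (use r norm_cis_minus_1_le in \<open>auto simp: norm_mult abs_mult intro!: AE_I2 order_trans[OF norm_cis_minus_1_le]\<close>)
    fix l :: "int^'n"
    obtain i where i: "norm (lattice_vec l) \<le> ?n * real_of_int \<bar>l $ i\<bar>" using exists_large_component by blast
    define J where "J = (real_of_int \<bar>l $ i\<bar> - 1) / (3 * R)"
    define z where "z = exp 2 * \<Xi> * c"
    have e2: "1 \<le> exp (2::real)" by simp
    have zX: "\<Xi> \<le> z"
    proof -
      have "1 * \<Xi> * 1 \<le> exp 2 * \<Xi> * c" using e2 c Xi by (intro mult_mono) auto
      then show ?thesis by (simp add: z_def)
    qed
    have M: "real_of_int \<bar>l $ i\<bar> = 3 * R * J + 1" using R1 by (simp add: J_def)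
    \<comment> \<open>A bound that ignores \<alpha> is converted by \<open>al\<close>: \<alpha> is
      at least \<open>\<alpha> 0\<close> divided by a polynomial factor.\<close>
    have core: "Lp_bdd r (?Z * (exp (- wl l) * \<alpha> l)) (conv (Kb l) (\<lambda>x. cis (t * v x) - 1))"
      if b: "Lp_bdd r b (conv (Kb l) (\<lambda>x. cis (t * v x) - 1))" and le: "b * (exp (wl l) * jb l ^ ?N) \<le> \<alpha> 0 * ?Z" for b
    proof (rule Lp_bdd_mono[OF b])
      have b0: "0 < b" using b by (rule Lp_bdd_pos)
      have "b * 1 \<le> b * (jb l ^ ?N / \<alpha> 0 * \<alpha> l)" using b0 by (intro mult_left_mono al) simp
      also have "\<dots> = (b * (exp (wl l) * jb l ^ ?N)) * (exp (- wl l) * \<alpha> l) / \<alpha> 0" by (simp add: exp_minus field_simps)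
      also have "\<dots> \<le> (\<alpha> 0 * ?Z) * (exp (- wl l) * \<alpha> l) / \<alpha> 0"
        using alpha_pos[of l] alpha_pos[of 0] by (intro divide_right_mono mult_right_mono le) auto
      also have "\<dots> = ?Z * (exp (- wl l) * \<alpha> l)" using alpha_pos[of 0] by simp
      finally show "b \<le> ?Z * (exp (- wl l) * \<alpha> l)" by simp
    qed (use r in simp)
    show "Lp_bdd r (?Z * (exp (- wl l) * \<alpha> l)) (conv (Kb l) (\<lambda>x. cis (t * v x) - 1))"
    proof (cases "J < 2 * z")
      case True
      show ?thesis
      proof (rule core[OF Lp_bdd_conv[OF r Kb_kernel E]])
        have "real_of_int \<bar>l $ i\<bar> \<le> 3 * R * (2 * z) + 1" unfolding M using True R1 by simp
        also have "\<dots> \<le> 6 * exp 2 * c * (R * \<Xi>) + R * \<Xi>"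
          using R1 Xi mult_mono[of 1 R 1 \<Xi>] by (simp add: z_def mult_ac)
        also have "\<dots> = (6 * exp 2 * c + 1) * (R * \<Xi>)" by (simp add: algebra_simps)
        finally have "?n * real_of_int \<bar>l $ i\<bar> \<le> ?n * ((6 * exp 2 * c + 1) * (R * \<Xi>))" by (intro mult_left_mono) auto
        then have nl: "norm (lattice_vec l) \<le> L * R * \<Xi>" using i unfolding L_def mult.assoc by linarith
        have "wl l \<le> ?W" unfolding wl_def using nl by (intro w_mono) auto
        moreover have "jb l ^ ?N \<le> D2 * exp (\<eta> * ?W)" using jbp[OF nl] D2(2)[OF LRX] by linarith
        ultimately have "exp (wl l) * jb l ^ ?N \<le> exp ?W * (D2 * exp (\<eta> * ?W))" using jb_pos[of l] by (intro mult_mono) auto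
        also have "\<dots> = D2 * exp ((1 + \<eta>) * ?W)" by (simp add: algebra_simps flip: exp_add)
        finally have "2 * (A0 * (\<Xi> * c)) * (exp (wl l) * jb l ^ ?N) \<le> 2 * (A0 * (\<Xi> * c)) * (D2 * exp ((1 + \<eta>) * ?W))"
          using A0_pos Xi c by (intro mult_left_mono) auto
        also have "\<dots> = (2 * A0 * c * D2) * (\<Xi> * exp ((1 + \<eta>) * ?W))" by (simp add: mult_ac)
        also have "\<dots> \<le> (2 * A0 * c * D2 + 4 * A0 * D3 * exp (2 * C9)) * (\<Xi> * exp ((1 + \<eta>) * ?W))"
          using A0_pos D3 Xi by (intro mult_right_mono) auto
        also have "\<dots> = \<alpha> 0 * ?Z" using alpha_pos[of 0] by (simp add: K_def)
        finally show "2 * (A0 * (\<Xi> * c)) * (exp (wl l) * jb l ^ ?N) \<le> \<alpha> 0 * ?Z" .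
      qed
    next
      case False
      then have J: "2 * z \<le> J" by simp
      have J2: "2 \<le> J" "2 * \<Xi> \<le> J" using J zX Xi by auto
      have "4 * A0 * exp (2 * z - 2 * J) \<le> 4 * A0 * exp (- J)" using J A0_pos by simp
      from Lp_bdd_mono[OF low_frequency_tail[OF U Us sp c Xi R1(2), of l i, folded J_def z_def] this]
      have tail: "Lp_bdd r (4 * A0 * exp (- J)) (conv (Kb l) (\<lambda>x. cis (t * v x) - 1))" using r by simp
      show ?thesis
      proof (rule core[OF tail])
        \<comment> \<open>Here \<open>e \<le> 1\<close> enters: it gives
          \<open>R \<le> 2 * \<Xi>\<close>, and \<open>2 * \<Xi> \<le> J\<close> in this
          regime.\<close>
        have "R * J \<le> J * J" using RX J2 by (intro mult_right_mono) auto
        moreover have "2 * 2 \<le> J * J" using J2 by (intro mult_mono) auto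
        ultimately have "real_of_int \<bar>l $ i\<bar> \<le> 4 * (J * J)" unfolding M by (simp add: mult.assoc)
        then have "?n * real_of_int \<bar>l $ i\<bar> \<le> ?n * (4 * (J * J))" by (intro mult_left_mono) auto
        also have "\<dots> = 4 * ?n * J\<^sup>2" by (simp add: power2_eq_square)
        finally have nl: "norm (lattice_vec l) \<le> 4 * ?n * J\<^sup>2" using i by linarith
        let ?V = "w (4 * ?n * J\<^sup>2)"
        have "?V \<le> 1 / (2 * sqrt (4 * ?n)) * sqrt (4 * ?n * J\<^sup>2) + C9" by (rule C9(2)) simp
        also have "sqrt (4 * ?n * J\<^sup>2) = sqrt (4 * ?n) * J" using J2 by (simp add: real_sqrt_mult)
        also have "1 / (2 * sqrt (4 * ?n)) * (sqrt (4 * ?n) * J) = J / 2" using n1 by simp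
        finally have V: "?V \<le> J / 2 + C9" .
        have "wl l \<le> ?V" unfolding wl_def using nl by (intro w_mono) auto
        moreover have "jb l ^ ?N \<le> D3 * exp ?V" using jbp[OF nl] D3(2)[of "4 * ?n * J\<^sup>2"] by simp
        ultimately have "exp (wl l) * jb l ^ ?N \<le> exp ?V * (D3 * exp ?V)" using jb_pos[of l] by (intro mult_mono) auto
        also have "\<dots> = D3 * exp (2 * ?V)" by (simp add: mult.left_commute flip: exp_add)
        also have "\<dots> \<le> D3 * exp (J + 2 * C9)" using V D3(1) by (intro mult_left_mono) auto
        finally have "4 * A0 * exp (- J) * (exp (wl l) * jb l ^ ?N) \<le> 4 * A0 * exp (- J) * (D3 * exp (J + 2 * C9))"
          using A0_pos by (intro mult_left_mono) auto
        also have "\<dots> = 4 * A0 * D3 * exp (2 * C9) * 1" by (simp add: exp_add exp_minus)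
        also have "\<dots> \<le> (2 * A0 * c * D2 + 4 * A0 * D3 * exp (2 * C9)) * (\<Xi> * exp ((1 + \<eta>) * ?W))"
        proof (intro mult_mono)
          have "1 * 1 \<le> \<Xi> * exp ((1 + \<eta>) * ?W)" using Xi h w_ge_1[OF LRX] by (intro mult_mono) auto
          then show "1 \<le> \<Xi> * exp ((1 + \<eta>) * ?W)" by simp
        qed (use A0_pos D2 D3 c in auto)
        also have "\<dots> = \<alpha> 0 * ?Z" using alpha_pos[of 0] by (simp add: K_def)
        finally show "4 * A0 * exp (- J) * (exp (wl l) * jb l ^ ?N) \<le> \<alpha> 0 * ?Z" .
      qed
    qed
  qed
  then show ?thesis using K L by blast
qed

text \<open>A box of \<open>u - v\<close> vanishes unless a component of its index exceeds
  \<open>\<Xi> powr e\<close>. For the remaining boxes half of the weight is at least \<Xi> up to a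
  constant, so passing from the full to the half weight gains \<open>1 / \<Xi>\<close>.\<close>

lemma low_high_split:
  assumes B: "\<And>k. \<alpha> k \<le> B" and u: "mod_bdd X Y (\<lambda>x. complex_of_real (u x))" and e: "0 < e"
  shows "\<exists>c\<ge>1. \<exists>X'>0. \<exists>Y'>0. \<forall>\<Xi>\<ge>1. \<exists>v.
    Lp_bdd r c (\<lambda>x. complex_of_real (v x)) \<and> (AE x in lborel. norm (complex_of_real (v x)) \<le> c) \<and>
    spec_in (cube 0 (3 * (\<Xi> powr e + 1))) (\<lambda>x. complex_of_real (v x)) \<and>
    mod_bdd X' (Y' / \<Xi>) (\<lambda>x. complex_of_real (u x - v x))"
proof -
  let ?U = "\<lambda>x. complex_of_real (u x)"
  obtain A where A: "A > 0" "\<And>R. 1 \<le> R \<Longrightarrow> \<exists>B (\<sigma> :: real^'n \<Rightarrow> complex) \<kappa>. fourier_pair B \<sigma> \<kappa> \<and> (\<integral>\<^sup>+x. norm (\<kappa> x) \<partial>lborel) \<le> ennreal A \<and> (\<forall>x. cnj (\<kappa> x) = \<kappa> x) \<and>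
     (\<forall>\<xi>. \<xi> \<notin> cube 0 (3 * R) \<longrightarrow> \<sigma> \<xi> = 0) \<and> (\<forall>\<xi>\<in>cube 0 R. \<sigma> \<xi> = 1)"
    using low_pass by blast
  obtain C4 where C4: "C4 > 0" "\<And>X Y g. mod_bdd X Y g \<Longrightarrow> (AE x in lborel. norm (g x) \<le> C4 * Y) \<and> Lp_bdd r (C4 * Y) g"
    using mod_bdd_sup by blast
  \<comment> \<open>The exponent \<open>1 / e\<close> undoes the power in
    \<open>\<Xi> powr e\<close>, so that half of the weight at that frequency dominates
    \<Xi>.\<close>
  obtain D where D: "D \<ge> 1" "\<And>s. 0 \<le> s \<Longrightarrow> (1 + s) powr (1 / e) \<le> D * exp (1/2 * w s)" using power_le_exp_w[of "1/2" "1/e"] by auto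
  have X: "0 < X" "0 < Y" using u by (auto simp: mod_bdd_def)
  have B0: "0 < B" using alpha_pos[of 0] B[of 0] by linarith
  obtain cu where cu: "Lp_bdd r cu ?U" using u by (auto simp: mod_bdd_def)
  define c where "c = max 1 (C4 * (2 * A * Y))"
  define X' where "X' = 2 * (1 + 2 * A) * X"
  define Y' where "Y' = X' * B * D"
  have X': "0 < X'" using A X by (simp add: X'_def)
  have Y': "0 < Y'" using X' B0 D by (simp add: Y'_def)
  have main: "\<exists>v. Lp_bdd r c (\<lambda>x. complex_of_real (v x)) \<and> (AE x in lborel. norm (complex_of_real (v x)) \<le> c) \<and>
    spec_in (cube 0 (3 * (\<Xi> powr e + 1))) (\<lambda>x. complex_of_real (v x)) \<and>
    mod_bdd X' (Y' / \<Xi>) (\<lambda>x. complex_of_real (u x - v x))" if Xi: "1 \<le> \<Xi>" for \<Xi>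
  proof -
    define R where "R = \<Xi> powr e + 1"
    have R: "1 \<le> R" by (simp add: R_def)
    obtain Bk \<sigma> and \<kappa> :: "real^'n \<Rightarrow> complex" where pair: "fourier_pair Bk \<sigma> \<kappa>" and L1: "(\<integral>\<^sup>+x. norm (\<kappa> x) \<partial>lborel) \<le> ennreal A"
      and real: "\<And>x. cnj (\<kappa> x) = \<kappa> x" and supp: "\<And>\<xi>. \<xi> \<notin> cube 0 (3 * R) \<Longrightarrow> \<sigma> \<xi> = 0" and one: "\<And>\<xi>. \<xi> \<in> cube 0 R \<Longrightarrow> \<sigma> \<xi> = 1"
      using A(2)[OF R] by blast
    note kk = fourier_pair_kernel[OF pair]
    have km: "\<kappa> \<in> borel_measurable borel" by (rule kernel_bdd_measurable[OF kk])
    \<comment> \<open>The kernel is real, so taking the real part changes nothing; real values of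
      \<open>v\<close> keep \<open>cis (t * v x)\<close> bounded by 1.\<close>
    define v where "v x = Re (conv \<kappa> ?U x)" for x
    have vU: "complex_of_real (v x) = conv \<kappa> ?U x" for x
    proof -
      have "cnj (conv \<kappa> ?U x) = (\<integral>z. cnj (\<kappa> z * complex_of_real (u (x - z))) \<partial>lborel)"
        unfolding conv_def by (rule Bochner_Integration.integral_cnj[symmetric])
      also have "\<dots> = conv \<kappa> ?U x" unfolding conv_def by (simp add: real)
      finally show ?thesis unfolding v_def by (metis Reals_cnj_iff of_real_Re)
    qed
    have v_eq: "(\<lambda>x. complex_of_real (v x)) = conv \<kappa> ?U" by (rule ext) (rule vU)
    have vL: "Lp_bdd r (2 * (A * cu)) (conv \<kappa> ?U)" by (rule Lp_bdd_conv_L1[OF r km L1 A(1) cu])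
    have box: "Lp_bdd r (2 * (A * b)) (conv (Kb l) (conv \<kappa> ?U))" if "Lp_bdd r b (conv (Kb l) ?U)" for b l
    proof -
      have "conv (Kb l) (conv \<kappa> ?U) = conv \<kappa> (conv (Kb l) ?U)" by (rule ext) (rule conv_commute[OF r Kb_kernel kk cu])
      then show ?thesis using Lp_bdd_conv_L1[OF r km L1 A(1) that] by simp
    qed
    have low: "mod_bdd (2 * A * X) (2 * A * Y) (conv \<kappa> ?U)"
      using u vL A(1) box unfolding mod_bdd_def by (auto simp: mult.assoc)
    have c4: "C4 * (2 * A * Y) \<le> c" by (simp add: c_def)
    have 1: "Lp_bdd r c (\<lambda>x. complex_of_real (v x))"
      unfolding v_eq using C4(2)[OF low] c4 r by (auto intro: Lp_bdd_mono)
    have 2: "AE x in lborel. norm (complex_of_real (v x)) \<le> c"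
      unfolding vU using conjunct1[OF C4(2)[OF low]] by eventually_elim (use c4 in linarith)
    have 3: "spec_in (cube 0 (3 * (\<Xi> powr e + 1))) (\<lambda>x. complex_of_real (v x))"
      unfolding v_eq R_def[symmetric] by (rule spec_in_conv[OF r pair cu supp])
    have V_eq: "(\<lambda>x. complex_of_real (u x - v x)) = (\<lambda>x. ?U x - conv \<kappa> ?U x)" by (simp add: vU)
    have cV: "conv (Kb l) (\<lambda>x. ?U x - conv \<kappa> ?U x) x = conv (Kb l) ?U x - conv (Kb l) (conv \<kappa> ?U) x" for l x
      by (rule conv_diff[OF r Kb_kernel cu vL])
    have cVm: "conv (Kb l) (\<lambda>x. ?U x - conv \<kappa> ?U x) \<in> borel_measurable borel" for l
      using Lp_bdd_measurable[OF cu] Lp_bdd_measurable[OF vL] by (intro conv_measurable) auto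
    have dich: "(AE x in lborel. conv (Kb l) (\<lambda>x. ?U x - conv \<kappa> ?U x) x = 0) \<or> \<Xi> powr e \<le> norm (lattice_vec l)" for l
    proof (cases "\<forall>i. real_of_int \<bar>l $ i\<bar> + 1 \<le> R")
      case True
      have "AE x in lborel. conv \<kappa> (conv (Kb l) ?U) x = conv (Kb l) ?U x"
      proof (rule conv_eq_self_of_spec[OF pair spec_Kb[OF r cu] one])
        fix \<eta> assume a: "\<eta> \<in> cube (lattice_vec l) 1"
        have "\<bar>\<eta> $ i\<bar> \<le> R" for i
        proof -
          have "\<bar>\<eta> $ i - real_of_int (l $ i)\<bar> \<le> 1" using a by (auto simp: cube_def)
          moreover have "\<bar>real_of_int (l $ i)\<bar> + 1 \<le> R" using True by simp
          ultimately show ?thesis by linarith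
        qed
        then show "\<eta> \<in> cube 0 R" by (simp add: cube_def)
      qed
      then have "AE x in lborel. conv (Kb l) (\<lambda>x. ?U x - conv \<kappa> ?U x) x = 0"
        by eventually_elim (simp add: cV conv_commute[OF r Kb_kernel kk cu])
      then show ?thesis ..
    next
      case False
      then obtain i where i: "R < real_of_int \<bar>l $ i\<bar> + 1" by (auto simp: not_le)
      have "\<bar>lattice_vec l $ i\<bar> \<le> norm (lattice_vec l)" by (rule component_le_norm_cart)
      then show ?thesis using i by (simp add: R_def)
    qed
    have big: "Lp_bdd r (X' * (exp (- wl l) * \<alpha> l)) (conv (Kb l) (\<lambda>x. ?U x - conv \<kappa> ?U x))" for l
    proof -
      let ?b = "X * (exp (- wl l) * \<alpha> l)"
      have b: "Lp_bdd r ?b (conv (Kb l) ?U)" using u by (simp add: mod_bdd_def)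
      have "Lp_bdd r (2 * (?b + 2 * (A * ?b))) (\<lambda>x. conv (Kb l) ?U x - conv (Kb l) (conv \<kappa> ?U) x)"
        by (rule Lp_bdd_diff[OF r b box[OF b]])
      moreover have "conv (Kb l) (\<lambda>x. ?U x - conv \<kappa> ?U x) = (\<lambda>x. conv (Kb l) ?U x - conv (Kb l) (conv \<kappa> ?U) x)"
        by (rule ext) (rule cV)
      moreover have "2 * (?b + 2 * (A * ?b)) = X' * (exp (- wl l) * \<alpha> l)" by (simp add: X'_def algebra_simps)
      ultimately show ?thesis by simp
    qed
    have small: "Lp_bdd r (Y' / \<Xi> * exp (- wl l / 2)) (conv (Kb l) (\<lambda>x. ?U x - conv \<kappa> ?U x))" for l
      using dich[of l]
    proof
      assume z: "AE x in lborel. conv (Kb l) (\<lambda>x. ?U x - conv \<kappa> ?U x) x = 0"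
      have "0 < Y' / \<Xi> * exp (- wl l / 2)" using Y' Xi by simp
      from Lp_bdd_cong_AE[OF Lp_bdd_zero[OF this] cVm _ z] show ?thesis using r by simp
    next
      assume l: "\<Xi> powr e \<le> norm (lattice_vec l)"
      have "\<Xi> = (\<Xi> powr e) powr (1 / e)" using e Xi by (simp add: powr_powr)
      also have "\<dots> \<le> (1 + \<Xi> powr e) powr (1 / e)" using e by (intro powr_mono2) auto
      also have "\<dots> \<le> D * exp (1/2 * w (\<Xi> powr e))" by (rule D(2)) simp
      also have "\<dots> \<le> D * exp (1/2 * wl l)" unfolding wl_def using D(1) l by (intro mult_left_mono) (auto intro: w_mono)
      finally have "exp (- wl l / 2) \<le> D / \<Xi>" using Xi by (simp add: exp_minus field_simps)
      then have "X' * (exp (- wl l / 2) * \<alpha> l) * exp (- wl l / 2) \<le> X' * (D / \<Xi> * B) * exp (- wl l / 2)"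
        using X' B alpha_pos[of l] D(1) Xi by (intro mult_right_mono mult_left_mono mult_mono) (auto simp: less_imp_le)
      moreover have "X' * (exp (- wl l / 2) * \<alpha> l) * exp (- wl l / 2) = X' * (exp (- wl l) * \<alpha> l)"
      proof -
        have "exp (- wl l) = exp (- wl l / 2) * exp (- wl l / 2)" by (simp flip: exp_add)
        then show ?thesis by (simp only: mult_ac)
      qed
      moreover have "X' * (D / \<Xi> * B) * exp (- wl l / 2) = Y' / \<Xi> * exp (- wl l / 2)" by (simp add: Y'_def)
      ultimately have "X' * (exp (- wl l) * \<alpha> l) \<le> Y' / \<Xi> * exp (- wl l / 2)" by linarith
      from Lp_bdd_mono[OF big this] show ?thesis using r by simp
    qed
    have 4: "mod_bdd X' (Y' / \<Xi>) (\<lambda>x. complex_of_real (u x - v x))"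
      unfolding V_eq mod_bdd_def using big small X' Y' Xi Lp_bdd_diff[OF r cu vL] by auto
    show ?thesis using 1 2 3 4 by blast
  qed
  have "1 \<le> c" by (simp add: c_def)
  then show ?thesis using X' Y' main by blast
qed

theorem mod_bdd_cis:
  assumes B: "\<And>k. \<alpha> k \<le> B" and u: "mod_bdd X Y (\<lambda>x. complex_of_real (u x))"
    and e: "0 < e" "e \<le> 1" and th: "1 < \<theta>"
  shows "\<exists>C>0. \<exists>L\<ge>1. \<forall>t. mod_bdd (C * exp (\<theta> * w (L * max 1 \<bar>t\<bar> powr (1 + e)))) (C * exp (\<theta> * w (L * max 1 \<bar>t\<bar> powr (1 + e)))) (\<lambda>x. cis (t * u x) - 1)"
proof -
  \<comment> \<open>The excess of \<theta> is spent in two halves: one inside the low-frequency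
    bound, one on the factor \<open>\<Xi> * \<Xi>\<close> at the end.\<close>
  define \<eta> where "\<eta> = (\<theta> - 1) / 2"
  have h: "0 < \<eta>" using th by (simp add: \<eta>_def)
  have h2: "\<theta> - 1 = 2 * \<eta>" by (simp add: \<eta>_def)
  have B0: "0 < B" using alpha_pos[of 0] B[of 0] by linarith
  obtain c X' Y' where c: "1 \<le> c" and X': "0 < X'" and Y': "0 < Y'" and split: "\<And>\<Xi>. 1 \<le> \<Xi> \<Longrightarrow> \<exists>v.
    Lp_bdd r c (\<lambda>x. complex_of_real (v x)) \<and> (AE x in lborel. norm (complex_of_real (v x)) \<le> c) \<and>
    spec_in (cube 0 (3 * (\<Xi> powr e + 1))) (\<lambda>x. complex_of_real (v x)) \<and>
    mod_bdd X' (Y' / \<Xi>) (\<lambda>x. complex_of_real (u x - v x))"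
    using low_high_split[OF B u e(1)] by auto
  obtain K L where K: "0 < K" and L: "1 \<le> L" and low: "\<And>\<Xi> t R v. 1 \<le> \<Xi> \<Longrightarrow> \<bar>t\<bar> \<le> \<Xi> \<Longrightarrow> R = \<Xi> powr e + 1 \<Longrightarrow>
    Lp_bdd r c (\<lambda>x. complex_of_real (v x)) \<Longrightarrow> AE x in lborel. norm (complex_of_real (v x)) \<le> c \<Longrightarrow>
    spec_in (cube 0 (3 * R)) (\<lambda>x. complex_of_real (v x)) \<Longrightarrow>
    mod_bdd (K * \<Xi> * exp ((1 + \<eta>) * w (L * R * \<Xi>))) (K * \<Xi> * exp ((1 + \<eta>) * w (L * R * \<Xi>)) * B) (\<lambda>x. cis (t * v x) - 1)"
    using low_frequency_bound[OF B c e h] by blast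
  obtain C5 where C5: "C5 > 0" "\<And>\<Xi> X Y t v. 0 < \<Xi> \<Longrightarrow> \<bar>t\<bar> \<le> \<Xi> \<Longrightarrow> mod_bdd X Y (\<lambda>x. complex_of_real (v x)) \<Longrightarrow>
     mod_bdd (2 * (\<Xi> * X * exp (C5 * \<Xi> * Y))) (2 * (\<Xi> * Y * exp (C5 * \<Xi> * Y))) (\<lambda>x. cis (t * v x) - 1)"
    using mod_bdd_exp_series by blast
  obtain C2 where C2: "C2 > 0" "\<And>X X' g Y Y' h. mod_bdd X X' g \<Longrightarrow> mod_bdd Y Y' h \<Longrightarrow>
     mod_bdd (C2 * (X * Y' + X' * Y)) (C2 * (X' * Y')) (\<lambda>x. g x * h x)" using mod_bdd_mult by blast
  obtain D where D: "D \<ge> 1" "\<And>s. 0 \<le> s \<Longrightarrow> (1 + s) powr 2 \<le> D * exp (\<eta> * w s)" using power_le_exp_w[OF h] by blast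
  \<comment> \<open>In the exponent of the series for the high part the factors \<Xi> and
    \<open>1 / \<Xi>\<close> cancel, which leaves \<open>C5 * Y'\<close>.\<close>
  define P1 where "P1 = 2 * (X' * exp (C5 * Y'))"
  define P2 where "P2 = 2 * (Y' * exp (C5 * Y'))"
  have P: "0 < P1" "0 < P2" using X' Y' by (auto simp: P1_def P2_def)
  define Q1 where "Q1 = 2 * (C2 * (P2 + B * P1) + 2 * (1 + P1 / K))"
  define Q2 where "Q2 = 2 * (C2 * (B * P2) + 2 * (B + P2 / K))"
  define Q where "Q = Q1 + Q2"
  have Q12: "0 < Q1" "0 < Q2" unfolding Q1_def Q2_def
    using C2(1) P B0 K by (intro mult_pos_pos add_pos_pos divide_pos_pos; simp)+
  then have Q: "0 < Q" "Q1 \<le> Q" "Q2 \<le> Q" by (simp_all add: Q_def)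
  define C where "C = Q * K * D"
  have C: "0 < C" using Q(1) K D(1) by (simp add: C_def)
  have "mod_bdd (C * exp (\<theta> * w (2 * L * \<Xi> powr (1 + e)))) (C * exp (\<theta> * w (2 * L * \<Xi> powr (1 + e)))) (\<lambda>x. cis (t * u x) - 1)"
    if Xi: "\<Xi> = max 1 \<bar>t\<bar>" for t \<Xi>
  proof -
    have Xi1: "1 \<le> \<Xi>" "\<bar>t\<bar> \<le> \<Xi>" by (auto simp: Xi)
    obtain v where v: "Lp_bdd r c (\<lambda>x. complex_of_real (v x))" "AE x in lborel. norm (complex_of_real (v x)) \<le> c"
      "spec_in (cube 0 (3 * (\<Xi> powr e + 1))) (\<lambda>x. complex_of_real (v x))"
      "mod_bdd X' (Y' / \<Xi>) (\<lambda>x. complex_of_real (u x - v x))" using split[OF Xi1(1)] by blast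
    define R where "R = \<Xi> powr e + 1"
    define W where "W = w (L * R * \<Xi>)"
    define Z where "Z = K * \<Xi> * exp ((1 + \<eta>) * W)"
    have LRX: "0 \<le> L * R * \<Xi>" using L Xi1 by (simp add: R_def add_nonneg_nonneg)
    have W1: "1 \<le> W" unfolding W_def by (rule w_ge_1[OF LRX])
    have E0: "mod_bdd Z (Z * B) (\<lambda>x. cis (t * v x) - 1)"
      unfolding Z_def W_def by (rule low[OF Xi1 R_def v(1,2)]) (use v(3) in \<open>simp add: R_def\<close>)
    have "mod_bdd (2 * (\<Xi> * X' * exp (C5 * \<Xi> * (Y' / \<Xi>)))) (2 * (\<Xi> * (Y' / \<Xi>) * exp (C5 * \<Xi> * (Y' / \<Xi>)))) (\<lambda>x. cis (t * (u x - v x)) - 1)"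
      using Xi1 by (intro C5(2)[OF _ _ v(4)]) auto
    then have E1: "mod_bdd (P1 * \<Xi>) P2 (\<lambda>x. cis (t * (u x - v x)) - 1)"
      using Xi1 by (simp add: P1_def P2_def mult_ac)
    have tot: "mod_bdd (2 * (C2 * (Z * P2 + Z * B * (P1 * \<Xi>)) + 2 * (Z + P1 * \<Xi>))) (2 * (C2 * (Z * B * P2) + 2 * (Z * B + P2)))
      (\<lambda>x. (cis (t * v x) - 1) * (cis (t * (u x - v x)) - 1) + ((cis (t * v x) - 1) + (cis (t * (u x - v x)) - 1)))"
      by (rule mod_bdd_add[OF C2(2)[OF E0 E1] mod_bdd_add[OF E0 E1]])
    have eq: "(cis (t * v x) - 1) * (cis (t * (u x - v x)) - 1) + ((cis (t * v x) - 1) + (cis (t * (u x - v x)) - 1)) = cis (t * u x) - 1" for x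
    proof -
      have "cis (t * v x) * cis (t * (u x - v x)) = cis (t * u x)" by (simp add: cis_mult algebra_simps)
      then show ?thesis by (simp add: algebra_simps)
    qed
    \<comment> \<open>The low-frequency bound \<open>Z\<close> is at least \<open>K\<close>, so
      every term without \<open>Z\<close> can be enlarged by \<open>Z / K\<close>; the sums then
      become multiples of \<open>\<Xi> * Z\<close>.\<close>
    have KZ: "K \<le> Z"
    proof -
      have "1 * 1 \<le> \<Xi> * exp ((1 + \<eta>) * W)" using Xi1 h W1 by (intro mult_mono) auto
      then have "K * 1 \<le> K * (\<Xi> * exp ((1 + \<eta>) * W))" using K by (intro mult_left_mono) auto
      then show ?thesis by (simp add: Z_def mult.assoc)
    qed
    have Z0: "0 < Z" using K KZ by linarith
    have ZX: "Z \<le> \<Xi> * Z" using Z0 Xi1 by simp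
    have ZK: "1 \<le> Z / K" using KZ K by simp
    have XZK: "\<Xi> * 1 \<le> \<Xi> * (Z / K)" using ZK Xi1 by (intro mult_left_mono) auto
    have b1: "2 * (C2 * (Z * P2 + Z * B * (P1 * \<Xi>)) + 2 * (Z + P1 * \<Xi>)) \<le> \<Xi> * Z * (2 * (C2 * (P2 + B * P1) + 2 * (1 + P1 / K)))"
    proof -
      have f1: "C2 * (Z * P2 + Z * B * (P1 * \<Xi>)) \<le> C2 * ((\<Xi> * Z) * P2 + Z * B * (P1 * \<Xi>))"
        using C2(1) P ZX Z0 B0 by (intro mult_left_mono add_mono mult_right_mono) auto
      have f2: "P1 * \<Xi> \<le> P1 * (\<Xi> * (Z / K))" using P XZK by (intro mult_left_mono) auto
      have "2 * (C2 * (Z * P2 + Z * B * (P1 * \<Xi>)) + 2 * (Z + P1 * \<Xi>)) \<le> 2 * (C2 * ((\<Xi> * Z) * P2 + Z * B * (P1 * \<Xi>)) + 2 * (\<Xi> * Z + P1 * (\<Xi> * (Z / K))))"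
        by (rule mult_left_mono[OF add_mono[OF f1 mult_left_mono[OF add_mono[OF ZX f2]]]]) auto
      also have "\<dots> = \<Xi> * Z * (2 * (C2 * (P2 + B * P1) + 2 * (1 + P1 / K)))" by (simp add: algebra_simps)
      finally show ?thesis .
    qed
    have b2: "2 * (C2 * (Z * B * P2) + 2 * (Z * B + P2)) \<le> \<Xi> * Z * (2 * (C2 * (B * P2) + 2 * (B + P2 / K)))"
    proof -
      have f1: "Z * B \<le> \<Xi> * Z * B" using ZX B0 by (intro mult_right_mono) auto
      have f2: "C2 * (Z * B * P2) \<le> C2 * (\<Xi> * Z * B * P2)" using C2(1) P ZX B0 by (intro mult_left_mono mult_right_mono) auto
      have "1 * 1 \<le> \<Xi> * (Z / K)" using Xi1 ZK by (intro mult_mono) auto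
      then have f3: "P2 \<le> P2 * (\<Xi> * (Z / K))" using P mult_left_mono[of 1 "\<Xi> * (Z / K)" P2] by auto
      have "2 * (C2 * (Z * B * P2) + 2 * (Z * B + P2)) \<le> 2 * (C2 * (\<Xi> * Z * B * P2) + 2 * (\<Xi> * Z * B + P2 * (\<Xi> * (Z / K))))"
        by (rule mult_left_mono[OF add_mono[OF f2 mult_left_mono[OF add_mono[OF f1 f3]]]]) auto
      also have "\<dots> = \<Xi> * Z * (2 * (C2 * (B * P2) + 2 * (B + P2 / K)))" by (simp add: algebra_simps)
      finally show ?thesis .
    qed
    \<comment> \<open>One \<Xi> comes from \<open>Z\<close>, one from the high part; together with
      the spare weight they turn \<open>1 + \<eta>\<close> into \<theta>.\<close>
    have XZ: "\<Xi> * Z \<le> K * D * exp (\<theta> * w (2 * L * \<Xi> powr (1 + e)))"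
    proof -
      have "\<Xi> * 1 \<le> \<Xi> * (L * R)" using L Xi1 mult_mono[of 1 L 1 R] by (intro mult_left_mono) (auto simp: R_def)
      then have "\<Xi> \<le> 1 + L * R * \<Xi>" by (simp add: mult_ac)
      then have "\<Xi> powr 2 \<le> (1 + L * R * \<Xi>) powr 2" using Xi1 by (intro powr_mono2) auto
      also have "\<dots> \<le> D * exp (\<eta> * W)" unfolding W_def by (rule D(2)[OF LRX])
      finally have X2: "\<Xi> * \<Xi> \<le> D * exp (\<eta> * W)" using Xi1 by (simp add: powr_numeral power2_eq_square)
      have "\<Xi> * Z = K * exp ((1 + \<eta>) * W) * (\<Xi> * \<Xi>)" by (simp add: Z_def)
      also have "\<dots> \<le> K * exp ((1 + \<eta>) * W) * (D * exp (\<eta> * W))" using K by (intro mult_left_mono X2) auto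
      also have "\<dots> = K * D * exp ((1 + \<eta>) * W + \<eta> * W)" by (simp add: exp_add)
      also have "(1 + \<eta>) * W + \<eta> * W = \<theta> * W"
      proof -
        have "\<theta> = 1 + 2 * \<eta>" using h2 by simp
        then show ?thesis by (simp add: algebra_simps)
      qed
      also have "K * D * exp (\<theta> * W) \<le> K * D * exp (\<theta> * w (2 * L * \<Xi> powr (1 + e)))"
      proof -
        have "\<Xi> powr e \<ge> 1" using Xi1 e by (intro ge_one_powr_ge_zero) auto
        then have "R \<le> 2 * \<Xi> powr e" by (simp add: R_def)
        then have "L * R * \<Xi> \<le> L * (2 * \<Xi> powr e) * \<Xi>" using L Xi1 by (intro mult_right_mono mult_left_mono) auto
        also have "\<dots> = 2 * L * \<Xi> powr (1 + e)" using Xi1 by (simp add: powr_add)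
        finally have "W \<le> w (2 * L * \<Xi> powr (1 + e))" unfolding W_def using LRX by (intro w_mono)
        then show ?thesis using K D(1) th by (intro mult_left_mono) auto
      qed
      finally show ?thesis .
    qed
    let ?M = "C * exp (\<theta> * w (2 * L * \<Xi> powr (1 + e)))"
    have XZ0: "0 \<le> \<Xi> * Z" using Xi1 Z0 by simp
    have QXZ: "\<Xi> * Z * Q \<le> ?M" using mult_right_mono[OF XZ, of Q] Q(1) by (simp add: C_def mult_ac)
    have "\<Xi> * Z * (2 * (C2 * (P2 + B * P1) + 2 * (1 + P1 / K))) \<le> \<Xi> * Z * Q"
      using mult_left_mono[OF Q(2) XZ0] by (simp only: Q1_def)
    from order.trans[OF order.trans[OF b1 this] QXZ] have m1: "2 * (C2 * (Z * P2 + Z * B * (P1 * \<Xi>)) + 2 * (Z + P1 * \<Xi>)) \<le> ?M" .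
    have "\<Xi> * Z * (2 * (C2 * (B * P2) + 2 * (B + P2 / K))) \<le> \<Xi> * Z * Q"
      using mult_left_mono[OF Q(3) XZ0] by (simp only: Q2_def)
    from order.trans[OF order.trans[OF b2 this] QXZ] have m2: "2 * (C2 * (Z * B * P2) + 2 * (Z * B + P2)) \<le> ?M" .
    show ?thesis using mod_bdd_mono[OF tot m1 m2] unfolding eq .
  qed
  moreover have "1 \<le> 2 * L" using L by simp
  ultimately show ?thesis using C by blast
qed

end

section \<open>Complex measures\<close>

definition signed_measure :: "(real set \<Rightarrow> real) \<Rightarrow> bool" where
  "signed_measure \<nu> \<longleftrightarrow>
     (\<forall>A :: nat \<Rightarrow> real set. range A \<subseteq> sets borel \<longrightarrow> disjoint_family A \<longrightarrow> (\<lambda>i. \<nu> (A i)) sums \<nu> (\<Union>i. A i))"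

lemma complex_measureD: "complex_measure \<mu> \<Longrightarrow> range A \<subseteq> sets borel \<Longrightarrow> disjoint_family A \<Longrightarrow> (\<lambda>i. \<mu> (A i)) sums \<mu> (\<Union>i. A i)"
  unfolding complex_measure_def by blast

lemma signed_measureD: "signed_measure \<nu> \<Longrightarrow> range A \<subseteq> sets borel \<Longrightarrow> disjoint_family A \<Longrightarrow> (\<lambda>i. \<nu> (A i)) sums \<nu> (\<Union>i. A i)"
  unfolding signed_measure_def by blast

lemma complex_measure_empty: "complex_measure \<mu> \<Longrightarrow> \<mu> {} = 0"
proof -
  assume "complex_measure \<mu>"
  then have "(\<lambda>i. \<mu> ((\<lambda>_ :: nat. {}) i)) sums \<mu> (\<Union>i :: nat. {})"
    unfolding complex_measure_def by (auto simp: disjoint_family_on_def)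
  then have "summable (\<lambda>_ :: nat. \<mu> {})" by (auto simp: summable_def)
  then have "(\<lambda>_ :: nat. \<mu> {}) \<longlonglongrightarrow> 0" by (rule summable_LIMSEQ_zero)
  then show "\<mu> {} = 0" by (simp add: LIMSEQ_const_iff)
qed

lemma complex_measure_of_real: "complex_measure (\<lambda>A. of_real (\<nu> A)) \<longleftrightarrow> signed_measure \<nu>"
  unfolding complex_measure_def signed_measure_def by (simp add: sums_of_real_iff)

lemma complex_measure_Un:
  assumes "complex_measure \<mu>" "A \<in> sets borel" "B \<in> sets borel" "A \<inter> B = {}"
  shows "\<mu> (A \<union> B) = \<mu> A + \<mu> B"
proof -
  define C where "C = (\<lambda>i :: nat. if i = 0 then A else if i = 1 then B else {})"
  have s1: "(\<lambda>i. \<mu> (C i)) sums \<mu> (\<Union>i. C i)"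
    by (rule complex_measureD[OF assms(1)]) (use assms(2-4) in \<open>auto simp: disjoint_family_on_def C_def\<close>)
  have s2: "(\<lambda>i. \<mu> (C i)) sums (\<Sum>i\<in>{0,1}. \<mu> (C i))"
    by (rule sums_finite) (auto simp: complex_measure_empty[OF assms(1)] C_def)
  have c: "C 0 = A" "C 1 = B" by (simp_all add: C_def)
  have U1: "A \<union> B \<subseteq> (\<Union>i. C i)" using c by blast
  have U2: "(\<Union>i. C i) \<subseteq> A \<union> B" by (auto simp: C_def split: if_splits)
  have "\<mu> (A \<union> B) = (\<Sum>i\<in>{0,1}. \<mu> (C i))" using sums_unique2[OF s1 s2] unfolding antisym[OF U1 U2] .
  also have "\<dots> = \<mu> (C 0) + \<mu> (C 1)" by simp
  finally show ?thesis unfolding c .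
qed

lemma signed_measure_empty: "signed_measure \<nu> \<Longrightarrow> \<nu> {} = 0"
  using complex_measure_empty[of "\<lambda>A. of_real (\<nu> A)"] by (simp add: complex_measure_of_real)

lemma signed_measure_Un:
  "signed_measure \<nu> \<Longrightarrow> A \<in> sets borel \<Longrightarrow> B \<in> sets borel \<Longrightarrow> A \<inter> B = {} \<Longrightarrow> \<nu> (A \<union> B) = \<nu> A + \<nu> B"
  using complex_measure_Un[of "\<lambda>A. of_real (\<nu> A)" A B] by (simp add: complex_measure_of_real flip: of_real_add)

lemma signed_measure_minus: "signed_measure \<nu> \<Longrightarrow> signed_measure (\<lambda>A. - \<nu> A)"
  unfolding signed_measure_def by (auto intro: sums_minus)

lemma signed_measure_Re: "complex_measure \<mu> \<Longrightarrow> signed_measure (\<lambda>A. Re (\<mu> A))"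
  and signed_measure_Im: "complex_measure \<mu> \<Longrightarrow> signed_measure (\<lambda>A. Im (\<mu> A))"
  unfolding signed_measure_def complex_measure_def by (auto intro: sums_Re sums_Im)

lemma disjoint_family_Int: "disjoint_family Q \<Longrightarrow> disjoint_family (\<lambda>i. F \<inter> Q i)"
  unfolding disjoint_family_on_def by blast

text \<open>\<open>measure_of\<close> returns the given set function only if it is a measure. For a
  supremum formula it is convenient to prove two one-sided properties: superadditivity on pairs
  gives monotonicity and the lower bound for series, countable subadditivity the upper
  bound.\<close>

lemma emeasure_measure_of_superadditive:
  fixes T :: "real set \<Rightarrow> ennreal"
  assumes empty: "T {} = 0"
    and super: "\<And>E F. E \<in> sets borel \<Longrightarrow> F \<in> sets borel \<Longrightarrow> E \<inter> F = {} \<Longrightarrow> T E + T F \<le> T (E \<union> F)"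
    and sub: "\<And>A. range A \<subseteq> sets borel \<Longrightarrow> disjoint_family A \<Longrightarrow> T (\<Union>i. A i) \<le> (\<Sum>i. T (A i))"
    and E: "E \<in> sets borel"
  shows "emeasure (measure_of UNIV (sets borel) T) E = T E"
proof -
  have mono: "T E \<le> T F" if "E \<in> sets borel" "F \<in> sets borel" "E \<subseteq> F" for E F
  proof -
    have "T E + T (F - E) \<le> T (E \<union> (F - E))" using that by (intro super) auto
    moreover have "E \<union> (F - E) = F" using that by auto
    ultimately show ?thesis using order_trans[of "T E" "T E + T (F - E)" "T F"] by simp
  qed
  have "countably_additive (sets borel) T"
    unfolding countably_additive_def
  proof (intro allI impI)
    fix A :: "nat \<Rightarrow> real set"
    assume A: "range A \<subseteq> sets borel" "disjoint_family A" "\<Union> (range A) \<in> sets borel"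
    have fin: "(\<Sum>i<n. T (A i)) \<le> T (\<Union>i<n. A i)" for n
    proof (induction n)
      case (Suc n)
      have "A i \<inter> A n = {}" if "i \<in> {..<n}" for i using that by (intro disjoint_family_onD[OF A(2)]) auto
      then have "(\<Union>i<n. A i) \<inter> A n = {}" by blast
      then have "T (\<Union>i<n. A i) + T (A n) \<le> T ((\<Union>i<n. A i) \<union> A n)" using A(1) by (intro super) auto
      moreover have "(\<Union>i<n. A i) \<union> A n = (\<Union>i<Suc n. A i)" by (auto simp: lessThan_Suc)
      ultimately show ?case using Suc by (auto intro: order_trans add_right_mono)
    qed (simp add: empty)
    have "(\<Sum>i. T (A i)) \<le> T (\<Union>i. A i)"
    proof (rule suminf_le_const)
      show "(\<Sum>i<n. T (A i)) \<le> T (\<Union>i. A i)" for n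
        by (rule order_trans[OF fin mono]) (use A in auto)
    qed simp
    then show "(\<Sum>i. T (A i)) = T (\<Union>i. A i)" using sub[OF A(1,2)] by (intro antisym)
  qed
  moreover have "positive (sets borel) T" using empty by (simp add: positive_def)
  moreover have "sigma_algebra UNIV (sets (borel :: real measure))" using sets.sigma_algebra_axioms[of "borel :: real measure"] by simp
  ultimately show ?thesis using E by (intro emeasure_measure_of_sigma)
qed

lemma SUP_add_SUP_le:
  fixes f :: "'a \<Rightarrow> ennreal"
  assumes "A \<noteq> {}" "B \<noteq> {}" "\<And>a b. a \<in> A \<Longrightarrow> b \<in> B \<Longrightarrow> f a + g b \<le> c"
  shows "(SUP a\<in>A. f a) + (SUP b\<in>B. g b) \<le> c"
proof -
  have 1: "f a + (SUP b\<in>B. g b) \<le> c" if "a \<in> A" for a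
  proof -
    have "f a + (SUP b\<in>B. g b) = (SUP b\<in>B. f a + g b)" using assms(2) by (simp add: ennreal_SUP_add_right)
    also have "\<dots> \<le> c" using assms(3)[OF that] by (rule SUP_least)
    finally show ?thesis .
  qed
  have "(SUP a\<in>A. f a) + (SUP b\<in>B. g b) = (SUP a\<in>A. f a + (SUP b\<in>B. g b))" using assms(1) by (simp add: ennreal_SUP_add_left)
  also have "\<dots> \<le> c" using 1 by (rule SUP_least)
  finally show ?thesis .
qed

lemma sets_pos_variation [simp, measurable_cong]: "sets (pos_variation \<nu>) = sets borel"
  and space_pos_variation [simp]: "space (pos_variation \<nu>) = UNIV"
  and sets_total_variation [simp, measurable_cong]: "sets (total_variation \<mu>) = sets borel"
  and space_total_variation [simp]: "space (total_variation \<mu>) = UNIV"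
  unfolding pos_variation_def total_variation_def
  using sets.sigma_sets_eq[of "borel :: real measure"] by (auto simp: sets_measure_of_conv space_measure_of_conv)

lemma norm_suminf_le_ennreal:
  fixes f :: "nat \<Rightarrow> 'a::banach"
  assumes "f sums s"
  shows "ennreal (norm s) \<le> (\<Sum>i. ennreal (norm (f i)))"
proof (rule tendsto_upperbound)
  have "(\<lambda>n. norm (\<Sum>i<n. f i)) \<longlonglongrightarrow> norm s" using assms unfolding sums_def by (rule tendsto_norm)
  then show "(\<lambda>n. ennreal (norm (\<Sum>i<n. f i))) \<longlonglongrightarrow> ennreal (norm s)" by (rule tendsto_ennrealI)
  show "\<forall>\<^sub>F n in sequentially. ennreal (norm (\<Sum>i<n. f i)) \<le> (\<Sum>i. ennreal (norm (f i)))"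
  proof (rule always_eventually, rule allI)
    fix n
    have "ennreal (norm (\<Sum>i<n. f i)) \<le> ennreal (\<Sum>i<n. norm (f i))" by (intro ennreal_leI norm_sum)
    also have "\<dots> = (\<Sum>i<n. ennreal (norm (f i)))" by (simp add: sum_ennreal)
    also have "\<dots> \<le> (\<Sum>i. ennreal (norm (f i)))" by (intro sum_le_suminf) auto
    finally show "ennreal (norm (\<Sum>i<n. f i)) \<le> (\<Sum>i. ennreal (norm (f i)))" .
  qed
qed simp

lemma suminf_ennreal_ge:
  fixes f :: "nat \<Rightarrow> real"
  assumes "f sums s"
  shows "ennreal s \<le> (\<Sum>i. ennreal (f i))"
proof (rule tendsto_upperbound)
  have "(\<lambda>n. (\<Sum>i<n. f i)) \<longlonglongrightarrow> s" using assms unfolding sums_def .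
  then show "(\<lambda>n. ennreal (\<Sum>i<n. f i)) \<longlonglongrightarrow> ennreal s" by (rule tendsto_ennrealI)
  show "\<forall>\<^sub>F n in sequentially. ennreal (\<Sum>i<n. f i) \<le> (\<Sum>i. ennreal (f i))"
  proof (rule always_eventually, rule allI)
    fix n
    have "ennreal (\<Sum>i<n. f i) \<le> ennreal (\<Sum>i<n. max 0 (f i))" by (intro ennreal_leI sum_mono) auto
    also have "\<dots> = (\<Sum>i<n. ennreal (max 0 (f i)))" by (simp add: sum_ennreal)
    also have "\<dots> = (\<Sum>i<n. ennreal (f i))" by (intro sum.cong) (auto simp: max_def ennreal_neg)
    also have "\<dots> \<le> (\<Sum>i. ennreal (f i))" by (intro sum_le_suminf) auto
    finally show "ennreal (\<Sum>i<n. f i) \<le> (\<Sum>i. ennreal (f i))" .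
  qed
qed simp

lemma emeasure_pos_variation:
  assumes \<nu>: "signed_measure \<nu>" and E: "E \<in> sets borel"
  shows "emeasure (pos_variation \<nu>) E = (SUP A\<in>{A \<in> sets borel. A \<subseteq> E}. ennreal (\<nu> A))"
  unfolding pos_variation_def
proof (rule emeasure_measure_of_superadditive[where T="\<lambda>E. SUP A\<in>{A \<in> sets borel. A \<subseteq> E}. ennreal (\<nu> A)", OF _ _ _ E])
  have "{A \<in> sets borel. A \<subseteq> ({} :: real set)} = {{}}" by auto
  then show "(SUP A\<in>{A \<in> sets borel. A \<subseteq> {}}. ennreal (\<nu> A)) = 0" by (simp add: signed_measure_empty[OF \<nu>])
next
  fix E F :: "real set" assume EF: "E \<in> sets borel" "F \<in> sets borel" "E \<inter> F = {}"
  show "(SUP A\<in>{A \<in> sets borel. A \<subseteq> E}. ennreal (\<nu> A)) + (SUP A\<in>{A \<in> sets borel. A \<subseteq> F}. ennreal (\<nu> A))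
    \<le> (SUP A\<in>{A \<in> sets borel. A \<subseteq> E \<union> F}. ennreal (\<nu> A))"
  proof (rule SUP_add_SUP_le)
    fix A B assume A: "A \<in> {A \<in> sets borel. A \<subseteq> E}" and B: "B \<in> {A \<in> sets borel. A \<subseteq> F}"
    \<comment> \<open>A set of negative value counts as 0 after truncation but would lower the value
      of a union; it is replaced by the empty set first.\<close>
    define A' B' where "A' = (if \<nu> A < 0 then {} else A)" and "B' = (if \<nu> B < 0 then {} else B)"
    have A': "A' \<in> sets borel" "A' \<subseteq> E" "ennreal (\<nu> A) = ennreal (\<nu> A')" "0 \<le> \<nu> A'"
      using A signed_measure_empty[OF \<nu>] by (auto simp: A'_def ennreal_neg)
    have B': "B' \<in> sets borel" "B' \<subseteq> F" "ennreal (\<nu> B) = ennreal (\<nu> B')" "0 \<le> \<nu> B'"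
      using B signed_measure_empty[OF \<nu>] by (auto simp: B'_def ennreal_neg)
    have "ennreal (\<nu> A) + ennreal (\<nu> B) = ennreal (\<nu> (A' \<union> B'))"
      using A' B' EF by (subst signed_measure_Un[OF \<nu>]) auto
    also have "\<dots> \<le> (SUP A\<in>{A \<in> sets borel. A \<subseteq> E \<union> F}. ennreal (\<nu> A))"
      using A' B' by (intro SUP_upper) auto
    finally show "ennreal (\<nu> A) + ennreal (\<nu> B) \<le> (SUP A\<in>{A \<in> sets borel. A \<subseteq> E \<union> F}. ennreal (\<nu> A))" .
  qed auto
next
  fix Q :: "nat \<Rightarrow> real set" assume Q: "range Q \<subseteq> sets borel" "disjoint_family Q"
  show "(SUP A\<in>{A \<in> sets borel. A \<subseteq> (\<Union>i. Q i)}. ennreal (\<nu> A)) \<le> (\<Sum>i. SUP A\<in>{A \<in> sets borel. A \<subseteq> Q i}. ennreal (\<nu> A))"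
  proof (rule SUP_least)
    fix A assume A: "A \<in> {A \<in> sets borel. A \<subseteq> (\<Union>i. Q i)}"
    have "disjoint_family (\<lambda>i. A \<inter> Q i)" by (rule disjoint_family_Int[OF Q(2)])
    then have "(\<lambda>i. \<nu> (A \<inter> Q i)) sums \<nu> (\<Union>i. A \<inter> Q i)"
      by (intro signed_measureD[OF \<nu>]) (use A Q(1) in \<open>auto simp: image_subset_iff\<close>)
    moreover have "(\<Union>i. A \<inter> Q i) = A" using A by auto
    ultimately have "ennreal (\<nu> A) \<le> (\<Sum>i. ennreal (\<nu> (A \<inter> Q i)))" using suminf_ennreal_ge by metis
    also have "\<dots> \<le> (\<Sum>i. SUP A\<in>{A \<in> sets borel. A \<subseteq> Q i}. ennreal (\<nu> A))"
      using A Q(1) by (intro suminf_le SUP_upper) auto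
    finally show "ennreal (\<nu> A) \<le> (\<Sum>i. SUP A\<in>{A \<in> sets borel. A \<subseteq> Q i}. ennreal (\<nu> A))" .
  qed
qed

lemma suminf_swap_ennreal:
  fixes f :: "nat \<Rightarrow> nat \<Rightarrow> ennreal"
  shows "(\<Sum>j. \<Sum>i. f j i) = (\<Sum>i. \<Sum>j. f j i)"
  using nn_integral_fst_count_space[of "\<lambda>(j, i). f j i"] nn_integral_snd_count_space[of "\<lambda>(j, i). f j i"]
  by (simp add: nn_integral_count_space_nat)

section \<open>Total variation\<close>

definition partitions :: "real set \<Rightarrow> (nat \<Rightarrow> real set) set" where
  "partitions E = {A. range A \<subseteq> sets borel \<and> disjoint_family A \<and> (\<Union>i. A i) = E}"

lemma partitions_Un:
  assumes "A \<in> partitions E" "B \<in> partitions F" "E \<inter> F = {}"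
  shows "(\<lambda>n. if even n then A (n div 2) else B (n div 2)) \<in> partitions (E \<union> F)"
proof -
  let ?C = "\<lambda>n. if even n then A (n div 2) else B (n div 2)"
  have AB: "range A \<subseteq> sets borel" "disjoint_family A" "(\<Union>i. A i) = E" "range B \<subseteq> sets borel" "disjoint_family B" "(\<Union>i. B i) = F"
    using assms by (auto simp: partitions_def)
  have AE: "A i \<subseteq> E" "B i \<subseteq> F" for i using AB by auto
  have "?C m \<inter> ?C n = {}" if "m \<noteq> n" for m n
  proof -
    have "A i \<inter> B j = {}" "B j \<inter> A i = {}" for i j using AE[of i] AE[of j] assms(3) by blast+
    moreover have "m div 2 \<noteq> n div 2" if "even m \<longleftrightarrow> even n" using \<open>m \<noteq> n\<close> that by presburger
    ultimately show ?thesis using AB(2,5) by (auto simp: disjoint_family_on_def)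
  qed
  then have "disjoint_family ?C" by (simp add: disjoint_family_on_def)
  moreover have "(\<Union>n. ?C n) = E \<union> F"
  proof (rule antisym)
    show "(\<Union>n. ?C n) \<subseteq> E \<union> F" using AE by auto
    have "A i \<subseteq> (\<Union>n. ?C n)" for i by (rule order_trans[OF _ UN_upper[of "2 * i"]]) auto
    moreover have "B i \<subseteq> (\<Union>n. ?C n)" for i by (rule order_trans[OF _ UN_upper[of "2 * i + 1"]]) auto
    ultimately show "E \<union> F \<subseteq> (\<Union>n. ?C n)" using AB(3,6) by blast
  qed
  ultimately show ?thesis using AB(1,4) by (auto simp: partitions_def)
qed

lemma partitions_Int:
  assumes "A \<in> partitions E" "F \<in> sets borel" "F \<subseteq> E"
  shows "(\<lambda>i. A i \<inter> F) \<in> partitions F"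
proof -
  have A: "range A \<subseteq> sets borel" "disjoint_family A" "(\<Union>i. A i) = E" using assms(1) by (auto simp: partitions_def)
  have "(\<Union>i. A i \<inter> F) = F" using A(3) assms(3) by blast
  moreover have "disjoint_family (\<lambda>i. A i \<inter> F)" using disjoint_family_Int[OF A(2), of F] by (simp only: Int_commute)
  moreover have "range (\<lambda>i. A i \<inter> F) \<subseteq> sets borel" using A(1) assms(2) by auto
  ultimately show ?thesis by (simp add: partitions_def)
qed

lemma emeasure_total_variation:
  assumes \<mu>: "complex_measure \<mu>" and E: "E \<in> sets borel"
  shows "emeasure (total_variation \<mu>) E = (SUP A\<in>partitions E. \<Sum>i. ennreal (norm (\<mu> (A i))))"
proof -
  have ne: "partitions E \<noteq> {}" if "E \<in> sets borel" for E
  proof -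
    have "(\<lambda>i. if i = 0 then E else {}) \<in> partitions E" using that by (auto simp: partitions_def disjoint_family_on_def)
    then show ?thesis by blast
  qed
  show ?thesis
    unfolding total_variation_def partitions_def[symmetric]
  proof (rule emeasure_measure_of_superadditive[where T="\<lambda>E. SUP A\<in>partitions E. \<Sum>i. ennreal (norm (\<mu> (A i)))", OF _ _ _ E])
    have "\<mu> (A i) = 0" if "A \<in> partitions {}" for A i
    proof -
      have "A i = {}" using that by (auto simp: partitions_def)
      then show ?thesis by (simp add: complex_measure_empty[OF \<mu>])
    qed
    then show "(SUP A\<in>partitions {}. \<Sum>i. ennreal (norm (\<mu> (A i)))) = 0" using ne[of "{}"] by simp
  next
    fix E F :: "real set" assume EF: "E \<in> sets borel" "F \<in> sets borel" "E \<inter> F = {}"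
    show "(SUP A\<in>partitions E. \<Sum>i. ennreal (norm (\<mu> (A i)))) + (SUP A\<in>partitions F. \<Sum>i. ennreal (norm (\<mu> (A i))))
      \<le> (SUP A\<in>partitions (E \<union> F). \<Sum>i. ennreal (norm (\<mu> (A i))))"
    proof (rule SUP_add_SUP_le[OF ne[OF EF(1)] ne[OF EF(2)]])
      fix A B assume AB: "A \<in> partitions E" "B \<in> partitions F"
      define C where "C = (\<lambda>n. if even n then A (n div 2) else B (n div 2))"
      have C: "C \<in> partitions (E \<union> F)" unfolding C_def by (rule partitions_Un[OF AB EF(3)])
      let ?c = "\<lambda>n. ennreal (norm (\<mu> (C n)))"
      \<comment> \<open>Even partial sums of the interleaved partition are partial sums of both
        given ones.\<close>
      have split: "(\<Sum>n<2 * N. ?c n) = (\<Sum>n<N. ennreal (norm (\<mu> (A n))) + ennreal (norm (\<mu> (B n))))" for N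
        by (induction N) (auto simp: C_def add.assoc)
      have "(\<Sum>i. ennreal (norm (\<mu> (A i)))) + (\<Sum>i. ennreal (norm (\<mu> (B i))))
        = (\<Sum>i. ennreal (norm (\<mu> (A i))) + ennreal (norm (\<mu> (B i))))" by (rule suminf_add) auto
      also have "\<dots> \<le> (\<Sum>n. ?c n)"
      proof (rule suminf_le_const)
        show "(\<Sum>n<N. ennreal (norm (\<mu> (A n))) + ennreal (norm (\<mu> (B n)))) \<le> (\<Sum>n. ?c n)" for N
          unfolding split[symmetric] by (rule sum_le_suminf) auto
      qed simp
      also have "\<dots> \<le> (SUP A\<in>partitions (E \<union> F). \<Sum>i. ennreal (norm (\<mu> (A i))))" using C by (rule SUP_upper)
      finally show "(\<Sum>i. ennreal (norm (\<mu> (A i)))) + (\<Sum>i. ennreal (norm (\<mu> (B i)))) \<le> (SUP A\<in>partitions (E \<union> F). \<Sum>i. ennreal (norm (\<mu> (A i))))" .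
    qed
  next
    fix Q :: "nat \<Rightarrow> real set" assume Q: "range Q \<subseteq> sets borel" "disjoint_family Q"
    show "(SUP A\<in>partitions (\<Union>i. Q i). \<Sum>j. ennreal (norm (\<mu> (A j)))) \<le> (\<Sum>i. SUP A\<in>partitions (Q i). \<Sum>j. ennreal (norm (\<mu> (A j))))"
    proof (rule SUP_least)
      fix A assume A: "A \<in> partitions (\<Union>i. Q i)"
      have "ennreal (norm (\<mu> (A j))) \<le> (\<Sum>i. ennreal (norm (\<mu> (A j \<inter> Q i))))" for j
      proof -
        have "disjoint_family (\<lambda>i. A j \<inter> Q i)" by (rule disjoint_family_Int[OF Q(2)])
        moreover have "range (\<lambda>i. A j \<inter> Q i) \<subseteq> sets borel" using A Q(1) by (auto simp: partitions_def image_subset_iff)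
        ultimately have "(\<lambda>i. \<mu> (A j \<inter> Q i)) sums \<mu> (\<Union>i. A j \<inter> Q i)"
          by (intro complex_measureD[OF \<mu>])
        moreover have "(\<Union>i. A j \<inter> Q i) = A j" using A by (auto simp: partitions_def)
        ultimately show ?thesis using norm_suminf_le_ennreal by metis
      qed
      then have "(\<Sum>j. ennreal (norm (\<mu> (A j)))) \<le> (\<Sum>j. \<Sum>i. ennreal (norm (\<mu> (A j \<inter> Q i))))" by (intro suminf_le) auto
      also have "\<dots> = (\<Sum>i. \<Sum>j. ennreal (norm (\<mu> (A j \<inter> Q i))))"
        by (rule suminf_swap_ennreal)
      also have "\<dots> \<le> (\<Sum>i. SUP A\<in>partitions (Q i). \<Sum>j. ennreal (norm (\<mu> (A j))))"
      proof (intro suminf_le)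
        fix i
        have "(\<lambda>j. A j \<inter> Q i) \<in> partitions (Q i)" using Q(1) by (intro partitions_Int[OF A]) auto
        then show "(\<Sum>j. ennreal (norm (\<mu> (A j \<inter> Q i)))) \<le> (SUP A\<in>partitions (Q i). \<Sum>j. ennreal (norm (\<mu> (A j))))"
          by (rule SUP_upper2) simp
      qed auto
      finally show "(\<Sum>j. ennreal (norm (\<mu> (A j)))) \<le> (\<Sum>i. SUP A\<in>partitions (Q i). \<Sum>j. ennreal (norm (\<mu> (A j))))" .
    qed
  qed
qed

text \<open>A competitor \<open>A\<close> for the positive variation is the first piece of the
  partition of \<open>E\<close> into \<open>A\<close> and its complement.\<close>

lemma pos_variation_le_total_variation:
  assumes \<mu>: "complex_measure \<mu>" and \<nu>: "signed_measure \<nu>" and le: "\<And>A. A \<in> sets borel \<Longrightarrow> \<nu> A \<le> norm (\<mu> A)"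
  shows "emeasure (pos_variation \<nu>) E \<le> emeasure (total_variation \<mu>) E"
proof (cases "E \<in> sets borel")
  case True
  show ?thesis unfolding emeasure_pos_variation[OF \<nu> True]
  proof (rule SUP_least)
    fix A assume A: "A \<in> {A \<in> sets borel. A \<subseteq> E}"
    define C where "C = (\<lambda>i :: nat. if i = 0 then A else if i = 1 then E - A else {})"
    have C0: "C 0 = A" and C1: "C 1 = E - A" by (simp_all add: C_def)
    have "A \<union> (E - A) \<subseteq> (\<Union>i. C i)" using C0 C1 by blast
    moreover have "(\<Union>i. C i) \<subseteq> E" using A by (auto simp: C_def split: if_splits)
    moreover have "disjoint_family C" by (auto simp: C_def disjoint_family_on_def)
    moreover have "range C \<subseteq> sets borel" using A True by (auto simp: C_def)
    ultimately have C: "C \<in> partitions E" unfolding partitions_def using A by blast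
    have "ennreal (\<nu> A) \<le> ennreal (norm (\<mu> (C 0)))" using A le C0 by (auto intro!: ennreal_leI)
    also have "\<dots> = (\<Sum>i<1. ennreal (norm (\<mu> (C i))))" by simp
    also have "\<dots> \<le> (\<Sum>i. ennreal (norm (\<mu> (C i))))" by (rule sum_le_suminf) auto
    also have "\<dots> \<le> emeasure (total_variation \<mu>) E" unfolding emeasure_total_variation[OF \<mu> True]
      using C by (rule SUP_upper)
    finally show "ennreal (\<nu> A) \<le> emeasure (total_variation \<mu>) E" .
  qed
qed (simp add: emeasure_notin_sets)

section \<open>Reduction to positive measures\<close>

text \<open>No Hahn decomposition is involved: \<nu> of a set is its total value minus the value of
  the complement, hence at most the total value plus the negative variation. The supremum gives one
  inequality, and exchanging \<nu> with its negative gives the other.\<close>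

lemma Jordan_UNIV:
  assumes \<nu>: "signed_measure \<nu>" and fin: "finite_measure (pos_variation \<nu>)" "finite_measure (pos_variation (\<lambda>A. - \<nu> A))"
  shows "measure (pos_variation \<nu>) UNIV - measure (pos_variation (\<lambda>A. - \<nu> A)) UNIV = \<nu> UNIV"
proof -
  have *: "measure (pos_variation \<nu>) UNIV \<le> \<nu> UNIV + measure (pos_variation (\<lambda>A. - \<nu> A)) UNIV"
    if \<nu>: "signed_measure \<nu>" and fin: "finite_measure (pos_variation \<nu>)" "finite_measure (pos_variation (\<lambda>A. - \<nu> A))" for \<nu>
  proof -
    note m = signed_measure_minus[OF \<nu>]
    have le: "\<nu> A \<le> \<nu> UNIV + measure (pos_variation (\<lambda>A. - \<nu> A)) UNIV" if "A \<in> sets borel" for A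
    proof -
      have "\<nu> (A \<union> - A) = \<nu> A + \<nu> (- A)" using that by (intro signed_measure_Un[OF \<nu>]) auto
      moreover have "ennreal (- \<nu> (- A)) \<le> emeasure (pos_variation (\<lambda>A. - \<nu> A)) UNIV"
        using that by (subst emeasure_pos_variation[OF m]) (auto intro!: SUP_upper)
      then have "- \<nu> (- A) \<le> measure (pos_variation (\<lambda>A. - \<nu> A)) UNIV"
        by (simp add: finite_measure.emeasure_eq_measure[OF fin(2)] ennreal_le_iff)
      ultimately show ?thesis by simp
    qed
    have nn: "0 \<le> \<nu> UNIV + measure (pos_variation (\<lambda>A. - \<nu> A)) UNIV" using le[of "{}"] signed_measure_empty[OF \<nu>] by simp
    have "emeasure (pos_variation \<nu>) UNIV \<le> ennreal (\<nu> UNIV + measure (pos_variation (\<lambda>A. - \<nu> A)) UNIV)"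
      by (subst emeasure_pos_variation[OF \<nu>]) (auto intro!: SUP_least ennreal_leI le)
    then show ?thesis using nn by (simp add: finite_measure.emeasure_eq_measure[OF fin(1)] ennreal_le_iff)
  qed
  from *[OF \<nu> fin] *[OF signed_measure_minus[OF \<nu>] fin(2)] fin(1) show ?thesis by simp
qed

lemma finite_pos_variation:
  assumes "complex_measure \<mu>" "emeasure (total_variation \<mu>) UNIV < \<infinity>" "signed_measure \<nu>" "\<And>A. A \<in> sets borel \<Longrightarrow> \<nu> A \<le> norm (\<mu> A)"
  shows "finite_measure (pos_variation \<nu>)"
  using pos_variation_le_total_variation[OF assms(1,3,4), of UNIV] assms(2)
  by (intro finite_measureI) (auto simp: top_unique)

text \<open>The last equation is the form in which the vanishing of the total mass is used: it
  allows 1 to be subtracted from the exponential under all four integrals at once.\<close>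

lemma inv_fourier_measure_decomposition:
  assumes \<mu>: "complex_measure \<mu>" and fin: "emeasure (total_variation \<mu>) UNIV < \<infinity>" and zero: "\<mu> UNIV = 0"
  shows "\<exists>(N :: nat \<Rightarrow> real measure) s. (\<forall>i<4. finite_measure (N i) \<and> sets (N i) = sets borel \<and> N i \<le> total_variation \<mu> \<and> norm (s i) \<le> 1) \<and>
    (\<forall>t. inv_fourier_measure \<mu> t = (\<Sum>i<4. s i * (\<integral>\<xi>. cis (t * \<xi>) \<partial>N i))) \<and> (\<Sum>i<4. s i * complex_of_real (measure (N i) UNIV)) = 0"
proof -
  let ?\<nu> = "[\<lambda>A. Re (\<mu> A), \<lambda>A. - Re (\<mu> A), \<lambda>A. Im (\<mu> A), \<lambda>A. - Im (\<mu> A)]"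
  define N where "N = (\<lambda>i. pos_variation (?\<nu> ! i))"
  define c where "c = complex_of_real (1 / sqrt (2 * pi))"
  define s where "s = (\<lambda>i. [c, - c, c * \<i>, - (c * \<i>)] ! i)"
  have c1: "norm c \<le> 1"
  proof -
    have "1 \<le> sqrt (2 * pi)" using pi_gt3 by simp
    then show ?thesis by (simp add: c_def norm_divide)
  qed
  have signed: "signed_measure (?\<nu> ! i)" and le: "\<And>A. (?\<nu> ! i) A \<le> norm (\<mu> A)" if "i < 4" for i
  proof -
    have i: "i = 0 \<or> i = 1 \<or> i = 2 \<or> i = 3" using that by auto
    then show "signed_measure (?\<nu> ! i)"
      using signed_measure_Re[OF \<mu>] signed_measure_Im[OF \<mu>] by (auto simp: signed_measure_minus)
    have "\<bar>Re z\<bar> \<le> norm z" "\<bar>Im z\<bar> \<le> norm z" for z by (rule abs_Re_le_cmod, rule abs_Im_le_cmod)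
    then have "Re z \<le> norm z" "- Re z \<le> norm z" "Im z \<le> norm z" "- Im z \<le> norm z" for z by (meson abs_le_D1 abs_le_D2)+
    then show "(?\<nu> ! i) A \<le> norm (\<mu> A)" for A using i by auto
  qed
  have fm: "finite_measure (N i)" if "i < 4" for i
    unfolding N_def by (rule finite_pos_variation[OF \<mu> fin signed[OF that] le[OF that]])
  have 1: "finite_measure (N i) \<and> sets (N i) = sets borel \<and> N i \<le> total_variation \<mu> \<and> norm (s i) \<le> 1" if i: "i < 4" for i
  proof -
    have sets: "sets (N i) = sets borel" by (simp add: N_def)
    have "N i \<le> total_variation \<mu>"
      by (subst le_measure) (auto simp: N_def intro!: pos_variation_le_total_variation[OF \<mu> signed[OF i] le[OF i]])
    moreover have "norm (s i) \<le> 1"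
    proof -
      have "i = 0 \<or> i = 1 \<or> i = 2 \<or> i = 3" using i by auto
      then show ?thesis using c1 by (auto simp: s_def norm_mult)
    qed
    ultimately show ?thesis using fm[OF i] sets by blast
  qed
  have N: "N 0 = pos_variation (\<lambda>A. Re (\<mu> A))" "N 1 = pos_variation (\<lambda>A. - Re (\<mu> A))" "N 2 = pos_variation (\<lambda>A. Im (\<mu> A))" "N 3 = pos_variation (\<lambda>A. - Im (\<mu> A))"
    by (simp_all add: N_def)
  have s: "s 0 = c" "s 1 = - c" "s 2 = c * \<i>" "s 3 = - (c * \<i>)" by (simp_all add: s_def)
  have sum4: "(\<Sum>i<4. h i) = h 0 + h 1 + h 2 + h 3" for h :: "nat \<Rightarrow> complex" by (simp add: eval_nat_numeral lessThan_Suc add_ac)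
  have 2: "inv_fourier_measure \<mu> t = (\<Sum>i<4. s i * (\<integral>\<xi>. cis (t * \<xi>) \<partial>N i))" for t
    unfolding inv_fourier_measure_def complex_measure_integral_def sum4 s N c_def by (simp add: algebra_simps)
  have "measure (N 0) UNIV - measure (N 1) UNIV = 0"
    unfolding N using Jordan_UNIV[OF signed_measure_Re[OF \<mu>]] fm[of 0, unfolded N] fm[of 1, unfolded N] zero by simp
  moreover have "measure (N 2) UNIV - measure (N 3) UNIV = 0"
    unfolding N using Jordan_UNIV[OF signed_measure_Im[OF \<mu>]] fm[of 2, unfolded N] fm[of 3, unfolded N] zero by simp
  ultimately have 3: "(\<Sum>i<4. s i * complex_of_real (measure (N i) UNIV)) = 0"
    unfolding sum4 s by simp
  show ?thesis using 1 2 3 by blast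
qed

section \<open>Smoothness of transforms of measures\<close>

text \<open>Up to normalisation the k-th derivative of the transform of \<open>N\<close>, so that
  differentiation just raises \<open>k\<close>.\<close>

definition moment_transform :: "real measure \<Rightarrow> nat \<Rightarrow> real \<Rightarrow> complex" where
  "moment_transform N k t = (\<integral>\<xi>. (\<i> * complex_of_real \<xi>) ^ k * cis (t * \<xi>) \<partial>N)"

lemma norm_cis_taylor: "norm (cis y - 1 - \<i> * complex_of_real y) \<le> y\<^sup>2"
proof -
  have "norm (cis y - 1 - \<i> * complex_of_real y) \<le> y\<^sup>2 / 2"
    using iexp_approx1[of y 1] by (simp add: cis_conv_exp diff_diff_eq power2_eq_square)
  also have "\<dots> \<le> y\<^sup>2" by simp
  finally show ?thesis .
qed

text \<open>The Taylor remainder of the exponential is at most the square of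
  \<open>h * \<xi>\<close>, so the error of the difference quotient is at most the moment of order
  \<open>k + 2\<close> times the increment.\<close>

lemma moment_transform_has_derivative:
  assumes N: "sets N = sets borel" and mom: "\<And>k. integrable N (\<lambda>\<xi>. \<bar>\<xi>\<bar> ^ k)"
  shows "(moment_transform N k has_derivative (\<lambda>h. h *\<^sub>R moment_transform N (Suc k) t)) (at t)"
proof -
  note [measurable_cong] = N
  have cis_m [measurable]: "(\<lambda>\<xi>. cis (t * \<xi>)) \<in> borel_measurable borel" for t
    by (intro borel_measurable_continuous_onI continuous_intros)
  have int: "integrable N (\<lambda>\<xi>. (\<i> * complex_of_real \<xi>) ^ k * cis (t * \<xi>))" for k t
    by (rule Bochner_Integration.integrable_bound[OF mom[of k]]) (measurable, simp add: norm_mult norm_power)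
  define M where "M = (\<integral>\<xi>. \<bar>\<xi>\<bar> ^ (k + 2) \<partial>N)"
  show ?thesis
  proof (rule has_derivativeI_sandwich[where e=1 and H="\<lambda>y. M * \<bar>y - t\<bar>"])
    show "bounded_linear (\<lambda>h. h *\<^sub>R moment_transform N (Suc k) t)" by (rule bounded_linear_scaleR_left)
    have "((\<lambda>y. M * \<bar>y - t\<bar>) \<longlongrightarrow> M * \<bar>t - t\<bar>) (at t)" by (intro tendsto_intros)
    then show "((\<lambda>y. M * \<bar>y - t\<bar>) \<longlongrightarrow> 0) (at t)" by simp
    fix y assume "y \<noteq> t"
    define h where "h = y - t"
    have h: "h \<noteq> 0" using \<open>y \<noteq> t\<close> by (simp add: h_def)
    let ?d = "\<lambda>\<xi>. (\<i> * complex_of_real \<xi>) ^ k * cis (t * \<xi>) * (cis (h * \<xi>) - 1 - \<i> * complex_of_real (h * \<xi>))"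
    have "moment_transform N k y - moment_transform N k t - h *\<^sub>R moment_transform N (Suc k) t
      = (\<integral>\<xi>. (\<i> * complex_of_real \<xi>) ^ k * cis (y * \<xi>) - (\<i> * complex_of_real \<xi>) ^ k * cis (t * \<xi>) - h *\<^sub>R ((\<i> * complex_of_real \<xi>) ^ Suc k * cis (t * \<xi>)) \<partial>N)"
      unfolding moment_transform_def
      by (simp only: Bochner_Integration.integral_diff[OF Bochner_Integration.integrable_diff[OF int int] integrable_scaleR_right[OF int]]
          Bochner_Integration.integral_diff[OF int int] integral_scaleR_right)
    also have "\<dots> = (\<integral>\<xi>. ?d \<xi> \<partial>N)"
    proof (rule Bochner_Integration.integral_cong[OF refl])
      fix \<xi>
      have "cis (y * \<xi>) = cis (t * \<xi>) * cis (h * \<xi>)" by (simp add: cis_mult h_def algebra_simps)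
      then show "(\<i> * complex_of_real \<xi>) ^ k * cis (y * \<xi>) - (\<i> * complex_of_real \<xi>) ^ k * cis (t * \<xi>) - h *\<^sub>R ((\<i> * complex_of_real \<xi>) ^ Suc k * cis (t * \<xi>)) = ?d \<xi>"
        by (simp add: scaleR_conv_of_real algebra_simps)
    qed
    also have "norm \<dots> \<le> (\<integral>\<xi>. h\<^sup>2 * \<bar>\<xi>\<bar> ^ (k + 2) \<partial>N)"
    proof (rule Bochner_Integration.integral_norm_bound_integral)
      show le: "norm (?d \<xi>) \<le> h\<^sup>2 * \<bar>\<xi>\<bar> ^ (k + 2)" for \<xi>
      proof -
        have "norm (?d \<xi>) = \<bar>\<xi>\<bar> ^ k * norm (cis (h * \<xi>) - 1 - \<i> * complex_of_real (h * \<xi>))"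
          by (simp only: norm_mult norm_power norm_cis norm_ii norm_of_real mult_1 mult_1_right)
        also have "\<dots> \<le> \<bar>\<xi>\<bar> ^ k * (h * \<xi>)\<^sup>2" by (intro mult_left_mono norm_cis_taylor) simp
        also have "\<dots> = h\<^sup>2 * \<bar>\<xi>\<bar> ^ (k + 2)" by (simp only: power_add power2_abs power_mult_distrib mult_ac)
        finally show ?thesis .
      qed
      show i2: "integrable N (\<lambda>\<xi>. h\<^sup>2 * \<bar>\<xi>\<bar> ^ (k + 2))" using mom by (rule integrable_mult_right)
      show "integrable N ?d"
        by (rule Bochner_Integration.integrable_bound[OF i2]) (measurable, rule AE_I2, use le in auto)
    qed
    also have "\<dots> = h\<^sup>2 * M" unfolding M_def by (rule integral_mult_right_zero)
    finally have "norm (moment_transform N k y - moment_transform N k t - h *\<^sub>R moment_transform N (Suc k) t) / norm h \<le> h\<^sup>2 * M / norm h"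
      by (rule divide_right_mono) simp
    also have "h\<^sup>2 * M / norm h = M * \<bar>h\<bar>" using h by (simp add: power2_eq_square field_simps abs_if)
    finally show "norm (moment_transform N k y - moment_transform N k t - (y - t) *\<^sub>R moment_transform N (Suc k) t) / norm (y - t) \<le> M * \<bar>y - t\<bar>"
      unfolding h_def .
  qed simp
qed

lemma smooth_moment_transform_sum:
  fixes s :: "nat \<Rightarrow> complex"
  assumes N: "\<And>i. i < n \<Longrightarrow> sets (N i) = sets borel" and mom: "\<And>i k. i < n \<Longrightarrow> integrable (N i) (\<lambda>\<xi>. \<bar>\<xi>\<bar> ^ k)"
  shows "smooth_on UNIV (\<lambda>t. \<Sum>i<n. s i * moment_transform (N i) 0 t)"
proof -
  have D: "((\<lambda>t. \<Sum>i<n. s i * moment_transform (N i) k t) has_derivative (\<lambda>h. \<Sum>i<n. s i * (h *\<^sub>R moment_transform (N i) (Suc k) t))) (at t)" for k t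
    by (intro has_derivative_sum has_derivative_mult_right moment_transform_has_derivative N mom) auto
  have "diff_order m (\<lambda>t. \<Sum>i<n. s i * moment_transform (N i) k t)" for m k
  proof (induction m arbitrary: k)
    case 0
    then show ?case using D by (auto simp: differentiable_def)
  next
    case (Suc m)
    have "dir_deriv 1 (\<lambda>t. \<Sum>i<n. s i * moment_transform (N i) k t) = (\<lambda>t. \<Sum>i<n. s i * moment_transform (N i) (Suc k) t)"
      by (rule ext) (simp add: dir_deriv_eqI[OF D])
    then show ?case using D Suc by (auto simp: differentiable_def)
  qed
  then show ?thesis by (simp add: smooth_on_UNIV_iff)
qed

context slow_weight
begin

text \<open>The values of \<open>w\<close> at negative numbers are arbitrary; cutting them off
  leaves a monotone function.\<close>

lemma w_max_measurable: "(\<lambda>x. w (max 0 x)) \<in> borel_measurable borel"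
  by (rule borel_measurable_mono) (auto simp: mono_def intro!: w_mono)

lemma w_measurable:
  assumes [measurable]: "g \<in> borel_measurable M" and "\<And>x. 0 \<le> g x"
  shows "(\<lambda>x. w (g x)) \<in> borel_measurable M"
proof -
  have "(\<lambda>x. w (max 0 (g x))) \<in> borel_measurable M"
    by (rule measurable_compose[OF _ w_max_measurable]) measurable
  then show ?thesis using assms(2) by (simp add: max_def)
qed

text \<open>The exponential of any positive multiple of the weight dominates all powers, so the
  moments of all orders exist.\<close>

lemma integrable_power_of_exp_w:
  assumes N: "sets N = sets borel" and th: "0 < \<theta>" and e: "0 < e"
    and fin: "(\<integral>\<^sup>+\<xi>. ennreal (exp (\<theta> * w (\<bar>\<xi>\<bar> powr (1 + e)))) \<partial>N) < \<infinity>"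
  shows "integrable N (\<lambda>\<xi>. \<bar>\<xi>\<bar> ^ k)"
proof -
  note [measurable_cong] = N
  obtain C where C: "C \<ge> 1" "\<And>t. 0 \<le> t \<Longrightarrow> (1 + t) powr real k \<le> C * exp (\<theta> * w t)" using power_le_exp_w[OF th] by blast
  have le: "\<bar>\<xi>\<bar> ^ k \<le> C * exp (\<theta> * w (\<bar>\<xi>\<bar> powr (1 + e)))" for \<xi> :: real
  proof -
    have "\<bar>\<xi>\<bar> \<le> 1 + \<bar>\<xi>\<bar> powr (1 + e)"
    proof (cases "\<bar>\<xi>\<bar> \<le> 1")
      case False
      then have "\<bar>\<xi>\<bar> powr 1 \<le> \<bar>\<xi>\<bar> powr (1 + e)" using e by (intro powr_mono) auto
      then show ?thesis by simp
    qed (simp add: add_increasing2)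
    then have "\<bar>\<xi>\<bar> ^ k \<le> (1 + \<bar>\<xi>\<bar> powr (1 + e)) ^ k" by (rule power_mono) simp
    also have "\<dots> = (1 + \<bar>\<xi>\<bar> powr (1 + e)) powr real k" by (subst powr_realpow) (auto simp: add_pos_nonneg)
    also have "\<dots> \<le> C * exp (\<theta> * w (\<bar>\<xi>\<bar> powr (1 + e)))" by (rule C(2)) simp
    finally show ?thesis .
  qed
  have [measurable]: "(\<lambda>\<xi> :: real. w (\<bar>\<xi>\<bar> powr (1 + e))) \<in> borel_measurable borel" by (rule w_measurable) auto
  have "(\<integral>\<^sup>+\<xi>. ennreal (norm (\<bar>\<xi>\<bar> ^ k)) \<partial>N) \<le> (\<integral>\<^sup>+\<xi>. ennreal C * ennreal (exp (\<theta> * w (\<bar>\<xi>\<bar> powr (1 + e)))) \<partial>N)"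
    using le C(1) by (intro nn_integral_mono) (auto simp flip: ennreal_mult' intro!: ennreal_leI)
  also have "\<dots> < \<infinity>" using fin by (subst nn_integral_cmult) (auto simp: ennreal_mult_less_top)
  finally show ?thesis by (intro integrableI_bounded) auto
qed

end

section \<open>Composition\<close>

lemma infsum_ennreal_eq_nn_integral:
  fixes f :: "'a::countable \<Rightarrow> ennreal"
  shows "infsum f UNIV = (\<integral>\<^sup>+x. f x \<partial>count_space UNIV)"
proof -
  have fin: "sum f F = (\<integral>\<^sup>+x. f x * indicator F x \<partial>count_space UNIV)" if "finite F" for F
    using that by (subst nn_integral_count_space_indicator[symmetric]) (auto simp: nn_integral_count_space_finite)
  have eq: "infsum f UNIV = (SUP F\<in>{F. finite F \<and> F \<subseteq> UNIV}. sum f F)" by (rule nonneg_infsum_complete) simp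
  show ?thesis
  proof (rule antisym)
    show "infsum f UNIV \<le> (\<integral>\<^sup>+x. f x \<partial>count_space UNIV)" unfolding eq
      by (rule SUP_least) (auto simp: fin indicator_def intro!: nn_integral_mono)
    define A where "A n = {x :: 'a. to_nat x \<le> n}" for n
    have A: "finite (A n)" for n
      by (rule finite_imageD[of to_nat]) (auto simp: A_def intro: finite_subset[of _ "{..n}"] inj_on_subset[OF inj_to_nat])
    have f: "f x = (SUP n. f x * indicator (A n) x)" for x
    proof (rule antisym)
      have "f x = f x * indicator (A (to_nat x)) x" by (simp add: A_def)
      also have "\<dots> \<le> (SUP n. f x * indicator (A n) x)" by (rule SUP_upper) simp
      finally show "f x \<le> (SUP n. f x * indicator (A n) x)" .
    qed (auto intro!: SUP_least simp: indicator_def)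
    have "(\<integral>\<^sup>+x. f x \<partial>count_space UNIV) = (\<integral>\<^sup>+x. (SUP n. f x * indicator (A n) x) \<partial>count_space UNIV)" by (simp only: f[symmetric])
    also have "\<dots> = (SUP n. \<integral>\<^sup>+x. f x * indicator (A n) x \<partial>count_space UNIV)"
      by (rule nn_integral_monotone_convergence_SUP) (auto simp: incseq_def le_fun_def A_def indicator_def)
    also have "\<dots> \<le> infsum f UNIV" unfolding eq
      by (rule SUP_least) (auto simp: fin[OF A, symmetric] A intro!: SUP_upper)
    finally show "(\<integral>\<^sup>+x. f x \<partial>count_space UNIV) \<le> infsum f UNIV" .
  qed
qed

lemma epow_finite_iff: "epow x a < \<infinity> \<longleftrightarrow> x < \<infinity>"
  by (auto simp: epow_def top.not_eq_extremum)

lemma epow_ennreal: "0 \<le> x \<Longrightarrow> epow (ennreal x) a = ennreal (x powr a)"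
  by (simp add: epow_def)

lemma epow_mono: "x \<le> y \<Longrightarrow> 0 \<le> a \<Longrightarrow> epow x a \<le> epow y a"
  by (cases x; cases y) (auto simp: epow_def ennreal_leI powr_mono2 top_unique)

lemma enn2real_exponent:
  assumes "p < \<infinity>"
  shows "1 < p \<Longrightarrow> 1 < enn2real p" and "1 \<le> p \<Longrightarrow> 1 \<le> enn2real p"
  using assms by (cases p; simp)+

context modulation_setting
begin

lemma mod_bdd_cis_integral:
  assumes B: "\<And>k. \<alpha> k \<le> B" and u: "mod_bdd X Y (\<lambda>x. complex_of_real (u x))"
    and \<epsilon>: "0 < \<epsilon>" and th: "1 < \<theta>" and N: "finite_measure N" and sets: "sets N = sets borel"
    and fin: "\<And>l. 0 < l \<Longrightarrow> (\<integral>\<^sup>+\<xi>. ennreal (exp (\<theta> * w (l * \<bar>\<xi>\<bar> powr (1 + \<epsilon>)))) \<partial>N) < \<infinity>"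
  shows "\<exists>X Y. mod_bdd X Y (\<lambda>x. \<integral>\<xi>. cis (\<xi> * u x) - 1 \<partial>N)"
proof -
  interpret N: finite_measure N by fact
  note [measurable_cong] = sets
  have space: "space N = UNIV" using sets_eq_imp_space_eq[OF sets] by simp
  \<comment> \<open>The estimate for exponentials assumes \<open>e \<le> 1\<close>; a smaller
    exponent only lowers the bound where \<open>\<bar>t\<bar> \<ge> 1\<close>.\<close>
  define e where "e = min \<epsilon> 1"
  have e: "0 < e" "e \<le> 1" using \<epsilon> by (auto simp: e_def)
  obtain C L where C: "0 < C" and L: "1 \<le> L"
    and box: "\<And>t. mod_bdd (C * exp (\<theta> * w (L * max 1 \<bar>t\<bar> powr (1 + e)))) (C * exp (\<theta> * w (L * max 1 \<bar>t\<bar> powr (1 + e)))) (\<lambda>x. cis (t * u x) - 1)"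
    using mod_bdd_cis[OF B u e th] by blast
  define M where "M t = C * exp (\<theta> * w (L * max 1 \<bar>t\<bar> powr (1 + e)))" for t
  have [measurable]: "(\<lambda>t :: real. w (L * max 1 \<bar>t\<bar> powr (1 + e))) \<in> borel_measurable borel"
    "(\<lambda>t :: real. w (L * \<bar>t\<bar> powr (1 + \<epsilon>))) \<in> borel_measurable borel"
    using L by (auto intro!: w_measurable)
  have Mm [measurable]: "M \<in> borel_measurable borel" unfolding M_def by measurable
  \<comment> \<open>The constant covers \<open>\<bar>t\<bar> \<le> 1\<close>, where the maximum is
    1; it is integrable because \<open>N\<close> is finite.\<close>
  have Mle: "M t \<le> C * exp (\<theta> * w L) + C * exp (\<theta> * w (L * \<bar>t\<bar> powr (1 + \<epsilon>)))" for t
  proof (cases "\<bar>t\<bar> \<le> 1")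
    case True
    then have "M t = C * exp (\<theta> * w L)" by (simp add: M_def max_def)
    moreover have "0 \<le> C * exp (\<theta> * w (L * \<bar>t\<bar> powr (1 + \<epsilon>)))" using C by simp
    ultimately show ?thesis by linarith
  next
    case False
    then have "max 1 \<bar>t\<bar> = \<bar>t\<bar>" by simp
    moreover have "\<bar>t\<bar> powr (1 + e) \<le> \<bar>t\<bar> powr (1 + \<epsilon>)" using False by (intro powr_mono) (auto simp: e_def)
    then have "w (L * \<bar>t\<bar> powr (1 + e)) \<le> w (L * \<bar>t\<bar> powr (1 + \<epsilon>))" using L by (intro w_mono mult_left_mono) auto
    then have "C * exp (\<theta> * w (L * \<bar>t\<bar> powr (1 + e))) \<le> C * exp (\<theta> * w (L * \<bar>t\<bar> powr (1 + \<epsilon>)))" using C th by simp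
    moreover have "0 \<le> C * exp (\<theta> * w L)" using C by simp
    ultimately show ?thesis unfolding M_def by simp
  qed
  have "(\<integral>\<^sup>+t. ennreal (M t) \<partial>N) \<le> (\<integral>\<^sup>+t. ennreal (C * exp (\<theta> * w L)) + ennreal C * ennreal (exp (\<theta> * w (L * \<bar>t\<bar> powr (1 + \<epsilon>)))) \<partial>N)"
    using C Mle by (intro nn_integral_mono) (auto simp flip: ennreal_mult ennreal_plus intro!: ennreal_leI)
  also have "\<dots> = ennreal (C * exp (\<theta> * w L)) * emeasure N (space N) + ennreal C * (\<integral>\<^sup>+t. ennreal (exp (\<theta> * w (L * \<bar>t\<bar> powr (1 + \<epsilon>)))) \<partial>N)"
    by (simp add: nn_integral_add nn_integral_cmult)
  also have "\<dots> < \<infinity>"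
    using fin[of L] L N.emeasure_finite[of "space N"] by (auto simp: ennreal_mult_eq_top_iff simp flip: top.not_eq_extremum)
  finally have Mfin: "(\<integral>\<^sup>+t. ennreal (M t) \<partial>N) < \<infinity>" .
  define S where "S = enn2real (\<integral>\<^sup>+t. ennreal (M t) \<partial>N) + 1"
  have S: "0 < S" by (simp add: S_def add_nonneg_pos)
  have MS: "(\<integral>\<^sup>+t. ennreal (M t) \<partial>N) \<le> ennreal S"
    using Mfin by (cases "\<integral>\<^sup>+t. ennreal (M t) \<partial>N") (auto simp: S_def intro!: ennreal_leI)
  have "(\<lambda>x. Re (complex_of_real (u x))) \<in> borel_measurable borel" using mod_bdd_measurable[OF u] by measurable
  then have um [measurable]: "u \<in> borel_measurable borel" by simp
  have cis_m [measurable]: "cis \<in> borel_measurable borel" by (intro borel_measurable_continuous_onI continuous_intros)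
  have "mod_bdd (2 * S) (2 * S) (\<lambda>x. \<integral>\<xi>. cis (\<xi> * u x) - 1 \<partial>N)"
  proof (rule mod_bdd_integral[where x=M and y=M])
    show "sigma_finite_measure N" by (rule N.sigma_finite_measure_axioms)
    show "(\<lambda>(\<xi>, x). cis (\<xi> * u x) - 1) \<in> borel_measurable (N \<Otimes>\<^sub>M borel)" by measurable
    show "M \<in> borel_measurable N" "M \<in> borel_measurable N" by measurable
    show "mod_bdd (M \<xi>) (M \<xi>) (\<lambda>x. cis (\<xi> * u x) - 1)" for \<xi> unfolding M_def by (rule box)
  qed (rule MS S)+
  then show ?thesis by blast
qed

lemma mod_bdd_sum:
  fixes n :: nat
  assumes "mod_bdd X Y h" "\<And>i. i < n \<Longrightarrow> \<exists>X Y. mod_bdd X Y (g i)" "\<And>i. i < n \<Longrightarrow> norm (s i) \<le> 1"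
  shows "\<exists>X Y. mod_bdd X Y (\<lambda>x. \<Sum>i<n. s i * g i x)"
  using assms(2,3)
proof (induction n)
  case 0
  show ?case using mod_bdd_scale[OF assms(1), of 1 0] by auto
next
  case (Suc n)
  obtain X1 Y1 where 1: "mod_bdd X1 Y1 (\<lambda>x. \<Sum>i<n. s i * g i x)" using Suc by (metis less_SucI)
  obtain X2 Y2 where 2: "mod_bdd X2 Y2 (g n)" using Suc.prems(1) by blast
  have "mod_bdd (1 * X2) (1 * Y2) (\<lambda>x. s n * g n x)" using Suc.prems(2) by (intro mod_bdd_scale[OF 2]) auto
  from mod_bdd_add[OF 1 this] show ?case by auto
qed

end

section \<open>Membership in modulation spaces\<close>

context decomposition
begin

text \<open>This translates membership into pointwise box bounds. The weighted box norms form a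
  sequence with finite q-norm, which is replaced by a moderate majorant, and \<open>u\<close> by a
  Borel version.\<close>

lemma modulation_space_majorant:
  fixes u :: "real^'n \<Rightarrow> real"
  assumes w: "w \<in> weights_W0" and p: "1 < p" "p < \<infinity>" and q: "1 \<le> q"
    and u: "(\<lambda>x. complex_of_real (u x)) \<in> modulation_space \<rho> w p q"
  shows "\<exists>v \<alpha> B c. v \<in> borel_measurable borel \<and> (AE x in lborel. u x = v x) \<and> moderate \<alpha> \<and> (\<forall>k. \<alpha> k \<le> B) \<and>
    Lp_bdd (enn2real p) c (\<lambda>x. complex_of_real (v x)) \<and>
    (\<forall>k. Lp_bdd (enn2real p) (exp (- w (norm (lattice_vec k))) * \<alpha> k) (conv (Kb k) (\<lambda>x. complex_of_real (v x)))) \<and>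
    (q \<noteq> \<infinity> \<longrightarrow> (\<integral>\<^sup>+k. ennreal (\<alpha> k powr enn2real q) \<partial>count_space UNIV) < \<infinity>)"
proof -
  let ?U = "\<lambda>x. complex_of_real (u x)"
  have um: "?U \<in> borel_measurable lebesgue" and uL: "Lp_norm p ?U < \<infinity>" and uM: "modulation_norm \<rho> w p q ?U < \<infinity>"
    using u by (auto simp: modulation_space_def Lp_space_def)
  have "(\<lambda>x. Re (?U x)) \<in> borel_measurable lebesgue" using um by measurable
  then have "u \<in> borel_measurable lebesgue" by simp
  then obtain v where v: "v \<in> borel_measurable lborel" "AE x in lborel. u x = v x" using completion_ex_borel_measurable_real by blast
  let ?V = "\<lambda>x. complex_of_real (v x)"
  have vm [measurable]: "v \<in> borel_measurable borel" using v(1) by simp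
  have UV: "AE x in lborel. ?U x = ?V x" using v(2) by eventually_elim simp
  have r: "1 < enn2real p" by (rule enn2real_exponent(1)[OF p(2,1)])
  have Vm: "?V \<in> borel_measurable borel" by measurable
  have "Lp_norm p ?V < \<infinity>" using uL Lp_norm_cong_AE[OF p(2) UV] by simp
  then obtain c where c: "Lp_bdd (enn2real p) c ?V" using Lp_norm_finite_imp_bdd[OF p Vm] by blast
  define D where "D k = distr_Lp_norm p (freq_box \<rho> k ?U)" for k
  have D: "D k = Lp_norm p (conv (Kb k) ?V)" for k unfolding D_def by (rule distr_Lp_norm_freq_box[OF p r um c UV])
  define a where "a k = exp (w (norm (lattice_vec k))) * enn2real (D k)" for k :: "int^'n"
  have a0: "0 \<le> a k" for k by (simp add: a_def)
  have main: "(\<forall>k. D k < \<infinity>) \<and> (\<exists>\<alpha> B. moderate \<alpha> \<and> (\<forall>k. a k \<le> \<alpha> k) \<and> (\<forall>k. \<alpha> k \<le> B) \<and>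
    (q \<noteq> \<infinity> \<longrightarrow> (\<integral>\<^sup>+k. ennreal (\<alpha> k powr enn2real q) \<partial>count_space UNIV) < \<infinity>))"
  proof (cases "q = \<infinity>")
    case True
    define S where "S = (SUP k. ennreal (exp (w (norm (lattice_vec k)))) * D k)"
    have S: "S < \<infinity>" using uM True by (simp add: modulation_norm_def S_def D_def)
    have le: "ennreal (exp (w (norm (lattice_vec k)))) * D k \<le> S" for k unfolding S_def by (rule SUP_upper) simp
    have Df: "D k < \<infinity>" for k
      using le_less_trans[OF le[of k] S] by (auto simp: ennreal_mult_less_top)
    have "a k \<le> enn2real S + 1" for k
    proof -
      have "ennreal (a k) = ennreal (exp (w (norm (lattice_vec k)))) * D k"
        unfolding a_def using Df[of k] by (subst ennreal_mult) (auto simp: top.not_eq_extremum)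
      then have "ennreal (a k) \<le> ennreal (enn2real S)" using le[of k] S by (simp add: top.not_eq_extremum)
      then show ?thesis by (simp add: ennreal_le_iff)
    qed
    \<comment> \<open>For infinite q a constant majorant suffices; adding 1 keeps it positive if the
      norm is 0.\<close>
    moreover have "moderate (\<lambda>_ :: int^'n. enn2real S + 1)" by (intro moderate_const add_nonneg_pos) auto
    ultimately show ?thesis using Df True by blast
  next
    case False
    define q' where "q' = enn2real q"
    have q': "1 \<le> q'" unfolding q'_def using q False by (intro enn2real_exponent(2)) (auto simp: top.not_eq_extremum)
    define t where "t k = ennreal (exp (q' * w (norm (lattice_vec k)))) * epow (D k) q'" for k
    have tfin: "(\<integral>\<^sup>+k. t k \<partial>count_space UNIV) < \<infinity>"
    proof -
      have "epow (\<Sum>\<^sub>\<infinity>k\<in>UNIV. t k) (1 / q') < \<infinity>" using uM False by (simp add: modulation_norm_def t_def q'_def D_def)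
      then show ?thesis by (simp only: epow_finite_iff infsum_ennreal_eq_nn_integral)
    qed
    have Df: "D k < \<infinity>" for k
    proof -
      have "t k = (\<integral>\<^sup>+j. t j * indicator {k} j \<partial>count_space UNIV)"
        by (subst nn_integral_count_space_indicator[symmetric]) (auto simp: nn_integral_count_space_finite)
      also have "\<dots> \<le> (\<integral>\<^sup>+k. t k \<partial>count_space UNIV)" by (intro nn_integral_mono) (auto simp: indicator_def)
      finally have "t k < \<infinity>" using tfin by (rule le_less_trans)
      then have "epow (D k) q' < \<infinity>" by (auto simp: t_def ennreal_mult_less_top)
      then show ?thesis by (simp only: epow_finite_iff)
    qed
    have "t k = ennreal (a k powr q')" for k
    proof -
      have "D k = ennreal (enn2real (D k))" using Df[of k] by (simp add: top.not_eq_extremum)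
      then have "epow (D k) q' = ennreal (enn2real (D k) powr q')" using epow_ennreal[of "enn2real (D k)" q'] by simp
      moreover have "exp (q' * w (norm (lattice_vec k))) = exp (w (norm (lattice_vec k))) powr q'" by (simp add: powr_def mult.commute)
      ultimately show ?thesis unfolding t_def a_def by (simp add: powr_mult flip: ennreal_mult)
    qed
    then have "(\<integral>\<^sup>+k. ennreal (a k powr q') \<partial>count_space UNIV) < \<infinity>" using tfin by simp
    from moderate_majorant[OF q' a0 this] show ?thesis using Df False unfolding q'_def by blast
  qed
  then obtain \<alpha> B where Df: "\<And>k. D k < \<infinity>" and \<alpha>: "moderate \<alpha>" "\<And>k. a k \<le> \<alpha> k" "\<And>k. \<alpha> k \<le> B"
    "q \<noteq> \<infinity> \<longrightarrow> (\<integral>\<^sup>+k. ennreal (\<alpha> k powr enn2real q) \<partial>count_space UNIV) < \<infinity>" by blast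
  have "Lp_bdd (enn2real p) (exp (- w (norm (lattice_vec k))) * \<alpha> k) (conv (Kb k) ?V)" for k
  proof -
    have pos: "0 < exp (- w (norm (lattice_vec k))) * \<alpha> k" using \<alpha>(1) by (simp add: moderate_def)
    have cm: "conv (Kb k) ?V \<in> borel_measurable borel"
      by (rule conv_measurable[OF kernel_bdd_measurable[OF Kb_kernel] Vm])
    have "enn2real (D k) = exp (- w (norm (lattice_vec k))) * a k" by (simp add: a_def exp_minus)
    also have "\<dots> \<le> exp (- w (norm (lattice_vec k))) * \<alpha> k" by (intro mult_left_mono \<alpha>(2)) simp
    finally have "ennreal (enn2real (D k)) \<le> ennreal (exp (- w (norm (lattice_vec k))) * \<alpha> k)" by (rule ennreal_leI)
    then have "Lp_norm p (conv (Kb k) ?V) \<le> ennreal (exp (- w (norm (lattice_vec k))) * \<alpha> k)" using Df[of k] by (simp add: D top.not_eq_extremum)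
    then show ?thesis using Lp_norm_le_iff[OF p cm pos] by blast
  qed
  then show ?thesis using vm v(2) \<alpha>(1,3,4) c by blast
qed

end

context modulation_setting
begin

lemma in_modulation_space_of_mod_bdd:
  assumes B: "\<And>k. \<alpha> k \<le> B" and p: "1 < p" "p < \<infinity>" "r = enn2real p" and q: "1 \<le> q"
    and fin: "q \<noteq> \<infinity> \<longrightarrow> (\<integral>\<^sup>+k. ennreal (\<alpha> k powr enn2real q) \<partial>count_space UNIV) < \<infinity>"
    and F: "mod_bdd X Y F" and G: "G \<in> borel_measurable lebesgue" and GF: "AE x in lborel. G x = F x"
  shows "G \<in> modulation_space \<rho> w p q"
proof -
  have Fm: "F \<in> borel_measurable borel" by (rule mod_bdd_measurable[OF F])
  obtain c where c: "Lp_bdd r c F" using F by (auto simp: mod_bdd_def)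
  have X: "0 < X" using F by (simp add: mod_bdd_def)
  have "Lp_norm p F \<le> ennreal c" using Lp_norm_le_iff[OF p(1,2) Fm] c Lp_bdd_pos[OF c] p(3) by simp
  then have "Lp_norm p G < \<infinity>" unfolding Lp_norm_cong_AE[OF p(2) GF] by (rule le_less_trans) simp
  then have GL: "G \<in> Lp_space p" using G by (simp add: Lp_space_def)
  have D: "distr_Lp_norm p (freq_box \<rho> k G) \<le> ennreal (X * (exp (- wl k) * \<alpha> k))" for k
  proof -
    have "0 < X * (exp (- wl k) * \<alpha> k)" using X alpha_pos[of k] by simp
    moreover have "conv (Kb k) F \<in> borel_measurable borel" by (rule conv_measurable[OF kernel_bdd_measurable[OF Kb_kernel] Fm])
    moreover have "Lp_bdd (enn2real p) (X * (exp (- wl k) * \<alpha> k)) (conv (Kb k) F)" using F by (simp add: mod_bdd_def flip: p(3))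
    ultimately have "Lp_norm p (conv (Kb k) F) \<le> ennreal (X * (exp (- wl k) * \<alpha> k))" using Lp_norm_le_iff[OF p(1,2)] by blast
    then show ?thesis using distr_Lp_norm_freq_box[OF p(1,2) _ G _ GF] c r p(3) by simp
  qed
  have "modulation_norm \<rho> w p q G < \<infinity>"
  proof (cases "q = \<infinity>")
    case True
    have "ennreal (exp (w (norm (lattice_vec k)))) * distr_Lp_norm p (freq_box \<rho> k G) \<le> ennreal (X * B)" for k
    proof -
      have "ennreal (exp (wl k)) * distr_Lp_norm p (freq_box \<rho> k G) \<le> ennreal (exp (wl k)) * ennreal (X * (exp (- wl k) * \<alpha> k))"
        by (intro mult_left_mono D) simp
      also have "\<dots> = ennreal (exp (wl k) * (X * (exp (- wl k) * \<alpha> k)))"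
        using X alpha_pos[of k] by (subst ennreal_mult) auto
      also have "exp (wl k) * (X * (exp (- wl k) * \<alpha> k)) = X * \<alpha> k" by (simp add: exp_minus)
      also have "ennreal (X * \<alpha> k) \<le> ennreal (X * B)" using X B by (intro ennreal_leI mult_left_mono) auto
      finally show ?thesis by (simp only: wl_def)
    qed
    then have "modulation_norm \<rho> w p q G \<le> ennreal (X * B)"
      using True by (auto simp: modulation_norm_def intro!: SUP_least)
    then show ?thesis by (rule le_less_trans) simp
  next
    case False
    define q' where "q' = enn2real q"
    have q': "1 \<le> q'" unfolding q'_def using q False by (intro enn2real_exponent(2)) (auto simp: top.not_eq_extremum)
    have le: "ennreal (exp (q' * wl k)) * epow (distr_Lp_norm p (freq_box \<rho> k G)) q' \<le> ennreal (X powr q') * ennreal (\<alpha> k powr q')" for k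
    proof -
      have "epow (distr_Lp_norm p (freq_box \<rho> k G)) q' \<le> epow (ennreal (X * (exp (- wl k) * \<alpha> k))) q'"
        using q' by (intro epow_mono D) simp
      also have "\<dots> = ennreal ((X * (exp (- wl k) * \<alpha> k)) powr q')" using X alpha_pos[of k] by (intro epow_ennreal) simp
      finally have "ennreal (exp (q' * wl k)) * epow (distr_Lp_norm p (freq_box \<rho> k G)) q' \<le> ennreal (exp (q' * wl k)) * ennreal ((X * (exp (- wl k) * \<alpha> k)) powr q')"
        by (rule mult_left_mono) simp
      also have "\<dots> = ennreal (exp (q' * wl k) * (X * (exp (- wl k) * \<alpha> k)) powr q')" by (simp flip: ennreal_mult)
      also have "exp (q' * wl k) * (X * (exp (- wl k) * \<alpha> k)) powr q' = X powr q' * \<alpha> k powr q'"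
      proof -
        have "(X * (exp (- wl k) * \<alpha> k)) powr q' = X powr q' * (exp (- wl k) powr q' * \<alpha> k powr q')"
          using X alpha_pos[of k] by (simp add: powr_mult)
        moreover have "exp (q' * wl k) * exp (- wl k) powr q' = 1" by (simp add: powr_def flip: exp_add)
        ultimately show ?thesis by (simp add: mult_ac)
      qed
      finally show ?thesis by (simp add: ennreal_mult)
    qed
    have "(\<integral>\<^sup>+k. ennreal (exp (q' * wl k)) * epow (distr_Lp_norm p (freq_box \<rho> k G)) q' \<partial>count_space UNIV)
      \<le> (\<integral>\<^sup>+k. ennreal (X powr q') * ennreal (\<alpha> k powr q') \<partial>count_space UNIV)" by (intro nn_integral_mono le)
    also have "\<dots> = ennreal (X powr q') * (\<integral>\<^sup>+k. ennreal (\<alpha> k powr q') \<partial>count_space UNIV)" by (rule nn_integral_cmult) simp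
    also have "\<dots> < \<infinity>" using fin False by (auto simp: q'_def ennreal_mult_less_top)
    finally have "(\<Sum>\<^sub>\<infinity>k\<in>UNIV. ennreal (exp (q' * w (norm (lattice_vec k)))) * epow (distr_Lp_norm p (freq_box \<rho> k G)) q') < \<infinity>"
      unfolding infsum_ennreal_eq_nn_integral wl_def .
    then show ?thesis using False by (simp add: modulation_norm_def epow_finite_iff q'_def del: infinity_ennreal_def)
  qed
  then show ?thesis using GL by (simp add: modulation_space_def)
qed

end

theorem theorem5p10:
  fixes p q :: ennreal and \<epsilon> \<theta> :: real and w :: "real \<Rightarrow> real"
    and \<mu> :: "real set \<Rightarrow> complex" and f :: "real \<Rightarrow> complex" and \<rho> :: "real^'n \<Rightarrow> real"
  assumes "decomp_bump \<rho>"
    and "1 < p" and "p < \<infinity>" and "1 \<le> q" and "\<epsilon> > 0" and "\<theta> > 1"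
    and "w \<in> weights_W0"
    and "complex_measure \<mu>" and "\<mu> UNIV = 0"
    and "\<And>l::real. l > 0 \<Longrightarrow>
           (\<integral>\<^sup>+\<xi>. ennreal (exp (\<theta> * w (l * \<bar>\<xi>\<bar> powr (1 + \<epsilon>)))) \<partial>total_variation \<mu>) < \<infinity>"
    and "f = inv_fourier_measure \<mu>"
  shows "smooth_on UNIV f \<and>
         (\<forall>u :: real^'n \<Rightarrow> real.
            (\<lambda>x. complex_of_real (u x)) \<in> modulation_space \<rho> w p q \<longrightarrow>
            (\<lambda>x. f (u x)) \<in> modulation_space \<rho> w p q)"
proof -
  note \<mu> = assms(8) and L3 = assms(10) and p = assms(2,3) and q = assms(4) and th = assms(6)
  interpret decomposition \<rho> by unfold_locales fact
  interpret slow_weight w by unfold_locales fact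
  \<comment> \<open>The integrand of the moment condition is at least 1, so that condition also
    shows that the total variation is finite.\<close>
  have "emeasure (total_variation \<mu>) UNIV = (\<integral>\<^sup>+\<xi>. 1 \<partial>total_variation \<mu>)" by simp
  also have "\<dots> \<le> (\<integral>\<^sup>+\<xi>. ennreal (exp (\<theta> * w (1 * \<bar>\<xi>\<bar> powr (1 + \<epsilon>)))) \<partial>total_variation \<mu>)"
  proof (intro nn_integral_mono)
    fix \<xi> :: real
    have "1 \<le> w (1 * \<bar>\<xi>\<bar> powr (1 + \<epsilon>))" by (rule w_ge_1) simp
    then have "0 \<le> \<theta> * w (1 * \<bar>\<xi>\<bar> powr (1 + \<epsilon>))" using th by (intro mult_nonneg_nonneg) auto
    then have "1 \<le> exp (\<theta> * w (1 * \<bar>\<xi>\<bar> powr (1 + \<epsilon>)))" by simp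
    then show "1 \<le> ennreal (exp (\<theta> * w (1 * \<bar>\<xi>\<bar> powr (1 + \<epsilon>))))" using ennreal_leI by fastforce
  qed
  also have "\<dots> < \<infinity>" by (rule L3) simp
  finally have fin: "emeasure (total_variation \<mu>) UNIV < \<infinity>" .
  obtain N s where N: "\<And>i :: nat. i < 4 \<Longrightarrow> finite_measure (N i)" "\<And>i. i < 4 \<Longrightarrow> sets (N i) = sets borel"
      "\<And>i. i < 4 \<Longrightarrow> N i \<le> total_variation \<mu>" "\<And>i. i < 4 \<Longrightarrow> norm (s i) \<le> 1"
    and f: "\<And>t. inv_fourier_measure \<mu> t = (\<Sum>i<4. s i * (\<integral>\<xi>. cis (t * \<xi>) \<partial>N i))"
    and zero: "(\<Sum>i<4. s i * complex_of_real (measure (N i) UNIV)) = 0"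
    using inv_fourier_measure_decomposition[OF \<mu> fin assms(9)] by auto
  have Nfin: "(\<integral>\<^sup>+\<xi>. ennreal (exp (\<theta> * w (l * \<bar>\<xi>\<bar> powr (1 + \<epsilon>)))) \<partial>N i) < \<infinity>" if "i < 4" "0 < l" for i l
    by (rule le_less_trans[OF nn_integral_mono_measure[OF _ N(3)[OF that(1)]] L3[OF that(2)]]) (simp add: N(2)[OF that(1)])
  have mom: "integrable (N i) (\<lambda>\<xi>. \<bar>\<xi>\<bar> ^ k)" if "i < 4" for i k
    using Nfin[OF that, of 1] th by (intro integrable_power_of_exp_w[OF N(2)[OF that] _ assms(5)]) auto
  have "smooth_on UNIV (\<lambda>t. \<Sum>i<4. s i * moment_transform (N i) 0 t)"
    by (rule smooth_moment_transform_sum[OF N(2) mom])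
  then have smooth: "smooth_on UNIV f" unfolding assms(11) f moment_transform_def by (simp add: f[symmetric])
  \<comment> \<open>The subtracted masses cancel by \<open>zero\<close>. In this form each integrand
    applied to \<open>v\<close> has the box bounds proved for
    \<open>cis (\<xi> * v x) - 1\<close>.\<close>
  have fdiff: "f t = (\<Sum>i<4. s i * (\<integral>\<xi>. cis (\<xi> * t) - 1 \<partial>N i))" for t
  proof -
    have "(\<integral>\<xi>. cis (\<xi> * t) - 1 \<partial>N i) = (\<integral>\<xi>. cis (t * \<xi>) \<partial>N i) - complex_of_real (measure (N i) UNIV)" if i: "i < 4" for i
    proof -
      interpret Ni: finite_measure "N i" by (rule N(1)[OF i])
      note [measurable_cong] = N(2)[OF i]
      have sp: "space (N i) = UNIV" using sets_eq_imp_space_eq[OF N(2)[OF i]] by simp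
      have "(\<lambda>\<xi>. cis (t * \<xi>)) \<in> borel_measurable borel" by (intro borel_measurable_continuous_onI continuous_intros)
      then have "integrable (N i) (\<lambda>\<xi>. cis (t * \<xi>))" by (intro Ni.integrable_const_bound[where B=1]) auto
      then show ?thesis by (simp add: mult.commute[of _ t] Bochner_Integration.integral_diff sp scaleR_conv_of_real)
    qed
    then have "(\<Sum>i<4. s i * (\<integral>\<xi>. cis (\<xi> * t) - 1 \<partial>N i)) = (\<Sum>i<4. s i * ((\<integral>\<xi>. cis (t * \<xi>) \<partial>N i) - complex_of_real (measure (N i) UNIV)))"
      by (intro sum.cong) auto
    also have "\<dots> = f t" using zero by (simp add: assms(11) f right_diff_distrib sum_subtractf)
    finally show ?thesis by simp
  qed
  have "(\<lambda>x. f (u x)) \<in> modulation_space \<rho> w p q" if u: "(\<lambda>x. complex_of_real (u x)) \<in> modulation_space \<rho> w p q" for u :: "real^'n \<Rightarrow> real"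
  proof -
    obtain v \<alpha> B c where v: "v \<in> borel_measurable borel" "AE x in lborel. u x = v x" and \<alpha>: "moderate \<alpha>" and B: "\<And>k. \<alpha> k \<le> B"
      and c: "Lp_bdd (enn2real p) c (\<lambda>x. complex_of_real (v x))"
      and box: "\<And>k. Lp_bdd (enn2real p) (exp (- w (norm (lattice_vec k))) * \<alpha> k) (conv (Kb k) (\<lambda>x. complex_of_real (v x)))"
      and \<alpha>q: "q \<noteq> \<infinity> \<longrightarrow> (\<integral>\<^sup>+k. ennreal (\<alpha> k powr enn2real q) \<partial>count_space UNIV) < \<infinity>"
      using modulation_space_majorant[OF assms(7) p q u] by blast
    \<comment> \<open>The majorant depends on \<open>u\<close>, so the setting is entered only after
      \<open>u\<close> is fixed.\<close>
    interpret modulation_setting \<rho> w "enn2real p" \<alpha>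
      by unfold_locales (rule enn2real_exponent(1)[OF p(2,1)], rule \<alpha>)
    have V: "mod_bdd 1 (1 * B) (\<lambda>x. complex_of_real (v x))"
      by (rule mod_bdd_of_box_bound[OF _ B c]) (use box in \<open>auto simp: wl_def\<close>)
    have "\<exists>X Y. mod_bdd X Y (\<lambda>x. \<integral>\<xi>. cis (\<xi> * v x) - 1 \<partial>N i)" if "i < 4" for i
      by (rule mod_bdd_cis_integral[OF B V assms(5) th N(1)[OF that] N(2)[OF that] Nfin[OF that]])
    then have "\<exists>X Y. mod_bdd X Y (\<lambda>x. \<Sum>i<4. s i * (\<integral>\<xi>. cis (\<xi> * v x) - 1 \<partial>N i))"
      by (rule mod_bdd_sum[OF V _ N(4)])
    then obtain X Y where F: "mod_bdd X Y (\<lambda>x. f (v x))" unfolding fdiff by blast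
    have "(\<lambda>x. complex_of_real (u x)) \<in> borel_measurable lebesgue"
      using u by (simp add: modulation_space_def Lp_space_def)
    then have "(\<lambda>x. Re (complex_of_real (u x))) \<in> borel_measurable lebesgue" by measurable
    then have um: "u \<in> borel_measurable lebesgue" by simp
    \<comment> \<open>The function \<open>u\<close> is only Lebesgue measurable; continuity of
      \<open>f\<close> makes the composition measurable in the same sense.\<close>
    have "f \<in> borel_measurable borel" using smooth_continuous[OF smooth] by (rule borel_measurable_continuous_onI)
    then have G: "(\<lambda>x. f (u x)) \<in> borel_measurable lebesgue" by (rule measurable_compose[OF um])
    have GF: "AE x in lborel. f (u x) = f (v x)" using v(2) by eventually_elim simp
    show ?thesis by (rule in_modulation_space_of_mod_bdd[OF B p refl q \<alpha>q F G GF])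
  qed
  then show ?thesis using smooth by blast
qed

end
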